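(* Let $\Psi$ be the quiver with four vertices $\tilde{\mathrm e}_3,\tilde{\mathrm e}_4,\tilde{\mathrm e}_5,\tilde{\mathrm e}_6$ and four arrows $$\tilde\tau_1:\tilde{\mathrm e}_6\to\tilde{\mathrm e}_3,\quad\tilde\tau_2:\tilde{\mathrm e}_3\to\tilde{\mathrm e}_6,\quad\tilde\tau_3:\tilde{\mathrm e}_6\to\tilde{\mathrm e}_4,\quad\tilde\tau_4:\tilde{\mathrm e}_4\to\tilde{\mathrm e}_6.$$ As $\mathbb F_3$-algebras, $$\Lambda'_{(3)}/3\Lambda'_{(3)}\;\cong\;\mathbb F_3\Psi/(\tilde\tau_4\tilde\tau_3,\ \tilde\tau_4\tilde\tau_1,\ \tilde\tau_2\tilde\tau_1,\ \tilde\tau_2\tilde\tau_3).$$ Moreover, $\mathrm{B}_{\mathbb F_3}(S_3,S_3)$ is Morita equivalent to $\Lambda'_{(3)}/3\Lambda'_{(3)}$.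
   Context: **Double Burnside algebra.** For a finite group $G$ and a commutative ring $R$, $\mathrm{B}_R(G,G)$ is the $R$-module generated by the isomorphism classes $[M]$ of finite $(G,G)$-bisets (finite sets with commuting left and right $G$-actions) modulo $[M\sqcup N]=[M]+[N]$, with multiplication induced by $[M]\cdot[N]=[M\times_G N]$, where $M\times_G N$ is the set of $G$-orbits on $M\times N$ under $g(m,n)=(mg^{-1},gn)$, with biset structure induced by $h(m,n)p=(hm,np)$. **The algebra $A$.** Let $\mathbb Q[\bar\eta,\bar\xi]=\mathbb Q[\eta,\xi]/(\eta^2,\eta\xi,\xi^2)$, with $\mathbb Q$-basis $1,\bar\eta,\bar\xi$. $A$ consists of arrays $[a_{i,j}]_{i,j\in\{1,2,3,4\}}$ with $a_{i,j}\in A_{i,j}$, where $A_{1,1}=\mathbb Q^{3\times3}$, $A_{1,4}=\mathbb Q^{3\times1}$, $A_{4,1}=\mathbb Q^{1\times3}$, $A_{2,2}=A_{2,4}=A_{3,3}=A_{4,2}=\mathbb Q$, $A_{4,4}=\mathbb Q[\bar\eta,\bar\xi]$, and all other $A_{i,j}=0$. Addition is entrywise; the product of $[a_{i,j}]$ and $[a'_{i,j}]$ has $(i,j)$ entry $\sum_r\alpha_{i,r,j}(a_{i,r},a'_{r,j})$, where the bilinear maps $\alpha_{i,j,k}:A_{i,j}\times A_{j,k}\to A_{i,k}$ are: zero whenever one of $A_{i,j},A_{j,k},A_{i,k}$ is zero; $\alpha_{1,4,1}=0$, $\alpha_{2,4,2}=0$; $\alpha_{4,1,4}(x,y)=(xy)\bar\eta$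 (row times column); $\alpha_{4,2,4}(x,y)=xy(\bar\xi-12\bar\eta)$; $\alpha_{4,4,4}$ is multiplication in $\mathbb Q[\bar\eta,\bar\xi]$; in $\alpha_{1,4,4},\alpha_{2,4,4},\alpha_{4,4,1},\alpha_{4,4,2}$ an element $a+b\bar\eta+c\bar\xi\in A_{4,4}$ acts as multiplication by its constant term $a$; and $\alpha_{1,1,1},\alpha_{1,1,4},\alpha_{4,1,1},\alpha_{2,2,2},\alpha_{2,2,4},\alpha_{4,2,2},\alpha_{3,3,3}$ are the usual (matrix) products. Elements of $A$ are written as $6\times6$ arrays with block sizes $3,1,1,1$. **The order $\Lambda_{(3)}$.** With $R=\mathbb Z_{(3)}$, $\Lambda_{(3)}$ is the $R$-subalgebra of $A$ consisting of all $$\begin{bmatrix} s_{1,1}&s_{1,2}&s_{1,3}&0&0&t_1\\ s_{2,1}&s_{2,2}&s_{2,3}&0&0&t_2\\ s_{3,1}&s_{3,2}&s_{3,3}&0&0&t_3\\ 0&0&0&u&0&v\\ 0&0&0&0&w&0\\ x_1&x_2&x_3&y&0&z_1+z_2\bar\eta+z_3\bar\xi\end{bmatrix}$$ with $s_{i,j},t_i,u,v,w,x_i,y,z_i\in R$ satisfying $x_1\equiv x_2\equiv x_3\equiv z_2\equiv0\pmod 3$. **The algebra $\Lambda'_{(3)}$.** Let $\mathrm e_3,\mathrm e_4,\mathrm e_5,\mathrm e_6\in\Lambda_{(3)}$ be the elements whose only nonzero entry is $1$ at position $(3,3),(4,4),(5,5),(6,6)$ respectively. Put $\Lambda'_{(3)}=(\mathrm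 e_3+\mathrm e_4+\mathrm e_5+\mathrm e_6)\Lambda_{(3)}(\mathrm e_3+\mathrm e_4+\mathrm e_5+\mathrm e_6)$. **Path algebra convention.** Paths are composed from left to right: $\alpha\beta$ means first the arrow $\alpha$, then $\beta$; an arrow $\alpha:x\to y$ satisfies $x\alpha y=\alpha$, where the vertices also denote the corresponding idempotents (trivial paths). Parentheses denote the two-sided ideal generated. *)

theory Defs
  imports
    "HOL-Algebra.QuotRing"
    "HOL-Algebra.Sym_Groups"
    "HOL-Algebra.Module"
    "HOL-Number_Theory.Residues"
    "HOL-Library.Infinite_Typeclass"
    "HOL-Analysis.Finite_Cartesian_Product"
    "Graph_Theory.Arc_Walk"
begin

section \<open>Algebras over a commutative ring\<close>

text \<open>
  Algebras are records of type \<^type>\<open>Module.module\<close>, which provide ring operations together with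
  a scalar multiplication. The locale \<^locale>\<open>Module.algebra\<close> is not used because it only
  covers commutative algebras.
\<close>

definition unital_algebra :: "('r, 'm) ring_scheme \<Rightarrow> ('r, 'a, 'n) module_scheme \<Rightarrow> bool" where
  "unital_algebra R A \<longleftrightarrow>
     Module.module R A \<and> Ring.ring A \<and>
     (\<forall>r\<in>carrier R. \<forall>x\<in>carrier A. \<forall>y\<in>carrier A.
        (r \<odot>\<^bsub>A\<^esub> x) \<otimes>\<^bsub>A\<^esub> y = r \<odot>\<^bsub>A\<^esub> (x \<otimes>\<^bsub>A\<^esub> y) \<and>
        x \<otimes>\<^bsub>A\<^esub> (r \<odot>\<^bsub>A\<^esub> y) = r \<odot>\<^bsub>A\<^esub> (x \<otimes>\<^bsub>A\<^esub> y))"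

definition isomorphic_algebras ::
  "('r, 'm) ring_scheme \<Rightarrow> ('r, 'a, 'n) module_scheme \<Rightarrow> ('r, 'b, 'k) module_scheme \<Rightarrow> bool" where
  "isomorphic_algebras R A B \<longleftrightarrow>
     unital_algebra R A \<and> unital_algebra R B \<and>
     (\<exists>h \<in> ring_iso A B. \<forall>r\<in>carrier R. \<forall>x\<in>carrier A. h (r \<odot>\<^bsub>A\<^esub> x) = r \<odot>\<^bsub>B\<^esub> h x)"

text \<open>
  The quotient ring \<^term>\<open>A Quot I\<close>, on which a scalar \<open>r\<close> sends the coset of \<open>x\<close> to the coset of
  \<open>act r x\<close>. The union plays the same role as in \<^const>\<open>rcoset_mult\<close>.
\<close>

definition quotient_algebra ::
  "('s \<Rightarrow> 'a \<Rightarrow> 'a) \<Rightarrow> ('r, 'a, 'm) module_scheme \<Rightarrow> 'a set \<Rightarrow> ('s, 'a set) module" where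
  "quotient_algebra act A I =
     ring.extend (A Quot I) (module.fields (\<lambda>r C. \<Union>x\<in>C. I +>\<^bsub>A\<^esub> (act r x)))"

text \<open>
  For an algebra \<open>A\<close> over a subring of the rationals: \<open>A / pA\<close> as an algebra over
  \<^term>\<open>residue_ring p\<close>, a residue acting through its integer representative.
\<close>

definition reduction :: "int \<Rightarrow> (rat, 'a, 'm) module_scheme \<Rightarrow> (int, 'a set) module" where
  "reduction p A =
     quotient_algebra (\<lambda>k x. of_int k \<odot>\<^bsub>A\<^esub> x) A ((\<lambda>x. of_int p \<odot>\<^bsub>A\<^esub> x) ` carrier A)"

definition corner :: "('r, 'a, 'm) module_scheme \<Rightarrow> 'a \<Rightarrow> ('r, 'a, 'm) module_scheme" where
  "corner A e = A\<lparr>carrier := (\<lambda>x. e \<otimes>\<^bsub>A\<^esub> x \<otimes>\<^bsub>A\<^esub> e) ` carrier A, one := e\<rparr>"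

text \<open>
  The free \<open>R\<close>-module on \<open>S\<close> with the multiplication that extends bilinearly the product \<open>mul\<close> of
  basis elements, where \<^term>\<open>None\<close> means that the product is zero. The unit is the sum of the
  elements of the finite set \<open>E\<close>.
\<close>

definition basis_algebra ::
  "('r, 'm) ring_scheme \<Rightarrow> 's set \<Rightarrow> ('s \<Rightarrow> 's \<Rightarrow> 's option) \<Rightarrow> 's set \<Rightarrow> ('r, 's \<Rightarrow> 'r) module" where
  "basis_algebra R S mul E =
     \<lparr> carrier = {f. (\<forall>s. f s \<in> carrier R) \<and> {s. f s \<noteq> \<zero>\<^bsub>R\<^esub>} \<subseteq> S \<and> finite {s. f s \<noteq> \<zero>\<^bsub>R\<^esub>}},
       monoid.mult = (\<lambda>f g s. finsum R (\<lambda>(a, b). f a \<otimes>\<^bsub>R\<^esub> g b)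
                 {(a, b). f a \<noteq> \<zero>\<^bsub>R\<^esub> \<and> g b \<noteq> \<zero>\<^bsub>R\<^esub> \<and> mul a b = Some s}),
       one = (\<lambda>s. if s \<in> E then \<one>\<^bsub>R\<^esub> else \<zero>\<^bsub>R\<^esub>),
       zero = (\<lambda>s. \<zero>\<^bsub>R\<^esub>),
       add = (\<lambda>f g s. f s \<oplus>\<^bsub>R\<^esub> g s),
       smult = (\<lambda>r f s. r \<otimes>\<^bsub>R\<^esub> f s) \<rparr>"

definition basis_elt :: "('r, 'm) ring_scheme \<Rightarrow> 's \<Rightarrow> 's \<Rightarrow> 'r" where
  "basis_elt R s = (\<lambda>t. if t = s then \<one>\<^bsub>R\<^esub> else \<zero>\<^bsub>R\<^esub>)"


section \<open>Path algebras\<close>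

text \<open>
  A quiver is a \<^type>\<open>pre_digraph\<close>. A path is a triple of its start vertex, its list of arrows in
  the order of traversal, and its end vertex; paths are composed from left to right.
\<close>

definition quiver_paths :: "('v, 'e) pre_digraph \<Rightarrow> ('v \<times> 'e list \<times> 'v) set" where
  "quiver_paths Q = {(u, p, v). pre_digraph.awalk Q u p v}"

fun path_comp :: "'v \<times> 'e list \<times> 'v \<Rightarrow> 'v \<times> 'e list \<times> 'v \<Rightarrow> ('v \<times> 'e list \<times> 'v) option" where
  "path_comp (u, p, v) (u', p', v') = (if v = u' then Some (u, p @ p', v') else None)"

definition path_algebra ::
  "('r, 'm) ring_scheme \<Rightarrow> ('v, 'e) pre_digraph \<Rightarrow> ('r, 'v \<times> 'e list \<times> 'v \<Rightarrow> 'r) module" where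
  "path_algebra K Q =
     basis_algebra K (quiver_paths Q) path_comp ((\<lambda>v. (v, [], v)) ` verts Q)"

definition arrow_elt ::
  "('r, 'm) ring_scheme \<Rightarrow> ('v, 'e) pre_digraph \<Rightarrow> 'e \<Rightarrow> 'v \<times> 'e list \<times> 'v \<Rightarrow> 'r" where
  "arrow_elt K Q a = basis_elt K (tail Q a, [a], head Q a)"


section \<open>Double Burnside algebras\<close>

record ('g, 'x) biset =
  points :: "'x set"
  lact :: "'g \<Rightarrow> 'x \<Rightarrow> 'x"
  ract :: "'x \<Rightarrow> 'g \<Rightarrow> 'x"

definition finite_biset :: "('g, 'm) monoid_scheme \<Rightarrow> ('g, 'x) biset \<Rightarrow> bool" where
  "finite_biset G M \<longleftrightarrow>
     finite (points M) \<and>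
     (\<forall>g\<in>carrier G. \<forall>x\<in>points M. lact M g x \<in> points M \<and> ract M x g \<in> points M) \<and>
     (\<forall>x\<in>points M. lact M \<one>\<^bsub>G\<^esub> x = x \<and> ract M x \<one>\<^bsub>G\<^esub> = x) \<and>
     (\<forall>g\<in>carrier G. \<forall>h\<in>carrier G. \<forall>x\<in>points M.
        lact M (g \<otimes>\<^bsub>G\<^esub> h) x = lact M g (lact M h x) \<and>
        ract M x (g \<otimes>\<^bsub>G\<^esub> h) = ract M (ract M x g) h \<and>
        ract M (lact M g x) h = lact M g (ract M x h))"

definition isomorphic_bisets ::
  "('g, 'm) monoid_scheme \<Rightarrow> ('g, 'x) biset \<Rightarrow> ('g, 'y) biset \<Rightarrow> bool" where
  "isomorphic_bisets G M N \<longleftrightarrow>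
     (\<exists>f. bij_betw f (points M) (points N) \<and>
          (\<forall>g\<in>carrier G. \<forall>x\<in>points M.
             f (lact M g x) = lact N g (f x) \<and> f (ract M x g) = ract N (f x) g))"

text \<open>
  Every finite biset has an isomorphic copy whose points are natural numbers, so isomorphism classes
  are represented by the sets of these copies.
\<close>

definition biset_class :: "('g, 'm) monoid_scheme \<Rightarrow> ('g, 'x) biset \<Rightarrow> ('g, nat) biset set" where
  "biset_class G M = {P. finite_biset G P \<and> isomorphic_bisets G P M}"

definition biset_classes :: "('g, 'm) monoid_scheme \<Rightarrow> ('g, nat) biset set set" where
  "biset_classes G = biset_class G ` {M :: ('g, nat) biset. finite_biset G M}"

definition regular_biset :: "('g, 'm) monoid_scheme \<Rightarrow> ('g, 'g) biset" where
  "regular_biset G = \<lparr> points = carrier G, lact = monoid.mult G, ract = monoid.mult G \<rparr>"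

definition biset_sum :: "('g, 'x) biset \<Rightarrow> ('g, 'y) biset \<Rightarrow> ('g, 'x + 'y) biset" where
  "biset_sum M N =
     \<lparr> points = points M <+> points N,
       lact = (\<lambda>g. map_sum (lact M g) (lact N g)),
       ract = (\<lambda>x g. map_sum (\<lambda>m. ract M m g) (\<lambda>n. ract N n g) x) \<rparr>"

text \<open>The biset \<open>M \<times>\<^sub>G N\<close>, whose points are the orbits of \<open>g (m, n) = (m g\<^sup>-\<^sup>1, g n)\<close>.\<close>

definition biset_prod ::
  "('g, 'm) monoid_scheme \<Rightarrow> ('g, 'x) biset \<Rightarrow> ('g, 'y) biset \<Rightarrow> ('g, ('x \<times> 'y) set) biset" where
  "biset_prod G M N =
     \<lparr> points = (\<lambda>(m, n). (\<lambda>g. (ract M m (inv\<^bsub>G\<^esub> g), lact N g n)) ` carrier G) ` (points M \<times> points N),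
       lact = (\<lambda>h. image (\<lambda>(m, n). (lact M h m, n))),
       ract = (\<lambda>C p. (\<lambda>(m, n). (m, ract N n p)) ` C) \<rparr>"

definition biset_class_mult ::
  "('g, 'm) monoid_scheme \<Rightarrow> ('g, nat) biset set \<Rightarrow> ('g, nat) biset set \<Rightarrow> ('g, nat) biset set" where
  "biset_class_mult G c d = (\<Union>M\<in>c. \<Union>N\<in>d. biset_class G (biset_prod G M N))"

definition free_biset_algebra ::
  "('r, 'n) ring_scheme \<Rightarrow> ('g, 'm) monoid_scheme \<Rightarrow> ('r, ('g, nat) biset set \<Rightarrow> 'r) module" where
  "free_biset_algebra R G =
     basis_algebra R (biset_classes G) (\<lambda>c d. Some (biset_class_mult G c d))
       {biset_class G (regular_biset G)}"

definition biset_relations ::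
  "('r, 'n) ring_scheme \<Rightarrow> ('g, 'm) monoid_scheme \<Rightarrow> (('g, nat) biset set \<Rightarrow> 'r) set" where
  "biset_relations R G =
     (\<lambda>H. submodule H R (free_biset_algebra R G)) hull
       {basis_elt R (biset_class G (biset_sum M N))
          \<ominus>\<^bsub>free_biset_algebra R G\<^esub>
          (basis_elt R (biset_class G M) \<oplus>\<^bsub>free_biset_algebra R G\<^esub> basis_elt R (biset_class G N))
        | (M :: ('g, nat) biset) (N :: ('g, nat) biset). finite_biset G M \<and> finite_biset G N}"

definition double_burnside_algebra ::
  "('r, 'n) ring_scheme \<Rightarrow> ('g, 'm) monoid_scheme \<Rightarrow> ('r, (('g, nat) biset set \<Rightarrow> 'r) set) module" where
  "double_burnside_algebra R G =
     quotient_algebra (smult (free_biset_algebra R G)) (free_biset_algebra R G) (biset_relations R G)"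


section \<open>Morita equivalence\<close>

text \<open>
  The category of left modules over a ring \<open>A\<close>. The type \<open>'u\<close> plays the role of the universe from
  which the underlying sets of the modules are taken. The locale \<^locale>\<open>Module.module\<close> requires
  the scalars to be commutative. The fields \<open>mult\<close> and \<open>one\<close> of the record \<open>M\<close> carry no meaning here.
\<close>

locale left_module = A?: Ring.ring A + M?: abelian_group M
  for A :: "('a, 'm) ring_scheme" (structure) and M :: "('a, 'u) module" (structure) +
  assumes smult_closed: "\<lbrakk>a \<in> carrier A; x \<in> carrier M\<rbrakk> \<Longrightarrow> a \<odot>\<^bsub>M\<^esub> x \<in> carrier M"
    and smult_l_distr: "\<lbrakk>a \<in> carrier A; b \<in> carrier A; x \<in> carrier M\<rbrakk> \<Longrightarrow>
      (a \<oplus>\<^bsub>A\<^esub> b) \<odot>\<^bsub>M\<^esub> x = a \<odot>\<^bsub>M\<^esub> x \<oplus>\<^bsub>M\<^esub> b \<odot>\<^bsub>M\<^esub> x"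
    and smult_r_distr: "\<lbrakk>a \<in> carrier A; x \<in> carrier M; y \<in> carrier M\<rbrakk> \<Longrightarrow>
      a \<odot>\<^bsub>M\<^esub> (x \<oplus>\<^bsub>M\<^esub> y) = a \<odot>\<^bsub>M\<^esub> x \<oplus>\<^bsub>M\<^esub> a \<odot>\<^bsub>M\<^esub> y"
    and smult_assoc: "\<lbrakk>a \<in> carrier A; b \<in> carrier A; x \<in> carrier M\<rbrakk> \<Longrightarrow>
      (a \<otimes>\<^bsub>A\<^esub> b) \<odot>\<^bsub>M\<^esub> x = a \<odot>\<^bsub>M\<^esub> (b \<odot>\<^bsub>M\<^esub> x)"
    and smult_one: "x \<in> carrier M \<Longrightarrow> \<one>\<^bsub>A\<^esub> \<odot>\<^bsub>M\<^esub> x = x"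

definition lmod_hom ::
  "('a, 'm) ring_scheme \<Rightarrow> ('a, 'u) module \<Rightarrow> ('a, 'v) module \<Rightarrow> ('u \<Rightarrow> 'v) set" where
  "lmod_hom A M N =
     {f \<in> carrier M \<rightarrow>\<^sub>E carrier N.
        (\<forall>x\<in>carrier M. \<forall>y\<in>carrier M. f (x \<oplus>\<^bsub>M\<^esub> y) = f x \<oplus>\<^bsub>N\<^esub> f y) \<and>
        (\<forall>a\<in>carrier A. \<forall>x\<in>carrier M. f (a \<odot>\<^bsub>M\<^esub> x) = a \<odot>\<^bsub>N\<^esub> f x)}"

text \<open>
  The action on morphisms takes source and target as arguments, since these cannot be recovered from
  the underlying function.
\<close>

definition lmod_functor ::
  "('a, 'm) ring_scheme \<Rightarrow> ('b, 'n) ring_scheme \<Rightarrow> (('a, 'u) module \<Rightarrow> ('b, 'u) module) \<Rightarrow>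
   (('a, 'u) module \<Rightarrow> ('a, 'u) module \<Rightarrow> ('u \<Rightarrow> 'u) \<Rightarrow> ('u \<Rightarrow> 'u)) \<Rightarrow> bool" where
  "lmod_functor A B F\<^sub>o F\<^sub>m \<longleftrightarrow>
     (\<forall>M. left_module A M \<longrightarrow>
        left_module B (F\<^sub>o M) \<and>
        F\<^sub>m M M (restrict id (carrier M)) = restrict id (carrier (F\<^sub>o M))) \<and>
     (\<forall>M N. left_module A M \<and> left_module A N \<longrightarrow>
        (\<forall>f \<in> lmod_hom A M N. F\<^sub>m M N f \<in> lmod_hom B (F\<^sub>o M) (F\<^sub>o N))) \<and>
     (\<forall>L M N. left_module A L \<and> left_module A M \<and> left_module A N \<longrightarrow>
        (\<forall>f \<in> lmod_hom A L M. \<forall>g \<in> lmod_hom A M N.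
           F\<^sub>m L N (compose (carrier L) g f) =
           compose (carrier (F\<^sub>o L)) (F\<^sub>m M N g) (F\<^sub>m L M f)))"

definition lmod_natural_iso ::
  "('a, 'm) ring_scheme \<Rightarrow> ('b, 'n) ring_scheme \<Rightarrow>
   (('a, 'u) module \<Rightarrow> ('b, 'u) module) \<Rightarrow>
   (('a, 'u) module \<Rightarrow> ('a, 'u) module \<Rightarrow> ('u \<Rightarrow> 'u) \<Rightarrow> ('u \<Rightarrow> 'u)) \<Rightarrow>
   (('a, 'u) module \<Rightarrow> ('b, 'u) module) \<Rightarrow>
   (('a, 'u) module \<Rightarrow> ('a, 'u) module \<Rightarrow> ('u \<Rightarrow> 'u) \<Rightarrow> ('u \<Rightarrow> 'u)) \<Rightarrow> bool" where
  "lmod_natural_iso A B F\<^sub>o F\<^sub>m G\<^sub>o G\<^sub>m \<longleftrightarrow>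
     (\<exists>t. (\<forall>M. left_module A M \<longrightarrow>
             t M \<in> lmod_hom B (F\<^sub>o M) (G\<^sub>o M) \<and> bij_betw (t M) (carrier (F\<^sub>o M)) (carrier (G\<^sub>o M))) \<and>
          (\<forall>M N. left_module A M \<and> left_module A N \<longrightarrow>
             (\<forall>f \<in> lmod_hom A M N.
                compose (carrier (F\<^sub>o M)) (G\<^sub>m M N f) (t M) =
                compose (carrier (F\<^sub>o M)) (t N) (F\<^sub>m M N f))))"

definition morita_equivalent ::
  "'u itself \<Rightarrow> ('a, 'm) ring_scheme \<Rightarrow> ('b, 'n) ring_scheme \<Rightarrow> bool" where
  "morita_equivalent _ A B \<longleftrightarrow>
     Ring.ring A \<and> Ring.ring B \<and>
     (\<exists>(F\<^sub>o :: ('a, 'u) module \<Rightarrow> ('b, 'u) module) F\<^sub>m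
       (G\<^sub>o :: ('b, 'u) module \<Rightarrow> ('a, 'u) module) G\<^sub>m.
        lmod_functor A B F\<^sub>o F\<^sub>m \<and> lmod_functor B A G\<^sub>o G\<^sub>m \<and>
        lmod_natural_iso A A (\<lambda>M. G\<^sub>o (F\<^sub>o M)) (\<lambda>M N f. G\<^sub>m (F\<^sub>o M) (F\<^sub>o N) (F\<^sub>m M N f))
          (\<lambda>M. M) (\<lambda>M N f. f) \<and>
        lmod_natural_iso B B (\<lambda>M. F\<^sub>o (G\<^sub>o M)) (\<lambda>M N f. F\<^sub>m (G\<^sub>o M) (G\<^sub>o N) (G\<^sub>m M N f))
          (\<lambda>M. M) (\<lambda>M N f. f))"


section \<open>The algebra A\<close>

text \<open>\<open>\<rat>[\<eta>, \<xi>] / (\<eta>\<^sup>2, \<eta>\<xi>, \<xi>\<^sup>2)\<close> in coordinates with respect to the basis \<open>1, \<eta>, \<xi>\<close>.\<close>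

datatype qex = Qex (const_part: rat) (eta_part: rat) (xi_part: rat)

instantiation qex :: comm_ring_1
begin

definition "0 = Qex 0 0 0"
definition "1 = Qex 1 0 0"

fun plus_qex :: "qex \<Rightarrow> qex \<Rightarrow> qex" where
  "Qex a b c + Qex a' b' c' = Qex (a + a') (b + b') (c + c')"

fun uminus_qex :: "qex \<Rightarrow> qex" where
  "- Qex a b c = Qex (- a) (- b) (- c)"

definition "x - y = x + - (y :: qex)"

fun times_qex :: "qex \<Rightarrow> qex \<Rightarrow> qex" where
  "Qex a b c * Qex a' b' c' = Qex (a * a') (a * b' + b * a') (a * c' + c * a')"

instance
proof
  fix x y z :: qex
  show "x + y + z = x + (y + z)" "x + y = y + x" "x * y * z = x * (y * z)" "x * y = y * x"
    "(x + y) * z = x * z + y * z"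
    by (cases x; cases y; cases z; simp add: algebra_simps)+
  show "0 + x = x" "- x + x = 0" "1 * x = x"
    by (cases x; simp add: zero_qex_def one_qex_def)+
qed (simp_all add: minus_qex_def zero_qex_def one_qex_def)

end

definition qconst :: "rat \<Rightarrow> qex" where "qconst a = Qex a 0 0"
definition eta :: qex where "eta = Qex 0 1 0"
definition xi :: qex where "xi = Qex 0 0 1"

lemma "Qex a b c = qconst a + qconst b * eta + qconst c * xi"
  by (simp add: qconst_def eta_def xi_def)

lemma "eta\<^sup>2 = 0" "eta * xi = 0" "xi\<^sup>2 = 0"
  by (simp_all add: eta_def xi_def power2_eq_square zero_qex_def)

text \<open>
  The nonzero blocks of an array: \<open>aij\<close> is the block in position \<open>(i, j)\<close>. Both columns and rows
  of length three are vectors. The elements of the index type \<open>3\<close> are \<open>1\<close>, \<open>2\<close> and \<open>3\<close>.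
\<close>

record arr =
  a11 :: "rat ^ 3 ^ 3"
  a14 :: "rat ^ 3"
  a22 :: rat
  a24 :: rat
  a33 :: rat
  a41 :: "rat ^ 3"
  a42 :: rat
  a44 :: qex

definition arr_zero :: arr where
  "arr_zero = \<lparr> a11 = 0, a14 = 0, a22 = 0, a24 = 0, a33 = 0, a41 = 0, a42 = 0, a44 = 0 \<rparr>"

definition arr_one :: arr where
  "arr_one = \<lparr> a11 = mat 1, a14 = 0, a22 = 1, a24 = 0, a33 = 1, a41 = 0, a42 = 0, a44 = 1 \<rparr>"

definition arr_add :: "arr \<Rightarrow> arr \<Rightarrow> arr" where
  "arr_add a b =
     \<lparr> a11 = a11 a + a11 b, a14 = a14 a + a14 b, a22 = a22 a + a22 b, a24 = a24 a + a24 b,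
       a33 = a33 a + a33 b, a41 = a41 a + a41 b, a42 = a42 a + a42 b, a44 = a44 a + a44 b \<rparr>"

definition arr_smult :: "rat \<Rightarrow> arr \<Rightarrow> arr" where
  "arr_smult r a =
     \<lparr> a11 = (\<chi> i. r *s (a11 a $ i)), a14 = r *s a14 a, a22 = r * a22 a, a24 = r * a24 a,
       a33 = r * a33 a, a41 = r *s a41 a, a42 = r * a42 a, a44 = qconst r * a44 a \<rparr>"

text \<open>The products of the blocks \<open>(1,4)\<close> with \<open>(4,1)\<close> and \<open>(2,4)\<close> with \<open>(4,2)\<close> are zero.\<close>

definition arr_mult :: "arr \<Rightarrow> arr \<Rightarrow> arr" where
  "arr_mult a b =
     \<lparr> a11 = a11 a ** a11 b,
       a14 = a11 a *v a14 b + const_part (a44 b) *s a14 a,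
       a22 = a22 a * a22 b,
       a24 = a22 a * a24 b + a24 a * const_part (a44 b),
       a33 = a33 a * a33 b,
       a41 = a41 a v* a11 b + const_part (a44 a) *s a41 b,
       a42 = a42 a * a22 b + const_part (a44 a) * a42 b,
       a44 = qconst (\<Sum>i\<in>UNIV. a41 a $ i * a14 b $ i) * eta
           + qconst (a42 a * a24 b) * (xi - 12 * eta)
           + a44 a * a44 b \<rparr>"

definition arr_algebra :: "(rat, arr) module" where
  "arr_algebra =
     \<lparr> carrier = UNIV, monoid.mult = arr_mult, one = arr_one, zero = arr_zero, add = arr_add,
       smult = arr_smult \<rparr>"


section \<open>The orders\<close>

definition localized_ints :: "int \<Rightarrow> rat set" where
  "localized_ints p = {of_int a / of_int b | a b. \<not> p dvd b}"

abbreviation "Z3 \<equiv> localized_ints 3"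

definition Lambda3 :: "(rat, arr) module" where
  "Lambda3 = arr_algebra
     \<lparr> carrier := {a.
         (\<forall>i j. a11 a $ i $ j \<in> Z3) \<and> (\<forall>i. a14 a $ i \<in> Z3) \<and>
         a22 a \<in> Z3 \<and> a24 a \<in> Z3 \<and> a33 a \<in> Z3 \<and>
         (\<forall>i. a41 a $ i \<in> (*) 3 ` Z3) \<and> a42 a \<in> Z3 \<and>
         const_part (a44 a) \<in> Z3 \<and> eta_part (a44 a) \<in> (*) 3 ` Z3 \<and> xi_part (a44 a) \<in> Z3} \<rparr>"

definition e3 :: arr where "e3 = arr_zero\<lparr>a11 := (\<chi> i j. if i = 3 \<and> j = 3 then 1 else 0)\<rparr>"
definition e4 :: arr where "e4 = arr_zero\<lparr>a22 := 1\<rparr>"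
definition e5 :: arr where "e5 = arr_zero\<lparr>a33 := 1\<rparr>"
definition e6 :: arr where "e6 = arr_zero\<lparr>a44 := 1\<rparr>"

definition Lambda3' :: "(rat, arr) module" where
  "Lambda3' = corner Lambda3 (e3 \<oplus>\<^bsub>Lambda3\<^esub> e4 \<oplus>\<^bsub>Lambda3\<^esub> e5 \<oplus>\<^bsub>Lambda3\<^esub> e6)"


section \<open>The quiver\<close>

datatype psi_vertex = E3 | E4 | E5 | E6
datatype psi_arrow = T1 | T2 | T3 | T4

definition Psi :: "(psi_vertex, psi_arrow) pre_digraph" where
  "Psi = \<lparr> verts = UNIV, arcs = UNIV,
     tail = (\<lambda>a. case a of T1 \<Rightarrow> E6 | T2 \<Rightarrow> E3 | T3 \<Rightarrow> E6 | T4 \<Rightarrow> E4),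
     head = (\<lambda>a. case a of T1 \<Rightarrow> E3 | T2 \<Rightarrow> E6 | T3 \<Rightarrow> E4 | T4 \<Rightarrow> E6) \<rparr>"

abbreviation F3 :: "int ring" where "F3 \<equiv> residue_ring 3"

abbreviation F3Psi :: "(int, psi_vertex \<times> psi_arrow list \<times> psi_vertex \<Rightarrow> int) module" where
  "F3Psi \<equiv> path_algebra F3 Psi"

abbreviation tau :: "psi_arrow \<Rightarrow> psi_vertex \<times> psi_arrow list \<times> psi_vertex \<Rightarrow> int" where
  "tau \<equiv> arrow_elt F3 Psi"

definition Psi_ideal :: "(psi_vertex \<times> psi_arrow list \<times> psi_vertex \<Rightarrow> int) set" where
  "Psi_ideal = Idl\<^bsub>F3Psi\<^esub>
     {tau T4 \<otimes>\<^bsub>F3Psi\<^esub> tau T3, tau T4 \<otimes>\<^bsub>F3Psi\<^esub> tau T1,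
      tau T2 \<otimes>\<^bsub>F3Psi\<^esub> tau T1, tau T2 \<otimes>\<^bsub>F3Psi\<^esub> tau T3}"

end

theory Submission imports Defs begin

text \<open>
  The class of a transitive biset is determined by the stabiliser of a point, a subgroup of
  \<open>S\<^sub>3 \<times> S\<^sub>3\<close> up to conjugation. The stabiliser of the class of \<open>(m, n)\<close> in \<open>M \<times>\<^sub>G N\<close> is the relational
  composite of the stabilisers of \<open>m\<close> and \<open>n\<close>, so that multiplication in the double Burnside algebra
  becomes a finite computation with the 22 conjugacy classes of subgroups. A product \<open>K \<times> P\<close> factors
  through the trivial group, a subgroup of the elements of equal sign through the group of order two,
  and the diagonal of the rotations through the group of order three. This leads to an integral matrix
  that sends the transitive bisets into a ring that agrees with \<open>\<Lambda>\<^sub>(\<^sub>3\<^sub>)\<close> modulo 3, respects products, and is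
  invertible modulo 3.

  Reducing entries modulo 3 maps \<open>\<Lambda>'\<^sub>(\<^sub>3\<^sub>)\<close> onto a corner of this algebra, and the four arrows are sent to
  off-diagonal unit entries of the same corner, where only the paths that avoid the four relations survive. In the
  \<open>3 \<times> 3\<close> block the first two diagonal idempotents are equivalent to the third, so the idempotent that
  cuts out the corner generates the unit ideal. For such an idempotent \<open>e\<close> of a ring \<open>A\<close> the functors
  \<open>M \<mapsto> eM\<close> and \<open>N \<mapsto> Hom\<^bsub>eAe\<^esub>(eA, N)\<close> are mutually inverse equivalences.
\<close>

section \<open>Morita equivalence for full idempotents\<close>

text \<open>Two obstacles shape the proof. Morita equivalence is stated for modules on one type
  \<open>'u\<close>, whereas the elements of Hom(eA, N) are functions into \<open>'u\<close>. As 1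
  is the sum of the \<open>q i\<close> times \<open>p i\<close>, such a map is determined by its
  values at the finitely many \<open>p i\<close>, and a list of fixed length over an infinite type
  can be coded by a single element. The double Burnside algebra is a quotient of a free module on
  all isomorphism classes. Its map to coordinates is therefore defined for every biset at once, as a
  weighted sum over points, for which additivity and multiplicativity are visible without a
  decomposition into orbits; decomposition serves for integrality and for the kernel. The matrix
  comes from the numbers of double cosets P g K, through which the products K \<times> P multiply.
  This table on the four classes of subgroups has rank 3: a factorisation of it gives the 3 \<times>
  3 block, the remaining direction gives \<open>cT\<close>, \<open>cX\<close>, \<open>cZ2\<close>.
  The other families are corrected by the inverses of the same tables for the groups of order two
  and three, whose denominators divide 2 and are harmless modulo 3.\<close>

definition pair_code :: "'u::infinite \<times> 'u \<Rightarrow> 'u" where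
  "pair_code = (SOME f. inj f)"

lemma inj_pair_code: "inj (pair_code :: 'u::infinite \<times> 'u \<Rightarrow> 'u)"
proof -
  obtain f :: "'u \<times> 'u \<Rightarrow> 'u" where "bij_betw f UNIV UNIV"
    using card_of_Times_same_infinite[OF infinite_UNIV[where 'a = 'u]]
    by (auto simp: card_of_ordIso[symmetric])
  then have "inj f" by (simp add: bij_betw_def)
  then show ?thesis unfolding pair_code_def by (rule someI[where P = inj])
qed

text \<open>Injective only among lists of equal length, since the empty list gets an arbitrary
  value. The lists that occur hold the values of a map at the \<open>p i\<close> and all have length
  \<open>n\<close>.\<close>

fun list_code :: "'u::infinite list \<Rightarrow> 'u" where
  "list_code [] = undefined"
| "list_code (x # xs) = pair_code (x, list_code xs)"

lemma list_code_inject: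
  "length xs = length ys \<Longrightarrow> list_code xs = list_code ys \<Longrightarrow> xs = ys"
proof (induction xs ys rule: list_induct2)
  case (Cons x xs y ys)
  then show ?case by (simp add: inj_eq[OF inj_pair_code])
qed simp

section \<open>Left modules: transport along injections, finite sums, inverses of
  isomorphisms\<close>

lemma left_moduleI:
  fixes A (structure) and M (structure)
  assumes "ring A" "abelian_group M"
    and "\<And>a x. \<lbrakk>a \<in> carrier A; x \<in> carrier M\<rbrakk> \<Longrightarrow> a \<odot>\<^bsub>M\<^esub> x \<in> carrier M"
    and "\<And>a b x. \<lbrakk>a \<in> carrier A; b \<in> carrier A; x \<in> carrier M\<rbrakk> \<Longrightarrow>
      (a \<oplus>\<^bsub>A\<^esub> b) \<odot>\<^bsub>M\<^esub> x = a \<odot>\<^bsub>M\<^esub> x \<oplus>\<^bsub>M\<^esub> b \<odot>\<^bsub>M\<^esub> x"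
    and "\<And>a x y. \<lbrakk>a \<in> carrier A; x \<in> carrier M; y \<in> carrier M\<rbrakk> \<Longrightarrow>
      a \<odot>\<^bsub>M\<^esub> (x \<oplus>\<^bsub>M\<^esub> y) = a \<odot>\<^bsub>M\<^esub> x \<oplus>\<^bsub>M\<^esub> a \<odot>\<^bsub>M\<^esub> y"
    and "\<And>a b x. \<lbrakk>a \<in> carrier A; b \<in> carrier A; x \<in> carrier M\<rbrakk> \<Longrightarrow>
      (a \<otimes>\<^bsub>A\<^esub> b) \<odot>\<^bsub>M\<^esub> x = a \<odot>\<^bsub>M\<^esub> (b \<odot>\<^bsub>M\<^esub> x)"
    and "\<And>x. x \<in> carrier M \<Longrightarrow> \<one>\<^bsub>A\<^esub> \<odot>\<^bsub>M\<^esub> x = x"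
  shows "left_module A M"
  using assms by (simp add: left_module_def left_module_axioms_def)

definition transport_module :: "('v \<Rightarrow> 'u) \<Rightarrow> ('a, 'v) module \<Rightarrow> ('a, 'u) module" where
  "transport_module f M = (let g = inv_into (carrier M) f in
     \<lparr> carrier = f ` carrier M,
       monoid.mult = (\<lambda>u v. f (g u \<otimes>\<^bsub>M\<^esub> g v)),
       one = f \<one>\<^bsub>M\<^esub>,
       zero = f \<zero>\<^bsub>M\<^esub>,
       add = (\<lambda>u v. f (g u \<oplus>\<^bsub>M\<^esub> g v)),
       smult = (\<lambda>a u. f (a \<odot>\<^bsub>M\<^esub> g u)) \<rparr>)"

lemma transport_module_simps:
  assumes "inj_on f (carrier M)"
  shows "carrier (transport_module f M) = f ` carrier M"
    and "\<zero>\<^bsub>transport_module f M\<^esub> = f \<zero>\<^bsub>M\<^esub>"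
    and "\<lbrakk>x \<in> carrier M; y \<in> carrier M\<rbrakk> \<Longrightarrow> f x \<oplus>\<^bsub>transport_module f M\<^esub> f y = f (x \<oplus>\<^bsub>M\<^esub> y)"
    and "x \<in> carrier M \<Longrightarrow> a \<odot>\<^bsub>transport_module f M\<^esub> f x = f (a \<odot>\<^bsub>M\<^esub> x)"
  using assms by (simp_all add: transport_module_def Let_def)

lemma left_module_transport:
  assumes "left_module A M" and inj: "inj_on f (carrier M)"
  shows "left_module A (transport_module f M)"
proof -
  interpret left_module A M by fact
  note [simp] = transport_module_simps[OF inj]
  have "\<exists>y\<in>carrier M. f (x \<oplus>\<^bsub>M\<^esub> y) = f \<zero>\<^bsub>M\<^esub>" "\<exists>y\<in>carrier M. f (y \<oplus>\<^bsub>M\<^esub> x) = f \<zero>\<^bsub>M\<^esub>"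
    if "x \<in> carrier M" for x
    using that by (auto intro!: bexI[of _ "\<ominus>\<^bsub>M\<^esub> x"] simp: M.l_neg M.r_neg)
  then show ?thesis
    by (intro left_moduleI abelian_groupI)
       (auto simp: A.ring_axioms M.a_ac smult_closed smult_l_distr smult_r_distr
         smult_assoc smult_one intro!: arg_cong[where f = f])
qed

lemma smult_finsum:
  assumes "left_module A M" "finite I" "f \<in> I \<rightarrow> carrier A" "x \<in> carrier M"
  shows "(finsum A f I) \<odot>\<^bsub>M\<^esub> x = (\<Oplus>\<^bsub>M\<^esub>i\<in>I. f i \<odot>\<^bsub>M\<^esub> x)"
proof -
  interpret left_module A M by fact
  have zero: "\<zero>\<^bsub>A\<^esub> \<odot>\<^bsub>M\<^esub> x = \<zero>\<^bsub>M\<^esub>"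
    by (metis A.zero_closed A.add.l_one M.add.r_cancel_one assms(4) smult_closed smult_l_distr)
  show ?thesis using assms(2,3)
    by (induction I rule: finite_induct)
       (simp_all add: zero A.finsum_insert M.finsum_insert Pi_iff smult_l_distr smult_closed assms(4))
qed

text \<open>Additivity is confined to a subset \<open>H\<close>, because the homomorphisms on eA to
  which this is applied take the value \<open>undefined\<close> outside of eA.\<close>

lemma additive_finsum:
  assumes "abelian_group M" "abelian_group N" "finite I"
    and f: "f \<in> I \<rightarrow> H" and H: "H \<subseteq> carrier M" "\<zero>\<^bsub>M\<^esub> \<in> H"
      "\<And>x y. \<lbrakk>x \<in> H; y \<in> H\<rbrakk> \<Longrightarrow> x \<oplus>\<^bsub>M\<^esub> y \<in> H"
    and \<phi>: "\<And>x. x \<in> H \<Longrightarrow> \<phi> x \<in> carrier N"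
      "\<And>x y. \<lbrakk>x \<in> H; y \<in> H\<rbrakk> \<Longrightarrow> \<phi> (x \<oplus>\<^bsub>M\<^esub> y) = \<phi> x \<oplus>\<^bsub>N\<^esub> \<phi> y"
  shows "\<phi> (finsum M f I) = (\<Oplus>\<^bsub>N\<^esub>i\<in>I. \<phi> (f i))"
proof -
  interpret M: abelian_group M by fact
  interpret N: abelian_group N by fact
  have zero: "\<phi> \<zero>\<^bsub>M\<^esub> = \<zero>\<^bsub>N\<^esub>"
    by (metis H(2) M.add.l_one M.zero_closed N.add.r_cancel_one \<phi>)
  have "\<phi> (finsum M f I) = (\<Oplus>\<^bsub>N\<^esub>i\<in>I. \<phi> (f i)) \<and> finsum M f I \<in> H"
    using assms(3) f
  proof (induction I rule: finite_induct)
    case (insert i I)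
    then have "f \<in> I \<rightarrow> carrier M" "f i \<in> carrier M" "(\<lambda>i. \<phi> (f i)) \<in> I \<rightarrow> carrier N"
      "\<phi> (f i) \<in> carrier N"
      using H(1) \<phi>(1) by (auto simp: Pi_iff)
    with insert show ?case
      by (simp add: M.finsum_insert N.finsum_insert \<phi> H)
  qed (simp add: zero H)
  then show ?thesis by blast
qed

lemma lmod_homD:
  assumes "f \<in> lmod_hom A M N"
  shows "x \<in> carrier M \<Longrightarrow> f x \<in> carrier N"
    and "\<lbrakk>x \<in> carrier M; y \<in> carrier M\<rbrakk> \<Longrightarrow> f (x \<oplus>\<^bsub>M\<^esub> y) = f x \<oplus>\<^bsub>N\<^esub> f y"
    and "\<lbrakk>a \<in> carrier A; x \<in> carrier M\<rbrakk> \<Longrightarrow> f (a \<odot>\<^bsub>M\<^esub> x) = a \<odot>\<^bsub>N\<^esub> f x"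
    and "x \<notin> carrier M \<Longrightarrow> f x = undefined"
  using assms by (auto simp: lmod_hom_def PiE_iff extensional_def)

lemma lmod_hom_inv_into:
  assumes M: "left_module A M" and f: "f \<in> lmod_hom A M N"
    and bij: "bij_betw f (carrier M) (carrier N)"
  shows "restrict (inv_into (carrier M) f) (carrier N) \<in> lmod_hom A N M"
    and "bij_betw (restrict (inv_into (carrier M) f) (carrier N)) (carrier N) (carrier M)"
proof -
  interpret left_module A M by fact
  note f = lmod_homD[OF f]
  let ?g = "inv_into (carrier M) f"
  have g: "?g (f x) = x" if "x \<in> carrier M" for x
    using bij that by (simp add: bij_betw_def)
  have surj: "\<exists>x\<in>carrier M. y = f x" if "y \<in> carrier N" for y
    using bij that by (auto simp: bij_betw_def)
  have "\<And>x y. \<lbrakk>x \<in> carrier M; y \<in> carrier M\<rbrakk> \<Longrightarrow> f x \<oplus>\<^bsub>N\<^esub> f y \<in> carrier N"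
    "\<And>a x. \<lbrakk>a \<in> carrier A; x \<in> carrier M\<rbrakk> \<Longrightarrow> a \<odot>\<^bsub>N\<^esub> f x \<in> carrier N"
    by (metis f(1,2) M.a_closed, metis f(1,3) smult_closed)
  moreover have "\<And>x y. \<lbrakk>x \<in> carrier M; y \<in> carrier M\<rbrakk> \<Longrightarrow> ?g (f x \<oplus>\<^bsub>N\<^esub> f y) = x \<oplus>\<^bsub>M\<^esub> y"
    "\<And>a x. \<lbrakk>a \<in> carrier A; x \<in> carrier M\<rbrakk> \<Longrightarrow> ?g (a \<odot>\<^bsub>N\<^esub> f x) = a \<odot>\<^bsub>M\<^esub> x"
    by (metis f(2) g M.a_closed, metis f(3) g smult_closed)
  ultimately have "x \<oplus>\<^bsub>N\<^esub> y \<in> carrier N \<and> ?g (x \<oplus>\<^bsub>N\<^esub> y) = ?g x \<oplus>\<^bsub>M\<^esub> ?g y"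
    "a \<in> carrier A \<Longrightarrow> a \<odot>\<^bsub>N\<^esub> x \<in> carrier N \<and> ?g (a \<odot>\<^bsub>N\<^esub> x) = a \<odot>\<^bsub>M\<^esub> ?g x"
    "?g x \<in> carrier M" if "x \<in> carrier N" "y \<in> carrier N" for a x y
    using surj[OF that(1)] surj[OF that(2)] by (auto simp: g)
  then show "restrict ?g (carrier N) \<in> lmod_hom A N M"
    by (auto simp: lmod_hom_def)
  show "bij_betw (restrict ?g (carrier N)) (carrier N) (carrier M)"
    using bij_betw_inv_into[OF bij] by (simp add: bij_betw_restrict_eq)
qed

text \<open>
  The map \<open>h\<close> identifies \<open>B\<close> with the corner ring \<open>eAe\<close>, and the family of the \<open>q i \<otimes> p i\<close> witnesses
  that the idempotent \<open>e\<close> generates \<open>A\<close> as a two-sided ideal.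
\<close>

locale full_corner = A?: ring A + B?: ring B for A :: "('a, 'm) ring_scheme" (structure)
    and B :: "('b, 'n) ring_scheme" (structure) +
  fixes h :: "'b \<Rightarrow> 'a" and n :: nat and p q :: "nat \<Rightarrow> 'a"
  assumes h_closed: "b \<in> carrier B \<Longrightarrow> h b \<in> carrier A"
    and h_add: "\<lbrakk>b \<in> carrier B; c \<in> carrier B\<rbrakk> \<Longrightarrow> h (b \<oplus>\<^bsub>B\<^esub> c) = h b \<oplus>\<^bsub>A\<^esub> h c"
    and h_mult: "\<lbrakk>b \<in> carrier B; c \<in> carrier B\<rbrakk> \<Longrightarrow> h (b \<otimes>\<^bsub>B\<^esub> c) = h b \<otimes>\<^bsub>A\<^esub> h c"
    and h_inj: "inj_on h (carrier B)"
    and h_onto: "a \<in> carrier A \<Longrightarrow> h \<one>\<^bsub>B\<^esub> \<otimes>\<^bsub>A\<^esub> a \<otimes>\<^bsub>A\<^esub> h \<one>\<^bsub>B\<^esub> \<in> h ` carrier B"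
    and p_closed: "i < n \<Longrightarrow> p i \<in> carrier A"
    and p_left: "i < n \<Longrightarrow> h \<one>\<^bsub>B\<^esub> \<otimes>\<^bsub>A\<^esub> p i = p i"
    and q_closed: "i < n \<Longrightarrow> q i \<in> carrier A"
    and full: "(\<Oplus>\<^bsub>A\<^esub>i\<in>{..<n}. q i \<otimes>\<^bsub>A\<^esub> p i) = \<one>\<^bsub>A\<^esub>"
begin

definition e :: 'a where "e = h \<one>\<^bsub>B\<^esub>"

lemma e_closed [simp]: "e \<in> carrier A"
  by (simp add: e_def h_closed)

lemma e_idem [simp]: "e \<otimes>\<^bsub>A\<^esub> e = e"
  by (metis B.one_closed B.r_one e_def h_mult)

lemma h_e: "b \<in> carrier B \<Longrightarrow> e \<otimes>\<^bsub>A\<^esub> h b = h b" "b \<in> carrier B \<Longrightarrow> h b \<otimes>\<^bsub>A\<^esub> e = h b"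
  by (metis B.one_closed B.l_one e_def h_mult, metis B.one_closed B.r_one e_def h_mult)

text \<open>The inverse of the embedding of \<open>B\<close>, extended to all of \<open>A\<close> by
  first cutting down to eAe.\<close>

definition lift :: "'a \<Rightarrow> 'b" where
  "lift a = inv_into (carrier B) h (e \<otimes>\<^bsub>A\<^esub> a \<otimes>\<^bsub>A\<^esub> e)"

lemma lift_closed [simp]: "a \<in> carrier A \<Longrightarrow> lift a \<in> carrier B"
  using h_onto inv_into_into[of _ h "carrier B"] by (simp add: lift_def e_def)

lemma h_lift: "a \<in> carrier A \<Longrightarrow> h (lift a) = e \<otimes>\<^bsub>A\<^esub> a \<otimes>\<^bsub>A\<^esub> e"
  using h_onto by (simp add: lift_def f_inv_into_f e_def)

lemma h_eqD: "\<lbrakk>h b = h c; b \<in> carrier B; c \<in> carrier B\<rbrakk> \<Longrightarrow> b = c"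
  using h_inj by (auto dest: inj_onD)

definition eA :: "'a set" where "eA = {x \<in> carrier A. e \<otimes>\<^bsub>A\<^esub> x = x}"

lemma eA_closed: "x \<in> eA \<Longrightarrow> x \<in> carrier A"
  by (simp add: eA_def)

lemma e_left: "x \<in> eA \<Longrightarrow> e \<otimes>\<^bsub>A\<^esub> x = x"
  by (simp add: eA_def)

lemma eA_intros [intro]:
  "e \<in> eA"
  "\<zero>\<^bsub>A\<^esub> \<in> eA"
  "i < n \<Longrightarrow> p i \<in> eA"
  "\<lbrakk>x \<in> eA; y \<in> eA\<rbrakk> \<Longrightarrow> x \<oplus>\<^bsub>A\<^esub> y \<in> eA"
  "\<lbrakk>x \<in> eA; a \<in> carrier A\<rbrakk> \<Longrightarrow> x \<otimes>\<^bsub>A\<^esub> a \<in> eA"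
  "\<lbrakk>b \<in> carrier B; x \<in> carrier A\<rbrakk> \<Longrightarrow> h b \<otimes>\<^bsub>A\<^esub> x \<in> eA"
  "a \<in> carrier A \<Longrightarrow> e \<otimes>\<^bsub>A\<^esub> a \<in> eA"
  using p_left p_closed
  by (auto simp: eA_def A.r_distr h_e h_closed simp flip: A.m_assoc e_def)

section \<open>The functor from M to eM\<close>

definition corner_module :: "('a, 'u) module \<Rightarrow> ('b, 'u) module" where
  "corner_module M =
     \<lparr> carrier = {x \<in> carrier M. e \<odot>\<^bsub>M\<^esub> x = x}, monoid.mult = monoid.mult M, one = \<one>\<^bsub>M\<^esub>,
       zero = \<zero>\<^bsub>M\<^esub>, add = add M, smult = (\<lambda>b x. h b \<odot>\<^bsub>M\<^esub> x) \<rparr>"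

lemma left_module_corner:
  assumes "left_module A M"
  shows "left_module B (corner_module M)"
proof -
  interpret left_module A M by fact
  \<comment> \<open>The inverse of x inside eM is taken to be e(-x), which e fixes because e is
    idempotent.\<close>
  have *: "\<exists>y. y \<in> carrier M \<and> e \<odot>\<^bsub>M\<^esub> y = y \<and> x \<oplus>\<^bsub>M\<^esub> y = \<zero>\<^bsub>M\<^esub>"
    if "x \<in> carrier M" "e \<odot>\<^bsub>M\<^esub> x = x" for x
  proof (intro exI conjI)
    show "e \<odot>\<^bsub>M\<^esub> (e \<odot>\<^bsub>M\<^esub> (\<ominus>\<^bsub>M\<^esub> x)) = e \<odot>\<^bsub>M\<^esub> (\<ominus>\<^bsub>M\<^esub> x)"
      using that by (simp flip: smult_assoc)
    have z: "e \<odot>\<^bsub>M\<^esub> \<zero>\<^bsub>M\<^esub> = \<zero>\<^bsub>M\<^esub>"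
      by (metis M.add.l_one M.add.r_cancel_one M.zero_closed e_closed smult_closed smult_r_distr)
    show "x \<oplus>\<^bsub>M\<^esub> e \<odot>\<^bsub>M\<^esub> (\<ominus>\<^bsub>M\<^esub> x) = \<zero>\<^bsub>M\<^esub>"
      using smult_r_distr[of e x "\<ominus>\<^bsub>M\<^esub> x"] that z by (simp add: M.r_neg)
  qed (use that smult_closed in simp)
  have z: "e \<odot>\<^bsub>M\<^esub> \<zero>\<^bsub>M\<^esub> = \<zero>\<^bsub>M\<^esub>"
    by (metis M.add.l_one M.add.r_cancel_one M.zero_closed e_closed smult_closed smult_r_distr)
  show ?thesis
    by (intro left_moduleI abelian_groupI)
       (auto simp: corner_module_def B.ring_axioms M.a_ac smult_closed smult_l_distr z
         smult_r_distr h_closed h_add h_mult h_e * smult_assoc simp flip: e_def smult_assoc[of e])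
qed

definition corner_map :: "('a, 'u) module \<Rightarrow> ('a, 'u) module \<Rightarrow> ('u \<Rightarrow> 'u) \<Rightarrow> 'u \<Rightarrow> 'u" where
  "corner_map M N f = restrict f (carrier (corner_module M))"

lemma corner_functor: "lmod_functor A B (corner_module :: ('a, 'u) module \<Rightarrow> _) corner_map"
proof -
  have hom: "corner_map M N f \<in> lmod_hom B (corner_module M) (corner_module N)"
    if "left_module A M" "left_module A N" "f \<in> lmod_hom A M N" for M N :: "('a, 'u) module" and f
  proof -
    interpret M: left_module A M by fact
    note f = lmod_homD[OF that(3)]
    interpret FM: left_module B "corner_module M" by (rule left_module_corner[OF that(1)])
    have "f x \<in> carrier (corner_module N)" if "x \<in> carrier (corner_module M)" for x
      using that f(3)[of e x] by (auto simp: corner_module_def f)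
    then show ?thesis
      using FM.add.m_closed FM.smult_closed f
      by (auto simp: corner_map_def lmod_hom_def) (auto simp: corner_module_def h_closed)
  qed
  show ?thesis
    unfolding lmod_functor_def
  proof (intro conjI allI impI ballI)
    fix L M N :: "('a, 'u) module" and f g
    assume LMN: "left_module A L \<and> left_module A M \<and> left_module A N"
      and f: "f \<in> lmod_hom A L M" and g: "g \<in> lmod_hom A M N"
    have "corner_map L M f \<in> lmod_hom B (corner_module L) (corner_module M)"
      using hom LMN f by blast
    then show "corner_map L N (compose (carrier L) g f) =
       compose (carrier (corner_module L)) (corner_map M N g) (corner_map L M f)"
      by (auto simp: fun_eq_iff compose_def corner_map_def restrict_def lmod_hom_def PiE_iff
          corner_module_def split: if_splits)
  qed (auto simp: left_module_corner hom, auto simp: corner_map_def corner_module_def fun_eq_iff)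
qed

section \<open>The functor from N to Hom(eA, N) over the corner, carried back to the type of
  N\<close>

definition hom_set :: "('b, 'v) module \<Rightarrow> ('a \<Rightarrow> 'v) set" where
  "hom_set N = {\<phi> \<in> eA \<rightarrow>\<^sub>E carrier N.
     (\<forall>x\<in>eA. \<forall>y\<in>eA. \<phi> (x \<oplus>\<^bsub>A\<^esub> y) = \<phi> x \<oplus>\<^bsub>N\<^esub> \<phi> y) \<and>
     (\<forall>b\<in>carrier B. \<forall>x\<in>eA. \<phi> (h b \<otimes>\<^bsub>A\<^esub> x) = b \<odot>\<^bsub>N\<^esub> \<phi> x)}"

lemma hom_setD:
  assumes "\<phi> \<in> hom_set N"
  shows "x \<in> eA \<Longrightarrow> \<phi> x \<in> carrier N"
    and "\<lbrakk>x \<in> eA; y \<in> eA\<rbrakk> \<Longrightarrow> \<phi> (x \<oplus>\<^bsub>A\<^esub> y) = \<phi> x \<oplus>\<^bsub>N\<^esub> \<phi> y"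
    and "\<lbrakk>b \<in> carrier B; x \<in> eA\<rbrakk> \<Longrightarrow> \<phi> (h b \<otimes>\<^bsub>A\<^esub> x) = b \<odot>\<^bsub>N\<^esub> \<phi> x"
    and "x \<notin> eA \<Longrightarrow> \<phi> x = undefined"
  using assms by (auto simp: hom_set_def PiE_iff extensional_def)

lemma hom_setI:
  assumes "\<And>x. x \<in> eA \<Longrightarrow> f x \<in> carrier N"
    and "\<And>x y. \<lbrakk>x \<in> eA; y \<in> eA\<rbrakk> \<Longrightarrow> f (x \<oplus>\<^bsub>A\<^esub> y) = f x \<oplus>\<^bsub>N\<^esub> f y"
    and "\<And>b x. \<lbrakk>b \<in> carrier B; x \<in> eA\<rbrakk> \<Longrightarrow> f (h b \<otimes>\<^bsub>A\<^esub> x) = b \<odot>\<^bsub>N\<^esub> f x"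
  shows "restrict f eA \<in> hom_set N"
  using assms eA_closed by (auto simp: hom_set_def eA_intros)

lemma hom_set_eqI:
  assumes "\<phi> \<in> hom_set N" "\<psi> \<in> hom_set N'" "\<And>x. x \<in> eA \<Longrightarrow> \<phi> x = \<psi> x"
  shows "\<phi> = \<psi>"
proof
  fix x
  show "\<phi> x = \<psi> x"
    using assms by (cases "x \<in> eA") (auto simp: hom_setD(4))
qed

text \<open>Expanding \<open>x = \<Sum> x q\<^sub>i p\<^sub>i\<close> shows that a homomorphism is determined by its values on the \<open>p i\<close>.\<close>

lemma hom_set_expand:
  assumes N: "left_module B N" and \<phi>: "\<phi> \<in> hom_set N" and x: "x \<in> eA"
  shows "\<phi> x = (\<Oplus>\<^bsub>N\<^esub>i\<in>{..<n}. lift (x \<otimes>\<^bsub>A\<^esub> q i) \<odot>\<^bsub>N\<^esub> \<phi> (p i))"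
proof -
  interpret N: left_module B N by fact
  have xA: "x \<in> carrier A" using x by (rule eA_closed)
  have "x = x \<otimes>\<^bsub>A\<^esub> (\<Oplus>\<^bsub>A\<^esub>i\<in>{..<n}. q i \<otimes>\<^bsub>A\<^esub> p i)"
    using xA by (simp add: full)
  also have "\<dots> = (\<Oplus>\<^bsub>A\<^esub>i\<in>{..<n}. x \<otimes>\<^bsub>A\<^esub> (q i \<otimes>\<^bsub>A\<^esub> p i))"
    using xA p_closed q_closed by (intro A.finsum_rdistr) auto
  finally have "\<phi> x = \<phi> (\<Oplus>\<^bsub>A\<^esub>i\<in>{..<n}. x \<otimes>\<^bsub>A\<^esub> (q i \<otimes>\<^bsub>A\<^esub> p i))"
    by simp
  also have "\<dots> = (\<Oplus>\<^bsub>N\<^esub>i\<in>{..<n}. \<phi> (x \<otimes>\<^bsub>A\<^esub> (q i \<otimes>\<^bsub>A\<^esub> p i)))"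
    by (rule additive_finsum[where H = eA])
       (use x p_closed q_closed eA_closed hom_setD[OF \<phi>] in
         \<open>auto intro: A.abelian_group_axioms N.M.abelian_group_axioms\<close>)
  also have "\<dots> = (\<Oplus>\<^bsub>N\<^esub>i\<in>{..<n}. lift (x \<otimes>\<^bsub>A\<^esub> q i) \<odot>\<^bsub>N\<^esub> \<phi> (p i))"
  proof (rule N.finsum_cong')
    fix i assume "i \<in> {..<n}"
    then have i: "p i \<in> eA" "p i \<in> carrier A" "q i \<in> carrier A"
      using p_closed q_closed by auto
    \<comment> \<open>As \<open>e\<close> fixes both x and \<open>p i\<close> from the left, the
      product contains e (x \<open>q i\<close>) e, an element of the corner, which can be pulled out
      of \<phi>.\<close>
    then have "x \<otimes>\<^bsub>A\<^esub> (q i \<otimes>\<^bsub>A\<^esub> p i) = (e \<otimes>\<^bsub>A\<^esub> x) \<otimes>\<^bsub>A\<^esub> (q i \<otimes>\<^bsub>A\<^esub> (e \<otimes>\<^bsub>A\<^esub> p i))"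
      using e_left x by simp
    also have "\<dots> = h (lift (x \<otimes>\<^bsub>A\<^esub> q i)) \<otimes>\<^bsub>A\<^esub> p i"
      using i xA by (simp add: h_lift A.m_assoc)
    finally show "\<phi> (x \<otimes>\<^bsub>A\<^esub> (q i \<otimes>\<^bsub>A\<^esub> p i)) = lift (x \<otimes>\<^bsub>A\<^esub> q i) \<odot>\<^bsub>N\<^esub> \<phi> (p i)"
      using hom_setD(3)[OF \<phi>] i xA by simp
  qed (use xA q_closed hom_setD(1)[OF \<phi>] in \<open>auto intro!: N.smult_closed\<close>)
  finally show ?thesis .
qed

text \<open>eA is a right \<open>A\<close>-module, which is what turns the maps out of it into a
  left \<open>A\<close>-module.\<close>

definition hom_module :: "('b, 'v) module \<Rightarrow> ('a, 'a \<Rightarrow> 'v) module" where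
  "hom_module N =
     \<lparr> carrier = hom_set N, monoid.mult = (\<lambda>\<phi> \<psi>. \<phi>), one = (\<lambda>x\<in>eA. \<zero>\<^bsub>N\<^esub>),
       zero = (\<lambda>x\<in>eA. \<zero>\<^bsub>N\<^esub>), add = (\<lambda>\<phi> \<psi>. \<lambda>x\<in>eA. \<phi> x \<oplus>\<^bsub>N\<^esub> \<psi> x),
       smult = (\<lambda>a \<phi>. \<lambda>x\<in>eA. \<phi> (x \<otimes>\<^bsub>A\<^esub> a)) \<rparr>"

lemma hom_module_simps [simp]:
  "carrier (hom_module N) = hom_set N"
  "\<zero>\<^bsub>hom_module N\<^esub> = (\<lambda>x\<in>eA. \<zero>\<^bsub>N\<^esub>)"
  "\<phi> \<oplus>\<^bsub>hom_module N\<^esub> \<psi> = (\<lambda>x\<in>eA. \<phi> x \<oplus>\<^bsub>N\<^esub> \<psi> x)"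
  "a \<odot>\<^bsub>hom_module N\<^esub> \<phi> = (\<lambda>x\<in>eA. \<phi> (x \<otimes>\<^bsub>A\<^esub> a))"
  by (simp_all add: hom_module_def)

lemma left_module_hom:
  assumes "left_module B N"
  shows "left_module A (hom_module N)"
proof -
  interpret N: left_module B N by fact
  have zero: "b \<odot>\<^bsub>N\<^esub> \<zero>\<^bsub>N\<^esub> = \<zero>\<^bsub>N\<^esub>" if "b \<in> carrier B" for b
    by (metis N.M.add.l_one N.M.add.r_cancel_one N.M.zero_closed that N.smult_closed N.smult_r_distr)
  have neg: "\<ominus>\<^bsub>N\<^esub> (b \<odot>\<^bsub>N\<^esub> x) = b \<odot>\<^bsub>N\<^esub> (\<ominus>\<^bsub>N\<^esub> x)" if "b \<in> carrier B" "x \<in> carrier N" for b x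
    using N.smult_r_distr[of b "\<ominus>\<^bsub>N\<^esub> x" x] that
    by (metis N.M.a_inv_closed N.M.l_neg N.M.minus_equality N.smult_closed zero)
  have add: "(\<lambda>x\<in>eA. \<phi> x \<oplus>\<^bsub>N\<^esub> \<psi> x) \<in> hom_set N" if "\<phi> \<in> hom_set N" "\<psi> \<in> hom_set N" for \<phi> \<psi>
    using hom_setD[OF that(1)] hom_setD[OF that(2)]
    by (intro hom_setI) (auto simp: N.M.a_ac N.smult_r_distr)
  have zero': "(\<lambda>x\<in>eA. \<zero>\<^bsub>N\<^esub>) \<in> hom_set N"
    by (intro hom_setI) (auto simp: zero)
  have neg': "(\<lambda>x\<in>eA. \<ominus>\<^bsub>N\<^esub> \<phi> x) \<in> hom_set N" if "\<phi> \<in> hom_set N" for \<phi>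
    using hom_setD[OF that] by (intro hom_setI) (auto simp: N.M.minus_add neg)
  have smult: "(\<lambda>x\<in>eA. \<phi> (x \<otimes>\<^bsub>A\<^esub> a)) \<in> hom_set N" if "\<phi> \<in> hom_set N" "a \<in> carrier A" for \<phi> a
    using hom_setD[OF that(1)] that(2)
    by (intro hom_setI) (auto simp: A.l_distr A.m_assoc eA_closed h_closed eA_intros)
  have inv: "\<exists>\<psi>\<in>hom_set N. (\<lambda>x\<in>eA. \<psi> x \<oplus>\<^bsub>N\<^esub> \<phi> x) = (\<lambda>x\<in>eA. \<zero>\<^bsub>N\<^esub>)" if "\<phi> \<in> hom_set N" for \<phi>
    using hom_setD(1)[OF that] by (intro bexI[OF _ neg'[OF that]] restrict_ext) (simp add: N.M.l_neg)
  show ?thesis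
  proof (intro left_moduleI abelian_groupI)
    fix \<phi> assume \<phi>: "\<phi> \<in> carrier (hom_module N)"
    show "\<zero>\<^bsub>hom_module N\<^esub> \<oplus>\<^bsub>hom_module N\<^esub> \<phi> = \<phi>" "\<one>\<^bsub>A\<^esub> \<odot>\<^bsub>hom_module N\<^esub> \<phi> = \<phi>"
      using \<phi> hom_setD[of \<phi>] by (auto simp: fun_eq_iff restrict_def eA_closed)
  next
    fix \<phi> \<psi> assume "\<phi> \<in> carrier (hom_module N)" "\<psi> \<in> carrier (hom_module N)"
    then show "\<phi> \<oplus>\<^bsub>hom_module N\<^esub> \<psi> = \<psi> \<oplus>\<^bsub>hom_module N\<^esub> \<phi>"
      by (auto simp: hom_setD N.M.a_comm intro!: restrict_ext)
  qed (auto simp: add zero' smult inv A.ring_axioms hom_setD N.M.a_assoc eA_closed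
      A.m_assoc A.r_distr eA_intros intro!: restrict_ext)
qed

text \<open>By \<open>hom_set_expand\<close> the values at the \<open>p i\<close> determine the map,
  so this code is injective on homomorphisms and keeps the induced module on the type
  \<open>'u\<close>.\<close>

definition hom_code :: "('a \<Rightarrow> 'u::infinite) \<Rightarrow> 'u" where
  "hom_code \<phi> = list_code (map (\<lambda>i. \<phi> (p i)) [0..<n])"

lemma inj_hom_code:
  assumes "left_module B N"
  shows "inj_on hom_code (hom_set N)"
proof (rule inj_onI)
  interpret N: left_module B N by fact
  fix \<phi> \<psi> assume \<phi>: "\<phi> \<in> hom_set N" and \<psi>: "\<psi> \<in> hom_set N" and eq: "hom_code \<phi> = hom_code \<psi>"
  have "map (\<lambda>i. \<phi> (p i)) [0..<n] = map (\<lambda>i. \<psi> (p i)) [0..<n]"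
    using eq unfolding hom_code_def by (rule list_code_inject[rotated]) simp
  then have eq: "\<phi> (p i) = \<psi> (p i)" if "i < n" for i
    using that by auto
  show "\<phi> = \<psi>"
  proof (rule hom_set_eqI[OF \<phi> \<psi>])
    fix x assume "x \<in> eA"
    then show "\<phi> x = \<psi> x"
      using eq q_closed hom_setD(1)[OF \<psi> eA_intros(3)] eA_closed
      by (auto simp: hom_set_expand[OF assms] \<phi> \<psi> intro!: N.finsum_cong' N.smult_closed)
  qed
qed

definition ind_module :: "('b, 'u::infinite) module \<Rightarrow> ('a, 'u) module" where
  "ind_module N = transport_module hom_code (hom_module N)"

lemma left_module_ind: "left_module B N \<Longrightarrow> left_module A (ind_module N)"
  unfolding ind_module_def
  by (intro left_module_transport left_module_hom) (simp_all add: inj_hom_code)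

definition hom_decode :: "('b, 'u::infinite) module \<Rightarrow> 'u \<Rightarrow> 'a \<Rightarrow> 'u" where
  "hom_decode N = inv_into (hom_set N) hom_code"

lemma hom_decode_code [simp]:
  "left_module B N \<Longrightarrow> \<phi> \<in> hom_set N \<Longrightarrow> hom_decode N (hom_code \<phi>) = \<phi>"
  by (simp add: hom_decode_def inj_hom_code)

lemma ind_module_simps:
  assumes "left_module B N"
  shows "carrier (ind_module N) = hom_code ` hom_set N"
    and "\<lbrakk>\<phi> \<in> hom_set N; \<psi> \<in> hom_set N\<rbrakk> \<Longrightarrow>
      hom_code \<phi> \<oplus>\<^bsub>ind_module N\<^esub> hom_code \<psi> = hom_code (\<lambda>x\<in>eA. \<phi> x \<oplus>\<^bsub>N\<^esub> \<psi> x)"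
    and "\<phi> \<in> hom_set N \<Longrightarrow> a \<odot>\<^bsub>ind_module N\<^esub> hom_code \<phi> = hom_code (\<lambda>x\<in>eA. \<phi> (x \<otimes>\<^bsub>A\<^esub> a))"
  using inj_hom_code[OF assms] transport_module_simps[of hom_code "hom_module N"]
  by (simp_all add: ind_module_def)

lemma hom_module_closed:
  assumes "left_module B N"
  shows "\<lbrakk>\<phi> \<in> hom_set N; \<psi> \<in> hom_set N\<rbrakk> \<Longrightarrow> (\<lambda>x\<in>eA. \<phi> x \<oplus>\<^bsub>N\<^esub> \<psi> x) \<in> hom_set N"
    and "\<lbrakk>\<phi> \<in> hom_set N; a \<in> carrier A\<rbrakk> \<Longrightarrow> (\<lambda>x\<in>eA. \<phi> (x \<otimes>\<^bsub>A\<^esub> a)) \<in> hom_set N"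
proof -
  interpret left_module A "hom_module N" by (rule left_module_hom[OF assms])
  show "\<lbrakk>\<phi> \<in> hom_set N; \<psi> \<in> hom_set N\<rbrakk> \<Longrightarrow> (\<lambda>x\<in>eA. \<phi> x \<oplus>\<^bsub>N\<^esub> \<psi> x) \<in> hom_set N"
    using M.a_closed[of \<phi> \<psi>] by simp
  show "\<lbrakk>\<phi> \<in> hom_set N; a \<in> carrier A\<rbrakk> \<Longrightarrow> (\<lambda>x\<in>eA. \<phi> (x \<otimes>\<^bsub>A\<^esub> a)) \<in> hom_set N"
    using smult_closed[of a \<phi>] by simp
qed

definition ind_map ::
  "('b, 'u::infinite) module \<Rightarrow> ('b, 'u) module \<Rightarrow> ('u \<Rightarrow> 'u) \<Rightarrow> 'u \<Rightarrow> 'u" where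
  "ind_map M N f = (\<lambda>u\<in>carrier (ind_module M). hom_code (\<lambda>x\<in>eA. f (hom_decode M u x)))"

lemma ind_map_code:
  "\<lbrakk>left_module B M; \<phi> \<in> hom_set M\<rbrakk> \<Longrightarrow> ind_map M N f (hom_code \<phi>) = hom_code (\<lambda>x\<in>eA. f (\<phi> x))"
  by (simp add: ind_map_def ind_module_simps cong: restrict_cong)

lemma hom_set_map:
  assumes f: "f \<in> lmod_hom B M N" and \<phi>: "\<phi> \<in> hom_set M"
  shows "(\<lambda>x\<in>eA. f (\<phi> x)) \<in> hom_set N"
  using lmod_homD[OF f] hom_setD[OF \<phi>] by (intro hom_setI) auto

lemma ind_map_hom:
  assumes M: "left_module B M" and N: "left_module B N" and f: "f \<in> lmod_hom B M N"
  shows "ind_map M N f \<in> lmod_hom A (ind_module M) (ind_module N)"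
proof -
  note f' = lmod_homD[OF f]
  have "ind_map M N f \<in> extensional (carrier (ind_module M))"
    by (simp add: ind_map_def)
  moreover have "(\<lambda>x\<in>eA. f ((\<lambda>x\<in>eA. \<phi> x \<oplus>\<^bsub>M\<^esub> \<psi> x) x)) =
      (\<lambda>x\<in>eA. (\<lambda>x\<in>eA. f (\<phi> x)) x \<oplus>\<^bsub>N\<^esub> (\<lambda>x\<in>eA. f (\<psi> x)) x)"
    if "\<phi> \<in> hom_set M" "\<psi> \<in> hom_set M" for \<phi> \<psi>
    using that by (intro restrict_ext) (simp add: hom_setD f')
  moreover have "(\<lambda>x\<in>eA. f ((\<lambda>x\<in>eA. \<phi> (x \<otimes>\<^bsub>A\<^esub> a)) x)) =
      (\<lambda>x\<in>eA. (\<lambda>x\<in>eA. f (\<phi> x)) (x \<otimes>\<^bsub>A\<^esub> a))" if "a \<in> carrier A" for \<phi> a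
    using that by (intro restrict_ext) (auto simp: eA_intros)
  ultimately show ?thesis
    by (auto simp: lmod_hom_def PiE_iff ind_module_simps M N ind_map_code hom_module_closed
        hom_set_map[OF f])
qed

lemma ind_functor: "lmod_functor B A (ind_module :: ('b, 'u::infinite) module \<Rightarrow> _) ind_map"
  unfolding lmod_functor_def
proof (intro conjI allI impI ballI)
  fix M :: "('b, 'u) module" assume M: "left_module B M"
  have id: "(\<lambda>x\<in>eA. if \<phi> x \<in> carrier M then id (\<phi> x) else undefined) = \<phi>" if "\<phi> \<in> hom_set M" for \<phi>
    using hom_setD[OF that] by (auto simp: fun_eq_iff restrict_def)
  show "ind_map M M (restrict id (carrier M)) = restrict id (carrier (ind_module M))"
  proof
    fix u
    show "ind_map M M (restrict id (carrier M)) u = restrict id (carrier (ind_module M)) u"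
    proof (cases "u \<in> carrier (ind_module M)")
      case True
      then obtain \<phi> where "\<phi> \<in> hom_set M" "u = hom_code \<phi>"
        by (auto simp: ind_module_simps M)
      with True show ?thesis by (simp add: ind_map_code M id)
    qed (simp add: ind_map_def)
  qed
next
  fix L M N :: "('b, 'u) module" and f g
  assume LMN: "left_module B L \<and> left_module B M \<and> left_module B N"
    and f: "f \<in> lmod_hom B L M" and g: "g \<in> lmod_hom B M N"
  have *: "(\<lambda>x\<in>eA. compose (carrier L) g f (\<phi> x)) = (\<lambda>x\<in>eA. g ((\<lambda>x\<in>eA. f (\<phi> x)) x))"
    if "\<phi> \<in> hom_set L" for \<phi>
    using hom_setD[OF that] by (intro restrict_ext) (simp add: compose_def)
  show "ind_map L N (compose (carrier L) g f) =
      compose (carrier (ind_module L)) (ind_map M N g) (ind_map L M f)"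
  proof
    fix u
    show "ind_map L N (compose (carrier L) g f) u =
      compose (carrier (ind_module L)) (ind_map M N g) (ind_map L M f) u"
    proof (cases "u \<in> carrier (ind_module L)")
      case True
      then obtain \<phi> where "\<phi> \<in> hom_set L" "u = hom_code \<phi>"
        using LMN by (auto simp: ind_module_simps)
      with True show ?thesis
        using LMN by (simp add: compose_eq ind_map_code * hom_set_map[OF f])
    qed (simp add: ind_map_def compose_def)
  qed
qed (auto simp: left_module_ind ind_map_hom)

text \<open>The isomorphism \<open>M \<rightarrow> Hom\<^sub>B(eA, eM)\<close> that sends \<open>m\<close> to the map \<open>x \<mapsto> x m\<close>.\<close>

definition ev_hom :: "('a, 'u) module \<Rightarrow> 'u \<Rightarrow> 'a \<Rightarrow> 'u" where
  "ev_hom M m = (\<lambda>x\<in>eA. x \<odot>\<^bsub>M\<^esub> m)"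

lemma ev_hom_in_hom_set:
  assumes "left_module A M" "m \<in> carrier M"
  shows "ev_hom M m \<in> hom_set (corner_module M)"
proof -
  interpret M: left_module A M by fact
  show ?thesis unfolding ev_hom_def
    by (rule hom_setI)
       (auto simp: corner_module_def eA_closed e_left M.smult_closed M.smult_l_distr M.smult_assoc
         h_closed assms(2) simp flip: M.smult_assoc[of e])
qed

text \<open>Since the \<open>q i\<close> times \<open>p i\<close> add up to 1, m is the sum of the
  \<open>q i\<close> (\<open>p i\<close> m), hence recovered from the values of its map at the
  \<open>p i\<close>. The same formula, with \<phi> (\<open>p i\<close>) in place of
  \<open>p i\<close> m, produces a preimage of an arbitrary \<phi>.\<close>

lemma ev_hom_bij:
  assumes "left_module A M"
  shows "bij_betw (ev_hom M) (carrier M) (hom_set (corner_module M))"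
proof -
  interpret M: left_module A M by fact
  let ?FM = "corner_module M"
  interpret FM: left_module B ?FM by (rule left_module_corner[OF assms])
  have qp: "(\<lambda>i. q i \<otimes>\<^bsub>A\<^esub> p i) \<in> {..<n} \<rightarrow> carrier A"
    using p_closed q_closed by auto
  have expand: "m = (\<Oplus>\<^bsub>M\<^esub>i\<in>{..<n}. q i \<odot>\<^bsub>M\<^esub> (p i \<odot>\<^bsub>M\<^esub> m))" if "m \<in> carrier M" for m
  proof -
    have "m = (\<Oplus>\<^bsub>A\<^esub>i\<in>{..<n}. q i \<otimes>\<^bsub>A\<^esub> p i) \<odot>\<^bsub>M\<^esub> m"
      using that by (simp add: full M.smult_one)
    also have "\<dots> = (\<Oplus>\<^bsub>M\<^esub>i\<in>{..<n}. (q i \<otimes>\<^bsub>A\<^esub> p i) \<odot>\<^bsub>M\<^esub> m)"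
      using that qp assms by (intro smult_finsum) auto
    also have "\<dots> = (\<Oplus>\<^bsub>M\<^esub>i\<in>{..<n}. q i \<odot>\<^bsub>M\<^esub> (p i \<odot>\<^bsub>M\<^esub> m))"
      using that p_closed q_closed
      by (intro M.finsum_cong') (auto simp: M.smult_assoc M.smult_closed)
    finally show ?thesis .
  qed
  \<comment> \<open>The expansion of \<phi> is a sum in eM and that of m is a sum in M: different
    carriers with the same addition.\<close>
  have finsum_eq: "finsum ?FM f I = finsum M f I" if "finite I" "f \<in> I \<rightarrow> carrier ?FM" for f and I :: "nat set"
    using that
  proof (induction I rule: finite_induct)
    case (insert i I)
    then have "f i \<in> carrier M" "f \<in> I \<rightarrow> carrier M" by (auto simp: corner_module_def)
    with insert show ?case
      by (simp add: FM.M.finsum_insert M.M.finsum_insert) (simp add: corner_module_def)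
  qed (subst FM.M.finsum_empty, simp add: corner_module_def)
  show ?thesis
  proof (rule bij_betw_imageI)
    show "inj_on (ev_hom M) (carrier M)"
    proof (rule inj_onI)
      fix m m' assume m: "m \<in> carrier M" "m' \<in> carrier M" and "ev_hom M m = ev_hom M m'"
      then have "p i \<odot>\<^bsub>M\<^esub> m = p i \<odot>\<^bsub>M\<^esub> m'" if "i < n" for i
        using eA_intros(3)[OF that] by (simp add: ev_hom_def fun_eq_iff restrict_def split: if_splits)
      then have "(\<Oplus>\<^bsub>M\<^esub>i\<in>{..<n}. q i \<odot>\<^bsub>M\<^esub> (p i \<odot>\<^bsub>M\<^esub> m)) = (\<Oplus>\<^bsub>M\<^esub>i\<in>{..<n}. q i \<odot>\<^bsub>M\<^esub> (p i \<odot>\<^bsub>M\<^esub> m'))"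
        using m p_closed q_closed by (intro M.finsum_cong') (auto simp: M.smult_closed)
      then show "m = m'" using expand m by metis
    qed
    show "ev_hom M ` carrier M = hom_set ?FM"
    proof (intro equalityI subsetI)
      fix \<phi> assume \<phi>: "\<phi> \<in> hom_set ?FM"
      define m where "m = (\<Oplus>\<^bsub>M\<^esub>i\<in>{..<n}. q i \<odot>\<^bsub>M\<^esub> \<phi> (p i))"
      have \<phi>M: "\<phi> (p i) \<in> carrier M" if "i < n" for i
        using hom_setD(1)[OF \<phi> eA_intros(3)[OF that]] by (simp add: corner_module_def)
      have m: "m \<in> carrier M"
        unfolding m_def using q_closed \<phi>M by (intro M.M.finsum_closed) (auto simp: M.smult_closed)
      have "x \<odot>\<^bsub>M\<^esub> m = \<phi> x" if x: "x \<in> eA" for x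
      proof -
        have xA: "x \<in> carrier A" using x by (rule eA_closed)
        have "x \<odot>\<^bsub>M\<^esub> m = (\<Oplus>\<^bsub>M\<^esub>i\<in>{..<n}. x \<odot>\<^bsub>M\<^esub> (q i \<odot>\<^bsub>M\<^esub> \<phi> (p i)))"
          unfolding m_def
          by (rule additive_finsum[where H = "carrier M"])
             (use xA q_closed \<phi>M M.M.abelian_group_axioms in
               \<open>auto simp: M.smult_closed M.smult_r_distr\<close>)
        also have "\<dots> = (\<Oplus>\<^bsub>M\<^esub>i\<in>{..<n}. lift (x \<otimes>\<^bsub>A\<^esub> q i) \<odot>\<^bsub>?FM\<^esub> \<phi> (p i))"
        proof (rule M.finsum_cong')
          fix i assume i: "i \<in> {..<n}"
          then have "e \<odot>\<^bsub>M\<^esub> \<phi> (p i) = \<phi> (p i)"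
            using hom_setD(1)[OF \<phi>] by (auto simp: corner_module_def)
          then have "x \<odot>\<^bsub>M\<^esub> (q i \<odot>\<^bsub>M\<^esub> \<phi> (p i)) = (e \<otimes>\<^bsub>A\<^esub> x) \<odot>\<^bsub>M\<^esub> (q i \<odot>\<^bsub>M\<^esub> (e \<odot>\<^bsub>M\<^esub> \<phi> (p i)))"
            using e_left x by simp
          also have "\<dots> = (e \<otimes>\<^bsub>A\<^esub> (x \<otimes>\<^bsub>A\<^esub> q i) \<otimes>\<^bsub>A\<^esub> e) \<odot>\<^bsub>M\<^esub> \<phi> (p i)"
            using i xA q_closed \<phi>M by (simp add: M.smult_assoc M.smult_closed)
          finally show "x \<odot>\<^bsub>M\<^esub> (q i \<odot>\<^bsub>M\<^esub> \<phi> (p i)) = lift (x \<otimes>\<^bsub>A\<^esub> q i) \<odot>\<^bsub>?FM\<^esub> \<phi> (p i)"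
            using i xA q_closed by (simp add: corner_module_def h_lift)
        qed (use xA q_closed \<phi>M in \<open>auto simp: corner_module_def intro!: M.smult_closed h_closed\<close>)
        also have "\<dots> = (\<Oplus>\<^bsub>?FM\<^esub>i\<in>{..<n}. lift (x \<otimes>\<^bsub>A\<^esub> q i) \<odot>\<^bsub>?FM\<^esub> \<phi> (p i))"
          using xA q_closed hom_setD(1)[OF \<phi>]
          by (intro finsum_eq[symmetric]) (auto intro!: FM.smult_closed)
        also have "\<dots> = \<phi> x"
          by (rule hom_set_expand[symmetric, OF left_module_corner[OF assms] \<phi> x])
        finally show ?thesis .
      qed
      then have "\<phi> = ev_hom M m"
        using hom_setD(4)[OF \<phi>] by (auto simp: ev_hom_def fun_eq_iff restrict_def)
      with m show "\<phi> \<in> ev_hom M ` carrier M" by blast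
    qed (auto simp: ev_hom_in_hom_set assms)
  qed
qed

lemma ind_corner_iso:
  "lmod_natural_iso A A (\<lambda>M :: ('a, 'u::infinite) module. ind_module (corner_module M))
     (\<lambda>M N f. ind_map (corner_module M) (corner_module N) (corner_map M N f)) (\<lambda>M. M) (\<lambda>M N f. f)"
proof -
  define ev where "ev M = (\<lambda>m\<in>carrier M. hom_code (ev_hom M m))" for M :: "('a, 'u) module"
  have ev_bij: "bij_betw (ev M) (carrier M) (carrier (ind_module (corner_module M)))"
    if M: "left_module A M" for M
  proof -
    have "bij_betw (hom_code \<circ> ev_hom M) (carrier M) (carrier (ind_module (corner_module M)))"
      using bij_betw_trans[OF ev_hom_bij[OF M] inj_on_imp_bij_betw[OF inj_hom_code]]
      by (simp add: ind_module_simps left_module_corner[OF M])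
    then show ?thesis by (simp add: ev_def comp_def bij_betw_restrict_eq)
  qed
  have ev_hom: "ev M \<in> lmod_hom A M (ind_module (corner_module M))" if M: "left_module A M" for M
  proof -
    interpret M: left_module A M by fact
    have "ev_hom M (x \<oplus>\<^bsub>M\<^esub> y) = (\<lambda>z\<in>eA. ev_hom M x z \<oplus>\<^bsub>corner_module M\<^esub> ev_hom M y z)"
      if "x \<in> carrier M" "y \<in> carrier M" for x y
      using that by (auto simp: ev_hom_def corner_module_def eA_closed M.smult_r_distr intro!: restrict_ext)
    moreover have "ev_hom M (a \<odot>\<^bsub>M\<^esub> x) = (\<lambda>z\<in>eA. ev_hom M x (z \<otimes>\<^bsub>A\<^esub> a))"
      if "a \<in> carrier A" "x \<in> carrier M" for a x
      using that by (auto simp: ev_hom_def eA_intros eA_closed M.smult_assoc intro!: restrict_ext)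
    ultimately show ?thesis
      by (auto simp: lmod_hom_def ev_def ind_module_simps left_module_corner[OF M]
          ev_hom_in_hom_set[OF M] M.smult_closed)
  qed
  \<comment> \<open>The natural isomorphism has to lead from the composite functor to the identity,
    hence the inverse of \<open>ev\<close>.\<close>
  define t where "t M = restrict (inv_into (carrier M) (ev M)) (carrier (ind_module (corner_module M)))"
    for M :: "('a, 'u) module"
  have t_ev: "t M (ev M m) = m" if "left_module A M" "m \<in> carrier M" for M m
    using ev_bij[OF that(1)] that(2) by (auto simp: t_def bij_betw_def)
  have "compose (carrier (ind_module (corner_module M))) f (t M) =
      compose (carrier (ind_module (corner_module M))) (t N)
        (ind_map (corner_module M) (corner_module N) (corner_map M N f))"
    if M: "left_module A M" and N: "left_module A N" and f: "f \<in> lmod_hom A M N" for M N f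
  proof (unfold compose_def, rule restrict_ext)
    fix u assume "u \<in> carrier (ind_module (corner_module M))"
    then obtain m where m: "m \<in> carrier M" and u: "u = ev M m"
      using ev_bij[OF M] by (auto simp: bij_betw_def)
    note f' = lmod_homD[OF f]
    have "corner_map M N f (ev_hom M m x) = ev_hom N (f m) x" if "x \<in> eA" for x
      using that m hom_setD(1)[OF ev_hom_in_hom_set[OF M m] that]
      by (simp add: ev_hom_def corner_map_def f' eA_closed)
    then have "(\<lambda>x\<in>eA. corner_map M N f (ev_hom M m x)) = ev_hom N (f m)"
      by (auto simp: ev_hom_def fun_eq_iff restrict_def)
    then have "ind_map (corner_module M) (corner_module N) (corner_map M N f) u = ev N (f m)"
      using m by (simp add: u ev_def ind_map_code left_module_corner[OF M] ev_hom_in_hom_set[OF M] f')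
    then show "f (t M u) = t N (ind_map (corner_module M) (corner_module N) (corner_map M N f) u)"
      using m by (simp add: t_ev M N f' u)
  qed
  then show ?thesis
    unfolding lmod_natural_iso_def
    using lmod_hom_inv_into[OF _ ev_hom ev_bij] by (intro exI[of _ t]) (auto simp: t_def)
qed

text \<open>The isomorphism \<open>e Hom\<^sub>B(eA, N) \<rightarrow> N\<close> is evaluation at \<open>e\<close>.\<close>

lemma corner_ind_iso:
  "lmod_natural_iso B B (\<lambda>N :: ('b, 'u::infinite) module. corner_module (ind_module N))
     (\<lambda>M N f. corner_map (ind_module M) (ind_module N) (ind_map M N f)) (\<lambda>M. M) (\<lambda>M N f. f)"
proof -
  \<comment> \<open>\<open>C N\<close> is e Hom(eA, N). A map in it is given by its value at e: it
    does not distinguish x from x e, and x e = e x e lies in the corner.\<close>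
  define C where "C N = {\<phi> \<in> hom_set N. \<forall>x\<in>eA. \<phi> (x \<otimes>\<^bsub>A\<^esub> e) = \<phi> x}" for N :: "('b, 'u) module"
  have carrier: "carrier (corner_module (ind_module N)) = hom_code ` C N" if N: "left_module B N" for N
  proof -
    have "e \<odot>\<^bsub>ind_module N\<^esub> hom_code \<phi> = hom_code \<phi> \<longleftrightarrow> \<phi> \<in> C N" if \<phi>: "\<phi> \<in> hom_set N" for \<phi>
    proof -
      have "e \<odot>\<^bsub>ind_module N\<^esub> hom_code \<phi> = hom_code \<phi> \<longleftrightarrow> (\<lambda>x\<in>eA. \<phi> (x \<otimes>\<^bsub>A\<^esub> e)) = \<phi>"
        using inj_onD[OF inj_hom_code[OF N]] \<phi> hom_module_closed(2)[OF N \<phi> e_closed]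
        by (auto simp: ind_module_simps N)
      also have "\<dots> \<longleftrightarrow> \<phi> \<in> C N"
        using \<phi> hom_setD(4)[OF \<phi>] by (auto simp: C_def fun_eq_iff restrict_def)
      finally show ?thesis .
    qed
    then show ?thesis
      by (auto simp: corner_module_def ind_module_simps N C_def)
  qed
  define t where "t N = (\<lambda>u\<in>carrier (corner_module (ind_module N)). hom_decode N u e)"
    for N :: "('b, 'u) module"
  have t: "t N (hom_code \<phi>) = \<phi> e" if "left_module B N" "\<phi> \<in> C N" for N \<phi>
    using that by (simp add: t_def carrier) (simp add: C_def)
  have C_eq: "\<phi> x = lift (x \<otimes>\<^bsub>A\<^esub> e) \<odot>\<^bsub>N\<^esub> \<phi> e" if "\<phi> \<in> C N" "x \<in> eA" for N \<phi> x
  proof -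
    have "x \<otimes>\<^bsub>A\<^esub> e = h (lift (x \<otimes>\<^bsub>A\<^esub> e)) \<otimes>\<^bsub>A\<^esub> e"
      using that(2) e_left[OF that(2)] by (simp add: h_lift eA_closed A.m_assoc flip: A.m_assoc[of e x])
    then show ?thesis
      using that hom_setD(3)[of \<phi> N "lift (x \<otimes>\<^bsub>A\<^esub> e)" e] by (auto simp: C_def eA_closed)
  qed
  have "t N \<in> lmod_hom B (corner_module (ind_module N)) N \<and>
      bij_betw (t N) (carrier (corner_module (ind_module N))) (carrier N)" if N: "left_module B N" for N
  proof
    interpret N: left_module B N by fact
    interpret FG: left_module B "corner_module (ind_module N)"
      by (intro left_module_corner left_module_ind N)
    have add: "t N (u \<oplus>\<^bsub>corner_module (ind_module N)\<^esub> v) = t N u \<oplus>\<^bsub>N\<^esub> t N v"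
      if "u \<in> carrier (corner_module (ind_module N))" "v \<in> carrier (corner_module (ind_module N))" for u v
    proof -
      from that obtain \<phi> \<psi> where *: "\<phi> \<in> C N" "u = hom_code \<phi>" "\<psi> \<in> C N" "v = hom_code \<psi>"
        by (auto simp: carrier[OF N])
      then have "u \<oplus>\<^bsub>corner_module (ind_module N)\<^esub> v = hom_code (\<lambda>x\<in>eA. \<phi> x \<oplus>\<^bsub>N\<^esub> \<psi> x)"
        by (simp add: corner_module_def ind_module_simps N C_def)
      moreover have "(\<lambda>x\<in>eA. \<phi> x \<oplus>\<^bsub>N\<^esub> \<psi> x) \<in> C N"
        using * by (auto simp: C_def hom_module_closed[OF N] eA_intros)
      ultimately show ?thesis using * by (simp add: t N eA_intros)
    qed
    have smult: "t N (b \<odot>\<^bsub>corner_module (ind_module N)\<^esub> u) = b \<odot>\<^bsub>N\<^esub> t N u"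
      if "b \<in> carrier B" "u \<in> carrier (corner_module (ind_module N))" for b u
    proof -
      from that obtain \<phi> where *: "\<phi> \<in> C N" "u = hom_code \<phi>"
        by (auto simp: carrier[OF N])
      then have "b \<odot>\<^bsub>corner_module (ind_module N)\<^esub> u = hom_code (\<lambda>x\<in>eA. \<phi> (x \<otimes>\<^bsub>A\<^esub> h b))"
        by (simp add: corner_module_def ind_module_simps N C_def)
      moreover have "(\<lambda>x\<in>eA. \<phi> (x \<otimes>\<^bsub>A\<^esub> h b)) \<in> C N"
        using * that(1) h_closed
        by (auto simp: C_def hom_module_closed[OF N] eA_intros eA_closed A.m_assoc h_e)
      moreover have "\<phi> (e \<otimes>\<^bsub>A\<^esub> h b) = b \<odot>\<^bsub>N\<^esub> \<phi> e"
        using * that(1) hom_setD(3)[of \<phi> N b e] by (auto simp: C_def h_e)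
      ultimately show ?thesis using * by (simp add: t N eA_intros)
    qed
    show "t N \<in> lmod_hom B (corner_module (ind_module N)) N"
      using add smult hom_setD(1)[OF _ eA_intros(1)]
      by (auto simp: lmod_hom_def carrier N t) (auto simp: t_def C_def carrier[OF N])
    show "bij_betw (t N) (carrier (corner_module (ind_module N))) (carrier N)"
    proof (rule bij_betw_imageI)
      show "inj_on (t N) (carrier (corner_module (ind_module N)))"
      proof (rule inj_onI, unfold carrier[OF N], elim imageE)
        fix u v \<phi> \<psi> assume "t N u = t N v" and *: "\<phi> \<in> C N" "u = hom_code \<phi>" "\<psi> \<in> C N" "v = hom_code \<psi>"
        then have "\<phi> e = \<psi> e" by (simp add: t N)
        have "\<phi> = \<psi>"
        proof (rule hom_set_eqI)
          fix x assume "x \<in> eA"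
          then show "\<phi> x = \<psi> x"
            unfolding C_eq[OF *(1) \<open>x \<in> eA\<close>] C_eq[OF *(3) \<open>x \<in> eA\<close>] by (simp add: \<open>\<phi> e = \<psi> e\<close>)
        qed (use * in \<open>auto simp: C_def\<close>)
        with * show "u = v" by simp
      qed
      show "t N ` carrier (corner_module (ind_module N)) = carrier N"
      proof (intro equalityI subsetI)
        fix y assume y: "y \<in> carrier N"
        \<comment> \<open>The only possible map with value y at e: x is replaced by the corner
          element x e, which acts on y through \<open>B\<close>.\<close>
        define \<phi> where "\<phi> = (\<lambda>x\<in>eA. lift (x \<otimes>\<^bsub>A\<^esub> e) \<odot>\<^bsub>N\<^esub> y)"
        have l: "lift e = \<one>\<^bsub>B\<^esub>"
          by (rule h_eqD) (simp_all add: h_lift, simp add: e_def)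
        have "\<phi> \<in> hom_set N"
          unfolding \<phi>_def
        proof (rule hom_setI)
          fix x x' assume x: "x \<in> eA" "x' \<in> eA"
          then have "lift ((x \<oplus>\<^bsub>A\<^esub> x') \<otimes>\<^bsub>A\<^esub> e) = lift (x \<otimes>\<^bsub>A\<^esub> e) \<oplus>\<^bsub>B\<^esub> lift (x' \<otimes>\<^bsub>A\<^esub> e)"
            by (intro h_eqD) (simp_all add: h_lift h_add eA_closed A.l_distr A.r_distr)
          with x y show "lift ((x \<oplus>\<^bsub>A\<^esub> x') \<otimes>\<^bsub>A\<^esub> e) \<odot>\<^bsub>N\<^esub> y =
              lift (x \<otimes>\<^bsub>A\<^esub> e) \<odot>\<^bsub>N\<^esub> y \<oplus>\<^bsub>N\<^esub> lift (x' \<otimes>\<^bsub>A\<^esub> e) \<odot>\<^bsub>N\<^esub> y"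
            by (simp add: N.smult_l_distr eA_closed)
        next
          fix b x assume b: "b \<in> carrier B" and x: "x \<in> eA"
          then have "e \<otimes>\<^bsub>A\<^esub> (h b \<otimes>\<^bsub>A\<^esub> x \<otimes>\<^bsub>A\<^esub> e) = h b \<otimes>\<^bsub>A\<^esub> x \<otimes>\<^bsub>A\<^esub> e"
            "e \<otimes>\<^bsub>A\<^esub> (x \<otimes>\<^bsub>A\<^esub> e) = x \<otimes>\<^bsub>A\<^esub> e"
            by (intro e_left; simp add: eA_intros eA_closed)+
          with b x have "lift (h b \<otimes>\<^bsub>A\<^esub> x \<otimes>\<^bsub>A\<^esub> e) = b \<otimes>\<^bsub>B\<^esub> lift (x \<otimes>\<^bsub>A\<^esub> e)"
            by (intro h_eqD) (simp_all add: h_lift h_mult eA_closed h_closed, simp add: eA_closed h_closed A.m_assoc)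
          with x y b show "lift (h b \<otimes>\<^bsub>A\<^esub> x \<otimes>\<^bsub>A\<^esub> e) \<odot>\<^bsub>N\<^esub> y = b \<odot>\<^bsub>N\<^esub> (lift (x \<otimes>\<^bsub>A\<^esub> e) \<odot>\<^bsub>N\<^esub> y)"
            by (simp add: N.smult_assoc eA_closed)
        qed (auto simp: N.smult_closed y eA_closed)
        then have "\<phi> \<in> C N"
          by (auto simp: C_def \<phi>_def eA_intros eA_closed A.m_assoc)
        moreover have "\<phi> e = y"
          using y by (simp add: \<phi>_def eA_intros l N.smult_one)
        ultimately show "y \<in> t N ` carrier (corner_module (ind_module N))"
          using N by (force simp: carrier t image_iff)
      next
        fix y assume "y \<in> t N ` carrier (corner_module (ind_module N))"
        then show "y \<in> carrier N"
          using hom_setD(1)[OF _ eA_intros(1)] by (auto simp: carrier N t) (auto simp: C_def)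
      qed
    qed
  qed
  moreover have "compose (carrier (corner_module (ind_module M))) f (t M) =
      compose (carrier (corner_module (ind_module M))) (t N)
        (corner_map (ind_module M) (ind_module N) (ind_map M N f))"
    if M: "left_module B M" and N: "left_module B N" and f: "f \<in> lmod_hom B M N" for M N f
  proof (unfold compose_def, rule restrict_ext)
    fix u assume u: "u \<in> carrier (corner_module (ind_module M))"
    then obtain \<phi> where \<phi>: "\<phi> \<in> C M" "u = hom_code \<phi>" by (auto simp: carrier M)
    then have "(\<lambda>x\<in>eA. f (\<phi> x)) \<in> C N"
      using hom_set_map[OF f] by (auto simp: C_def eA_intros)
    with u \<phi> show "f (t M u) = t N (corner_map (ind_module M) (ind_module N) (ind_map M N f) u)"
      using ind_map_code[OF M, of \<phi>] by (simp add: corner_map_def t M N eA_intros) (simp add: C_def t N eA_intros)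
  qed
  ultimately show ?thesis
    unfolding lmod_natural_iso_def by (intro exI[of _ t]) blast
qed

theorem morita_equivalent: "morita_equivalent TYPE('u::infinite) A B"
  unfolding morita_equivalent_def
  using A.ring_axioms B.ring_axioms corner_functor ind_functor ind_corner_iso corner_ind_iso by blast

end


section \<open>Bisets\<close>

lemma card_uniform_fibres:
  assumes "finite A" "\<And>x. x \<in> A \<Longrightarrow> card {y \<in> A. f y = f x} = k"
  shows "card A = k * card (f ` A)"
proof -
  have "card A = (\<Sum>y\<in>f ` A. \<Sum>x\<in>{x \<in> A. f x = y}. 1)"
    using sum.image_gen[OF assms(1), of "\<lambda>_. 1 :: nat" f] by simp
  also have "\<dots> = (\<Sum>y\<in>f ` A. k)"
    using assms(2) by (intro sum.cong) auto
  finally show ?thesis by simp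
qed

lemma isomorphic_bisets_trans:
  assumes "isomorphic_bisets G L M" "isomorphic_bisets G M N"
  shows "isomorphic_bisets G L N"
proof -
  from assms(1) obtain f where f: "bij_betw f (points L) (points M)"
    "\<forall>g\<in>carrier G. \<forall>x\<in>points L. f (lact L g x) = lact M g (f x) \<and> f (ract L x g) = ract M (f x) g"
    unfolding isomorphic_bisets_def by blast
  from assms(2) obtain h where h: "bij_betw h (points M) (points N)"
    "\<forall>g\<in>carrier G. \<forall>x\<in>points M. h (lact M g x) = lact N g (h x) \<and> h (ract M x g) = ract N (h x) g"
    unfolding isomorphic_bisets_def by blast
  show ?thesis
    unfolding isomorphic_bisets_def
    using f h bij_betw_trans[OF f(1) h(1)] bij_betwE[OF f(1)] by (intro exI[of _ "h \<circ> f"]) auto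
qed

text \<open>The stabiliser for the action (g, h) x = g x h^{-1}, written as a relation between the
  two copies of G so that products of bisets lead to composition of relations.\<close>

definition stab :: "('g, 'm) monoid_scheme \<Rightarrow> ('g, 'x) biset \<Rightarrow> 'x \<Rightarrow> ('g \<times> 'g) set" where
  "stab G M x = {(g, h). g \<in> carrier G \<and> h \<in> carrier G \<and> lact M g x = ract M x h}"

definition conj_rel :: "('g, 'm) monoid_scheme \<Rightarrow> 'g \<Rightarrow> 'g \<Rightarrow> ('g \<times> 'g) set \<Rightarrow> ('g \<times> 'g) set" where
  "conj_rel G g h L = {(a, b). a \<in> carrier G \<and> b \<in> carrier G \<and>
     (inv\<^bsub>G\<^esub> g \<otimes>\<^bsub>G\<^esub> a \<otimes>\<^bsub>G\<^esub> g, inv\<^bsub>G\<^esub> h \<otimes>\<^bsub>G\<^esub> b \<otimes>\<^bsub>G\<^esub> h) \<in> L}"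

definition orbit :: "('g, 'm) monoid_scheme \<Rightarrow> ('g, 'x) biset \<Rightarrow> 'x \<Rightarrow> 'x set" where
  "orbit G M x = (\<lambda>(g, h). lact M g (ract M x h)) ` (carrier G \<times> carrier G)"

definition pair_orbit ::
  "('g, 'm) monoid_scheme \<Rightarrow> ('g, 'x) biset \<Rightarrow> ('g, 'y) biset \<Rightarrow> 'x \<times> 'y \<Rightarrow> ('x \<times> 'y) set" where
  "pair_orbit G M N = (\<lambda>(m, n). (\<lambda>g. (ract M m (inv\<^bsub>G\<^esub> g), lact N g n)) ` carrier G)"

lemma points_prod: "points (biset_prod G M N) = pair_orbit G M N ` (points M \<times> points N)"
  by (simp add: biset_prod_def pair_orbit_def)

definition sub_biset :: "('g, 'x) biset \<Rightarrow> 'x set \<Rightarrow> ('g, 'x) biset" where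
  "sub_biset M A = \<lparr> points = A, lact = lact M, ract = ract M \<rparr>"

locale biset_group = G?: group G for G :: "('g, 'm) monoid_scheme" (structure) +
  assumes finite_G: "finite (carrier G)"
begin

lemma finite_bisetD:
  assumes "finite_biset G M"
  shows "finite (points M)"
    and "\<lbrakk>g \<in> carrier G; x \<in> points M\<rbrakk> \<Longrightarrow> lact M g x \<in> points M"
    and "\<lbrakk>g \<in> carrier G; x \<in> points M\<rbrakk> \<Longrightarrow> ract M x g \<in> points M"
    and "x \<in> points M \<Longrightarrow> lact M \<one> x = x"
    and "x \<in> points M \<Longrightarrow> ract M x \<one> = x"
    and "\<lbrakk>g \<in> carrier G; h \<in> carrier G; x \<in> points M\<rbrakk> \<Longrightarrow> lact M (g \<otimes> h) x = lact M g (lact M h x)"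
    and "\<lbrakk>g \<in> carrier G; h \<in> carrier G; x \<in> points M\<rbrakk> \<Longrightarrow> ract M x (g \<otimes> h) = ract M (ract M x g) h"
    and "\<lbrakk>g \<in> carrier G; h \<in> carrier G; x \<in> points M\<rbrakk> \<Longrightarrow> ract M (lact M g x) h = lact M g (ract M x h)"
  using assms by (simp_all add: finite_biset_def)

lemma lact_inv:
  assumes "finite_biset G M" "g \<in> carrier G" "x \<in> points M"
  shows "lact M (inv g) (lact M g x) = x" "lact M g (lact M (inv g) x) = x"
  using finite_bisetD(4,6)[OF assms(1)] assms(2,3)
  by (metis G.inv_closed G.l_inv, metis G.inv_closed G.r_inv)

lemma ract_inv:
  assumes "finite_biset G M" "g \<in> carrier G" "x \<in> points M"
  shows "ract M (ract M x g) (inv g) = x" "ract M (ract M x (inv g)) g = x"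
  using finite_bisetD(5,7)[OF assms(1)] assms(2,3)
  by (metis G.inv_closed G.r_inv, metis G.inv_closed G.l_inv)

lemma isomorphic_bisets_sym:
  assumes M: "finite_biset G M" and "isomorphic_bisets G M N"
  shows "isomorphic_bisets G N M"
proof -
  from assms(2) obtain f where bij: "bij_betw f (points M) (points N)"
    and f: "\<forall>g\<in>carrier G. \<forall>x\<in>points M. f (lact M g x) = lact N g (f x) \<and> f (ract M x g) = ract N (f x) g"
    unfolding isomorphic_bisets_def by blast
  let ?h = "inv_into (points M) f"
  have h: "?h (f x) = x" if "x \<in> points M" for x using bij that by (simp add: bij_betw_def)
  have "?h (lact N g y) = lact M g (?h y) \<and> ?h (ract N y g) = ract M (?h y) g"
    if g: "g \<in> carrier G" and y: "y \<in> points N" for g y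
  proof -
    have "y \<in> f ` points M" using bij y by (simp add: bij_betw_def)
    then obtain x where x: "x \<in> points M" "y = f x" by blast
    have "lact N g y = f (lact M g x)" "ract N y g = f (ract M x g)" using f g x by simp_all
    then show ?thesis using x g by (simp add: h finite_bisetD[OF M])
  qed
  then show ?thesis
    unfolding isomorphic_bisets_def using bij_betw_inv_into[OF bij] by blast
qed

lemma nat_copy:
  assumes M: "finite_biset G M"
  shows "\<exists>P :: ('g, nat) biset. finite_biset G P \<and> isomorphic_bisets G P M"
proof -
  obtain f where bij: "bij_betw f {0..<card (points M)} (points M)"
    using ex_bij_betw_nat_finite[OF finite_bisetD(1)[OF M]] by blast
  let ?A = "{0..<card (points M)}"
  let ?h = "inv_into ?A f"
  have fh: "f (?h x) = x" "?h x \<in> ?A" if "x \<in> points M" for x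
    using bij_betw_inv_into_right[OF bij that] bij_betwE[OF bij_betw_inv_into[OF bij]] that by blast+
  have hf: "?h (f i) = i" "f i \<in> points M" if "i \<in> ?A" for i
    using bij_betw_inv_into_left[OF bij that] bij_betwE[OF bij] that by blast+
  define P where "P = \<lparr> points = ?A, lact = (\<lambda>g i. ?h (lact M g (f i))), ract = (\<lambda>i g. ?h (ract M (f i) g)) \<rparr>"
  have "finite_biset G P"
    unfolding finite_biset_def P_def biset.simps
  proof (intro conjI ballI)
    fix g h i assume "g \<in> carrier G" "h \<in> carrier G" "i \<in> ?A"
    then show "?h (lact M (g \<otimes> h) (f i)) = ?h (lact M g (f (?h (lact M h (f i)))))"
      "?h (ract M (f i) (g \<otimes> h)) = ?h (ract M (f (?h (ract M (f i) g))) h)"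
      "?h (ract M (f (?h (lact M g (f i)))) h) = ?h (lact M g (f (?h (ract M (f i) h))))"
      using fh(1) hf(2) finite_bisetD[OF M] by simp_all
  qed (use fh(2) hf finite_bisetD[OF M] in simp_all)
  moreover have "isomorphic_bisets G P M"
    unfolding isomorphic_bisets_def P_def
    using bij fh(1) hf(2) finite_bisetD[OF M] by (intro exI[of _ f]) simp
  ultimately show ?thesis by blast
qed

lemma biset_class_eq_iff:
  assumes "finite_biset G M" "finite_biset G N"
  shows "biset_class G M = biset_class G N \<longleftrightarrow> isomorphic_bisets G M N"
proof
  assume eq: "biset_class G M = biset_class G N"
  obtain P :: "('g, nat) biset" where P: "finite_biset G P" "isomorphic_bisets G P M"
    using nat_copy[OF assms(1)] by blast
  then have "P \<in> biset_class G N" using eq by (auto simp: biset_class_def)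
  then show "isomorphic_bisets G M N"
    using P by (auto simp: biset_class_def intro: isomorphic_bisets_trans isomorphic_bisets_sym)
next
  assume "isomorphic_bisets G M N"
  then show "biset_class G M = biset_class G N"
    using assms by (auto simp: biset_class_def intro: isomorphic_bisets_trans isomorphic_bisets_sym)
qed

lemma biset_class_nonempty: "finite_biset G M \<Longrightarrow> \<exists>P. P \<in> biset_class G M"
  using nat_copy by (fastforce simp: biset_class_def)

lemma biset_class_in: "finite_biset G M \<Longrightarrow> biset_class G M \<in> biset_classes G"
proof -
  assume M: "finite_biset G M"
  then obtain P :: "('g, nat) biset" where P: "finite_biset G P" "isomorphic_bisets G P M"
    using nat_copy by blast
  then have "biset_class G M = biset_class G P" using M biset_class_eq_iff by metis
  then show ?thesis using P by (simp add: biset_classes_def)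
qed

lemma biset_classE:
  assumes "c \<in> biset_classes G"
  obtains M :: "('g, nat) biset" where "finite_biset G M" "c = biset_class G M"
  using assms by (auto simp: biset_classes_def)


subsection \<open>Products\<close>

context
  fixes M :: "('g, 'x) biset" and N :: "('g, 'y) biset"
  assumes M: "finite_biset G M" and N: "finite_biset G N"
begin

lemma pair_orbit_self: "\<lbrakk>m \<in> points M; n \<in> points N\<rbrakk> \<Longrightarrow> (m, n) \<in> pair_orbit G M N (m, n)"
  by (auto simp: pair_orbit_def finite_bisetD[OF M] finite_bisetD[OF N] intro!: image_eqI[of _ _ \<one>])

lemma pair_orbit_move:
  assumes "m \<in> points M" "n \<in> points N" "g \<in> carrier G"
  shows "pair_orbit G M N (ract M m (inv g), lact N g n) = pair_orbit G M N (m, n)"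
proof -
  have *: "pair_orbit G M N (ract M m (inv g), lact N g n) \<subseteq> pair_orbit G M N (m, n)"
    if "m \<in> points M" "n \<in> points N" "g \<in> carrier G" for m n g
  proof
    fix p assume "p \<in> pair_orbit G M N (ract M m (inv g), lact N g n)"
    then obtain h where h: "h \<in> carrier G"
      and p: "p = (ract M (ract M m (inv g)) (inv h), lact N h (lact N g n))"
      by (auto simp: pair_orbit_def)
    have "p = (ract M m (inv (h \<otimes> g)), lact N (h \<otimes> g) n)"
      using that h by (simp add: p G.inv_mult_group finite_bisetD[OF M] finite_bisetD[OF N])
    then show "p \<in> pair_orbit G M N (m, n)"
      using that h by (auto simp: pair_orbit_def)
  qed
  have "pair_orbit G M N (ract M (ract M m (inv g)) (inv (inv g)), lact N (inv g) (lact N g n)) \<subseteq>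
      pair_orbit G M N (ract M m (inv g), lact N g n)"
    using assms by (intro *) (simp_all add: finite_bisetD[OF M] finite_bisetD[OF N])
  moreover have "ract M (ract M m (inv g)) (inv (inv g)) = m" "lact N (inv g) (lact N g n) = n"
    using assms by (simp_all add: ract_inv[OF M] lact_inv[OF N])
  ultimately show ?thesis using *[OF assms] by auto
qed

lemma pair_orbit_eq_iff:
  assumes "m \<in> points M" "n \<in> points N" "m' \<in> points M" "n' \<in> points N"
  shows "pair_orbit G M N (m, n) = pair_orbit G M N (m', n') \<longleftrightarrow>
    (\<exists>g\<in>carrier G. m' = ract M m (inv g) \<and> n' = lact N g n)"
proof
  assume "pair_orbit G M N (m, n) = pair_orbit G M N (m', n')"
  then have "(m', n') \<in> pair_orbit G M N (m, n)" using pair_orbit_self[OF assms(3,4)] by simp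
  then show "\<exists>g\<in>carrier G. m' = ract M m (inv g) \<and> n' = lact N g n"
    by (auto simp: pair_orbit_def)
next
  assume "\<exists>g\<in>carrier G. m' = ract M m (inv g) \<and> n' = lact N g n"
  then show "pair_orbit G M N (m, n) = pair_orbit G M N (m', n')"
    using pair_orbit_move[OF assms(1,2)] by metis
qed

lemma pair_orbit_subset:
  "\<lbrakk>m \<in> points M; n \<in> points N\<rbrakk> \<Longrightarrow> pair_orbit G M N (m, n) \<subseteq> points M \<times> points N"
  by (auto simp: pair_orbit_def finite_bisetD[OF M] finite_bisetD[OF N])

lemma pair_orbit_mem:
  assumes "m \<in> points M" "n \<in> points N" "p \<in> pair_orbit G M N (m, n)"
  shows "pair_orbit G M N p = pair_orbit G M N (m, n)"
proof -
  from assms(3) obtain g where "g \<in> carrier G" "p = (ract M m (inv g), lact N g n)"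
    by (auto simp: pair_orbit_def)
  then show ?thesis using pair_orbit_move[OF assms(1,2)] by simp
qed

lemma prod_lact:
  assumes "m \<in> points M" "n \<in> points N" "h \<in> carrier G"
  shows "lact (biset_prod G M N) h (pair_orbit G M N (m, n)) = pair_orbit G M N (lact M h m, n)"
proof -
  have "lact (biset_prod G M N) h (pair_orbit G M N (m, n)) =
      (\<lambda>g. (lact M h (ract M m (inv g)), lact N g n)) ` carrier G"
    by (simp add: biset_prod_def pair_orbit_def image_image)
  also have "\<dots> = pair_orbit G M N (lact M h m, n)"
    using assms by (simp add: pair_orbit_def finite_bisetD[OF M])
  finally show ?thesis .
qed

lemma prod_ract:
  assumes "m \<in> points M" "n \<in> points N" "h \<in> carrier G"
  shows "ract (biset_prod G M N) (pair_orbit G M N (m, n)) h = pair_orbit G M N (m, ract N n h)"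
proof -
  have "ract (biset_prod G M N) (pair_orbit G M N (m, n)) h =
      (\<lambda>g. (ract M m (inv g), ract N (lact N g n) h)) ` carrier G"
    by (simp add: biset_prod_def pair_orbit_def image_image)
  also have "\<dots> = pair_orbit G M N (m, ract N n h)"
    using assms by (simp add: pair_orbit_def finite_bisetD[OF N])
  finally show ?thesis .
qed

lemma finite_biset_prod: "finite_biset G (biset_prod G M N)"
  unfolding finite_biset_def points_prod
  using finite_bisetD[OF M] finite_bisetD[OF N]
  by (auto simp: prod_lact prod_ract)

text \<open>The pairs (a m, n) and (m, n c) lie in one orbit exactly if some g satisfies a m = m g
  and g n = n c. This g is the middle element of the composite.\<close>

lemma stab_prod:
  assumes "m \<in> points M" "n \<in> points N"
  shows "stab G (biset_prod G M N) (pair_orbit G M N (m, n)) = stab G M m O stab G N n"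
proof -
  have "lact (biset_prod G M N) a (pair_orbit G M N (m, n)) = ract (biset_prod G M N) (pair_orbit G M N (m, n)) c \<longleftrightarrow>
      (\<exists>g\<in>carrier G. lact M a m = ract M m g \<and> lact N g n = ract N n c)"
    if a: "a \<in> carrier G" and c: "c \<in> carrier G" for a c
  proof -
    have "lact (biset_prod G M N) a (pair_orbit G M N (m, n)) = ract (biset_prod G M N) (pair_orbit G M N (m, n)) c \<longleftrightarrow>
        (\<exists>g\<in>carrier G. m = ract M (lact M a m) (inv g) \<and> ract N n c = lact N g n)"
      using assms a c by (simp add: prod_lact prod_ract pair_orbit_eq_iff finite_bisetD[OF M] finite_bisetD[OF N])
    also have "\<dots> \<longleftrightarrow> (\<exists>g\<in>carrier G. lact M a m = ract M m g \<and> lact N g n = ract N n c)"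
      using ract_inv[OF M] finite_bisetD(2,3)[OF M] a assms(1) by metis
    finally show ?thesis .
  qed
  then show ?thesis unfolding stab_def by auto
qed

text \<open>Let K consist of the k with m k = m and k n = n. The orbit of (m, n) has |G| / |K|
  elements, and the middle elements over a fixed pair (a, c) form a coset of K, so that each pair of
  the composite stems from |K| triples.\<close>

lemma triples_orbit:
  assumes m: "m \<in> points M" and n: "n \<in> points N"
  shows "card {(a, b, c). (a, b) \<in> stab G M m \<and> (b, c) \<in> stab G N n} * card (pair_orbit G M N (m, n)) =
    card (carrier G) * card (stab G M m O stab G N n)"
proof -
  define K where "K = {k \<in> carrier G. ract M m k = m \<and> lact N k n = n}"
  have ract_fix: "ract M m (inv k) = m" if "k \<in> carrier G" "ract M m k = m" for k
    using ract_inv(1)[OF M that(1) m] that by simp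
  have "card (carrier G) = card K * card (pair_orbit G M N (m, n))"
    unfolding pair_orbit_def prod.case
  proof (rule card_uniform_fibres[OF finite_G])
    fix g assume g: "g \<in> carrier G"
    have "{h \<in> carrier G. (ract M m (inv h), lact N h n) = (ract M m (inv g), lact N g n)} = (\<otimes>) g ` K"
    proof (intro equalityI subsetI)
      fix h assume "h \<in> {h \<in> carrier G. (ract M m (inv h), lact N h n) = (ract M m (inv g), lact N g n)}"
      then have h: "h \<in> carrier G" "ract M m (inv h) = ract M m (inv g)" "lact N h n = lact N g n" by auto
      have "ract M m (inv g \<otimes> h) = ract M (ract M m (inv g)) h"
        using g h(1) m by (simp add: finite_bisetD[OF M])
      also have "\<dots> = ract M (ract M m (inv h)) h" by (simp only: h(2))
      finally have "ract M m (inv g \<otimes> h) = m" using h(1) m by (simp add: ract_inv[OF M])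
      moreover have "lact N (inv g \<otimes> h) n = n"
        using g h n by (simp add: finite_bisetD[OF N] lact_inv[OF N])
      ultimately have "inv g \<otimes> h \<in> K" using g h by (simp add: K_def)
      moreover have "h = g \<otimes> (inv g \<otimes> h)" using g h by (simp add: G.inv_solve_left' flip: G.m_assoc)
      ultimately show "h \<in> (\<otimes>) g ` K" by (rule image_eqI[rotated])
    next
      fix h assume "h \<in> (\<otimes>) g ` K"
      then show "h \<in> {h \<in> carrier G. (ract M m (inv h), lact N h n) = (ract M m (inv g), lact N g n)}"
        using g m n by (auto simp: K_def G.inv_mult_group finite_bisetD[OF M] finite_bisetD[OF N] ract_fix)
    qed
    moreover have "inj_on ((\<otimes>) g) K"
      using g by (auto simp: K_def intro!: inj_onI)
    ultimately show "card {y \<in> carrier G. (ract M m (inv y), lact N y n) = (ract M m (inv g), lact N g n)} = card K"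
      by (simp add: card_image)
  qed
  moreover have "card {(a, b, c). (a, b) \<in> stab G M m \<and> (b, c) \<in> stab G N n} =
      card K * card (stab G M m O stab G N n)"
  proof -
    let ?T = "{(a, b, c). (a, b) \<in> stab G M m \<and> (b, c) \<in> stab G N n}"
    have "?T \<subseteq> carrier G \<times> carrier G \<times> carrier G" by (auto simp: stab_def)
    then have fin: "finite ?T" using finite_G by (auto intro: finite_subset)
    have "card ?T = card K * card ((\<lambda>(a, b, c). (a, c)) ` ?T)"
    proof (rule card_uniform_fibres[OF fin], clarify)
      fix a b c assume "(a, b) \<in> stab G M m" "(b, c) \<in> stab G N n"
      then have abc: "a \<in> carrier G" "b \<in> carrier G" "c \<in> carrier G" "lact M a m = ract M m b"
        "lact N b n = ract N n c" by (auto simp: stab_def)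
      have "{t \<in> ?T. (case t of (a, b, c) \<Rightarrow> (a, c)) = (a, c)} = (\<lambda>k. (a, k \<otimes> b, c)) ` K"
      proof (intro equalityI subsetI)
        fix t assume "t \<in> {t \<in> ?T. (case t of (a, b, c) \<Rightarrow> (a, c)) = (a, c)}"
        then obtain b' where t: "t = (a, b', c)" and b': "b' \<in> carrier G" "lact M a m = ract M m b'"
          "lact N b' n = ract N n c" by (auto simp: stab_def)
        have "ract M m (b' \<otimes> inv b) = ract M (ract M m b) (inv b)"
          using abc b' m by (simp add: finite_bisetD[OF M])
        then have "ract M m (b' \<otimes> inv b) = m" using abc m by (simp add: ract_inv[OF M])
        moreover have "lact N (b' \<otimes> inv b) n = n"
        proof -
          have "lact N b (ract N n (inv c)) = n"
            using abc n ract_inv[OF N] by (simp add: finite_bisetD(8)[OF N, symmetric])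
          then have "lact N (inv b) n = ract N n (inv c)"
            using abc n lact_inv(1)[OF N, of b "ract N n (inv c)"] by (simp add: finite_bisetD[OF N])
          then have "lact N (b' \<otimes> inv b) n = lact N b' (ract N n (inv c))"
            using abc b' n by (simp add: finite_bisetD[OF N])
          also have "\<dots> = ract N (ract N n c) (inv c)"
            using abc b' n by (simp add: finite_bisetD(8)[OF N, symmetric])
          finally show ?thesis using abc n by (simp add: ract_inv[OF N])
        qed
        ultimately have "b' \<otimes> inv b \<in> K" using abc b' by (simp add: K_def)
        moreover have "t = (a, (b' \<otimes> inv b) \<otimes> b, c)" using abc b' by (simp add: t G.m_assoc)
        ultimately show "t \<in> (\<lambda>k. (a, k \<otimes> b, c)) ` K" by (rule image_eqI[rotated])
      next
        fix t assume "t \<in> (\<lambda>k. (a, k \<otimes> b, c)) ` K"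
        then show "t \<in> {t \<in> ?T. (case t of (a, b, c) \<Rightarrow> (a, c)) = (a, c)}"
          using abc m n by (auto simp: K_def stab_def finite_bisetD[OF M] finite_bisetD[OF N]
              finite_bisetD(8)[OF N, symmetric])
      qed
      moreover have "inj_on (\<lambda>k. (a, k \<otimes> b, c)) K"
        using abc by (auto simp: K_def intro!: inj_onI)
      ultimately show "card {t \<in> ?T. (case t of (a, b, c) \<Rightarrow> (a, c)) = (a, c)} = card K"
        by (simp add: card_image)
    qed
    moreover have "(\<lambda>(a, b, c). (a, c)) ` ?T = stab G M m O stab G N n"
      by (force simp: image_iff)
    ultimately show ?thesis by simp
  qed
  ultimately show ?thesis by (simp add: algebra_simps)
qed

text \<open>Weighting each point by the order of its stabiliser makes the product of bisets a composition of relations.\<close>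

lemma weighted_sum_prod:
  fixes \<psi> :: "('g \<times> 'g) set \<Rightarrow> rat"
  shows "of_nat (card (carrier G)) *
      (\<Sum>C\<in>points (biset_prod G M N). of_nat (card (stab G (biset_prod G M N) C)) * \<psi> (stab G (biset_prod G M N) C)) =
    (\<Sum>(m, n)\<in>points M \<times> points N.
      of_nat (card {(a, b, c). (a, b) \<in> stab G M m \<and> (b, c) \<in> stab G N n}) * \<psi> (stab G M m O stab G N n))"
    (is "_ * ?S = (\<Sum>p\<in>_. ?F p)")
proof -
  let ?P = "points M \<times> points N"
  have fin: "finite ?P" using finite_bisetD(1)[OF M] finite_bisetD(1)[OF N] by simp
  have "(\<Sum>p\<in>?P. ?F p) = (\<Sum>C\<in>pair_orbit G M N ` ?P. \<Sum>p\<in>{p \<in> ?P. pair_orbit G M N p = C}. ?F p)"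
    by (rule sum.image_gen[OF fin])
  also have "\<dots> = (\<Sum>C\<in>pair_orbit G M N ` ?P. of_nat (card (carrier G)) *
      (of_nat (card (stab G (biset_prod G M N) C)) * \<psi> (stab G (biset_prod G M N) C)))"
  proof (rule sum.cong[OF refl])
    fix C assume "C \<in> pair_orbit G M N ` ?P"
    then obtain m0 n0 where m0: "m0 \<in> points M" "n0 \<in> points N" "C = pair_orbit G M N (m0, n0)" by auto
    have C: "{p \<in> ?P. pair_orbit G M N p = C} = C"
      using pair_orbit_self pair_orbit_subset[OF m0(1,2)] pair_orbit_mem[OF m0(1,2)] m0(3) by auto
    have "card C > 0"
      using m0 pair_orbit_self[OF m0(1,2)] finite_subset[OF pair_orbit_subset[OF m0(1,2)] fin]
      by (auto simp: card_gt_0_iff)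
    let ?s = "stab G (biset_prod G M N) C"
    \<comment> \<open>The summand is constant along the orbit \<open>C\<close>, and
      \<open>triples_orbit\<close> trades the size of \<open>C\<close> for the order of G.\<close>
    have "?F p = of_nat (card (carrier G)) * (of_nat (card ?s) * \<psi> ?s) / of_nat (card C)" if "p \<in> C" for p
    proof -
      obtain m n where p: "p = (m, n)" by (cases p)
      have mn: "m \<in> points M" "n \<in> points N" "pair_orbit G M N (m, n) = C"
        using that C p by auto
      have s: "stab G M m O stab G N n = ?s" using stab_prod[OF mn(1,2)] mn(3) by simp
      have "(of_nat (card {(a, b, c). (a, b) \<in> stab G M m \<and> (b, c) \<in> stab G N n} * card C) :: rat) =
          of_nat (card (carrier G) * card ?s)"
        using triples_orbit[OF mn(1,2)] unfolding mn(3) s by simp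
      then show ?thesis using \<open>card C > 0\<close> by (simp add: p s field_simps)
    qed
    then have "(\<Sum>p\<in>C. ?F p) = (\<Sum>p\<in>C. of_nat (card (carrier G)) * (of_nat (card ?s) * \<psi> ?s) / of_nat (card C))"
      by (rule sum.cong[OF refl])
    then show "(\<Sum>p\<in>{p \<in> ?P. pair_orbit G M N p = C}. ?F p) =
        of_nat (card (carrier G)) * (of_nat (card ?s) * \<psi> ?s)"
      unfolding C using \<open>card C > 0\<close> by simp
  qed
  finally show ?thesis by (simp add: points_prod sum_distrib_left)
qed

end

lemma prod_isomorphic:
  assumes fin: "finite_biset G M" "finite_biset G N" "finite_biset G M'" "finite_biset G N'"
    and "isomorphic_bisets G M M'" "isomorphic_bisets G N N'"
  shows "isomorphic_bisets G (biset_prod G M N) (biset_prod G M' N')"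
proof -
  from assms(5) obtain f where f: "bij_betw f (points M) (points M')"
    "\<And>g x. \<lbrakk>g \<in> carrier G; x \<in> points M\<rbrakk> \<Longrightarrow> f (lact M g x) = lact M' g (f x)"
    "\<And>g x. \<lbrakk>g \<in> carrier G; x \<in> points M\<rbrakk> \<Longrightarrow> f (ract M x g) = ract M' (f x) g"
    unfolding isomorphic_bisets_def by blast
  from assms(6) obtain k where k: "bij_betw k (points N) (points N')"
    "\<And>g x. \<lbrakk>g \<in> carrier G; x \<in> points N\<rbrakk> \<Longrightarrow> k (lact N g x) = lact N' g (k x)"
    "\<And>g x. \<lbrakk>g \<in> carrier G; x \<in> points N\<rbrakk> \<Longrightarrow> k (ract N x g) = ract N' (k x) g"
    unfolding isomorphic_bisets_def by blast
  note fp = bij_betwE[OF f(1), rule_format] and kp = bij_betwE[OF k(1), rule_format]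
  define F where "F = image (map_prod f k)"
  have F: "F (pair_orbit G M N (m, n)) = pair_orbit G M' N' (f m, k n)"
    if "m \<in> points M" "n \<in> points N" for m n
    using that by (simp add: F_def pair_orbit_def image_image f k cong: image_cong)
  have "bij_betw F (points (biset_prod G M N)) (points (biset_prod G M' N'))"
  proof (rule bij_betw_imageI)
    show "inj_on F (points (biset_prod G M N))"
    proof (rule inj_onI, unfold points_prod, clarify)
      fix m n m' n' assume p: "m \<in> points M" "n \<in> points N" "m' \<in> points M" "n' \<in> points N"
        and "F (pair_orbit G M N (m, n)) = F (pair_orbit G M N (m', n'))"
      then have "pair_orbit G M' N' (f m, k n) = pair_orbit G M' N' (f m', k n')" by (simp add: F)
      then obtain g where g: "g \<in> carrier G" "f m' = ract M' (f m) (inv g)" "k n' = lact N' g (k n)"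
        using pair_orbit_eq_iff[OF fin(3,4) fp[OF p(1)] kp[OF p(2)] fp[OF p(3)] kp[OF p(4)]] by auto
      then have "f m' = f (ract M m (inv g))" "k n' = k (lact N g n)" using p by (simp_all add: f k)
      moreover have "ract M m (inv g) \<in> points M" "lact N g n \<in> points N"
        using p g by (simp_all add: finite_bisetD[OF fin(1)] finite_bisetD[OF fin(2)])
      ultimately have "m' = ract M m (inv g)" "n' = lact N g n"
        using p(3,4) inj_onD[OF bij_betw_imp_inj_on[OF f(1)]] inj_onD[OF bij_betw_imp_inj_on[OF k(1)]]
        by blast+
      then show "pair_orbit G M N (m, n) = pair_orbit G M N (m', n')"
        using pair_orbit_eq_iff[OF fin(1,2)] p g by blast
    qed
    have "F ` points (biset_prod G M N) = (\<lambda>(m, n). pair_orbit G M' N' (f m, k n)) ` (points M \<times> points N)"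
      unfolding points_prod image_image by (intro image_cong) (auto simp: F)
    also have "\<dots> = pair_orbit G M' N' ` (f ` points M \<times> k ` points N)"
      by force
    finally show "F ` points (biset_prod G M N) = points (biset_prod G M' N')"
      using bij_betw_imp_surj_on[OF f(1)] bij_betw_imp_surj_on[OF k(1)] by (simp add: points_prod)
  qed
  moreover have "F (lact (biset_prod G M N) g C) = lact (biset_prod G M' N') g (F C) \<and>
      F (ract (biset_prod G M N) C g) = ract (biset_prod G M' N') (F C) g"
    if g: "g \<in> carrier G" and C: "C \<in> points (biset_prod G M N)" for g C
  proof -
    obtain m n where mn: "m \<in> points M" "n \<in> points N" "C = pair_orbit G M N (m, n)"
      using C by (auto simp: points_prod)
    then show ?thesis
      using g fp kp by (simp add: F prod_lact[OF fin(1,2)] prod_ract[OF fin(1,2)] prod_lact[OF fin(3,4)]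
          prod_ract[OF fin(3,4)] finite_bisetD[OF fin(1)] finite_bisetD[OF fin(2)] f k)
  qed
  ultimately show ?thesis unfolding isomorphic_bisets_def by blast
qed

text \<open>The product of classes is a union over all pairs of representatives. By
  \<open>prod_isomorphic\<close> its members coincide.\<close>

lemma biset_class_mult_eq:
  assumes M: "finite_biset G M" and N: "finite_biset G N"
  shows "biset_class_mult G (biset_class G M) (biset_class G N) = biset_class G (biset_prod G M N)"
proof -
  have eq: "biset_class G (biset_prod G P Q) = biset_class G (biset_prod G M N)"
    if "P \<in> biset_class G M" "Q \<in> biset_class G N" for P Q
  proof -
    have "finite_biset G P" "finite_biset G Q" "isomorphic_bisets G P M" "isomorphic_bisets G Q N"
      using that by (auto simp: biset_class_def)
    then show ?thesis
      using M N prod_isomorphic by (subst biset_class_eq_iff) (simp_all add: finite_biset_prod)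
  qed
  obtain P Q where "P \<in> biset_class G M" "Q \<in> biset_class G N"
    using biset_class_nonempty M N by metis
  moreover have "biset_class_mult G (biset_class G M) (biset_class G N) =
      (\<Union>P\<in>biset_class G M. \<Union>Q\<in>biset_class G N. biset_class G (biset_prod G M N))"
    unfolding biset_class_mult_def using eq by simp
  ultimately show ?thesis by auto
qed


subsection \<open>Orbits\<close>

text \<open>Right multiplication by h is the action of (1, h^{-1}); hence the \<open>inv h\<close>
  in the conjugating pair.\<close>

lemma stab_conj:
  assumes M: "finite_biset G M" and x: "x \<in> points M" and g: "g \<in> carrier G" and h: "h \<in> carrier G"
  shows "stab G M (lact M g (ract M x h)) = conj_rel G g (inv h) (stab G M x)"
proof -
  have "lact M a (lact M g (ract M x h)) = ract M (lact M g (ract M x h)) b \<longleftrightarrow>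
      lact M (inv g \<otimes> a \<otimes> g) x = ract M x (h \<otimes> b \<otimes> inv h)"
    if a: "a \<in> carrier G" and b: "b \<in> carrier G" for a b
  proof -
    have "lact M a (lact M g (ract M x h)) = ract M (lact M (a \<otimes> g) x) h"
      "ract M (lact M g (ract M x h)) b = lact M g (ract M x (h \<otimes> b))"
      using a b g h x by (simp_all add: finite_bisetD[OF M])
    moreover have "ract M (lact M (a \<otimes> g) x) h = lact M g (ract M x (h \<otimes> b)) \<longleftrightarrow>
        lact M (a \<otimes> g) x = lact M g (ract M x (h \<otimes> b \<otimes> inv h))"
    proof
      assume "ract M (lact M (a \<otimes> g) x) h = lact M g (ract M x (h \<otimes> b))"
      then have "ract M (ract M (lact M (a \<otimes> g) x) h) (inv h) = ract M (lact M g (ract M x (h \<otimes> b))) (inv h)"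
        by simp
      then show "lact M (a \<otimes> g) x = lact M g (ract M x (h \<otimes> b \<otimes> inv h))"
        using a b g h x by (simp add: ract_inv[OF M] finite_bisetD[OF M])
    next
      assume "lact M (a \<otimes> g) x = lact M g (ract M x (h \<otimes> b \<otimes> inv h))"
      then have "ract M (lact M (a \<otimes> g) x) h = ract M (lact M g (ract M x (h \<otimes> b \<otimes> inv h))) h" by simp
      then show "ract M (lact M (a \<otimes> g) x) h = lact M g (ract M x (h \<otimes> b))"
        using a b g h x ract_inv(2)[OF M h, of "ract M x (h \<otimes> b)"] by (simp add: finite_bisetD[OF M])
    qed
    moreover have "lact M (a \<otimes> g) x = lact M g (ract M x (h \<otimes> b \<otimes> inv h)) \<longleftrightarrow>
        lact M (inv g \<otimes> a \<otimes> g) x = ract M x (h \<otimes> b \<otimes> inv h)"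
    proof
      assume "lact M (a \<otimes> g) x = lact M g (ract M x (h \<otimes> b \<otimes> inv h))"
      then have "lact M (inv g) (lact M (a \<otimes> g) x) = ract M x (h \<otimes> b \<otimes> inv h)"
        using a b g h x by (simp add: lact_inv[OF M] finite_bisetD[OF M])
      then show "lact M (inv g \<otimes> a \<otimes> g) x = ract M x (h \<otimes> b \<otimes> inv h)"
        using a b g h x by (simp add: finite_bisetD(6)[OF M] finite_bisetD(2)[OF M] G.m_assoc)
    next
      assume "lact M (inv g \<otimes> a \<otimes> g) x = ract M x (h \<otimes> b \<otimes> inv h)"
      then have "lact M g (ract M x (h \<otimes> b \<otimes> inv h)) = lact M g (lact M (inv g \<otimes> a \<otimes> g) x)" by simp
      also have "\<dots> = lact M (a \<otimes> g) x"
        using a g x by (simp add: G.m_assoc finite_bisetD(6)[OF M] finite_bisetD(2)[OF M] lact_inv[OF M])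
      finally show "lact M (a \<otimes> g) x = lact M g (ract M x (h \<otimes> b \<otimes> inv h))" ..
    qed
    ultimately show ?thesis by simp
  qed
  then show ?thesis
    using g h by (auto simp: stab_def conj_rel_def)
qed

lemma orbit_subset: "finite_biset G M \<Longrightarrow> x \<in> points M \<Longrightarrow> orbit G M x \<subseteq> points M"
  by (auto simp: orbit_def finite_bisetD)

lemma orbit_self: "finite_biset G M \<Longrightarrow> x \<in> points M \<Longrightarrow> x \<in> orbit G M x"
  by (auto simp: orbit_def finite_bisetD image_iff intro!: bexI[of _ \<one>])

lemma orbit_closed:
  assumes M: "finite_biset G M" and x: "x \<in> points M" and g: "g \<in> carrier G" and y: "y \<in> points M"
  shows "lact M g y \<in> orbit G M x \<longleftrightarrow> y \<in> orbit G M x" "ract M y g \<in> orbit G M x \<longleftrightarrow> y \<in> orbit G M x"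
proof -
  have *: "lact M g y \<in> orbit G M x" "ract M y g \<in> orbit G M x"
    if "g \<in> carrier G" "y \<in> orbit G M x" for g y
  proof -
    from that(2) obtain a b where ab: "a \<in> carrier G" "b \<in> carrier G" "y = lact M a (ract M x b)"
      by (auto simp: orbit_def)
    then have "lact M g y = lact M (g \<otimes> a) (ract M x b)" "ract M y g = lact M a (ract M x (b \<otimes> g))"
      using that(1) x by (simp_all add: finite_bisetD[OF M])
    then show "lact M g y \<in> orbit G M x" "ract M y g \<in> orbit G M x"
      using ab that(1) by (auto simp: orbit_def)
  qed
  show "lact M g y \<in> orbit G M x \<longleftrightarrow> y \<in> orbit G M x"
    using *(1)[of "inv g" "lact M g y"] *(1)[of g y] g y by (auto simp: lact_inv[OF M])
  show "ract M y g \<in> orbit G M x \<longleftrightarrow> y \<in> orbit G M x"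
    using *(2)[of "inv g" "ract M y g"] *(2)[of g y] g y by (auto simp: ract_inv[OF M])
qed

text \<open>Orbit-stabiliser theorem for G \<times> G: the pairs that move x to g x h are the (g a,
  b^{-1} h) with (a, b) in the stabiliser.\<close>

lemma orbit_card:
  assumes M: "finite_biset G M" and x: "x \<in> points M"
  shows "card (stab G M x) * card (orbit G M x) = card (carrier G) ^ 2"
proof -
  let ?f = "\<lambda>(g, h). lact M g (ract M x h)"
  have "card (carrier G \<times> carrier G) = card (stab G M x) * card (?f ` (carrier G \<times> carrier G))"
  proof (rule card_uniform_fibres)
    fix p assume "p \<in> carrier G \<times> carrier G"
    then obtain g h where p: "p = (g, h)" and g: "g \<in> carrier G" and h: "h \<in> carrier G" by auto
    let ?k = "\<lambda>(a, b). (g \<otimes> a, inv b \<otimes> h)"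
    have "{q \<in> carrier G \<times> carrier G. ?f q = ?f p} = ?k ` stab G M x"
    proof (intro equalityI subsetI)
      fix q assume "q \<in> {q \<in> carrier G \<times> carrier G. ?f q = ?f p}"
      then obtain c d where q: "q = (c, d)" and c: "c \<in> carrier G" and d: "d \<in> carrier G"
        and eq: "lact M c (ract M x d) = lact M g (ract M x h)" by (auto simp: p)
      have "lact M (inv g) (lact M c (ract M x d)) = ract M x h"
        using eq g h x by (simp add: lact_inv[OF M] finite_bisetD[OF M])
      then have "ract M (lact M (inv g \<otimes> c) x) d = ract M x h"
        using c d g x by (simp add: finite_bisetD[OF M])
      then have "ract M (ract M (lact M (inv g \<otimes> c) x) d) (inv d) = ract M x (h \<otimes> inv d)"
        using d h x by (simp add: finite_bisetD[OF M])
      then have "lact M (inv g \<otimes> c) x = ract M x (h \<otimes> inv d)"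
        using c d g x by (simp add: ract_inv[OF M] finite_bisetD(2)[OF M])
      then have "(inv g \<otimes> c, h \<otimes> inv d) \<in> stab G M x"
        using c d g h by (simp add: stab_def)
      moreover have "q = ?k (inv g \<otimes> c, h \<otimes> inv d)"
        using c d g h by (simp add: q G.inv_mult_group G.m_assoc) (simp flip: G.m_assoc)
      ultimately show "q \<in> ?k ` stab G M x" by (rule image_eqI[rotated])
    next
      fix q assume "q \<in> ?k ` stab G M x"
      then obtain a b where ab: "a \<in> carrier G" "b \<in> carrier G" "lact M a x = ract M x b"
        and q: "q = (g \<otimes> a, inv b \<otimes> h)" by (auto simp: stab_def)
      have "lact M (g \<otimes> a) (ract M x (inv b \<otimes> h)) = lact M g (ract M (ract M (lact M a x) (inv b)) h)"
        using ab(1,2) g h x by (simp add: finite_bisetD[OF M])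
      also have "\<dots> = lact M g (ract M x h)"
        using ab g h x by (simp add: ract_inv[OF M])
      finally show "q \<in> {q \<in> carrier G \<times> carrier G. ?f q = ?f p}"
        using ab g h by (simp add: p q)
    qed
    moreover have "inj_on ?k (stab G M x)"
    proof (rule inj_onI)
      fix s t assume "s \<in> stab G M x" "t \<in> stab G M x" "?k s = ?k t"
      then show "s = t" using g h by (auto simp: stab_def)
    qed
    ultimately show "card {q \<in> carrier G \<times> carrier G. ?f q = ?f p} = card (stab G M x)"
      by (simp add: card_image)
  qed (simp add: finite_G)
  then show ?thesis by (simp add: orbit_def power2_eq_square card_cartesian_product)
qed

lemma finite_sub_biset:
  assumes "finite_biset G M" "A \<subseteq> points M"
    and "\<And>g y. \<lbrakk>g \<in> carrier G; y \<in> A\<rbrakk> \<Longrightarrow> lact M g y \<in> A \<and> ract M y g \<in> A"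
  shows "finite_biset G (sub_biset M A)"
  using assms finite_subset[OF assms(2) finite_bisetD(1)[OF assms(1)]]
  by (auto simp: finite_biset_def sub_biset_def subset_iff)

lemma sub_biset_sum:
  assumes "points M = A \<union> B" "A \<inter> B = {}"
    and "\<And>g y. \<lbrakk>g \<in> carrier G; y \<in> A\<rbrakk> \<Longrightarrow> lact M g y \<in> A \<and> ract M y g \<in> A"
    and "\<And>g y. \<lbrakk>g \<in> carrier G; y \<in> B\<rbrakk> \<Longrightarrow> lact M g y \<in> B \<and> ract M y g \<in> B"
  shows "isomorphic_bisets G M (biset_sum (sub_biset M A) (sub_biset M B))"
proof -
  let ?f = "\<lambda>x. if x \<in> A then Inl x else Inr x"
  have "bij_betw ?f (points M) (A <+> B)"
    using assms by (auto simp: bij_betw_def inj_on_def image_iff split: if_splits)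
  then show ?thesis
    unfolding isomorphic_bisets_def biset_sum_def sub_biset_def
    using assms by (intro exI[of _ ?f]) auto
qed

lemma finite_biset_sum: "finite_biset G M \<Longrightarrow> finite_biset G N \<Longrightarrow> finite_biset G (biset_sum M N)"
  by (auto simp: finite_biset_def biset_sum_def)

text \<open>The map g x h \<mapsto> g y h is well defined and injective, because in either biset two
  such points coincide exactly if one and the same pair of group elements lies in the
  stabiliser.\<close>

lemma transitive_isomorphic:
  assumes M: "finite_biset G M" and N: "finite_biset G N" and x: "x \<in> points M" and y: "y \<in> points N"
    and trans: "points M = orbit G M x" "points N = orbit G N y" and eq: "stab G M x = stab G N y"
  shows "isomorphic_bisets G M N"
proof -
  have key: "lact L g (ract L z h) = lact L g' (ract L z h') \<longleftrightarrow> (inv g' \<otimes> g, h' \<otimes> inv h) \<in> stab G L z"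
    if L: "finite_biset G L" and z: "z \<in> points L" and gh: "g \<in> carrier G" "h \<in> carrier G" "g' \<in> carrier G" "h' \<in> carrier G"
    for L :: "('g, 'z) biset" and z g h g' h'
  proof -
    have "lact L g (ract L z h) = lact L g' (ract L z h') \<longleftrightarrow> lact L (inv g' \<otimes> g) (ract L z h) = ract L z h'"
    proof
      assume "lact L g (ract L z h) = lact L g' (ract L z h')"
      then have "lact L (inv g') (lact L g (ract L z h)) = lact L (inv g') (lact L g' (ract L z h'))" by simp
      then show "lact L (inv g' \<otimes> g) (ract L z h) = ract L z h'"
        using gh z by (simp add: lact_inv[OF L] finite_bisetD(3,6)[OF L])
    next
      assume "lact L (inv g' \<otimes> g) (ract L z h) = ract L z h'"
      then have "lact L g' (lact L (inv g') (lact L g (ract L z h))) = lact L g' (ract L z h')"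
        using gh z by (simp add: finite_bisetD(3,6)[OF L])
      then show "lact L g (ract L z h) = lact L g' (ract L z h')"
        using gh z by (simp add: lact_inv[OF L] finite_bisetD(2,3)[OF L])
    qed
    also have "lact L (inv g' \<otimes> g) (ract L z h) = ract L (lact L (inv g' \<otimes> g) z) h"
      using gh z by (simp add: finite_bisetD(8)[OF L])
    also have "ract L (lact L (inv g' \<otimes> g) z) h = ract L z h' \<longleftrightarrow>
        lact L (inv g' \<otimes> g) z = ract L z (h' \<otimes> inv h)"
    proof -
      have "lact L (inv g' \<otimes> g) z \<in> points L" using gh z by (simp add: finite_bisetD(2)[OF L])
      note w = this
      show ?thesis
      proof
        assume "ract L (lact L (inv g' \<otimes> g) z) h = ract L z h'"
        then have "ract L (ract L (lact L (inv g' \<otimes> g) z) h) (inv h) = ract L (ract L z h') (inv h)" by simp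
        then show "lact L (inv g' \<otimes> g) z = ract L z (h' \<otimes> inv h)"
          using gh z w by (simp add: ract_inv[OF L] finite_bisetD(3,7)[OF L])
      next
        assume "lact L (inv g' \<otimes> g) z = ract L z (h' \<otimes> inv h)"
        then have "ract L (lact L (inv g' \<otimes> g) z) h = ract L (ract L (ract L z h') (inv h)) h"
          using gh z by (simp add: finite_bisetD(3,7)[OF L])
        then show "ract L (lact L (inv g' \<otimes> g) z) h = ract L z h'"
          using gh z by (simp add: ract_inv[OF L] finite_bisetD(3)[OF L])
      qed
    qed
    finally show ?thesis using gh by (simp add: stab_def)
  qed
  \<comment> \<open>An arbitrary way of writing u as g x h is chosen; the next step shows that the
    choice does not affect the value.\<close>
  define f where "f u = (SOME v. \<exists>g\<in>carrier G. \<exists>h\<in>carrier G. u = lact M g (ract M x h) \<and> v = lact N g (ract N y h))" for u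
  have f: "f (lact M g (ract M x h)) = lact N g (ract N y h)" if gh: "g \<in> carrier G" "h \<in> carrier G" for g h
  proof -
    let ?P = "\<lambda>v. \<exists>g'\<in>carrier G. \<exists>h'\<in>carrier G. lact M g (ract M x h) = lact M g' (ract M x h') \<and> v = lact N g' (ract N y h')"
    have "?P (f (lact M g (ract M x h)))"
      unfolding f_def by (rule someI[where P = ?P and x = "lact N g (ract N y h)"]) (use gh in blast)
    then obtain g' h' where gh': "g' \<in> carrier G" "h' \<in> carrier G"
      and *: "lact M g (ract M x h) = lact M g' (ract M x h')" "f (lact M g (ract M x h)) = lact N g' (ract N y h')"
      by blast
    have "lact N g (ract N y h) = lact N g' (ract N y h')"
      using key[OF M x gh gh'] key[OF N y gh gh'] eq *(1) by simp
    then show ?thesis using *(2) by simp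
  qed
  have "bij_betw f (points M) (points N)"
  proof (rule bij_betw_imageI)
    show "inj_on f (points M)"
      unfolding trans orbit_def using key[OF M x] key[OF N y] eq by (auto simp: f intro!: inj_onI)
    show "f ` points M = points N"
      unfolding trans orbit_def image_image by (intro image_cong) (auto simp: f)
  qed
  moreover have "f (lact M a u) = lact N a (f u) \<and> f (ract M u a) = ract N (f u) a"
    if a: "a \<in> carrier G" and u: "u \<in> points M" for a u
  proof -
    from u obtain g h where gh: "g \<in> carrier G" "h \<in> carrier G" "u = lact M g (ract M x h)"
      by (auto simp: trans orbit_def)
    have "lact M a u = lact M (a \<otimes> g) (ract M x h)" "ract M u a = lact M g (ract M x (h \<otimes> a))"
      using a gh x by (simp_all add: finite_bisetD[OF M])
    moreover have "lact N a (f u) = lact N (a \<otimes> g) (ract N y h)" "ract N (f u) a = lact N g (ract N y (h \<otimes> a))"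
      using a gh y by (simp_all add: f finite_bisetD[OF N])
    ultimately show ?thesis using a gh by (simp add: f)
  qed
  ultimately show ?thesis unfolding isomorphic_bisets_def by blast
qed

text \<open>The biset \<open>(G \<times> G) / L\<close> on the cosets \<open>(u, v) L\<close>, on which \<open>h\<close> acts from the right by \<open>(1, h\<^sup>-\<^sup>1)\<close>.\<close>

definition coset_of :: "('g \<times> 'g) set \<Rightarrow> 'g \<Rightarrow> 'g \<Rightarrow> ('g \<times> 'g) set" where
  "coset_of L u v = (\<lambda>(a, b). (u \<otimes> a, v \<otimes> b)) ` L"

definition coset_biset :: "('g \<times> 'g) set \<Rightarrow> ('g, ('g \<times> 'g) set) biset" where
  "coset_biset L = \<lparr> points = (\<lambda>(u, v). coset_of L u v) ` (carrier G \<times> carrier G),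
     lact = (\<lambda>g. image (\<lambda>(a, b). (g \<otimes> a, b))), ract = (\<lambda>C h. (\<lambda>(a, b). (a, inv h \<otimes> b)) ` C) \<rparr>"

lemma coset_biset_props:
  assumes L: "L \<subseteq> carrier G \<times> carrier G" "(\<one>, \<one>) \<in> L"
    "\<And>a b c d. \<lbrakk>(a, b) \<in> L; (c, d) \<in> L\<rbrakk> \<Longrightarrow> (a \<otimes> c, b \<otimes> d) \<in> L"
    "\<And>a b. (a, b) \<in> L \<Longrightarrow> (inv a, inv b) \<in> L"
  shows "finite_biset G (coset_biset L)" "L \<in> points (coset_biset L)"
    "points (coset_biset L) = orbit G (coset_biset L) L" "stab G (coset_biset L) L = L"
proof -
  have Lc: "a \<in> carrier G" "b \<in> carrier G" if "(a, b) \<in> L" for a b using L(1) that by auto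
  have lact: "lact (coset_biset L) g (coset_of L u v) = coset_of L (g \<otimes> u) v"
    and ract: "ract (coset_biset L) (coset_of L u v) g = coset_of L u (inv g \<otimes> v)"
    if "g \<in> carrier G" "u \<in> carrier G" "v \<in> carrier G" for g u v
    using that Lc by (auto simp: coset_biset_def coset_of_def image_image G.m_assoc intro!: image_cong)
  have base: "coset_of L \<one> \<one> = L"
  proof -
    have "coset_of L \<one> \<one> = (\<lambda>p. p) ` L"
      unfolding coset_of_def using Lc by (intro image_cong) auto
    then show ?thesis by simp
  qed
  have points: "coset_of L u v \<in> (\<lambda>(u, v). coset_of L u v) ` (carrier G \<times> carrier G)"
    if "u \<in> carrier G" "v \<in> carrier G" for u v
    using that by (intro image_eqI[of _ _ "(u, v)"]) auto
  show "finite_biset G (coset_biset L)"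
    unfolding finite_biset_def
  proof (intro conjI ballI)
    show "finite (points (coset_biset L))" by (simp add: coset_biset_def finite_G)
  qed (auto simp: coset_biset_def[of L, THEN arg_cong, of points, simplified] lact ract points G.m_assoc G.inv_mult_group)
  show "L \<in> points (coset_biset L)"
    using base by (force simp: coset_biset_def)
  have orb: "orbit G (coset_biset L) L = (\<lambda>(g, h). coset_of L g (inv h)) ` (carrier G \<times> carrier G)"
    unfolding orbit_def
  proof (intro image_cong refl, clarify)
    fix g h assume gh: "g \<in> carrier G" "h \<in> carrier G"
    have "ract (coset_biset L) L h = coset_of L \<one> (inv h)" using gh ract[of h \<one> \<one>] base by simp
    then show "lact (coset_biset L) g (ract (coset_biset L) L h) = coset_of L g (inv h)"
      using gh by (simp add: lact)
  qed
  show "points (coset_biset L) = orbit G (coset_biset L) L"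
  proof (intro equalityI subsetI)
    fix C assume "C \<in> points (coset_biset L)"
    then obtain u v where "u \<in> carrier G" "v \<in> carrier G" "C = coset_of L u v" by (auto simp: coset_biset_def)
    then show "C \<in> orbit G (coset_biset L) L"
      unfolding orb by (intro image_eqI[of _ _ "(u, inv v)"]) auto
  next
    fix C assume "C \<in> orbit G (coset_biset L) L"
    then show "C \<in> points (coset_biset L)" unfolding orb by (auto simp: coset_biset_def)
  qed
  \<comment> \<open>In the biset g L = L h says that the cosets of (g, 1) and (1, h^{-1}) agree,
    which is membership of (g, h) in L.\<close>
  have "coset_of L g \<one> = coset_of L \<one> (inv h) \<longleftrightarrow> (g, h) \<in> L" if gh: "g \<in> carrier G" "h \<in> carrier G" for g h
  proof
    assume "coset_of L g \<one> = coset_of L \<one> (inv h)"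
    moreover have "(g, \<one>) \<in> coset_of L g \<one>"
      using L(2) gh by (force simp: coset_of_def)
    ultimately obtain a b where ab: "(a, b) \<in> L" "g = \<one> \<otimes> a" "\<one> = inv h \<otimes> b" by (auto simp: coset_of_def)
    then have "g = a" "h = b" using Lc[OF ab(1)] gh by (simp_all, metis G.inv_equality G.inv_inv G.inv_closed)
    then show "(g, h) \<in> L" using ab by simp
  next
    assume gL: "(g, h) \<in> L"
    show "coset_of L g \<one> = coset_of L \<one> (inv h)"
    proof (intro equalityI subsetI)
      fix p assume "p \<in> coset_of L g \<one>"
      then obtain a b where ab: "(a, b) \<in> L" "p = (g \<otimes> a, \<one> \<otimes> b)" by (auto simp: coset_of_def)
      have "(g \<otimes> a, h \<otimes> b) \<in> L" using L(3)[OF gL ab(1)] .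
      moreover have "p = (\<one> \<otimes> (g \<otimes> a), inv h \<otimes> (h \<otimes> b))"
        using Lc[OF ab(1)] gh by (simp add: ab(2) flip: G.m_assoc)
      ultimately show "p \<in> coset_of L \<one> (inv h)" by (force simp: coset_of_def)
    next
      fix p assume "p \<in> coset_of L \<one> (inv h)"
      then obtain a b where ab: "(a, b) \<in> L" "p = (\<one> \<otimes> a, inv h \<otimes> b)" by (auto simp: coset_of_def)
      have "(inv g \<otimes> a, inv h \<otimes> b) \<in> L" using L(3)[OF L(4)[OF gL] ab(1)] .
      moreover have "p = (g \<otimes> (inv g \<otimes> a), \<one> \<otimes> (inv h \<otimes> b))"
        using Lc[OF ab(1)] gh by (simp add: ab(2) flip: G.m_assoc)
      ultimately show "p \<in> coset_of L g \<one>" by (force simp: coset_of_def)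
    qed
  qed
  moreover have "lact (coset_biset L) g L = coset_of L g \<one>" "ract (coset_biset L) L g = coset_of L \<one> (inv g)"
    if "g \<in> carrier G" for g
    using lact[of g \<one> \<one>] ract[of g \<one> \<one>] that by (simp_all add: base)
  ultimately have "(g, h) \<in> stab G (coset_biset L) L \<longleftrightarrow> (g, h) \<in> L" for g h
    using Lc[of g h] by (cases "g \<in> carrier G \<and> h \<in> carrier G") (auto simp: stab_def simp del: split_paired_All)
  then show "stab G (coset_biset L) L = L" by auto
qed

end


section \<open>The coordinate algebra\<close>

datatype tri = I0 | I1 | I2

text \<open>
  The entries of an array in \<open>\<Lambda>\<^sub>(\<^sub>3\<^sub>)\<close>, where \<open>x\<^sub>i\<close> is divided by 3, and \<open>z\<^sub>2\<close> is replaced by \<open>z\<^sub>2 / 3 + z\<^sub>3\<close>;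
  the product is the one that results modulo 3.
\<close>

datatype coord = cS tri tri | cT tri | cX tri | cU | cV | cW | cY | cZ1 | cZ2 | cZ3

definition tsum :: "(tri \<Rightarrow> 'a::plus) \<Rightarrow> 'a" where
  "tsum f = f I0 + f I1 + f I2"

fun cmul :: "(coord \<Rightarrow> 'a::comm_ring_1) \<Rightarrow> (coord \<Rightarrow> 'a) \<Rightarrow> coord \<Rightarrow> 'a" where
  "cmul x y (cS i j) = tsum (\<lambda>k. x (cS i k) * y (cS k j))"
| "cmul x y (cT i) = tsum (\<lambda>k. x (cS i k) * y (cT k)) + x (cT i) * y cZ1"
| "cmul x y (cX j) = tsum (\<lambda>k. x (cX k) * y (cS k j)) + x cZ1 * y (cX j)"
| "cmul x y cU = x cU * y cU"
| "cmul x y cV = x cU * y cV + x cV * y cZ1"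
| "cmul x y cW = x cW * y cW"
| "cmul x y cY = x cY * y cU + x cZ1 * y cY"
| "cmul x y cZ1 = x cZ1 * y cZ1"
| "cmul x y cZ2 = tsum (\<lambda>k. x (cX k) * y (cT k)) + x cZ1 * y cZ2 + x cZ2 * y cZ1"
| "cmul x y cZ3 = x cY * y cV + x cZ1 * y cZ3 + x cZ3 * y cZ1"

fun cone :: "coord \<Rightarrow> 'a::comm_ring_1" where
  "cone (cS i j) = (if i = j then 1 else 0)"
| "cone cU = 1"
| "cone cW = 1"
| "cone cZ1 = 1"
| "cone _ = 0"

text \<open>Both bracketings agree because \<open>cT\<close> times \<open>cX\<close> and
  \<open>cV\<close> times \<open>cY\<close> vanish, while \<open>cZ2\<close> and \<open>cZ3\<close>
  act as zero on \<open>cT\<close>, \<open>cX\<close>, \<open>cV\<close> and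
  \<open>cY\<close>.\<close>

lemma cmul_assoc: "cmul (cmul x y) z = cmul x (cmul y z)"
proof
  fix k
  show "cmul (cmul x y) z k = cmul x (cmul y z) k"
    by (cases k) (simp_all add: tsum_def algebra_simps)
qed

lemma cmul_cone: "cmul cone x = x" "cmul x cone = x"
proof -
  have "cmul cone x k = x k \<and> cmul x cone k = x k" for k
  proof (cases k)
    case (cS i j) then show ?thesis by (cases i; cases j) (simp_all add: tsum_def)
  next
    case (cT i) then show ?thesis by (cases i) (simp_all add: tsum_def)
  next
    case (cX i) then show ?thesis by (cases i) (simp_all add: tsum_def)
  qed (simp_all add: tsum_def)
  then show "cmul cone x = x" "cmul x cone = x" by auto
qed

lemma cmul_distrib:
  "cmul (\<lambda>k. x k + y k) z = (\<lambda>k. cmul x z k + cmul y z k)"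
  "cmul z (\<lambda>k. x k + y k) = (\<lambda>k. cmul z x k + cmul z y k)"
proof -
  have "cmul (\<lambda>k. x k + y k) z k = cmul x z k + cmul y z k \<and>
      cmul z (\<lambda>k. x k + y k) k = cmul z x k + cmul z y k" for k
    by (cases k) (simp_all add: tsum_def algebra_simps)
  then show "cmul (\<lambda>k. x k + y k) z = (\<lambda>k. cmul x z k + cmul y z k)"
    "cmul z (\<lambda>k. x k + y k) = (\<lambda>k. cmul z x k + cmul z y k)" by auto
qed

lemma cmul_scale:
  "cmul (\<lambda>k. r * x k) z = (\<lambda>k. r * cmul x z k)"
  "cmul z (\<lambda>k. r * x k) = (\<lambda>k. r * cmul z x k)"
proof -
  have "cmul (\<lambda>k. r * x k) z k = r * cmul x z k \<and> cmul z (\<lambda>k. r * x k) k = r * cmul z x k" for k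
    by (cases k) (simp_all add: tsum_def algebra_simps)
  then show "cmul (\<lambda>k. r * x k) z = (\<lambda>k. r * cmul x z k)"
    "cmul z (\<lambda>k. r * x k) = (\<lambda>k. r * cmul z x k)" by auto
qed

lemma cmul_zero: "cmul (\<lambda>k. 0) z = (\<lambda>k. 0)" "cmul z (\<lambda>k. 0) = (\<lambda>k. 0)"
  using cmul_scale(1)[where r = 0 and x = "\<lambda>k. 0" and z = z]
    cmul_scale(2)[where r = 0 and x = "\<lambda>k. 0" and z = z] by simp_all

lemma of_int_cmul: "cmul (\<lambda>k. of_int (x k)) (\<lambda>k. of_int (y k)) k = of_int (cmul x y k)"
  by (cases k) (simp_all add: tsum_def)

lemma cmul_sum:
  "cmul (\<lambda>k. \<Sum>i\<in>I. x i k) z = (\<lambda>k. \<Sum>i\<in>I. cmul (x i) z k)"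
  "cmul z (\<lambda>k. \<Sum>i\<in>I. x i k) = (\<lambda>k. \<Sum>i\<in>I. cmul z (x i) k)"
proof -
  have "cmul (\<lambda>k. \<Sum>i\<in>I. x i k) z = (\<lambda>k. \<Sum>i\<in>I. cmul (x i) z k) \<and>
      cmul z (\<lambda>k. \<Sum>i\<in>I. x i k) = (\<lambda>k. \<Sum>i\<in>I. cmul z (x i) k)"
    by (induction I rule: infinite_finite_induct) (simp_all add: cmul_zero cmul_distrib)
  then show "cmul (\<lambda>k. \<Sum>i\<in>I. x i k) z = (\<lambda>k. \<Sum>i\<in>I. cmul (x i) z k)"
    "cmul z (\<lambda>k. \<Sum>i\<in>I. x i k) = (\<lambda>k. \<Sum>i\<in>I. cmul z (x i) k)" by auto
qed


section \<open>Subgroups of \<open>S\<^sub>3 \<times> S\<^sub>3\<close>\<close>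

fun tplus :: "tri \<Rightarrow> tri \<Rightarrow> tri" where
  "tplus I0 j = j"
| "tplus I1 I0 = I1" | "tplus I1 I1 = I2" | "tplus I1 I2 = I0"
| "tplus I2 I0 = I2" | "tplus I2 I1 = I0" | "tplus I2 I2 = I1"

fun tneg :: "tri \<Rightarrow> tri" where
  "tneg I0 = I0" | "tneg I1 = I2" | "tneg I2 = I1"

text \<open>The affine maps of the integers modulo 3, with \<open>tri\<close> for the residues:
  \<open>Rot i\<close> is k \<mapsto> i + k and \<open>Ref i\<close> is k \<mapsto> i - k.
  Constructors in place of permutations allow the tables below to be evaluated by rewriting.\<close>

datatype s3 = Rot tri | Ref tri

abbreviation "s1 \<equiv> Rot I0"

fun smul :: "s3 \<Rightarrow> s3 \<Rightarrow> s3" where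
  "smul (Rot i) (Rot j) = Rot (tplus i j)"
| "smul (Rot i) (Ref j) = Ref (tplus i j)"
| "smul (Ref i) (Rot j) = Ref (tplus i (tneg j))"
| "smul (Ref i) (Ref j) = Rot (tplus i (tneg j))"

fun sinv :: "s3 \<Rightarrow> s3" where
  "sinv (Rot i) = Rot (tneg i)"
| "sinv (Ref i) = Ref i"

fun reflection :: "s3 \<Rightarrow> bool" where
  "reflection (Rot i) = False"
| "reflection (Ref i) = True"

definition all3 :: "tri list" where "all3 = [I0, I1, I2]"
definition all6 :: "s3 list" where "all6 = [Rot I0, Rot I1, Rot I2, Ref I0, Ref I1, Ref I2]"

lemma set_all3: "set all3 = UNIV"
  using tri.exhaust by (auto simp: all3_def)

lemma set_all6: "set all6 = UNIV"
proof -
  have "x \<in> set all6" for x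
  proof (cases x)
    case (Rot i) then show ?thesis by (cases i) (simp_all add: all6_def)
  next
    case (Ref i) then show ?thesis by (cases i) (simp_all add: all6_def)
  qed
  then show ?thesis by auto
qed

datatype sub = C1 | C2 | C3 | C6

text \<open>One label for each of the 22 conjugacy classes of subgroups.\<close>

datatype label = Prod sub sub | Sgn bool bool | Cyc | Diag

fun in_sub :: "sub \<Rightarrow> s3 \<Rightarrow> bool" where
  "in_sub C1 g = (g = s1)"
| "in_sub C2 g = (g = s1 \<or> g = Ref I0)"
| "in_sub C3 g = (\<not> reflection g)"
| "in_sub C6 g = True"

text \<open>The rotations in \<open>sgn_sub x\<close> form the subgroup \<open>sgn_ker x\<close> of
  index two. Thus the two projections of a label \<open>Sgn x y\<close> have the group of order two
  as common quotient.\<close>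

definition sgn_sub :: "bool \<Rightarrow> sub" where "sgn_sub x = (if x then C6 else C2)"
definition sgn_ker :: "bool \<Rightarrow> sub" where "sgn_ker x = (if x then C3 else C1)"

fun in_rep :: "label \<Rightarrow> s3 \<Rightarrow> s3 \<Rightarrow> bool" where
  "in_rep (Prod K P) g h = (in_sub K g \<and> in_sub P h)"
| "in_rep (Sgn x y) g h =
    (in_sub (sgn_sub x) g \<and> in_sub (sgn_sub y) h \<and> reflection g = reflection h)"
| "in_rep Cyc g h = (g = h \<and> \<not> reflection g)"
| "in_rep Diag g h = (g = h)"

definition all_subs :: "sub list" where "all_subs = [C1, C2, C3, C6]"

definition labels :: "label list" where
  "labels = [Prod K P. K \<leftarrow> all_subs, P \<leftarrow> all_subs] @ [Sgn x y. x \<leftarrow> [False, True], y \<leftarrow> [False, True]]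
     @ [Cyc, Diag]"

definition coords :: "coord list" where
  "coords = [cS i j. i \<leftarrow> all3, j \<leftarrow> all3] @ map cT all3 @ map cX all3 @ [cU, cV, cW, cY, cZ1, cZ2, cZ3]"

text \<open>
  \<open>coeff i\<close> are the coordinates of the transitive biset with stabiliser \<open>i\<close>. For a product \<open>K \<times> P\<close> they
  are the outer product of a column that depends on \<open>K\<close> and a row that depends on \<open>P\<close>.
\<close>

fun avec :: "sub \<Rightarrow> tri \<Rightarrow> int" where
  "avec C1 I0 = 2" | "avec C1 I1 = 1" | "avec C1 I2 = -2"
| "avec C2 I0 = 1" | "avec C2 I1 = 0" | "avec C2 I2 = 0"
| "avec C3 I0 = 0" | "avec C3 I1 = 1" | "avec C3 I2 = 0"
| "avec C6 I0 = 0" | "avec C6 I1 = 0" | "avec C6 I2 = 1"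

text \<open>In \<open>avec\<close>, the class \<open>C1\<close> equals 2 \<open>C2\<close> +
  \<open>C3\<close> - 2 \<open>C6\<close>, a relation between permutation characters; the last entry
  tells the two sides apart. Its value is 2 and not 1 in order that the coordinate
  \<open>cZ2\<close> of \<open>Cyc\<close>, which is half of that of \<open>C1\<close> \<times>
  \<open>C1\<close>, be integral.\<close>

fun a_last :: "sub \<Rightarrow> int" where
  "a_last C1 = 2" | "a_last C2 = 0" | "a_last C3 = 0" | "a_last C6 = 0"

text \<open>The scalar product of \<open>bvec P\<close> and \<open>avec K\<close> is the number of
  double cosets of P and K in the group. Giving the unit vectors to \<open>C2\<close>,
  \<open>C3\<close> and \<open>C6\<close> in \<open>avec\<close> determines all other
  values.\<close>

fun bvec :: "sub \<Rightarrow> tri \<Rightarrow> int" where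
  "bvec C1 I0 = 3" | "bvec C1 I1 = 2" | "bvec C1 I2 = 1"
| "bvec C2 I0 = 2" | "bvec C2 I1 = 1" | "bvec C2 I2 = 1"
| "bvec C3 I0 = 1" | "bvec C3 I1 = 2" | "bvec C3 I2 = 1"
| "bvec C6 I0 = 1" | "bvec C6 I1 = 1" | "bvec C6 I2 = 1"

fun b_last :: "sub \<Rightarrow> int" where
  "b_last C1 = 1" | "b_last C2 = 0" | "b_last C3 = 0" | "b_last C6 = 0"

fun outer :: "sub \<Rightarrow> sub \<Rightarrow> coord \<Rightarrow> int" where
  "outer K P (cS i j) = avec K i * bvec P j"
| "outer K P (cT i) = avec K i * b_last P"
| "outer K P (cX j) = a_last K * bvec P j"
| "outer K P cZ2 = a_last K * b_last P"
| "outer K P _ = 0"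

text \<open>Of rank one like \<open>outer\<close>: the column with entries 1 and
  \<open>of_bool (\<not> x)\<close> times the row with entries 1 and
  \<open>of_bool (\<not> y)\<close>. A row meets a column only in the first entry, 1: up to bisets
  through the trivial group, every composite in the middle is the identity of the group of order
  two.\<close>

fun sgn_part :: "bool \<Rightarrow> bool \<Rightarrow> coord \<Rightarrow> int" where
  "sgn_part x y cU = 1"
| "sgn_part x y cV = of_bool (\<not> y)"
| "sgn_part x y cY = of_bool (\<not> x)"
| "sgn_part x y cZ3 = of_bool (\<not> x \<and> \<not> y)"
| "sgn_part x y _ = 0"

text \<open>Besides 2 at \<open>cW\<close>, which reflects that the square of \<open>Cyc\<close> is
  2 \<open>Cyc\<close>, this is half of \<open>outer C1 C1\<close> - \<open>outer C1 C3\<close> -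
  \<open>outer C3 C1\<close> + 3 \<open>outer C3 C3\<close>. The factors 1/2, -1/2, -1/2, 3/2 form
  the inverse of the table of double cosets for the group of order three.\<close>

fun cyc_coeff :: "coord \<Rightarrow> int" where
  "cyc_coeff (cS I0 I0) = 2" | "cyc_coeff (cS I1 I0) = 1" | "cyc_coeff (cS I2 I0) = -2"
| "cyc_coeff (cS I1 I1) = 2" | "cyc_coeff (cS I1 I2) = 1"
| "cyc_coeff (cT I0) = 1" | "cyc_coeff (cT I2) = -1" | "cyc_coeff (cX I0) = 2" | "cyc_coeff cZ2 = 1"
| "cyc_coeff cW = 2" | "cyc_coeff _ = 0"

text \<open>The numbers 1, -1, -1, 2 in the second equation form the inverse of the table of double
  cosets for the group of order two. The four products are the part of \<open>Sgn x y\<close> that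
  factors through the trivial group.\<close>

fun coeff :: "label \<Rightarrow> coord \<Rightarrow> int" where
  "coeff (Prod K P) k = outer K P k"
| "coeff (Sgn x y) k = sgn_part x y k + outer (sgn_ker x) (sgn_ker y) k
     - outer (sgn_ker x) (sgn_sub y) k - outer (sgn_sub x) (sgn_ker y) k
     + 2 * outer (sgn_sub x) (sgn_sub y) k"
| "coeff Cyc k = cyc_coeff k"
| "coeff Diag k = cone k"

text \<open>Functions on the group as tuples, so that the finite checks are decided by rewriting ground terms.\<close>

datatype 'a six = Six 'a 'a 'a 'a 'a 'a

fun nth6 :: "'a six \<Rightarrow> s3 \<Rightarrow> 'a" where
  "nth6 (Six a b c d e f) (Rot I0) = a"
| "nth6 (Six a b c d e f) (Rot I1) = b"
| "nth6 (Six a b c d e f) (Rot I2) = c"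
| "nth6 (Six a b c d e f) (Ref I0) = d"
| "nth6 (Six a b c d e f) (Ref I1) = e"
| "nth6 (Six a b c d e f) (Ref I2) = f"

definition six :: "(s3 \<Rightarrow> 'a) \<Rightarrow> 'a six" where
  "six f = Six (f (Rot I0)) (f (Rot I1)) (f (Rot I2)) (f (Ref I0)) (f (Ref I1)) (f (Ref I2))"

fun map6 :: "('a \<Rightarrow> 'b) \<Rightarrow> 'a six \<Rightarrow> 'b six" where
  "map6 h (Six a b c d e f) = Six (h a) (h b) (h c) (h d) (h e) (h f)"

fun or6 :: "bool six \<Rightarrow> bool six \<Rightarrow> bool six" where
  "or6 (Six a b c d e f) (Six a' b' c' d' e' f') =
    Six (a \<or> a') (b \<or> b') (c \<or> c') (d \<or> d') (e \<or> e') (f \<or> f')"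

fun or_if :: "bool \<Rightarrow> bool six \<Rightarrow> bool six \<Rightarrow> bool six" where
  "or_if True r s = or6 r s"
| "or_if False r s = s"

definition none6 :: "bool six" where "none6 = Six False False False False False False"
definition full6 :: "bool six" where "full6 = Six True True True True True True"

fun row_comp :: "bool six six \<Rightarrow> bool six \<Rightarrow> bool six" where
  "row_comp (Six r s t u v w) (Six a b c d e f) =
    or_if a r (or_if b s (or_if c t (or_if d u (or_if e v (or_if f w none6)))))"

definition mat_comp :: "bool six six \<Rightarrow> bool six six \<Rightarrow> bool six six" where
  "mat_comp L P = map6 (row_comp P) L"

fun sum6 :: "int six \<Rightarrow> int" where
  "sum6 (Six a b c d e f) = a + b + c + d + e + f"

definition count :: "bool six \<Rightarrow> int" where "count r = sum6 (map6 of_bool r)"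

fun dot6 :: "int six \<Rightarrow> bool six \<Rightarrow> int" where
  "dot6 (Six a' b' c' d' e' f') (Six a b c d e f) =
    of_bool a * a' + of_bool b * b' + of_bool c * c' + of_bool d * d' + of_bool e * e' + of_bool f * f'"

definition some6 :: "bool six \<Rightarrow> bool" where "some6 r \<longleftrightarrow> r \<noteq> none6"

definition head6 :: "bool six \<Rightarrow> bool" where "head6 r = nth6 r s1"

definition mat_range :: "bool six six \<Rightarrow> int" where "mat_range L = count (row_comp L full6)"
definition mat_domain :: "bool six six \<Rightarrow> int" where "mat_domain L = count (map6 some6 L)"
definition mat_ker :: "bool six six \<Rightarrow> int" where "mat_ker L = count (map6 head6 L)"
definition mat_card :: "bool six six \<Rightarrow> int" where "mat_card L = sum6 (map6 count L)"

definition mat_triples :: "bool six six \<Rightarrow> bool six six \<Rightarrow> int" where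
  "mat_triples L P = sum6 (map6 (dot6 (map6 count P)) L)"

definition conj_nth :: "'a six \<Rightarrow> s3 \<Rightarrow> s3 \<Rightarrow> 'a" where
  "conj_nth P g a = nth6 P (smul (smul (sinv g) a) g)"

definition conj6 :: "'a six \<Rightarrow> s3 \<Rightarrow> 'a six" where "conj6 P g = six (conj_nth P g)"

definition sub_of :: "int \<Rightarrow> sub" where
  "sub_of n = (if n = 1 then C1 else if n = 2 then C2 else if n = 3 then C3 else C6)"

text \<open>
  \<open>p\<close>, \<open>k\<close> and \<open>r\<close> are the orders of the first projection, of its intersection with the first factor, and
  of the second projection. They determine the conjugacy class.
\<close>

definition label_of :: "int \<Rightarrow> int \<Rightarrow> int \<Rightarrow> label" where
  "label_of p k r = (if p = k then Prod (sub_of p) (sub_of r)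
     else if p = 2 * k then Sgn (p = 6) (r = 6) else if p = 3 then Cyc else Diag)"

definition mat_label :: "bool six six \<Rightarrow> label" where
  "mat_label L = label_of (mat_domain L) (mat_ker L) (mat_range L)"

definition row_rep :: "sub \<Rightarrow> bool six" where "row_rep K = six (in_sub K)"

definition rep_row :: "label \<Rightarrow> s3 \<Rightarrow> bool six" where "rep_row i a = six (in_rep i a)"
definition mat_rep :: "label \<Rightarrow> bool six six" where "mat_rep i = six (rep_row i)"

text \<open>The summand of \<open>g\<close> in the Mackey formula for the product of two transitive bisets.\<close>

definition mackey_term :: "bool six six \<Rightarrow> bool six six \<Rightarrow> s3 \<Rightarrow> int \<times> label" where
  "mackey_term L P g = (mat_triples L (conj6 P g), mat_label (mat_comp L (conj6 P g)))"

fun comb :: "(int \<times> label) list \<Rightarrow> coord \<Rightarrow> int" where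
  "comb [] k = 0"
| "comb ((t, i) # ts) k = t * coeff i k + comb ts k"

text \<open>The Mackey formula sums over double cosets, whereas here g runs through the whole group.
  The double coset of g has |L| |P| elements divided by the number of triples, so with the weights
  \<open>mat_triples\<close> each double coset contributes |L| |P| times its summand.\<close>

definition mackey_coord :: "label \<Rightarrow> label \<Rightarrow> (int \<times> label) list \<Rightarrow> int \<Rightarrow> coord \<Rightarrow> bool" where
  "mackey_coord i j ts n k \<longleftrightarrow> comb ts k = n * cmul (coeff i) (coeff j) k"

definition mackey_ok :: "label \<Rightarrow> label \<Rightarrow> bool" where
  "mackey_ok i j \<longleftrightarrow> list_all (mackey_coord i j (map (mackey_term (mat_rep i) (mat_rep j)) all6)
     (mat_card (mat_rep i) * mat_card (mat_rep j))) coords"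

definition mackey_row :: "label \<Rightarrow> bool" where "mackey_row i \<longleftrightarrow> list_all (mackey_ok i) labels"

text \<open>All 22 \<times> 22 products are compared in 22 coordinates over the integers: for these
  coefficients \<open>cmul\<close> is exact even before reduction modulo 3.\<close>

lemma mackey_table: "list_all mackey_row labels"
  by code_simp

section \<open>Candidates for the subgroups, listed by their rows\<close>

definition shift_nth :: "bool six \<Rightarrow> s3 \<Rightarrow> s3 \<Rightarrow> bool" where "shift_nth r h c = nth6 r (smul c (sinv h))"
definition shift :: "bool six \<Rightarrow> s3 \<Rightarrow> bool six" where "shift r h = six (shift_nth r h)"

definition rotations :: "s3 list" where "rotations = [s1, Rot I1, Rot I2]"

definition subgroup_rows :: "bool six list" where
  "subgroup_rows = row_rep C1 # row_rep C3 # row_rep C6 # map (conj6 (row_rep C2)) rotations"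

text \<open>\<open>h\<close> and \<open>h'\<close> lie over the generators \<open>Rot I1\<close> and
  \<open>Ref I0\<close> of the first factor. The remaining rows lie over the square of
  \<open>Rot I1\<close> and over \<open>Rot I1\<close> and \<open>Rot I2\<close> times
  \<open>Ref I0\<close>.\<close>

definition candidates_gen2 :: "bool six \<Rightarrow> s3 \<Rightarrow> s3 \<Rightarrow> bool six six" where
  "candidates_gen2 k h h' = Six k (shift k h) (shift k (smul h h))
     (shift k h') (shift k (smul h h')) (shift k (smul (smul h h) h'))"

definition candidates_gen1 :: "bool six \<Rightarrow> s3 \<Rightarrow> bool six six list" where
  "candidates_gen1 k h =
     Six k none6 none6 (shift k h) none6 none6 #
     Six k none6 none6 none6 (shift k h) none6 #
     Six k none6 none6 none6 none6 (shift k h) #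
     Six k (shift k h) (shift k (smul h h)) none6 none6 none6 #
     map (candidates_gen2 k h) all6"

definition candidates :: "bool six \<Rightarrow> bool six six list" where
  "candidates k = Six k none6 none6 none6 none6 none6 # concat (map (candidates_gen1 k) all6)"

definition mat_mem :: "bool six six \<Rightarrow> s3 \<Rightarrow> s3 \<Rightarrow> bool" where
  "mat_mem m a b = nth6 (nth6 m a) b"

definition closed4 :: "bool six six \<Rightarrow> s3 \<Rightarrow> s3 \<Rightarrow> s3 \<Rightarrow> s3 \<Rightarrow> bool" where
  "closed4 m a b c d \<longleftrightarrow> (mat_mem m c d \<longrightarrow> mat_mem m (smul a c) (smul b d))"
definition closed3 :: "bool six six \<Rightarrow> s3 \<Rightarrow> s3 \<Rightarrow> s3 \<Rightarrow> bool" where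
  "closed3 m a b c \<longleftrightarrow> list_all (closed4 m a b c) all6"
definition closed2 :: "bool six six \<Rightarrow> s3 \<Rightarrow> s3 \<Rightarrow> bool" where
  "closed2 m a b \<longleftrightarrow> (mat_mem m a b \<longrightarrow> list_all (closed3 m a b) all6)"
definition closed1 :: "bool six six \<Rightarrow> s3 \<Rightarrow> bool" where
  "closed1 m a \<longleftrightarrow> list_all (closed2 m a) all6"
definition mat_closed :: "bool six six \<Rightarrow> bool" where
  "mat_closed m \<longleftrightarrow> list_all (closed1 m) all6"

definition conj2_row :: "s3 \<Rightarrow> bool six \<Rightarrow> bool six" where "conj2_row y r = conj6 r y"
definition mat_conj2 :: "bool six six \<Rightarrow> s3 \<Rightarrow> s3 \<Rightarrow> bool six six" where
  "mat_conj2 P x y = map6 (conj2_row y) (conj6 P x)"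

definition is_conj2 :: "bool six six \<Rightarrow> bool six six \<Rightarrow> s3 \<Rightarrow> s3 \<Rightarrow> bool" where
  "is_conj2 m P x y \<longleftrightarrow> m = mat_conj2 P x y"
definition is_conj1 :: "bool six six \<Rightarrow> bool six six \<Rightarrow> s3 \<Rightarrow> bool" where
  "is_conj1 m P x \<longleftrightarrow> list_ex (is_conj2 m P x) all6"

text \<open>The second alternative lets candidates pass that are no subgroups. In the first factor,
  conjugation by rotations reaches every conjugate, because each representative is normalised by
  (\<open>Ref I0\<close>, y) for a suitable y.\<close>

definition mat_classified :: "bool six six \<Rightarrow> bool" where
  "mat_classified m \<longleftrightarrow> list_ex (is_conj1 m (mat_rep (mat_label m))) rotations \<or> \<not> mat_closed m"

definition candidates_ok :: "bool six \<Rightarrow> bool" where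
  "candidates_ok k \<longleftrightarrow> list_all mat_classified (candidates k)"

lemma candidates_table: "list_all candidates_ok subgroup_rows"
  by code_simp


section \<open>Group laws, and quantifiers and sums over the six elements\<close>

lemma UNIV_s3: "(UNIV :: s3 set) = {Rot I0, Rot I1, Rot I2, Ref I0, Ref I1, Ref I2}"
  using set_all6 by (simp add: all6_def)

lemma finite_s3 [simp]: "finite (UNIV :: s3 set)"
  by (simp add: UNIV_s3)

instance s3 :: finite
  by standard simp

lemma all_s3: "(\<forall>x :: s3. P x) \<longleftrightarrow> P (Rot I0) \<and> P (Rot I1) \<and> P (Rot I2) \<and> P (Ref I0) \<and> P (Ref I1) \<and> P (Ref I2)"
  using UNIV_s3 by (metis UNIV_I insertE singletonD)

lemma ex_s3: "(\<exists>x :: s3. P x) \<longleftrightarrow> P (Rot I0) \<or> P (Rot I1) \<or> P (Rot I2) \<or> P (Ref I0) \<or> P (Ref I1) \<or> P (Ref I2)"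
  using all_s3[of "\<lambda>x. \<not> P x"] by blast

lemma sum_s3: "(\<Sum>x\<in>UNIV. f x) = f (Rot I0) + f (Rot I1) + f (Rot I2) + f (Ref I0) + f (Ref I1) + f (Ref I2 :: s3)"
  for f :: "s3 \<Rightarrow> 'a::comm_monoid_add"
  by (simp add: UNIV_s3 add.assoc)

lemma tplus_laws: "tplus (tplus i j) k = tplus i (tplus j k)" "tplus i j = tplus j i"
  "tplus i (tplus j k) = tplus j (tplus i k)"
  "tplus i I0 = i" "tplus i (tneg i) = I0" "tneg (tplus i j) = tplus (tneg i) (tneg j)" "tneg (tneg i) = i"
  by (cases i; cases j; cases k; simp)+

lemma smul_assoc: "smul (smul a b) c = smul a (smul b c)"
  by (cases a; cases b; cases c) (simp_all add: tplus_laws)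

lemma smul_one [simp]: "smul s1 a = a" "smul a s1 = a"
  by (cases a; simp add: tplus_laws)+

lemma smul_inv [simp]: "smul (sinv a) a = s1" "smul a (sinv a) = s1"
proof -
  have "smul (sinv a) a = s1 \<and> smul a (sinv a) = s1"
    using all_s3[of "\<lambda>a. smul (sinv a) a = s1 \<and> smul a (sinv a) = s1"] by simp
  then show "smul (sinv a) a = s1" "smul a (sinv a) = s1" by auto
qed

lemma smul_cancel [simp]: "smul (sinv a) (smul a b) = b" "smul a (smul (sinv a) b) = b"
  by (simp_all flip: smul_assoc)

lemma sinv_smul: "sinv (smul a b) = smul (sinv b) (sinv a)"
  by (metis smul_assoc smul_cancel(1) smul_inv(2) smul_one(2))

lemma sinv_sinv [simp]: "sinv (sinv a) = a"
  by (cases a) (simp_all add: tplus_laws)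

text \<open>The exponent of the group is 6. This provides inverses in every set closed under
  products, as used in \<open>rel_subgroupD\<close>.\<close>

lemma sinv_power: "sinv a = smul a (smul a (smul a (smul a a)))"
  using all_s3[of "\<lambda>a. sinv a = smul a (smul a (smul a (smul a a)))"] by simp


subsection \<open>Relations as matrices\<close>

definition mat :: "(s3 \<times> s3) set \<Rightarrow> bool six six" where
  "mat L = six (\<lambda>a. six (\<lambda>b. (a, b) \<in> L))"

text \<open>Conjugation by (g, 1): the change of the stabiliser when a point is moved by g from the
  left.\<close>

definition conj1 :: "s3 \<Rightarrow> (s3 \<times> s3) set \<Rightarrow> (s3 \<times> s3) set" where
  "conj1 g P = {(a, b). (smul (smul (sinv g) a) g, b) \<in> P}"

definition conj2 :: "s3 \<Rightarrow> s3 \<Rightarrow> (s3 \<times> s3) set \<Rightarrow> (s3 \<times> s3) set" where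
  "conj2 x y P = {(a, b). (smul (smul (sinv x) a) x, smul (smul (sinv y) b) y) \<in> P}"

definition triples :: "('a \<times> 'a) set \<Rightarrow> ('a \<times> 'a) set \<Rightarrow> nat" where
  "triples L P = card {(a, b, c). (a, b) \<in> L \<and> (b, c) \<in> P}"

definition rel_label :: "(s3 \<times> s3) set \<Rightarrow> label" where
  "rel_label L = label_of (int (card (Domain L))) (int (card {a. (a, s1) \<in> L})) (int (card (Range L)))"

definition rel_rep :: "label \<Rightarrow> (s3 \<times> s3) set" where
  "rel_rep i = {(a, b). in_rep i a b}"

lemma nth6_six [simp]: "nth6 (six f) a = f a"
proof -
  have "\<forall>a. nth6 (six f) a = f a" unfolding all_s3 by (simp add: six_def)
  then show ?thesis ..
qed

lemma map6_six [simp]: "map6 h (six f) = six (\<lambda>a. h (f a))"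
  by (simp add: six_def)

lemma six_inject [simp]: "six f = six g \<longleftrightarrow> f = g"
  by (metis nth6_six ext)


lemma sum6_six [simp]: "sum6 (six f) = (\<Sum>a\<in>UNIV. f a)"
  by (simp add: six_def sum_s3)

lemma count_six [simp]: "count (six p) = int (card {a. p a})"
  by (simp add: count_def of_bool_def sum.If_cases)

lemma or_if_six: "or_if x (six q) (six r) = six (\<lambda>c. x \<and> q c \<or> r c)"
  by (cases x) (simp_all add: six_def)

lemma none6_six: "none6 = six (\<lambda>c. False)"
  by (simp add: none6_def six_def)

lemma full6_six: "full6 = six (\<lambda>c. True)"
  by (simp add: full6_def six_def)

lemma row_comp_six: "row_comp (six (\<lambda>b. six (q b))) (six p) = six (\<lambda>c. \<exists>b. p b \<and> q b c)"
proof -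
  have "row_comp (six (\<lambda>b. six (q b))) (six p) =
      six (\<lambda>c. p (Rot I0) \<and> q (Rot I0) c \<or> p (Rot I1) \<and> q (Rot I1) c \<or> p (Rot I2) \<and> q (Rot I2) c \<or>
        p (Ref I0) \<and> q (Ref I0) c \<or> p (Ref I1) \<and> q (Ref I1) c \<or> p (Ref I2) \<and> q (Ref I2) c \<or> False)"
    unfolding none6_six six_def[of "\<lambda>b. six (q b)"] six_def[of p] row_comp.simps or_if_six ..
  then show ?thesis by (simp add: ex_s3)
qed

lemma mat_comp_mat: "mat_comp (mat L) (mat P) = mat (L O P)"
  by (simp add: mat_comp_def mat_def row_comp_six relcomp_unfold)

lemma mat_domain_mat: "mat_domain (mat L) = int (card (Domain L))"
proof -
  have "some6 (six p) \<longleftrightarrow> (\<exists>c. p c)" for p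
    unfolding some6_def none6_six six_inject fun_eq_iff by simp
  then show ?thesis by (simp add: mat_domain_def mat_def Domain_unfold)
qed

lemma mat_range_mat: "mat_range (mat L) = int (card (Range L))"
proof -
  have "{c. \<exists>b. (b, c) \<in> L} = Range L" by auto
  then show ?thesis unfolding mat_range_def mat_def full6_six row_comp_six by simp
qed

lemma mat_ker_mat: "mat_ker (mat L) = int (card {a. (a, s1) \<in> L})"
  by (simp add: mat_ker_def mat_def head6_def)

lemma mat_label_mat: "mat_label (mat L) = rel_label L"
  by (simp add: mat_label_def rel_label_def mat_domain_mat mat_range_mat mat_ker_mat)

lemma card_pairs: "card {(a, b). P a b} = (\<Sum>a\<in>UNIV. card {b. P a b})"
  for P :: "s3 \<Rightarrow> 'b::finite \<Rightarrow> bool"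
proof -
  have "{(a, b). P a b} = (SIGMA a:UNIV. {b. P a b})" by auto
  then show ?thesis by simp
qed

lemma mat_card_mat: "mat_card (mat L) = int (card L)"
  using card_pairs[of "\<lambda>a b. (a, b) \<in> L"] by (simp add: mat_card_def mat_def)

lemma dot6_six: "dot6 (six w) (six p) = (\<Sum>b\<in>UNIV. of_bool (p b) * w b)"
  by (simp add: six_def sum_s3)

lemma mat_triples_mat: "mat_triples (mat L) (mat P) = int (triples L P)"
proof -
  have "int (card {bc. (a, fst bc) \<in> L \<and> bc \<in> P}) = (\<Sum>b\<in>UNIV. of_bool ((a, b) \<in> L) * int (card {c. (b, c) \<in> P}))" for a
  proof -
    have "card {(b, c). (a, b) \<in> L \<and> (b, c) \<in> P} = (\<Sum>b\<in>UNIV. card {c. (a, b) \<in> L \<and> (b, c) \<in> P})"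
      by (rule card_pairs)
    moreover have "{bc. (a, fst bc) \<in> L \<and> bc \<in> P} = {(b, c). (a, b) \<in> L \<and> (b, c) \<in> P}" by auto
    moreover have "card {c. (a, b) \<in> L \<and> (b, c) \<in> P} = of_bool ((a, b) \<in> L) * card {c. (b, c) \<in> P}" for b
      by (cases "(a, b) \<in> L") simp_all
    ultimately show ?thesis by simp
  qed
  moreover have "triples L P = (\<Sum>a\<in>UNIV. card {bc. (a, fst bc) \<in> L \<and> bc \<in> P})"
    using card_pairs[of "\<lambda>a bc. (a, fst bc) \<in> L \<and> bc \<in> P"]
    by (simp add: triples_def case_prod_unfold)
  ultimately show ?thesis
    by (simp add: mat_triples_def mat_def dot6_six)
qed

lemma conj6_mat: "conj6 (mat P) g = mat (conj1 g P)"
  by (simp add: conj6_def conj_nth_def[abs_def] mat_def conj1_def)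

lemma mat_rep_mat: "mat_rep i = mat (rel_rep i)"
  by (simp add: mat_rep_def rep_row_def[abs_def] mat_def rel_rep_def)

lemma mat_inject: "mat L = mat P \<longleftrightarrow> L = P"
  by (auto simp: mat_def fun_eq_iff)

lemma set_labels: "set labels = UNIV"
proof -
  have "set all_subs = UNIV" using sub.exhaust by (auto simp: all_subs_def)
  have "x \<in> set labels" for x
  proof (cases x)
    case (Prod K P)
    then show ?thesis by (cases K; cases P) (simp_all add: labels_def all_subs_def)
  next
    case (Sgn a b)
    then show ?thesis by (cases a; cases b) (simp_all add: labels_def)
  qed (simp_all add: labels_def)
  then show ?thesis by auto
qed

lemma set_coords: "set coords = UNIV"
proof -
  have "k \<in> set coords" for k
    using set_all3 by (cases k) (auto simp: coords_def)
  then show ?thesis by auto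
qed

lemma comb_map: "comb (map (\<lambda>g. (t g, l g)) xs) k = (\<Sum>g\<leftarrow>xs. t g * coeff (l g) k)"
  by (induction xs) simp_all

lemma mackey_rep:
  "(\<Sum>g\<in>UNIV. int (triples (rel_rep i) (conj1 g (rel_rep j))) * coeff (rel_label (rel_rep i O conj1 g (rel_rep j))) k)
     = int (card (rel_rep i)) * int (card (rel_rep j)) * cmul (coeff i) (coeff j) k"
proof -
  have "mackey_ok i j"
    using mackey_table set_labels by (simp add: list_all_iff mackey_row_def)
  then have "comb (map (mackey_term (mat_rep i) (mat_rep j)) all6) k =
      mat_card (mat_rep i) * mat_card (mat_rep j) * cmul (coeff i) (coeff j) k"
    using set_coords by (simp add: mackey_ok_def mackey_coord_def[abs_def] list_all_iff)
  moreover have "mackey_term (mat_rep i) (mat_rep j) =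
      (\<lambda>g. (int (triples (rel_rep i) (conj1 g (rel_rep j))), rel_label (rel_rep i O conj1 g (rel_rep j))))"
    by (simp add: fun_eq_iff mackey_term_def mat_rep_mat conj6_mat mat_triples_mat mat_comp_mat mat_label_mat)
  ultimately show ?thesis
    by (simp add: comb_map mat_rep_mat mat_card_mat) (simp add: all6_def sum_s3 algebra_simps)
qed

subsection \<open>Classification\<close>

definition rel_subgroup :: "(s3 \<times> s3) set \<Rightarrow> bool" where
  "rel_subgroup L \<longleftrightarrow> (s1, s1) \<in> L \<and>
     (\<forall>a b c d. (a, b) \<in> L \<longrightarrow> (c, d) \<in> L \<longrightarrow> (smul a c, smul b d) \<in> L)"

lemma rel_subgroupD:
  assumes "rel_subgroup L"
  shows "(s1, s1) \<in> L" "\<lbrakk>(a, b) \<in> L; (c, d) \<in> L\<rbrakk> \<Longrightarrow> (smul a c, smul b d) \<in> L"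
    "(a, b) \<in> L \<Longrightarrow> (sinv a, sinv b) \<in> L"
proof -
  show mult: "(smul a c, smul b d) \<in> L" if "(a, b) \<in> L" "(c, d) \<in> L" for a b c d
    using assms that by (simp add: rel_subgroup_def)
  show "(sinv a, sinv b) \<in> L" if "(a, b) \<in> L"
    unfolding sinv_power[of a] sinv_power[of b] using that by (intro mult)
qed (use assms in \<open>simp add: rel_subgroup_def\<close>)

lemma subgroup_row:
  assumes "K s1" "\<And>a b. \<lbrakk>K a; K b\<rbrakk> \<Longrightarrow> K (smul a b)"
  shows "six K \<in> set subgroup_rows"
proof -
  have sub: "set subgroup_rows = {Six True False False False False False, Six True True True False False False,
      Six True True True True True True, Six True False False True False False,
      Six True False False False True False, Six True False False False False True}"
  proof -
    have rows: "subgroup_rows = [Six True False False False False False, Six True True True False False False,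
      Six True True True True True True, Six True False False True False False,
      Six True False False False False True, Six True False False False True False]"
      by code_simp
    show ?thesis unfolding rows by auto
  qed
  have "K (Rot I1) \<longleftrightarrow> K (Rot I2)"
    using assms(2)[of "Rot I1" "Rot I1"] assms(2)[of "Rot I2" "Rot I2"] by auto
  moreover have "K (Rot I1) \<longrightarrow> K (Ref I0) \<longrightarrow> K (Ref I1)" "K (Rot I1) \<longrightarrow> K (Ref I1) \<longrightarrow> K (Ref I2)"
    "K (Rot I1) \<longrightarrow> K (Ref I2) \<longrightarrow> K (Ref I0)"
    using assms(2)[of "Rot I1" "Ref I0"] assms(2)[of "Rot I1" "Ref I1"] assms(2)[of "Rot I1" "Ref I2"] by auto
  moreover have "K (Ref I0) \<longrightarrow> K (Ref I1) \<longrightarrow> K (Rot I2)" "K (Ref I0) \<longrightarrow> K (Ref I2) \<longrightarrow> K (Rot I1)"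
    "K (Ref I1) \<longrightarrow> K (Ref I2) \<longrightarrow> K (Rot I2)"
    using assms(2)[of "Ref I0" "Ref I1"] assms(2)[of "Ref I0" "Ref I2"] assms(2)[of "Ref I1" "Ref I2"] by auto
  \<comment> \<open>The implications leave six possibilities: with the nontrivial rotations, all
    reflections or none; without them, at most one reflection. What remains is
    propositional.\<close>
  ultimately show ?thesis
    using assms(1) unfolding six_def sub insert_iff empty_iff six.inject by argo
qed

text \<open>
  A subgroup of \<open>S\<^sub>3 \<times> S\<^sub>3\<close> is determined by its intersection with the second factor and by one element
  over each member of a generating set of its first projection.
\<close>

lemma mat_candidate:
  assumes L: "rel_subgroup L"
  shows "\<exists>k\<in>set subgroup_rows. mat L \<in> set (candidates k)"
proof -
  define k where "k = six (\<lambda>h. (s1, h) \<in> L)"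
  note D = rel_subgroupD[OF L]
  have "k \<in> set subgroup_rows"
    unfolding k_def using D by (intro subgroup_row) (auto dest: D(2))
  \<comment> \<open>Multiplication by (a, h) or its inverse moves between the rows over a and over
    the identity, so the former is a coset of the latter.\<close>
  moreover have row: "six (\<lambda>c. (a, c) \<in> L) = shift k h" if "(a, h) \<in> L" for a h
  proof -
    have "(a, c) \<in> L \<longleftrightarrow> (s1, smul c (sinv h)) \<in> L" for c
    proof
      assume "(a, c) \<in> L"
      from D(2)[OF this D(3)[OF that]] show "(s1, smul c (sinv h)) \<in> L" by simp
    next
      assume "(s1, smul c (sinv h)) \<in> L"
      from D(2)[OF this that] show "(a, c) \<in> L" by (simp add: smul_assoc)
    qed
    then show ?thesis by (simp add: shift_def k_def shift_nth_def[abs_def])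
  qed
  have norow: "six (\<lambda>c. (a, c) \<in> L) = none6" if "a \<notin> Domain L" for a
    using that by (auto simp: none6_six)
  have mat: "mat L = Six k (six (\<lambda>c. (Rot I1, c) \<in> L)) (six (\<lambda>c. (Rot I2, c) \<in> L))
      (six (\<lambda>c. (Ref I0, c) \<in> L)) (six (\<lambda>c. (Ref I1, c) \<in> L)) (six (\<lambda>c. (Ref I2, c) \<in> L))"
    by (simp add: mat_def k_def six_def[of "\<lambda>a. six (\<lambda>b. (a, b) \<in> L)"])
  have dom: "Rot I1 \<in> Domain L \<longleftrightarrow> Rot I2 \<in> Domain L"
    "Rot I1 \<in> Domain L \<Longrightarrow> Ref I1 \<in> Domain L \<Longrightarrow> Ref I0 \<in> Domain L"
    "Rot I1 \<in> Domain L \<Longrightarrow> Ref I2 \<in> Domain L \<Longrightarrow> Ref I0 \<in> Domain L"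
    "Ref I0 \<in> Domain L \<Longrightarrow> Ref I1 \<in> Domain L \<Longrightarrow> Rot I1 \<in> Domain L"
    "Ref I0 \<in> Domain L \<Longrightarrow> Ref I2 \<in> Domain L \<Longrightarrow> Rot I1 \<in> Domain L"
    "Ref I1 \<in> Domain L \<Longrightarrow> Ref I2 \<in> Domain L \<Longrightarrow> Rot I1 \<in> Domain L"
  proof -
    have mult: "smul a b \<in> Domain L" if "a \<in> Domain L" "b \<in> Domain L" for a b
      using that D(2) by blast
    show dom12: "Rot I1 \<in> Domain L \<longleftrightarrow> Rot I2 \<in> Domain L"
      using mult[of "Rot I1" "Rot I1"] mult[of "Rot I2" "Rot I2"] by auto
    show "Rot I1 \<in> Domain L \<Longrightarrow> Ref I1 \<in> Domain L \<Longrightarrow> Ref I0 \<in> Domain L"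
      "Rot I1 \<in> Domain L \<Longrightarrow> Ref I2 \<in> Domain L \<Longrightarrow> Ref I0 \<in> Domain L"
      using mult[of "Rot I2" "Ref I1"] mult[of "Rot I1" "Ref I2"] dom12 by auto
    show "Ref I0 \<in> Domain L \<Longrightarrow> Ref I1 \<in> Domain L \<Longrightarrow> Rot I1 \<in> Domain L"
      "Ref I0 \<in> Domain L \<Longrightarrow> Ref I2 \<in> Domain L \<Longrightarrow> Rot I1 \<in> Domain L"
      "Ref I1 \<in> Domain L \<Longrightarrow> Ref I2 \<in> Domain L \<Longrightarrow> Rot I1 \<in> Domain L"
      using mult[of "Ref I0" "Ref I1"] mult[of "Ref I0" "Ref I2"] mult[of "Ref I1" "Ref I2"] dom12 by auto
  qed
  have set6: "x \<in> set all6" for x using set_all6 by simp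
  have gen1: "m \<in> set (candidates k)" if "m \<in> set (candidates_gen1 k h)" for m h
    using that set6[of h] by (auto simp: candidates_def)
  have "mat L \<in> set (candidates k)"
  proof (cases "Rot I1 \<in> Domain L")
    case True
    then obtain h where h: "(Rot I1, h) \<in> L" by blast
    have rot: "(Rot I2, smul h h) \<in> L" using D(2)[OF h h] by simp
    show ?thesis
    proof (cases "Ref I0 \<in> Domain L")
      case True
      then obtain h' where h': "(Ref I0, h') \<in> L" by blast
      have "(Ref I1, smul h h') \<in> L" "(Ref I2, smul (smul h h) h') \<in> L"
        using D(2)[OF h h'] D(2)[OF rot h'] by simp_all
      then have "mat L = candidates_gen2 k h h'"
        unfolding mat candidates_gen2_def using row h rot h' by simp
      then show ?thesis using set6[of h'] by (intro gen1[of _ h]) (simp add: candidates_gen1_def)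
    next
      case False
      with True dom have "Ref I1 \<notin> Domain L" "Ref I2 \<notin> Domain L" by auto
      with False have "mat L = Six k (shift k h) (shift k (smul h h)) none6 none6 none6"
        unfolding mat using row h rot norow by simp
      then show ?thesis by (intro gen1[of _ h]) (simp add: candidates_gen1_def)
    qed
  next
    case False
    with dom have rot: "six (\<lambda>c. (Rot I1, c) \<in> L) = none6" "six (\<lambda>c. (Rot I2, c) \<in> L) = none6"
      by (simp_all add: norow)
    \<comment> \<open>Two distinct reflections have a nontrivial rotation as product, so at most one
      reflection is left in the first projection.\<close>
    consider "Ref I0 \<in> Domain L" "Ref I1 \<notin> Domain L" "Ref I2 \<notin> Domain L"
      | "Ref I0 \<notin> Domain L" "Ref I1 \<in> Domain L" "Ref I2 \<notin> Domain L"
      | "Ref I0 \<notin> Domain L" "Ref I1 \<notin> Domain L" "Ref I2 \<in> Domain L"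
      | "Ref I0 \<notin> Domain L" "Ref I1 \<notin> Domain L" "Ref I2 \<notin> Domain L"
      using False dom by blast
    then show ?thesis
    proof cases
      case 1
      then obtain h where "(Ref I0, h) \<in> L" by blast
      with 1 have "mat L = Six k none6 none6 (shift k h) none6 none6" unfolding mat rot by (simp add: row norow)
      then show ?thesis by (intro gen1[of _ h]) (simp add: candidates_gen1_def)
    next
      case 2
      then obtain h where "(Ref I1, h) \<in> L" by blast
      with 2 have "mat L = Six k none6 none6 none6 (shift k h) none6" unfolding mat rot by (simp add: row norow)
      then show ?thesis by (intro gen1[of _ h]) (simp add: candidates_gen1_def)
    next
      case 3
      then obtain h where "(Ref I2, h) \<in> L" by blast
      with 3 have "mat L = Six k none6 none6 none6 none6 (shift k h)" unfolding mat rot by (simp add: row norow)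
      then show ?thesis by (intro gen1[of _ h]) (simp add: candidates_gen1_def)
    next
      case 4
      then have "mat L = Six k none6 none6 none6 none6 none6" unfolding mat rot by (simp add: norow)
      then show ?thesis by (simp add: candidates_def)
    qed
  qed
  with \<open>k \<in> set subgroup_rows\<close> show ?thesis ..
qed

lemma conj2_mat: "mat_conj2 (mat P) x y = mat (conj2 x y P)"
  by (simp add: mat_conj2_def conj6_def conj_nth_def[abs_def] conj2_row_def mat_def conj2_def)

theorem subgroup_classification:
  assumes L: "rel_subgroup L"
  shows "\<exists>x y. L = conj2 x y (rel_rep (rel_label L))"
proof -
  have "mat_classified (mat L)"
    using mat_candidate[OF L] candidates_table by (auto simp: list_all_iff candidates_ok_def)
  moreover have "mat_closed (mat L)"
  proof -
    have mem: "mat_mem (mat L) a b \<longleftrightarrow> (a, b) \<in> L" for a b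
      by (simp add: mat_mem_def mat_def)
    show ?thesis
      using rel_subgroupD[OF L]
      by (simp add: mat_closed_def list_all_iff closed1_def closed2_def closed3_def closed4_def mem)
  qed
  ultimately show ?thesis
    by (auto simp: mat_classified_def list_ex_iff is_conj1_def is_conj2_def mat_label_mat mat_rep_mat
        conj2_mat mat_inject)
qed

section \<open>Invariance of labels, orders and triples under conjugation\<close>

lemma smul_conj_iff: "smul (smul (sinv x) a) x = b \<longleftrightarrow> a = smul (smul x b) (sinv x)"
  by (metis smul_assoc smul_cancel smul_inv smul_one)

lemma inj_conj: "inj (\<lambda>a. smul (smul (sinv x) a) x)"
  by (rule injI) (metis smul_conj_iff)

lemma conj_bij: "bij (\<lambda>a. smul (smul (sinv x) a) x)"
  using inj_conj by (simp add: bij_def finite_UNIV_inj_surj)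

lemma card_conj: "card {a. P (smul (smul (sinv x) a) x)} = card {a. P a}"
proof -
  have "{a. P a} = (\<lambda>a. smul (smul (sinv x) a) x) ` {a. P (smul (smul (sinv x) a) x)}"
    using bij_is_surj[OF conj_bij[of x]] by (force simp: surj_def image_iff)
  then show ?thesis by (metis card_image inj_conj inj_on_subset subset_UNIV)
qed

lemma ex_conj: "(\<exists>b. Q (smul (smul (sinv y) b) y)) \<longleftrightarrow> (\<exists>b. Q b)"
proof
  assume "\<exists>b. Q b"
  then obtain b where "Q b" ..
  then show "\<exists>b. Q (smul (smul (sinv y) b) y)"
    by (intro exI[of _ "smul (smul y b) (sinv y)"]) (simp add: smul_assoc)
qed blast

lemma rel_label_conj2: "rel_label (conj2 x y L) = rel_label L"
proof -
  have surj: "(\<exists>b. P (smul (smul (sinv z) b) z)) \<longleftrightarrow> (\<exists>b. P b)" for P z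
    by (rule ex_conj)
  have "card (Domain (conj2 x y L)) = card (Domain L)"
    unfolding Domain_unfold conj2_def using card_conj[of "\<lambda>a. \<exists>b. (a, b) \<in> L" x]
    by (simp add: surj[of "\<lambda>b. (_, b) \<in> L"])
  moreover have "card (Range (conj2 x y L)) = card (Range L)"
  proof -
    have "Range L' = {b. \<exists>a. (a, b) \<in> L'}" for L' :: "(s3 \<times> s3) set" by auto
    then show ?thesis
      unfolding conj2_def using card_conj[of "\<lambda>b. \<exists>a. (a, b) \<in> L" y]
      by (simp add: surj[of "\<lambda>a. (a, _) \<in> L"])
  qed
  moreover have "card {a. (a, s1) \<in> conj2 x y L} = card {a. (a, s1) \<in> L}"
    unfolding conj2_def using card_conj[of "\<lambda>a. (a, s1) \<in> L" x] by (simp add: smul_assoc)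
  ultimately show ?thesis by (simp add: rel_label_def)
qed

lemma card_conj2: "card (conj2 x y L) = card L"
proof -
  have "L = map_prod (\<lambda>a. smul (smul (sinv x) a) x) (\<lambda>a. smul (smul (sinv y) a) y) ` conj2 x y L"
    using bij_is_surj[OF conj_bij[of x]] bij_is_surj[OF conj_bij[of y]]
    by (force simp: conj2_def surj_def image_iff)
  moreover have "inj (map_prod (\<lambda>a. smul (smul (sinv x) a) x) (\<lambda>a. smul (smul (sinv y) a) y))"
    using inj_conj by (simp add: prod.inj_map)
  ultimately show ?thesis by (metis card_image inj_on_subset subset_UNIV)
qed

lemma conj1_conj2: "conj1 g (conj2 x y P) = conj2 (smul g x) y P"
  by (simp add: conj1_def conj2_def sinv_smul smul_assoc)

text \<open>Conjugating the middle element by y is a change of the bound variable. It removes y on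
  the left, and leaves g of the factor y g on the right.\<close>

lemma relcomp_conj2: "conj2 x y L O conj2 (smul y g) z P = conj2 x z (L O conj1 g P)"
proof -
  have surj: "(\<exists>b. Q (smul (smul (sinv y) b) y)) \<longleftrightarrow> (\<exists>b. Q b)" for Q
    by (rule ex_conj)
  have "(a, c) \<in> conj2 x y L O conj2 (smul y g) z P \<longleftrightarrow> (a, c) \<in> conj2 x z (L O conj1 g P)" for a c
  proof -
  have "(a, c) \<in> conj2 x y L O conj2 (smul y g) z P \<longleftrightarrow>
      (\<exists>b. (smul (smul (sinv x) a) x, smul (smul (sinv y) b) y) \<in> L \<and>
        (smul (smul (sinv g) (smul (smul (sinv y) b) y)) g, smul (smul (sinv z) c) z) \<in> P)"
    by (auto simp: conj2_def sinv_smul smul_assoc relcomp_unfold)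
  also have "\<dots> \<longleftrightarrow> (\<exists>b. (smul (smul (sinv x) a) x, b) \<in> L \<and>
        (smul (smul (sinv g) b) g, smul (smul (sinv z) c) z) \<in> P)"
    by (rule surj)
  also have "\<dots> \<longleftrightarrow> (a, c) \<in> conj2 x z (L O conj1 g P)"
    by (auto simp: conj2_def conj1_def relcomp_unfold)
  finally show ?thesis .
  qed
  then show ?thesis by (simp add: set_eq_iff)
qed

lemma triples_conj2: "triples (conj2 x y L) (conj2 (smul y g) z P) = triples L (conj1 g P)"
proof -
  let ?f = "\<lambda>(a, b, c). (smul (smul (sinv x) a) x, smul (smul (sinv y) b) y, smul (smul (sinv z) c) z)"
  have "?f = map_prod (\<lambda>a. smul (smul (sinv x) a) x)
      (map_prod (\<lambda>a. smul (smul (sinv y) a) y) (\<lambda>a. smul (smul (sinv z) a) z))" by auto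
  then have inj: "inj ?f" using inj_conj by (simp only: prod.inj_map)
  have "{(a, b, c). (a, b) \<in> L \<and> (b, c) \<in> conj1 g P} =
      ?f ` {(a, b, c). (a, b) \<in> conj2 x y L \<and> (b, c) \<in> conj2 (smul y g) z P}" (is "?A = ?f ` ?B")
  proof (intro equalityI subsetI)
    fix t assume t: "t \<in> ?A"
    obtain a b c where abc: "t = (smul (smul (sinv x) a) x, smul (smul (sinv y) b) y, smul (smul (sinv z) c) z)"
    proof -
      obtain a b c where "t = (a, b, c)" by (cases t)
      then show thesis
        by (intro that[of "smul (smul x a) (sinv x)" "smul (smul y b) (sinv y)" "smul (smul z c) (sinv z)"])
           (simp add: smul_assoc)
    qed
    then have "(a, b, c) \<in> ?B"
      using t by (simp add: conj2_def conj1_def sinv_smul smul_assoc)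
    then show "t \<in> ?f ` ?B" by (rule image_eqI[rotated]) (simp add: abc)
  qed (auto simp: conj2_def conj1_def sinv_smul smul_assoc)
  then have "card ?A = card ?B" by (simp only: card_image[OF inj_on_subset[OF inj subset_UNIV]])
  then show ?thesis unfolding triples_def by (rule sym)
qed

theorem mackey:
  assumes "rel_subgroup L" "rel_subgroup P"
  shows "(\<Sum>g\<in>UNIV. int (triples L (conj1 g P)) * coeff (rel_label (L O conj1 g P)) k)
     = int (card L) * int (card P) * cmul (coeff (rel_label L)) (coeff (rel_label P)) k"
proof -
  obtain x y where L: "L = conj2 x y (rel_rep (rel_label L))"
    using subgroup_classification[OF assms(1)] by blast
  obtain x' y' where P: "P = conj2 x' y' (rel_rep (rel_label P))"
    using subgroup_classification[OF assms(2)] by blast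
  define i j where "i = rel_label L" and "j = rel_label P"
  \<comment> \<open>The substitution g \<mapsto> y^{-1} g x' absorbs the conjugations of L and P in
    the inner factors. Those in the outer factors change neither labels nor numbers of
    triples.\<close>
  have "bij (\<lambda>g. smul (sinv y) (smul g x'))"
  proof (rule bij_betw_byWitness[where f' = "\<lambda>g. smul y (smul g (sinv x'))"])
  qed (auto simp: smul_assoc)
  then have "(\<Sum>g\<in>UNIV. int (triples (rel_rep i) (conj1 g (rel_rep j))) * coeff (rel_label (rel_rep i O conj1 g (rel_rep j))) k)
      = (\<Sum>g\<in>UNIV. int (triples (rel_rep i) (conj1 (smul (sinv y) (smul g x')) (rel_rep j))) *
          coeff (rel_label (rel_rep i O conj1 (smul (sinv y) (smul g x')) (rel_rep j))) k)"
    by (intro sum.reindex_bij_betw[symmetric]) (simp add: bij_def bij_betw_def)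
  also have "\<dots> = (\<Sum>g\<in>UNIV. int (triples L (conj1 g P)) * coeff (rel_label (L O conj1 g P)) k)"
  proof (rule sum.cong[OF refl])
    fix g
    have eq: "conj1 g P = conj2 (smul y (smul (sinv y) (smul g x'))) y' (rel_rep j)"
      by (subst P) (simp add: conj1_conj2 j_def)
    have "L O conj1 g P = conj2 x y' (rel_rep i O conj1 (smul (sinv y) (smul g x')) (rel_rep j))"
      unfolding eq by (subst L) (simp only: relcomp_conj2 i_def)
    moreover have "triples L (conj1 g P) = triples (rel_rep i) (conj1 (smul (sinv y) (smul g x')) (rel_rep j))"
      unfolding eq by (subst L) (simp only: triples_conj2 i_def)
    ultimately show "int (triples (rel_rep i) (conj1 (smul (sinv y) (smul g x')) (rel_rep j))) *
          coeff (rel_label (rel_rep i O conj1 (smul (sinv y) (smul g x')) (rel_rep j))) k =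
        int (triples L (conj1 g P)) * coeff (rel_label (L O conj1 g P)) k"
      by (simp add: rel_label_conj2)
  qed
  finally have "(\<Sum>g\<in>UNIV. int (triples L (conj1 g P)) * coeff (rel_label (L O conj1 g P)) k) =
      int (card (rel_rep i)) * int (card (rel_rep j)) * cmul (coeff i) (coeff j) k"
    by (simp add: mackey_rep)
  moreover have "card L = card (rel_rep i)" "card P = card (rel_rep j)"
    using card_conj2 L P by (metis i_def, metis j_def)
  ultimately show ?thesis by (simp add: i_def j_def)
qed


section \<open>Quotients of algebras\<close>

lemma unital_algebra_transport:
  assumes C: "unital_algebra R C" and bij: "bij_betw f (carrier C) (carrier Q)"
    and add: "\<And>x y. \<lbrakk>x \<in> carrier C; y \<in> carrier C\<rbrakk> \<Longrightarrow> f (x \<oplus>\<^bsub>C\<^esub> y) = f x \<oplus>\<^bsub>Q\<^esub> f y"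
    and mult: "\<And>x y. \<lbrakk>x \<in> carrier C; y \<in> carrier C\<rbrakk> \<Longrightarrow> f (x \<otimes>\<^bsub>C\<^esub> y) = f x \<otimes>\<^bsub>Q\<^esub> f y"
    and one: "f \<one>\<^bsub>C\<^esub> = \<one>\<^bsub>Q\<^esub>" and zero: "f \<zero>\<^bsub>C\<^esub> = \<zero>\<^bsub>Q\<^esub>"
    and smult: "\<And>r x. \<lbrakk>r \<in> carrier R; x \<in> carrier C\<rbrakk> \<Longrightarrow> f (r \<odot>\<^bsub>C\<^esub> x) = r \<odot>\<^bsub>Q\<^esub> f x"
  shows "unital_algebra R Q"
proof -
  interpret C: Ring.ring C using C by (simp add: unital_algebra_def)
  interpret M: Module.module R C using C by (simp add: unital_algebra_def)
  have Q: "carrier Q = f ` carrier C" using bij by (simp add: bij_betw_def)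
  note add' = add[symmetric] and mult' = mult[symmetric] and smult' = smult[symmetric]
  have grp: "abelian_group Q"
  proof (rule abelian_groupI)
    fix x assume "x \<in> carrier Q"
    then obtain y where "y \<in> carrier C" "x = f y" by (auto simp: Q)
    then show "\<exists>z\<in>carrier Q. z \<oplus>\<^bsub>Q\<^esub> x = \<zero>\<^bsub>Q\<^esub>"
      by (intro bexI[of _ "f (\<ominus>\<^bsub>C\<^esub> y)"]) (auto simp: Q add' zero[symmetric] C.l_neg)
  qed (auto simp: Q add' zero[symmetric] C.a_assoc intro!: imageI arg_cong[where f = f] C.a_comm)
  have "Ring.ring Q"
    by (rule ringI[OF grp monoidI])
       (auto simp: Q add' mult' one[symmetric] C.m_assoc C.l_distr C.r_distr)
  moreover have "Module.module R Q"
    using grp M.R.cring_axioms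
    by (intro moduleI)
       (auto simp: Q add' smult' M.smult_l_distr M.smult_r_distr M.smult_assoc1)
  ultimately show ?thesis
    using C by (auto simp: unital_algebra_def Q mult' smult')
qed

text \<open>The ring laws of the quotient are carried over from \<open>C\<close> along the fibres of
  \<open>h\<close>. In this way the associativity of the double Burnside algebra comes from
  \<open>cmul_assoc\<close> and not from triple products of bisets.\<close>

locale algebra_quotient = A?: abelian_group A
  for A :: "('r, 'a, 'm) module_scheme" (structure) and C :: "('s, 'b) module"
    and R :: "('s, 'k) ring_scheme" and act :: "'s \<Rightarrow> 'a \<Rightarrow> 'a" and h :: "'a \<Rightarrow> 'b" and I :: "'a set" +
  assumes mult_closed: "\<lbrakk>x \<in> carrier A; y \<in> carrier A\<rbrakk> \<Longrightarrow> x \<otimes>\<^bsub>A\<^esub> y \<in> carrier A"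
    and one_closed: "\<one>\<^bsub>A\<^esub> \<in> carrier A"
    and act_closed: "\<lbrakk>r \<in> carrier R; x \<in> carrier A\<rbrakk> \<Longrightarrow> act r x \<in> carrier A"
    and h_onto: "h ` carrier A = carrier C"
    and h_add: "\<lbrakk>x \<in> carrier A; y \<in> carrier A\<rbrakk> \<Longrightarrow> h (x \<oplus>\<^bsub>A\<^esub> y) = h x \<oplus>\<^bsub>C\<^esub> h y"
    and h_mult: "\<lbrakk>x \<in> carrier A; y \<in> carrier A\<rbrakk> \<Longrightarrow> h (x \<otimes>\<^bsub>A\<^esub> y) = h x \<otimes>\<^bsub>C\<^esub> h y"
    and h_one: "h \<one>\<^bsub>A\<^esub> = \<one>\<^bsub>C\<^esub>"
    and h_act: "\<lbrakk>r \<in> carrier R; x \<in> carrier A\<rbrakk> \<Longrightarrow> h (act r x) = r \<odot>\<^bsub>C\<^esub> h x"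
    and I_eq: "I = {x \<in> carrier A. h x = \<zero>\<^bsub>C\<^esub>}"
    and C: "unital_algebra R C"
begin

abbreviation "Q \<equiv> quotient_algebra act A I"

definition fib :: "'b \<Rightarrow> 'a set" where "fib c = {x \<in> carrier A. h x = c}"

lemma coset_eq: "x \<in> carrier A \<Longrightarrow> I +>\<^bsub>A\<^esub> x = fib (h x)"
proof -
  interpret C: Ring.ring C using C by (simp add: unital_algebra_def)
  assume x: "x \<in> carrier A"
  have hC: "h y \<in> carrier C" if "y \<in> carrier A" for y using that h_onto by blast
  have "y \<in> I +>\<^bsub>A\<^esub> x" if "y \<in> fib (h x)" for y
  proof -
    have y: "y \<in> carrier A" "h y = h x" using that by (auto simp: fib_def)
    have eq: "(y \<ominus>\<^bsub>A\<^esub> x) \<oplus>\<^bsub>A\<^esub> x = y" using x y by (simp add: A.minus_eq A.a_assoc A.l_neg)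
    then have "h (y \<ominus>\<^bsub>A\<^esub> x) \<oplus>\<^bsub>C\<^esub> h x = h x" using x y h_add[of "y \<ominus>\<^bsub>A\<^esub> x" x] by simp
    then have "h (y \<ominus>\<^bsub>A\<^esub> x) = \<zero>\<^bsub>C\<^esub>"
      using x y hC by (simp add: C.add.r_cancel_one')
    then show ?thesis
      using x y eq by (auto simp: a_r_coset_def' I_eq intro!: exI[of _ "y \<ominus>\<^bsub>A\<^esub> x"])
  qed
  moreover have "y \<in> fib (h x)" if "y \<in> I +>\<^bsub>A\<^esub> x" for y
    using that x hC by (auto simp: a_r_coset_def' I_eq fib_def h_add)
  ultimately show ?thesis by blast
qed

lemma quotient_simps:
  "carrier Q = fib ` carrier C"
  "\<one>\<^bsub>Q\<^esub> = fib \<one>\<^bsub>C\<^esub>"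
  "\<zero>\<^bsub>Q\<^esub> = fib \<zero>\<^bsub>C\<^esub>"
  "\<lbrakk>c \<in> carrier C; d \<in> carrier C\<rbrakk> \<Longrightarrow> fib c \<oplus>\<^bsub>Q\<^esub> fib d = fib (c \<oplus>\<^bsub>C\<^esub> d)"
  "\<lbrakk>c \<in> carrier C; d \<in> carrier C\<rbrakk> \<Longrightarrow> fib c \<otimes>\<^bsub>Q\<^esub> fib d = fib (c \<otimes>\<^bsub>C\<^esub> d)"
  "\<lbrakk>r \<in> carrier R; c \<in> carrier C\<rbrakk> \<Longrightarrow> r \<odot>\<^bsub>Q\<^esub> fib c = fib (r \<odot>\<^bsub>C\<^esub> c)"
proof -
  interpret C: Ring.ring C using C by (simp add: unital_algebra_def)
  have "carrier Q = (\<lambda>x. I +>\<^bsub>A\<^esub> x) ` carrier A"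
    by (auto simp: quotient_algebra_def ring.defs module.defs FactRing_def A_RCOSETS_def')
  also have "\<dots> = fib ` h ` carrier A" by (simp add: coset_eq image_image)
  finally show "carrier Q = fib ` carrier C" by (simp add: h_onto)
  show "\<one>\<^bsub>Q\<^esub> = fib \<one>\<^bsub>C\<^esub>"
    by (simp add: quotient_algebra_def ring.defs module.defs FactRing_def coset_eq one_closed h_one)
  show "\<zero>\<^bsub>Q\<^esub> = fib \<zero>\<^bsub>C\<^esub>"
    by (simp add: quotient_algebra_def ring.defs module.defs FactRing_def I_eq fib_def)
  have ex: "\<exists>x\<in>carrier A. h x = c" if "c \<in> carrier C" for c
    using that h_onto by (metis imageE)
  show "fib c \<oplus>\<^bsub>Q\<^esub> fib d = fib (c \<oplus>\<^bsub>C\<^esub> d)" if "c \<in> carrier C" "d \<in> carrier C"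
  proof -
    have Q: "fib c \<oplus>\<^bsub>Q\<^esub> fib d = fib c <+>\<^bsub>A\<^esub> fib d"
      by (simp add: quotient_algebra_def ring.defs module.defs FactRing_def)
    have "z \<in> fib c <+>\<^bsub>A\<^esub> fib d" if z: "z \<in> fib (c \<oplus>\<^bsub>C\<^esub> d)" for z
    proof -
      obtain y where y: "y \<in> carrier A" "h y = d" using ex \<open>d \<in> carrier C\<close> by blast
      have zA: "z \<in> carrier A" "h z = c \<oplus>\<^bsub>C\<^esub> d" using z by (auto simp: fib_def)
      have eq: "(z \<ominus>\<^bsub>A\<^esub> y) \<oplus>\<^bsub>A\<^esub> y = z" using zA y by (simp add: A.minus_eq A.a_assoc A.l_neg)
      then have "h (z \<ominus>\<^bsub>A\<^esub> y) \<oplus>\<^bsub>C\<^esub> d = c \<oplus>\<^bsub>C\<^esub> d"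
        using zA y h_add[of "z \<ominus>\<^bsub>A\<^esub> y" y] by simp
      then have "h (z \<ominus>\<^bsub>A\<^esub> y) = c"
        using zA y that \<open>c \<in> carrier C\<close> \<open>d \<in> carrier C\<close> h_onto C.add.right_cancel
        by (metis A.minus_closed image_eqI)
      then have "z \<ominus>\<^bsub>A\<^esub> y \<in> fib c" "y \<in> fib d" using zA y by (simp_all add: fib_def)
      then have "(z \<ominus>\<^bsub>A\<^esub> y) \<oplus>\<^bsub>A\<^esub> y \<in> fib c <+>\<^bsub>A\<^esub> fib d" unfolding set_add_def' by blast
      with eq show ?thesis by simp
    qed
    then show ?thesis unfolding Q by (auto simp: set_add_def' fib_def h_add)
  qed
  show "fib c \<otimes>\<^bsub>Q\<^esub> fib d = fib (c \<otimes>\<^bsub>C\<^esub> d)" if "c \<in> carrier C" "d \<in> carrier C"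
  proof -
    have "fib c \<otimes>\<^bsub>Q\<^esub> fib d = (\<Union>a\<in>fib c. \<Union>b\<in>fib d. fib (h (a \<otimes>\<^bsub>A\<^esub> b)))"
      by (simp add: quotient_algebra_def ring.defs module.defs FactRing_def rcoset_mult_def fib_def
          coset_eq mult_closed)
    also have "\<dots> = (\<Union>a\<in>fib c. \<Union>b\<in>fib d. fib (c \<otimes>\<^bsub>C\<^esub> d))"
      by (simp add: fib_def h_mult)
    \<comment> \<open>All members of the union are the same fibre, and both index sets are nonempty
      because \<open>h\<close> is onto.\<close>
    also have "\<dots> = fib (c \<otimes>\<^bsub>C\<^esub> d)"
      using ex[OF that(1)] ex[OF that(2)] by (auto simp: fib_def)
    finally show ?thesis .
  qed
  show "r \<odot>\<^bsub>Q\<^esub> fib c = fib (r \<odot>\<^bsub>C\<^esub> c)" if "r \<in> carrier R" "c \<in> carrier C"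
  proof -
    have "r \<odot>\<^bsub>Q\<^esub> fib c = (\<Union>x\<in>fib c. I +>\<^bsub>A\<^esub> (act r x))"
      by (simp add: quotient_algebra_def ring.defs module.defs)
    also have "\<dots> = (\<Union>x\<in>fib c. fib (r \<odot>\<^bsub>C\<^esub> c))"
      using that by (simp add: fib_def coset_eq act_closed h_act)
    also have "\<dots> = fib (r \<odot>\<^bsub>C\<^esub> c)" using ex[OF that(2)] by (auto simp: fib_def)
    finally show ?thesis .
  qed
qed

lemma fib_bij: "bij_betw fib (carrier C) (carrier Q)"
proof (rule bij_betw_imageI)
  show "inj_on fib (carrier C)"
  proof (rule inj_onI)
    fix c d assume c: "c \<in> carrier C" and "fib c = fib d"
    moreover obtain x where "x \<in> carrier A" "h x = c" using c h_onto by (metis imageE)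
    ultimately show "c = d" by (auto simp: fib_def set_eq_iff)
  qed
qed (simp add: quotient_simps)

lemma unital_algebra_quotient: "unital_algebra R Q"
  by (rule unital_algebra_transport[OF C fib_bij]) (simp_all add: quotient_simps)

end

lemma isomorphic_algebras_quotients:
  assumes "algebra_quotient A C R act h I" "algebra_quotient A' C R act' h' I'"
  shows "isomorphic_algebras R (quotient_algebra act A I) (quotient_algebra act' A' I')"
proof -
  interpret Q1: algebra_quotient A C R act h I by fact
  interpret Q2: algebra_quotient A' C R act' h' I' by fact
  interpret C: Ring.ring C using Q1.C by (simp add: unital_algebra_def)
  interpret M: Module.module R C using Q1.C by (simp add: unital_algebra_def)
  let ?f = "inv_into (carrier C) Q1.fib"
  have f: "?f (Q1.fib c) = c" if "c \<in> carrier C" for c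
    using Q1.fib_bij that by (simp add: bij_betw_def)
  have "Q2.fib \<circ> ?f \<in> ring_iso Q1.Q Q2.Q"
    using bij_betw_trans[OF bij_betw_inv_into[OF Q1.fib_bij] Q2.fib_bij] bij_betwE[OF Q2.fib_bij]
    by (auto simp: ring_iso_def ring_hom_def Q1.quotient_simps f Q2.quotient_simps)
  moreover have "\<forall>r\<in>carrier R. \<forall>x\<in>carrier Q1.Q.
      (Q2.fib \<circ> ?f) (r \<odot>\<^bsub>Q1.Q\<^esub> x) = r \<odot>\<^bsub>Q2.Q\<^esub> (Q2.fib \<circ> ?f) x"
    by (auto simp: Q1.quotient_simps f Q2.quotient_simps)
  ultimately show ?thesis
    unfolding isomorphic_algebras_def
    using Q1.unital_algebra_quotient Q2.unital_algebra_quotient by blast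
qed


section \<open>The coordinate algebra over the field with three elements\<close>

lemma of_int_3_eq_iff: "(of_int x :: 3) = of_int y \<longleftrightarrow> x mod 3 = y mod 3"
  by (simp add: of_int_eq_iff_cong_CHAR cong_def)

lemma of_int_mod_3 [simp]: "(of_int (x mod 3) :: 3) = of_int x"
  by (simp add: of_int_3_eq_iff)

lemma of_int_3_surj: "\<exists>r. 0 \<le> r \<and> r < 3 \<and> (of_int r :: 3) = x"
  by (cases x) auto

lemma F3_simps [simp]:
  "carrier F3 = {0..2}" "\<one>\<^bsub>F3\<^esub> = 1" "\<zero>\<^bsub>F3\<^esub> = 0"
  "x \<otimes>\<^bsub>F3\<^esub> y = (x * y) mod 3" "x \<oplus>\<^bsub>F3\<^esub> y = (x + y) mod 3"
  by (simp_all add: residue_ring_def)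

lemma residues_F3: "residues 3"
  by (simp add: residues_def)

text \<open>Entries are taken from the type \<open>3\<close>, whose arithmetic is that of a ring
  class; scalars remain integers, as in \<open>residue_ring 3\<close>, and act through
  \<open>of_int\<close>.\<close>

definition coord_algebra :: "coord set \<Rightarrow> (int, coord \<Rightarrow> 3) module" where
  "coord_algebra J =
     \<lparr> carrier = {x. \<forall>k. k \<notin> J \<longrightarrow> x k = 0}, monoid.mult = cmul,
       one = (\<lambda>k. if k \<in> J then cone k else 0), zero = (\<lambda>k. 0), add = (\<lambda>x y k. x k + y k),
       smult = (\<lambda>r x k. of_int r * x k) \<rparr>"

text \<open>The entries that can be nonzero in an array of \<open>\<Lambda>'\<^sub>(\<^sub>3\<^sub>)\<close>.\<close>

definition corner_coords :: "coord set" where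
  "corner_coords = {cS I2 I2, cT I2, cX I2, cU, cV, cW, cY, cZ1, cZ2, cZ3}"

lemma abelian_group_coord: "abelian_group (coord_algebra J)"
proof (rule abelian_groupI)
  fix x assume "x \<in> carrier (coord_algebra J)"
  then show "\<exists>y\<in>carrier (coord_algebra J). y \<oplus>\<^bsub>coord_algebra J\<^esub> x = \<zero>\<^bsub>coord_algebra J\<^esub>"
    by (intro bexI[of _ "\<lambda>k. - x k"]) (auto simp: coord_algebra_def)
qed (auto simp: coord_algebra_def fun_eq_iff)

lemma unital_algebra_coordI:
  assumes "\<And>x y. \<lbrakk>x \<in> carrier (coord_algebra J); y \<in> carrier (coord_algebra J)\<rbrakk> \<Longrightarrow>
      cmul x y \<in> carrier (coord_algebra J)"
    and "\<And>x. x \<in> carrier (coord_algebra J) \<Longrightarrow> cmul \<one>\<^bsub>coord_algebra J\<^esub> x = x"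
    and "\<And>x. x \<in> carrier (coord_algebra J) \<Longrightarrow> cmul x \<one>\<^bsub>coord_algebra J\<^esub> = x"
  shows "unital_algebra F3 (coord_algebra J)"
proof -
  interpret residues 3 F3 by (rule residues_F3, simp)
  let ?C = "coord_algebra J"
  have "Ring.ring ?C"
  proof (rule ringI[OF abelian_group_coord monoidI])
    fix x y z assume "x \<in> carrier ?C" "y \<in> carrier ?C" "z \<in> carrier ?C"
    show "(x \<oplus>\<^bsub>?C\<^esub> y) \<otimes>\<^bsub>?C\<^esub> z = x \<otimes>\<^bsub>?C\<^esub> z \<oplus>\<^bsub>?C\<^esub> y \<otimes>\<^bsub>?C\<^esub> z"
      "z \<otimes>\<^bsub>?C\<^esub> (x \<oplus>\<^bsub>?C\<^esub> y) = z \<otimes>\<^bsub>?C\<^esub> x \<oplus>\<^bsub>?C\<^esub> z \<otimes>\<^bsub>?C\<^esub> y"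
      "x \<otimes>\<^bsub>?C\<^esub> y \<otimes>\<^bsub>?C\<^esub> z = x \<otimes>\<^bsub>?C\<^esub> (y \<otimes>\<^bsub>?C\<^esub> z)"
      by (simp_all add: coord_algebra_def cmul_distrib cmul_assoc)
  qed (use assms in \<open>simp_all add: coord_algebra_def\<close>)
  moreover have "Module.module F3 ?C"
    by (rule moduleI[OF cring abelian_group_coord])
       (auto simp: coord_algebra_def algebra_simps fun_eq_iff)
  ultimately show ?thesis
    by (auto simp: unital_algebra_def coord_algebra_def cmul_scale)
qed

lemma unital_algebra_coord: "unital_algebra F3 (coord_algebra UNIV)"
  by (rule unital_algebra_coordI) (simp_all add: coord_algebra_def cmul_cone)

lemma corner_coords_iff:
  "(\<forall>k. k \<notin> corner_coords \<longrightarrow> x k = 0) \<longleftrightarrow>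
     x (cS I0 I0) = 0 \<and> x (cS I0 I1) = 0 \<and> x (cS I0 I2) = 0 \<and> x (cS I1 I0) = 0 \<and> x (cS I1 I1) = 0 \<and>
     x (cS I1 I2) = 0 \<and> x (cS I2 I0) = 0 \<and> x (cS I2 I1) = 0 \<and> x (cT I0) = 0 \<and> x (cT I1) = 0 \<and>
     x (cX I0) = 0 \<and> x (cX I1) = 0" (is "_ = ?R")
proof
  assume R: ?R
  have "k \<notin> corner_coords \<longrightarrow> x k = 0" for k
  proof (cases k)
    case (cS i j) with R show ?thesis by (cases i; cases j) (simp_all add: corner_coords_def)
  next
    case (cT i) with R show ?thesis by (cases i) (simp_all add: corner_coords_def)
  next
    case (cX i) with R show ?thesis by (cases i) (simp_all add: corner_coords_def)
  qed (simp_all add: corner_coords_def)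
  then show "\<forall>k. k \<notin> corner_coords \<longrightarrow> x k = 0" by blast
qed (simp add: corner_coords_def)

lemma coord_eq_iff:
  "x = y \<longleftrightarrow> x (cS I0 I0) = y (cS I0 I0) \<and> x (cS I0 I1) = y (cS I0 I1) \<and> x (cS I0 I2) = y (cS I0 I2) \<and>
     x (cS I1 I0) = y (cS I1 I0) \<and> x (cS I1 I1) = y (cS I1 I1) \<and> x (cS I1 I2) = y (cS I1 I2) \<and>
     x (cS I2 I0) = y (cS I2 I0) \<and> x (cS I2 I1) = y (cS I2 I1) \<and> x (cS I2 I2) = y (cS I2 I2) \<and>
     x (cT I0) = y (cT I0) \<and> x (cT I1) = y (cT I1) \<and> x (cT I2) = y (cT I2) \<and>
     x (cX I0) = y (cX I0) \<and> x (cX I1) = y (cX I1) \<and> x (cX I2) = y (cX I2) \<and>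
     x cU = y cU \<and> x cV = y cV \<and> x cW = y cW \<and> x cY = y cY \<and> x cZ1 = y cZ1 \<and> x cZ2 = y cZ2 \<and>
     x cZ3 = y cZ3" (is "_ = ?R")
proof
  assume R: ?R
  show "x = y"
  proof
    fix k
    show "x k = y k"
    proof (cases k)
      case (cS i j) with R show ?thesis by (cases i; cases j) simp_all
    next
      case (cT i) with R show ?thesis by (cases i) simp_all
    next
      case (cX i) with R show ?thesis by (cases i) simp_all
    qed (use R in simp_all)
  qed
qed simp

lemma unital_algebra_corner_coord: "unital_algebra F3 (coord_algebra corner_coords)"
proof (rule unital_algebra_coordI)
  fix x y :: "coord \<Rightarrow> 3"
  assume x: "x \<in> carrier (coord_algebra corner_coords)" and y: "y \<in> carrier (coord_algebra corner_coords)"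
  show "cmul x y \<in> carrier (coord_algebra corner_coords)"
    using x y by (simp add: coord_algebra_def corner_coords_iff tsum_def)
  show "cmul \<one>\<^bsub>coord_algebra corner_coords\<^esub> x = x" "cmul x \<one>\<^bsub>coord_algebra corner_coords\<^esub> = x"
    using x by (simp_all add: coord_algebra_def corner_coords_iff coord_eq_iff tsum_def)
      (simp_all add: corner_coords_def)
qed


section \<open>Algebras with a multiplicative basis\<close>

text \<open>The linear extension of \<phi>, evaluated at f. Equations in a basis algebra are proved
  by applying all such functionals, under which the reductions modulo 3 in its operations
  disappear.\<close>

definition val :: "('s \<Rightarrow> int) \<Rightarrow> ('s \<Rightarrow> 3) \<Rightarrow> 3" where
  "val f \<phi> = (\<Sum>s | f s \<noteq> 0. of_int (f s) * \<phi> s)"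

definition opt :: "('s \<Rightarrow> 3) \<Rightarrow> 's option \<Rightarrow> 3" where
  "opt \<phi> = case_option 0 \<phi>"

lemma opt_simps [simp]: "opt \<phi> None = 0" "opt \<phi> (Some s) = \<phi> s"
  by (simp_all add: opt_def)

lemma val_superset: "\<lbrakk>finite T; {s. f s \<noteq> 0} \<subseteq> T\<rbrakk> \<Longrightarrow> val f \<phi> = (\<Sum>s\<in>T. of_int (f s) * \<phi> s)"
  unfolding val_def by (rule sum.mono_neutral_left) auto

lemma val_linear:
  "val f (\<lambda>s. \<phi> s + \<psi> s) = val f \<phi> + val f \<psi>"
  "val f (\<lambda>s. r * \<phi> s) = r * val f \<phi>"
  "val f (\<lambda>s. 0) = 0"
  "val f (\<lambda>s. \<Sum>i\<in>I. \<theta> i s) = (\<Sum>i\<in>I. val f (\<theta> i))"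
proof -
  show "val f (\<lambda>s. \<Sum>i\<in>I. \<theta> i s) = (\<Sum>i\<in>I. val f (\<theta> i))"
    by (simp add: val_def sum_distrib_left sum.swap[of _ I])
qed (simp_all add: val_def sum.distrib sum_distrib_left algebra_simps)

lemma val_cong: "(\<And>s. f s \<noteq> 0 \<Longrightarrow> \<phi> s = \<psi> s) \<Longrightarrow> val f \<phi> = val f \<psi>"
  by (simp add: val_def)

lemma cmul_val:
  "cmul (\<lambda>k. val f (\<lambda>s. \<Phi> s k)) (\<lambda>k. val g (\<lambda>s. \<Psi> s k)) k =
     val f (\<lambda>s. val g (\<lambda>t. cmul (\<Phi> s) (\<Psi> t) k))"
  unfolding val_def by (simp add: cmul_sum cmul_scale sum_distrib_left)

context
  fixes S :: "'s set" and mul :: "'s \<Rightarrow> 's \<Rightarrow> 's option" and E :: "'s set"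
begin

abbreviation (input) "BA \<equiv> basis_algebra F3 S mul E"

lemma basis_carrier_iff:
  "f \<in> carrier BA \<longleftrightarrow> (\<forall>s. 0 \<le> f s \<and> f s < 3) \<and> {s. f s \<noteq> 0} \<subseteq> S \<and> finite {s. f s \<noteq> 0}"
proof -
  have "x \<le> 2 \<longleftrightarrow> x < 3" for x :: int by auto
  then show ?thesis by (auto simp: basis_algebra_def)
qed

lemma basis_add: "(f \<oplus>\<^bsub>BA\<^esub> g) s = (f s + g s) mod 3"
  by (simp add: basis_algebra_def)

lemma basis_zero: "\<zero>\<^bsub>BA\<^esub> = (\<lambda>s. 0)"
  by (simp add: basis_algebra_def)

lemma basis_one: "\<one>\<^bsub>BA\<^esub> = (\<lambda>s. if s \<in> E then 1 else 0)"
  by (simp add: basis_algebra_def cong: if_cong)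

lemma basis_smult: "(r \<odot>\<^bsub>BA\<^esub> f) s = (r * f s) mod 3"
  by (simp add: basis_algebra_def)

lemma basis_mult:
  assumes "finite {s. f s \<noteq> 0}" "finite {s. g s \<noteq> 0}"
  shows "(f \<otimes>\<^bsub>BA\<^esub> g) s =
    (\<Sum>(a, b) | f a \<noteq> 0 \<and> g b \<noteq> 0 \<and> mul a b = Some s. f a * g b) mod 3"
proof -
  interpret residues 3 F3 by (rule residues_F3, simp)
  have "finite {(a, b). f a \<noteq> 0 \<and> g b \<noteq> 0 \<and> mul a b = Some s}"
    by (rule finite_subset[OF _ finite_cartesian_product[OF assms]]) auto
  from sum_cong[OF this, of "\<lambda>(a, b). f a * g b"] show ?thesis
    by (simp add: basis_algebra_def case_prod_unfold)
qed

lemma val_add: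
  assumes "finite {s. f s \<noteq> 0}" "finite {s. g s \<noteq> 0}"
  shows "val (f \<oplus>\<^bsub>BA\<^esub> g) \<phi> = val f \<phi> + val g \<phi>"
proof -
  let ?T = "{s. f s \<noteq> 0} \<union> {s. g s \<noteq> 0}"
  have "finite ?T" using assms by simp
  moreover have "{s. (f \<oplus>\<^bsub>BA\<^esub> g) s \<noteq> 0} \<subseteq> ?T" by (auto simp: basis_add)
  ultimately show ?thesis
    by (simp add: val_superset[of ?T] basis_add sum.distrib algebra_simps)
qed

lemma val_smult:
  assumes "finite {s. f s \<noteq> 0}"
  shows "val (r \<odot>\<^bsub>BA\<^esub> f) \<phi> = of_int r * val f \<phi>"
proof -
  have "{s. (r \<odot>\<^bsub>BA\<^esub> f) s \<noteq> 0} \<subseteq> {s. f s \<noteq> 0}" by (auto simp: basis_smult)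
  with assms show ?thesis
    by (simp add: val_superset[OF assms] basis_smult sum_distrib_left algebra_simps)
qed

lemma val_mult:
  assumes f: "finite {s. f s \<noteq> 0}" and g: "finite {s. g s \<noteq> 0}"
  shows "val (f \<otimes>\<^bsub>BA\<^esub> g) \<phi> = val f (\<lambda>a. val g (\<lambda>b. opt \<phi> (mul a b)))"
    and "finite {s. (f \<otimes>\<^bsub>BA\<^esub> g) s \<noteq> 0}"
    and "{s. (f \<otimes>\<^bsub>BA\<^esub> g) s \<noteq> 0} \<subseteq> {s. \<exists>a b. f a \<noteq> 0 \<and> g b \<noteq> 0 \<and> mul a b = Some s}"
proof -
  define P where "P = {a. f a \<noteq> 0} \<times> {b. g b \<noteq> 0}"
  \<comment> \<open>Pairs without a product are sent to an arbitrary value of \<open>the\<close>.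
    This only enlarges the finite set \<open>T\<close>, over which \<open>val\<close> may be summed
    all the same.\<close>
  define T where "T = (\<lambda>(a, b). the (mul a b)) ` P"
  have fin: "finite P" "finite T" using f g by (simp_all add: P_def T_def)
  have mult: "(f \<otimes>\<^bsub>BA\<^esub> g) s = (\<Sum>(a, b)\<in>{p \<in> P. case p of (a, b) \<Rightarrow> mul a b = Some s}. f a * g b) mod 3" for s
    unfolding basis_mult[OF f g] by (intro arg_cong[where f = "\<lambda>x. x mod 3"] sum.cong) (auto simp: P_def)
  show sub: "{s. (f \<otimes>\<^bsub>BA\<^esub> g) s \<noteq> 0} \<subseteq> {s. \<exists>a b. f a \<noteq> 0 \<and> g b \<noteq> 0 \<and> mul a b = Some s}"
  proof (rule subsetI, rule ccontr)
    fix s assume s: "s \<in> {s. (f \<otimes>\<^bsub>BA\<^esub> g) s \<noteq> 0}"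
      and "s \<notin> {s. \<exists>a b. f a \<noteq> 0 \<and> g b \<noteq> 0 \<and> mul a b = Some s}"
    then have empty: "{p \<in> P. case p of (a, b) \<Rightarrow> mul a b = Some s} = {}" by (auto simp: P_def)
    have "(f \<otimes>\<^bsub>BA\<^esub> g) s = 0" unfolding mult empty by simp
    with s show False by simp
  qed
  have "{s. \<exists>a b. f a \<noteq> 0 \<and> g b \<noteq> 0 \<and> mul a b = Some s} \<subseteq> T" by (force simp: T_def P_def)
  with sub have sub': "{s. (f \<otimes>\<^bsub>BA\<^esub> g) s \<noteq> 0} \<subseteq> T" by blast
  with fin show "finite {s. (f \<otimes>\<^bsub>BA\<^esub> g) s \<noteq> 0}" by (blast intro: finite_subset)
  let ?w = "\<lambda>p. (of_int (f (fst p)) * of_int (g (snd p)) :: 3)"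
  have "val (f \<otimes>\<^bsub>BA\<^esub> g) \<phi> =
      (\<Sum>s\<in>T. (\<Sum>p\<in>P. if (case p of (a, b) \<Rightarrow> mul a b = Some s) then ?w p else 0) * \<phi> s)"
    unfolding val_superset[OF fin(2) sub'] mult using fin
    by (simp add: sum.inter_filter case_prod_unfold if_distrib[of "of_int :: int \<Rightarrow> 3"] cong: if_cong)
  also have "\<dots> = (\<Sum>p\<in>P. \<Sum>s\<in>T. if (case p of (a, b) \<Rightarrow> mul a b = Some s) then ?w p * \<phi> s else 0)"
    unfolding sum_distrib_right by (subst sum.swap) (intro sum.cong refl, auto)
  also have "\<dots> = (\<Sum>p\<in>P. ?w p * opt \<phi> (case p of (a, b) \<Rightarrow> mul a b))"
  proof (rule sum.cong[OF refl])
    fix p assume p: "p \<in> P"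
    show "(\<Sum>s\<in>T. if (case p of (a, b) \<Rightarrow> mul a b = Some s) then ?w p * \<phi> s else 0) =
        ?w p * opt \<phi> (case p of (a, b) \<Rightarrow> mul a b)"
    proof (cases "case p of (a, b) \<Rightarrow> mul a b")
      case None then show ?thesis by (simp add: case_prod_unfold)
    next
      case (Some t)
      then have "t \<in> T" using p by (force simp: T_def case_prod_unfold)
      with Some fin show ?thesis by (simp add: case_prod_unfold)
    qed
  qed
  also have "\<dots> = val f (\<lambda>a. val g (\<lambda>b. opt \<phi> (mul a b)))"
    unfolding val_def P_def
    by (simp add: sum.cartesian_product case_prod_unfold sum_distrib_left algebra_simps)
  finally show "val (f \<otimes>\<^bsub>BA\<^esub> g) \<phi> = val f (\<lambda>a. val g (\<lambda>b. opt \<phi> (mul a b)))" .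
qed

lemma val_indicator: "finite {s. f s \<noteq> 0} \<Longrightarrow> val f (\<lambda>s. if s = t then 1 else 0) = of_int (f t)"
  by (simp add: val_def if_distrib[of "\<lambda>x. _ * x"] cong: if_cong)

text \<open>Indicator functions read off the coefficients modulo 3, and in the carrier all
  coefficients are reduced.\<close>

lemma basis_eqI:
  assumes "f \<in> carrier BA" "g \<in> carrier BA" "\<And>\<phi>. val f \<phi> = val g \<phi>"
  shows "f = g"
proof
  fix t
  have "(of_int (f t) :: 3) = of_int (g t)"
    using assms by (metis basis_carrier_iff val_indicator)
  then show "f t = g t"
    using assms(1,2) by (simp add: of_int_3_eq_iff basis_carrier_iff)
qed

lemma basis_finite: "f \<in> carrier BA \<Longrightarrow> finite {s. f s \<noteq> 0}"
  by (simp add: basis_carrier_iff)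

lemma basis_add_closed: "\<lbrakk>f \<in> carrier BA; g \<in> carrier BA\<rbrakk> \<Longrightarrow> f \<oplus>\<^bsub>BA\<^esub> g \<in> carrier BA"
proof -
  assume *: "f \<in> carrier BA" "g \<in> carrier BA"
  have "{s. (f \<oplus>\<^bsub>BA\<^esub> g) s \<noteq> 0} \<subseteq> {s. f s \<noteq> 0} \<union> {s. g s \<noteq> 0}" by (auto simp: basis_add)
  moreover have "finite ({s. f s \<noteq> 0} \<union> {s. g s \<noteq> 0})" "{s. f s \<noteq> 0} \<union> {s. g s \<noteq> 0} \<subseteq> S"
    using * by (auto simp: basis_carrier_iff)
  ultimately have "finite {s. (f \<oplus>\<^bsub>BA\<^esub> g) s \<noteq> 0}" "{s. (f \<oplus>\<^bsub>BA\<^esub> g) s \<noteq> 0} \<subseteq> S"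
    by (blast intro: finite_subset)+
  then show ?thesis by (simp add: basis_carrier_iff basis_add)
qed

lemma basis_smult_closed: "f \<in> carrier BA \<Longrightarrow> r \<odot>\<^bsub>BA\<^esub> f \<in> carrier BA"
proof -
  assume *: "f \<in> carrier BA"
  have "{s. (r \<odot>\<^bsub>BA\<^esub> f) s \<noteq> 0} \<subseteq> {s. f s \<noteq> 0}" by (auto simp: basis_smult)
  moreover have "finite {s. f s \<noteq> 0}" "{s. f s \<noteq> 0} \<subseteq> S"
    using * by (simp_all add: basis_carrier_iff)
  ultimately have "finite {s. (r \<odot>\<^bsub>BA\<^esub> f) s \<noteq> 0}" "{s. (r \<odot>\<^bsub>BA\<^esub> f) s \<noteq> 0} \<subseteq> S"
    by (blast intro: finite_subset)+
  then show ?thesis by (simp add: basis_carrier_iff basis_smult)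
qed

lemma module_basis: "Module.module F3 BA"
proof -
  interpret residues 3 F3 by (rule residues_F3, simp)
  note fin = basis_finite basis_add_closed basis_smult_closed
  have "abelian_group BA"
  proof (rule abelian_groupI)
    fix f assume f: "f \<in> carrier BA"
    \<comment> \<open>The scalar -1 is not a reduced residue, but the multiple is reduced again by
      the definition of the action.\<close>
    let ?g = "(-1) \<odot>\<^bsub>BA\<^esub> f"
    have "?g \<oplus>\<^bsub>BA\<^esub> f = \<zero>\<^bsub>BA\<^esub>"
      by (simp add: fun_eq_iff basis_add basis_smult basis_zero mod_simps)
    with f show "\<exists>g\<in>carrier BA. g \<oplus>\<^bsub>BA\<^esub> f = \<zero>\<^bsub>BA\<^esub>" by (blast intro: basis_smult_closed)
  next
    fix f assume "f \<in> carrier BA"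
    then show "\<zero>\<^bsub>BA\<^esub> \<oplus>\<^bsub>BA\<^esub> f = f"
      by (simp add: fun_eq_iff basis_add basis_zero basis_carrier_iff)
  qed (simp_all add: basis_add_closed fun_eq_iff basis_add mod_simps add_ac,
       simp add: basis_carrier_iff basis_zero)
  then show ?thesis
  proof (rule moduleI[OF cring])
    fix f assume "f \<in> carrier BA"
    then show "\<one>\<^bsub>F3\<^esub> \<odot>\<^bsub>BA\<^esub> f = f"
      by (simp add: fun_eq_iff basis_smult basis_carrier_iff)
  qed (simp_all add: basis_smult_closed,
       simp_all add: fun_eq_iff basis_add basis_smult mod_simps algebra_simps)
qed

lemma basis_mult_closed:
  assumes "\<And>a b s. \<lbrakk>a \<in> S; b \<in> S; mul a b = Some s\<rbrakk> \<Longrightarrow> s \<in> S"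
    and "f \<in> carrier BA" "g \<in> carrier BA"
  shows "f \<otimes>\<^bsub>BA\<^esub> g \<in> carrier BA"
proof -
  note fin = basis_finite[OF assms(2)] basis_finite[OF assms(3)]
  have "{s. f s \<noteq> 0} \<subseteq> S" "{s. g s \<noteq> 0} \<subseteq> S"
    using assms(2,3) by (simp_all add: basis_carrier_iff)
  with val_mult(3)[OF fin] assms(1) have "{s. (f \<otimes>\<^bsub>BA\<^esub> g) s \<noteq> 0} \<subseteq> S" by blast
  moreover have "0 \<le> (f \<otimes>\<^bsub>BA\<^esub> g) s \<and> (f \<otimes>\<^bsub>BA\<^esub> g) s < 3" for s
    by (simp add: basis_mult[OF fin])
  ultimately show ?thesis
    using val_mult(2)[OF fin] unfolding basis_carrier_iff by blast
qed

lemma val_one: "finite E \<Longrightarrow> val \<one>\<^bsub>BA\<^esub> \<phi> = (\<Sum>s\<in>E. \<phi> s)"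
  by (simp add: val_superset[of E] basis_one)

lemma ring_basis:
  assumes closed: "\<And>a b s. \<lbrakk>a \<in> S; b \<in> S; mul a b = Some s\<rbrakk> \<Longrightarrow> s \<in> S"
    and assoc: "\<And>a b c. Option.bind (mul a b) (\<lambda>s. mul s c) = Option.bind (mul b c) (\<lambda>t. mul a t)"
    and E: "finite E" "E \<subseteq> S"
    and unit: "\<And>\<phi> b. b \<in> S \<Longrightarrow> (\<Sum>a\<in>E. opt \<phi> (mul a b)) = \<phi> b" "\<And>\<phi> b. b \<in> S \<Longrightarrow> (\<Sum>a\<in>E. opt \<phi> (mul b a)) = \<phi> b"
  shows "Ring.ring BA"
proof -
  interpret Module.module F3 BA by (rule module_basis)
  note mult_closed = basis_mult_closed[OF closed]
  have one: "\<one>\<^bsub>BA\<^esub> \<in> carrier BA"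
    using E by (auto simp: basis_carrier_iff basis_one intro: finite_subset)
  note vals = val_mult(1) val_add basis_finite mult_closed M.a_closed val_one[OF E(1)]
  show ?thesis
  proof (rule ringI[OF M.abelian_group_axioms monoidI])
    fix f g h assume f: "f \<in> carrier BA" and g: "g \<in> carrier BA" and h: "h \<in> carrier BA"
    show "f \<otimes>\<^bsub>BA\<^esub> g \<otimes>\<^bsub>BA\<^esub> h = f \<otimes>\<^bsub>BA\<^esub> (g \<otimes>\<^bsub>BA\<^esub> h)"
    proof (rule basis_eqI)
      fix \<phi>
      have "opt (\<lambda>a. val h (\<lambda>c. opt \<phi> (mul a c))) (mul a b) =
          val h (\<lambda>c. opt (\<lambda>t. opt \<phi> (mul a t)) (mul b c))" for a b
      proof -
        have "opt (\<lambda>a. val h (\<lambda>c. opt \<phi> (mul a c))) (mul a b) =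
            val h (\<lambda>c. opt \<phi> (Option.bind (mul a b) (\<lambda>s. mul s c)))"
          by (cases "mul a b") (simp_all add: val_linear)
        also have "\<dots> = val h (\<lambda>c. opt (\<lambda>t. opt \<phi> (mul a t)) (mul b c))"
        proof (rule val_cong)
          fix c show "opt \<phi> (Option.bind (mul a b) (\<lambda>s. mul s c)) = opt (\<lambda>t. opt \<phi> (mul a t)) (mul b c)"
            unfolding assoc by (cases "mul b c") simp_all
        qed
        finally show ?thesis .
      qed
      then show "val (f \<otimes>\<^bsub>BA\<^esub> g \<otimes>\<^bsub>BA\<^esub> h) \<phi> = val (f \<otimes>\<^bsub>BA\<^esub> (g \<otimes>\<^bsub>BA\<^esub> h)) \<phi>"
        using f g h by (simp add: vals)
    qed (use f g h in \<open>simp_all add: mult_closed\<close>)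
    show "(f \<oplus>\<^bsub>BA\<^esub> g) \<otimes>\<^bsub>BA\<^esub> h = f \<otimes>\<^bsub>BA\<^esub> h \<oplus>\<^bsub>BA\<^esub> g \<otimes>\<^bsub>BA\<^esub> h"
      "h \<otimes>\<^bsub>BA\<^esub> (f \<oplus>\<^bsub>BA\<^esub> g) = h \<otimes>\<^bsub>BA\<^esub> f \<oplus>\<^bsub>BA\<^esub> h \<otimes>\<^bsub>BA\<^esub> g"
      using f g h by (auto intro!: basis_eqI simp: vals val_linear)
  next
    fix f assume f: "f \<in> carrier BA"
    have "val f (\<lambda>b. \<Sum>a\<in>E. opt \<phi> (mul a b)) = val f \<phi>" "val f (\<lambda>b. \<Sum>a\<in>E. opt \<phi> (mul b a)) = val f \<phi>" for \<phi>
      using f by (auto intro!: val_cong simp: unit basis_carrier_iff)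
    with f one show "\<one>\<^bsub>BA\<^esub> \<otimes>\<^bsub>BA\<^esub> f = f" "f \<otimes>\<^bsub>BA\<^esub> \<one>\<^bsub>BA\<^esub> = f"
      by (auto intro!: basis_eqI simp: vals val_linear)
  qed (simp_all add: mult_closed one)
qed

end


section \<open>The path algebra\<close>

lemma basis_elt_eq: "basis_elt F3 s = (\<lambda>t. if t = s then 1 else 0)"
  by (simp add: basis_elt_def cong: if_cong)

lemma basis_elt_carrier: "s \<in> S \<Longrightarrow> basis_elt F3 s \<in> carrier (basis_algebra F3 S mul E)"
  by (simp add: basis_carrier_iff basis_elt_eq)

lemma val_basis_elt: "val (basis_elt F3 s) \<phi> = \<phi> s"
  by (simp add: val_superset[of "{s}"] basis_elt_eq)

lemma finite_basis_elt: "finite {t. basis_elt F3 s t \<noteq> 0}"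
  by (simp add: basis_elt_eq)

lemma basis_elt_mult:
  assumes "mul s t = Some r"
  shows "basis_elt F3 s \<otimes>\<^bsub>basis_algebra F3 S mul E\<^esub> basis_elt F3 t = basis_elt F3 r"
proof
  fix q
  have "{(a, b). basis_elt F3 s a \<noteq> 0 \<and> basis_elt F3 t b \<noteq> 0 \<and> mul a b = Some q} =
      (if q = r then {(s, t)} else {})"
    using assms by (auto simp: basis_elt_eq split: if_splits)
  then show "(basis_elt F3 s \<otimes>\<^bsub>basis_algebra F3 S mul E\<^esub> basis_elt F3 t) q = basis_elt F3 r q"
    by (simp add: basis_mult[OF finite_basis_elt finite_basis_elt]) (simp add: basis_elt_eq)
qed

text \<open>Over three elements every multiple of a basis element is a sum of copies of it, so
  closure under addition takes the place of closure under scalars. It serves for ideals of the path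
  algebra and for the set \<open>H\<close> in \<open>burnside_kernel\<close>.\<close>

lemma basis_span:
  assumes zero: "(\<lambda>s. 0) \<in> J"
    and add: "\<And>f g. \<lbrakk>f \<in> J; g \<in> J\<rbrakk> \<Longrightarrow> f \<oplus>\<^bsub>basis_algebra F3 S mul E\<^esub> g \<in> J"
    and f: "f \<in> carrier (basis_algebra F3 S mul E)" and J: "\<And>s. f s \<noteq> 0 \<Longrightarrow> basis_elt F3 s \<in> J"
  shows "f \<in> J"
proof -
  let ?B = "basis_algebra F3 S mul E"
  have multiple: "(\<lambda>t. if t = s then r else 0) \<in> J" if "basis_elt F3 s \<in> J" "0 \<le> r" "r < 3" for s r
  proof -
    have "basis_elt F3 s \<oplus>\<^bsub>?B\<^esub> basis_elt F3 s = (\<lambda>t. if t = s then 2 else 0)"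
      by (auto simp: fun_eq_iff basis_add basis_elt_eq)
    moreover have "r = 0 \<or> r = 1 \<or> r = 2" using that by auto
    ultimately show ?thesis
      using zero add[OF that(1,1)] that(1) by (auto simp: basis_elt_eq)
  qed
  have *: "g \<in> J" if "finite A" "{s. g s \<noteq> 0} \<subseteq> A" "\<And>s. 0 \<le> g s \<and> g s < 3"
    "\<And>s. g s \<noteq> 0 \<Longrightarrow> basis_elt F3 s \<in> J" for A g
    using that
  proof (induction A arbitrary: g rule: finite_induct)
    case empty
    then have "g = (\<lambda>s. 0)" by auto
    then show ?case using zero by simp
  next
    case (insert a A)
    have "g = g(a := 0) \<oplus>\<^bsub>?B\<^esub> (\<lambda>t. if t = a then g a else 0)"
      using insert.prems(2) by (auto simp: fun_eq_iff basis_add)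
    moreover have "g(a := 0) \<in> J"
    proof (rule insert.IH)
      show "basis_elt F3 s \<in> J" if "(g(a := 0)) s \<noteq> 0" for s
        using that insert.prems(3) by (cases "s = a") simp_all
    qed (use insert.prems(1,2) in auto)
    moreover have "(\<lambda>t. if t = a then g a else 0) \<in> J"
    proof (cases "g a = 0")
      case True
      then have "(\<lambda>t. if t = a then g a else 0) = (\<lambda>s. 0)" by auto
      then show ?thesis using zero by simp
    next
      case False then show ?thesis using insert.prems(2) by (intro multiple insert.prems(3)) simp_all
    qed
    ultimately show ?case using add by metis
  qed
  show ?thesis
  proof (rule *[of "{s. f s \<noteq> 0}"])
    show "basis_elt F3 s \<in> J" if "f s \<noteq> 0" for s using that by (rule J)
  qed (use f in \<open>simp_all add: basis_carrier_iff\<close>)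
qed

lemma UNIV_psi_vertex: "(UNIV :: psi_vertex set) = {E3, E4, E5, E6}"
  using psi_vertex.exhaust by auto

lemma finite_psi_vertex [simp]: "finite (UNIV :: psi_vertex set)"
  by (simp add: UNIV_psi_vertex)

lemma quiver_paths_Psi: "(u, p, v) \<in> quiver_paths Psi \<longleftrightarrow> pre_digraph.cas Psi u p v"
  by (simp add: quiver_paths_def pre_digraph.awalk_def Psi_def)

lemma cas_Psi:
  "pre_digraph.cas Psi u [] v \<longleftrightarrow> u = v"
  "pre_digraph.cas Psi u (a # p) v \<longleftrightarrow> tail Psi a = u \<and> pre_digraph.cas Psi (head Psi a) p v"
  by (simp_all add: pre_digraph.cas.simps)

lemma cas_Psi_append:
  "pre_digraph.cas Psi u (p @ q) v \<longleftrightarrow> (\<exists>w. pre_digraph.cas Psi u p w \<and> pre_digraph.cas Psi w q v)"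
  by (induction p arbitrary: u) (auto simp: cas_Psi)

lemma ends_Psi [simp]:
  "tail Psi T1 = E6" "tail Psi T2 = E3" "tail Psi T3 = E6" "tail Psi T4 = E4"
  "head Psi T1 = E3" "head Psi T2 = E6" "head Psi T3 = E4" "head Psi T4 = E6"
  by (simp_all add: Psi_def)

abbreviation "vertex_path v \<equiv> (v, [], v)"

lemma F3Psi_eq: "F3Psi = basis_algebra F3 (quiver_paths Psi) path_comp (range vertex_path)"
  by (simp add: path_algebra_def Psi_def)

lemma path_comp_closed:
  "\<lbrakk>a \<in> quiver_paths Psi; b \<in> quiver_paths Psi; path_comp a b = Some s\<rbrakk> \<Longrightarrow> s \<in> quiver_paths Psi"
  by (cases a; cases b) (auto simp: quiver_paths_Psi cas_Psi_append split: if_splits)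

lemma ring_F3Psi: "Ring.ring F3Psi"
  unfolding F3Psi_eq
proof (rule ring_basis[OF path_comp_closed])
  fix a b c :: "psi_vertex \<times> psi_arrow list \<times> psi_vertex"
  show "Option.bind (path_comp a b) (\<lambda>s. path_comp s c) = Option.bind (path_comp b c) (path_comp a)"
    by (cases a; cases b; cases c) simp
next
  fix \<phi> :: "psi_vertex \<times> psi_arrow list \<times> psi_vertex \<Rightarrow> 3" and b :: "psi_vertex \<times> psi_arrow list \<times> psi_vertex"
  obtain u p v where b: "b = (u, p, v)" by (cases b)
  have inj: "inj vertex_path" by (simp add: inj_def)
  show "(\<Sum>a\<in>range vertex_path. opt \<phi> (path_comp a b)) = \<phi> b"
    "(\<Sum>a\<in>range vertex_path. opt \<phi> (path_comp b a)) = \<phi> b"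
    by (simp_all add: sum.reindex[OF inj] b if_distrib[of "opt \<phi>"] cong: if_cong)
qed (auto simp: quiver_paths_Psi cas_Psi)

text \<open>The normal forms of the quotient. The coordinates are chosen such that composing
  \<open>T1\<close> with \<open>T2\<close> corresponds to \<open>cX I2\<close> times
  \<open>cT I2\<close>, and \<open>T3\<close> with \<open>T4\<close> to \<open>cY\<close> times
  \<open>cV\<close>.\<close>

definition short_paths :: "((psi_vertex \<times> psi_arrow list \<times> psi_vertex) \<times> coord) list" where
  "short_paths =
     [(vertex_path E3, cS I2 I2), (vertex_path E4, cU), (vertex_path E5, cW), (vertex_path E6, cZ1),
      ((E6, [T1], E3), cX I2), ((E3, [T2], E6), cT I2), ((E6, [T3], E4), cY), ((E4, [T4], E6), cV),
      ((E6, [T1, T2], E6), cZ2), ((E6, [T3, T4], E6), cZ3)]"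

definition path_coord :: "psi_vertex \<times> psi_arrow list \<times> psi_vertex \<Rightarrow> coord option" where
  "path_coord = map_of short_paths"

definition path_img :: "psi_vertex \<times> psi_arrow list \<times> psi_vertex \<Rightarrow> coord \<Rightarrow> 3" where
  "path_img s k = of_bool (path_coord s = Some k)"

lemma path_coord_dom: "path_coord s = Some k \<Longrightarrow> (s, k) \<in> set short_paths"
  by (simp add: path_coord_def map_of_SomeD)

text \<open>\<open>T2\<close> and \<open>T4\<close> enter \<open>E6\<close>, and \<open>T1\<close>
  and \<open>T3\<close> leave it: the four relations are all the paths of length two with
  \<open>E6\<close> in the middle.\<close>

definition bad :: "psi_arrow \<Rightarrow> psi_arrow \<Rightarrow> bool" where
  "bad a b \<longleftrightarrow> (a = T2 \<or> a = T4) \<and> (b = T1 \<or> b = T3)"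

lemma short_not_bad: "path_coord (u, p1 @ [a, b] @ p2, v) = Some k \<Longrightarrow> \<not> bad a b"
  by (drule path_coord_dom) (auto simp: short_paths_def bad_def append_eq_Cons_conv)

text \<open>Arrows into and out of \<open>E6\<close> alternate along a path, so among three
  consecutive arrows one enters \<open>E6\<close> and the next one leaves it. Paths with at most two
  arrows are inspected one by one.\<close>

lemma long_path_bad:
  assumes "pre_digraph.cas Psi u p v" "path_coord (u, p, v) = None"
  shows "\<exists>p1 a b p2. p = p1 @ [a, b] @ p2 \<and> bad a b"
proof -
  consider "p = []" | a where "p = [a]" | a b where "p = [a, b]" | a b c q where "p = a # b # c # q"
    by (metis list.exhaust)
  then show ?thesis
  proof cases
    case 1
    with assms show ?thesis by (cases u) (auto simp: cas_Psi path_coord_def short_paths_def)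
  next
    case 2
    with assms show ?thesis by (cases a) (auto simp: cas_Psi path_coord_def short_paths_def)
  next
    case (3 a b)
    with assms have "bad a b"
      by (cases a; cases b) (auto simp: cas_Psi path_coord_def short_paths_def bad_def)
    with 3 show ?thesis by (intro exI[of _ "[]"] exI[of _ a] exI[of _ b] exI[of _ "[]"]) simp
  next
    case (4 a b c q)
    with assms(1) have "bad a b \<or> bad b c"
      by (cases a; cases b; cases c) (auto simp: cas_Psi bad_def)
    then show ?thesis
    proof
      assume "bad a b"
      with 4 show ?thesis by (intro exI[of _ "[]"] exI[of _ a] exI[of _ b] exI[of _ "c # q"]) simp
    next
      assume "bad b c"
      with 4 show ?thesis by (intro exI[of _ "[a]"] exI[of _ b] exI[of _ c] exI[of _ q]) simp
    qed
  qed
qed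

text \<open>A path without coordinate contains a bad pair of arrows, and this pair survives in every
  longer path.\<close>

lemma path_coord_comp_None:
  assumes "a \<in> quiver_paths Psi" "b \<in> quiver_paths Psi" "path_comp a b = Some s"
    and "path_coord a = None \<or> path_coord b = None"
  shows "path_coord s = None"
proof -
  obtain u p v where a: "a = (u, p, v)" by (cases a)
  obtain u' p' v' where b: "b = (u', p', v')" by (cases b)
  have s: "s = (u, p @ p', v')" using assms(3) by (auto simp: a b split: if_splits)
  have "\<exists>q1 c d q2. p @ p' = q1 @ [c, d] @ q2 \<and> bad c d"
    using assms(4)
  proof
    assume "path_coord a = None"
    then obtain q1 c d q2 where "p = q1 @ [c, d] @ q2" "bad c d"
      using long_path_bad[of u p v] assms(1) by (auto simp: a quiver_paths_Psi)
    then show ?thesis by (intro exI[of _ q1] exI[of _ c] exI[of _ d] exI[of _ "q2 @ p'"]) simp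
  next
    assume "path_coord b = None"
    then obtain q1 c d q2 where "p' = q1 @ [c, d] @ q2" "bad c d"
      using long_path_bad[of u' p' v'] assms(2) by (auto simp: b quiver_paths_Psi)
    then show ?thesis by (intro exI[of _ "p @ q1"] exI[of _ c] exI[of _ d] exI[of _ q2]) simp
  qed
  then show ?thesis
    unfolding s using short_not_bad by (metis not_Some_eq)
qed

definition unit_coord :: "coord \<Rightarrow> coord \<Rightarrow> 3" where
  "unit_coord i k = of_bool (k = i)"

lemma short_table:
  "list_all (\<lambda>p. list_all (\<lambda>q. cmul (unit_coord (snd p)) (unit_coord (snd q)) =
     (\<lambda>k. opt (\<lambda>s. path_img s k) (path_comp (fst p) (fst q)))) short_paths) short_paths"
proof -
  have "path_img s k = (case path_coord s of None \<Rightarrow> 0 | Some i \<Rightarrow> unit_coord i k)" for s k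
    by (auto simp: path_img_def unit_coord_def split: option.split)
  then show ?thesis
    by (simp add: short_paths_def path_coord_def) (simp add: coord_eq_iff unit_coord_def tsum_def)
qed

lemma path_img_mult:
  assumes "a \<in> quiver_paths Psi" "b \<in> quiver_paths Psi"
  shows "cmul (path_img a) (path_img b) k = opt (\<lambda>s. path_img s k) (path_comp a b)"
proof (cases "path_coord a = None \<or> path_coord b = None")
  case True
  then have "path_img a = (\<lambda>k. 0) \<or> path_img b = (\<lambda>k. 0)" by (auto simp: path_img_def fun_eq_iff)
  then have "cmul (path_img a) (path_img b) k = 0" by (auto simp: cmul_zero)
  moreover have "opt (\<lambda>s. path_img s k) (path_comp a b) = 0"
    using path_coord_comp_None[OF assms _ True]
    by (cases "path_comp a b") (auto simp: path_img_def)
  ultimately show ?thesis by simp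
next
  case False
  then obtain i j where "path_coord a = Some i" "path_coord b = Some j"
    by auto
  moreover from this have i: "(a, i) \<in> set short_paths" and j: "(b, j) \<in> set short_paths"
    by (auto dest: path_coord_dom)
  ultimately have "path_img a = unit_coord i" "path_img b = unit_coord j"
    by (auto simp: path_img_def unit_coord_def fun_eq_iff)
  moreover have "cmul (unit_coord i) (unit_coord j) = (\<lambda>k. opt (\<lambda>s. path_img s k) (path_comp a b))"
    using short_table[unfolded list_all_iff, THEN bspec, OF i, THEN bspec, OF j] by simp
  ultimately show ?thesis by simp
qed

definition path_hom :: "(psi_vertex \<times> psi_arrow list \<times> psi_vertex \<Rightarrow> int) \<Rightarrow> coord \<Rightarrow> 3" where
  "path_hom f k = val f (\<lambda>s. path_img s k)"

lemma path_hom_eq: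
  assumes "f \<in> carrier F3Psi"
  shows "path_hom f k = (\<Sum>(s, j)\<leftarrow>short_paths. if j = k then of_int (f s) else 0)"
proof -
  have fin: "finite {s. f s \<noteq> 0}" using assms by (simp add: F3Psi_eq basis_carrier_iff)
  let ?T = "{s. f s \<noteq> 0} \<union> fst ` set short_paths"
  have "path_hom f k = (\<Sum>s\<in>?T. of_int (f s) * path_img s k)"
    unfolding path_hom_def using fin by (intro val_superset) auto
  also have "\<dots> = (\<Sum>s\<in>fst ` set short_paths. of_int (f s) * path_img s k)"
    using fin path_coord_dom
    by (intro sum.mono_neutral_right) (force simp: path_img_def)+
  also have "\<dots> = (\<Sum>(s, j)\<leftarrow>short_paths. if j = k then of_int (f s) else 0)"
    by (simp add: short_paths_def path_img_def path_coord_def)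
  finally show ?thesis .
qed

lemma path_hom_carrier:
  assumes "f \<in> carrier F3Psi"
  shows "path_hom f \<in> carrier (coord_algebra corner_coords)"
  using assms by (auto simp: coord_algebra_def path_hom_eq short_paths_def corner_coords_def)

definition Psi_relations :: "(psi_vertex \<times> psi_arrow list \<times> psi_vertex \<Rightarrow> int) set" where
  "Psi_relations =
     {tau T4 \<otimes>\<^bsub>F3Psi\<^esub> tau T3, tau T4 \<otimes>\<^bsub>F3Psi\<^esub> tau T1,
      tau T2 \<otimes>\<^bsub>F3Psi\<^esub> tau T1, tau T2 \<otimes>\<^bsub>F3Psi\<^esub> tau T3}"

lemma Psi_relations_eq:
  "Psi_relations = {basis_elt F3 (tail Psi a, [a, b], head Psi b) | a b. bad a b}"
proof -
  have "tau a \<otimes>\<^bsub>F3Psi\<^esub> tau b = basis_elt F3 (tail Psi a, [a, b], head Psi b)" if "bad a b" for a b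
    using that unfolding F3Psi_eq arrow_elt_def
    by (intro basis_elt_mult) (auto simp: bad_def)
  then have "tau T4 \<otimes>\<^bsub>F3Psi\<^esub> tau T3 = basis_elt F3 (E4, [T4, T3], E4)"
    "tau T4 \<otimes>\<^bsub>F3Psi\<^esub> tau T1 = basis_elt F3 (E4, [T4, T1], E3)"
    "tau T2 \<otimes>\<^bsub>F3Psi\<^esub> tau T1 = basis_elt F3 (E3, [T2, T1], E3)"
    "tau T2 \<otimes>\<^bsub>F3Psi\<^esub> tau T3 = basis_elt F3 (E3, [T2, T3], E4)"
    by (simp_all add: bad_def)
  moreover have "{basis_elt F3 (tail Psi a, [a, b], head Psi b) | a b. bad a b} =
      {basis_elt F3 (E4, [T4, T3], E4), basis_elt F3 (E4, [T4, T1], E3),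
       basis_elt F3 (E3, [T2, T1], E3), basis_elt F3 (E3, [T2, T3], E4)}" (is "?A = ?B")
  proof
    have "basis_elt F3 (tail Psi a, [a, b], head Psi b) \<in> ?A" if "bad a b" for a b
      using that by blast
    from this[of T4 T3] this[of T4 T1] this[of T2 T1] this[of T2 T3] show "?B \<subseteq> ?A"
      by (simp add: bad_def)
  qed (auto simp: bad_def)
  ultimately show ?thesis by (simp add: Psi_relations_def)
qed

lemma path_quotient:
  "algebra_quotient F3Psi (coord_algebra corner_coords) F3 (smult F3Psi) path_hom Psi_ideal"
proof -
  interpret R: Ring.ring F3Psi by (rule ring_F3Psi)
  interpret M: Module.module F3 F3Psi unfolding F3Psi_eq by (rule module_basis)
  let ?C = "coord_algebra corner_coords"
  have fin: "finite {s. f s \<noteq> 0}" if "f \<in> carrier F3Psi" for f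
    using that unfolding F3Psi_eq by (rule basis_finite)
  have add: "path_hom (f \<oplus>\<^bsub>F3Psi\<^esub> g) = (\<lambda>k. path_hom f k + path_hom g k)"
    if "f \<in> carrier F3Psi" "g \<in> carrier F3Psi" for f g
    using fin[OF that(1)] fin[OF that(2)] by (simp add: fun_eq_iff path_hom_def F3Psi_eq val_add)
  have mult: "path_hom (f \<otimes>\<^bsub>F3Psi\<^esub> g) = cmul (path_hom f) (path_hom g)"
    if f: "f \<in> carrier F3Psi" and g: "g \<in> carrier F3Psi" for f g
  proof
    fix k
    have "path_hom (f \<otimes>\<^bsub>F3Psi\<^esub> g) k = val f (\<lambda>a. val g (\<lambda>b. opt (\<lambda>s. path_img s k) (path_comp a b)))"
      using fin[OF f] fin[OF g] by (simp add: path_hom_def F3Psi_eq val_mult(1))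
    also have "\<dots> = val f (\<lambda>a. val g (\<lambda>b. cmul (path_img a) (path_img b) k))"
      using f g by (intro val_cong) (auto simp: path_img_mult F3Psi_eq basis_carrier_iff subset_iff)
    also have "\<dots> = cmul (path_hom f) (path_hom g) k"
      unfolding path_hom_def[abs_def] cmul_val by simp
    finally show "path_hom (f \<otimes>\<^bsub>F3Psi\<^esub> g) k = cmul (path_hom f) (path_hom g) k" .
  qed
  define ker where "ker = {f \<in> carrier F3Psi. path_hom f = (\<lambda>k. 0)}"
  have zero: "path_hom \<zero>\<^bsub>F3Psi\<^esub> = (\<lambda>k. 0)"
    by (simp add: fun_eq_iff path_hom_def F3Psi_eq basis_zero val_def)
  have rel_carrier: "basis_elt F3 (tail Psi a, [a, b], head Psi b) \<in> carrier F3Psi" if "bad a b" for a b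
    using that unfolding F3Psi_eq
    by (intro basis_elt_carrier) (auto simp: quiver_paths_Psi cas_Psi bad_def)
  have "ideal ker F3Psi"
  proof (rule idealI[OF R.ring_axioms])
    show "subgroup ker (add_monoid F3Psi)"
    proof (rule R.add.subgroupI)
      fix f assume f: "f \<in> ker"
      then have "path_hom (f \<oplus>\<^bsub>F3Psi\<^esub> \<ominus>\<^bsub>F3Psi\<^esub> f) = path_hom (\<ominus>\<^bsub>F3Psi\<^esub> f)"
        by (subst add) (auto simp: ker_def)
      with f show "\<ominus>\<^bsub>F3Psi\<^esub> f \<in> ker"
        by (auto simp: ker_def R.r_neg zero)
    qed (auto simp: ker_def add zero intro!: exI[of _ "\<zero>\<^bsub>F3Psi\<^esub>"])
  qed (auto simp: ker_def mult cmul_zero)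
  moreover have "Psi_relations \<subseteq> ker"
  proof -
    have "path_hom (basis_elt F3 (tail Psi a, [a, b], head Psi b)) = (\<lambda>k. 0)" if "bad a b" for a b
      using that by (auto simp: path_hom_def val_basis_elt fun_eq_iff path_img_def path_coord_def
          short_paths_def bad_def)
    then show ?thesis using rel_carrier by (auto simp: Psi_relations_eq ker_def)
  qed
  ultimately have "Psi_ideal \<subseteq> ker"
    unfolding Psi_ideal_def Psi_relations_def[symmetric] by (rule R.genideal_minimal)
  moreover have "f \<in> Psi_ideal" if f: "f \<in> ker" for f
  proof -
    have "f \<in> J" if J: "ideal J F3Psi" "Psi_relations \<subseteq> J" for J
    proof -
      interpret J: ideal J F3Psi by fact
      have "basis_elt F3 s \<in> J" if s: "f s \<noteq> 0" for s
      proof -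
        obtain u p v where s': "s = (u, p, v)" by (cases s)
        have cas: "pre_digraph.cas Psi u p v"
          using f s by (auto simp: s' ker_def F3Psi_eq basis_carrier_iff quiver_paths_Psi[symmetric])
        \<comment> \<open>Each coordinate belongs to one short path, so \<open>path_hom f\<close>
          has the coefficient of f at a short path as an entry. For f in the kernel it
          vanishes.\<close>
        have "path_coord s = None"
        proof (rule ccontr)
          assume "path_coord s \<noteq> None"
          then obtain k where k: "(s, k) \<in> set short_paths" by (auto dest: path_coord_dom)
          have "f \<in> carrier F3Psi" using f by (simp add: ker_def)
          then have "path_hom f k = of_int (f s)"
            using k unfolding path_hom_eq[OF \<open>f \<in> carrier F3Psi\<close>] by (auto simp: short_paths_def)
          then have "(of_int (f s) :: 3) = of_int 0" using f by (simp add: ker_def)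
          moreover have "0 \<le> f s \<and> f s < 3" using f unfolding ker_def F3Psi_eq basis_carrier_iff by blast
          ultimately show False using s unfolding of_int_3_eq_iff by simp
        qed
        then obtain p1 a b p2 where p: "p = p1 @ [a, b] @ p2" and "bad a b"
          using long_path_bad[OF cas] unfolding s' by blast
        let ?b = "(tail Psi a, [a, b], head Psi b)"
        have cas': "pre_digraph.cas Psi u p1 (tail Psi a)" "pre_digraph.cas Psi (head Psi b) p2 v"
          using cas unfolding p by (auto simp: cas_Psi_append cas_Psi)
        have "basis_elt F3 ?b \<in> J"
          using J(2) \<open>bad a b\<close> by (auto simp: Psi_relations_eq)
        moreover have "basis_elt F3 (u, p1, tail Psi a) \<in> carrier F3Psi"
          "basis_elt F3 (head Psi b, p2, v) \<in> carrier F3Psi"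
          using cas' unfolding F3Psi_eq by (auto intro!: basis_elt_carrier simp: quiver_paths_Psi)
        ultimately have "basis_elt F3 (u, p1, tail Psi a) \<otimes>\<^bsub>F3Psi\<^esub> basis_elt F3 ?b
            \<otimes>\<^bsub>F3Psi\<^esub> basis_elt F3 (head Psi b, p2, v) \<in> J"
          by (intro J.I_r_closed J.I_l_closed)
        moreover have "basis_elt F3 (u, p1, tail Psi a) \<otimes>\<^bsub>F3Psi\<^esub> basis_elt F3 ?b =
            basis_elt F3 (u, p1 @ [a, b], head Psi b)"
          unfolding F3Psi_eq by (intro basis_elt_mult) simp
        moreover have "basis_elt F3 (u, p1 @ [a, b], head Psi b) \<otimes>\<^bsub>F3Psi\<^esub> basis_elt F3 (head Psi b, p2, v) =
            basis_elt F3 (u, (p1 @ [a, b]) @ p2, v)"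
          unfolding F3Psi_eq by (intro basis_elt_mult) simp
        ultimately show ?thesis by (simp add: s' p)
      qed
      note basis = this
      show ?thesis
      proof (rule basis_span)
        show "(\<lambda>s. 0) \<in> J" using J.zero_closed by (simp add: F3Psi_eq basis_zero)
        show "g \<oplus>\<^bsub>basis_algebra F3 (quiver_paths Psi) path_comp (range vertex_path)\<^esub> g' \<in> J"
          if "g \<in> J" "g' \<in> J" for g g'
          using J.a_closed[OF that] by (simp only: F3Psi_eq)
        show "f \<in> carrier (basis_algebra F3 (quiver_paths Psi) path_comp (range vertex_path))"
          using f by (simp add: ker_def F3Psi_eq)
      qed (rule basis)
    qed
    then show ?thesis
      unfolding Psi_ideal_def Psi_relations_def[symmetric] genideal_def by simp
  qed
  ultimately have ideal_eq: "Psi_ideal = ker" by blast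
  have onto: "path_hom ` carrier F3Psi = carrier ?C"
  proof (intro equalityI subsetI)
    fix x assume x: "x \<in> carrier ?C"
    obtain r :: "3 \<Rightarrow> int" where r: "\<And>c. 0 \<le> r c \<and> r c < 3 \<and> of_int (r c) = c"
      using of_int_3_surj by metis
    have r0: "r 0 = 0"
    proof -
      have "(of_int (r 0) :: 3) = of_int 0" using r by simp
      then show ?thesis using r[of 0] unfolding of_int_3_eq_iff by simp
    qed
    define f where "f s = (case path_coord s of None \<Rightarrow> 0 | Some k \<Rightarrow> r (x k))" for s
    have sub: "{s. f s \<noteq> 0} \<subseteq> fst ` set short_paths"
      by (auto simp: f_def split: option.splits dest!: path_coord_dom) force
    moreover have "fst ` set short_paths \<subseteq> quiver_paths Psi"
      by (auto simp: short_paths_def quiver_paths_Psi cas_Psi)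
    ultimately have f: "f \<in> carrier F3Psi"
      unfolding F3Psi_eq basis_carrier_iff
      using r finite_subset[OF sub] by (auto simp: f_def split: option.splits)
    have "path_hom f = x"
      using x unfolding coord_eq_iff
      by (simp add: path_hom_eq[OF f] short_paths_def f_def path_coord_def r coord_algebra_def
          corner_coords_iff)
    with f show "x \<in> path_hom ` carrier F3Psi" by blast
  qed (use path_hom_carrier in blast)
  have one: "path_hom \<one>\<^bsub>F3Psi\<^esub> = \<one>\<^bsub>?C\<^esub>"
    using R.one_closed unfolding coord_eq_iff
    by (simp add: path_hom_eq coord_algebra_def corner_coords_def)
       (simp add: short_paths_def F3Psi_eq basis_one image_iff)
  show ?thesis
  proof
    show "path_hom (r \<odot>\<^bsub>F3Psi\<^esub> f) = r \<odot>\<^bsub>?C\<^esub> path_hom f" if "f \<in> carrier F3Psi" for r f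
      using fin[OF that] by (simp add: path_hom_def[abs_def] F3Psi_eq val_smult coord_algebra_def)
    show "Psi_ideal = {f \<in> carrier F3Psi. path_hom f = \<zero>\<^bsub>?C\<^esub>}"
      by (simp add: ideal_eq ker_def coord_algebra_def)
  qed (use add mult onto one unital_algebra_corner_coord in \<open>auto simp: coord_algebra_def\<close>)
qed


section \<open>The reduction of the order\<close>

lemma three_times [simp]: "3 * r = (0 :: 3)"
proof -
  have "(3 :: 3) = 0" by simp
  then show ?thesis by (metis mult_zero_left)
qed

text \<open>In the field with three elements a nonzero b is its own inverse, so that a b is the
  residue of a / b.\<close>

definition residue :: "rat \<Rightarrow> 3" where
  "residue x = (case quotient_of x of (a, b) \<Rightarrow> of_int (a * b))"

lemma square_3:
  assumes "\<not> 3 dvd b"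
  shows "(of_int b :: 3) * of_int b = 1"
proof -
  have "b mod 3 = 1 \<or> b mod 3 = 2" using assms by presburger
  moreover have "(b * b) mod 3 = ((b mod 3) * (b mod 3)) mod 3" by (simp add: mod_mult_eq)
  ultimately have "(b * b) mod 3 = 1 mod 3" by auto
  then have "(of_int (b * b) :: 3) = of_int 1" unfolding of_int_3_eq_iff .
  then show ?thesis by simp
qed

lemma residue_frac:
  assumes b: "\<not> 3 dvd b"
  shows "residue (of_int a / of_int b) = of_int a * of_int b"
proof -
  obtain p q where pq: "quotient_of (of_int a / of_int b) = (p, q)" by fastforce
  have q: "q > 0" "coprime p q" using quotient_of_denom_pos[OF pq] quotient_of_coprime[OF pq] .
  have "(of_int a / of_int b :: rat) = of_int p / of_int q" using quotient_of_div[OF pq] .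
  moreover have "b \<noteq> 0" using b by auto
  ultimately have "(of_int (a * q) :: rat) = of_int (p * b)"
    using q(1) by (simp add: field_simps)
  then have eq: "a * q = p * b" by (simp only: of_int_eq_iff)
  then have "q dvd p * b" by (metis dvd_triv_right)
  then have "q dvd b" using q(2) by (metis coprime_commute coprime_dvd_mult_right_iff)
  then have q3: "\<not> 3 dvd q" using b dvd_trans by blast
  have "(of_int (p * q) :: 3) = of_int (p * q) * (of_int b * of_int b)" by (simp add: square_3[OF b])
  also have "\<dots> = of_int (p * b) * of_int q * of_int b" by (simp add: algebra_simps)
  also have "\<dots> = of_int (a * q) * of_int q * of_int b" by (simp only: eq)
  also have "\<dots> = of_int a * of_int b * (of_int q * of_int q)" by (simp add: algebra_simps)
  also have "\<dots> = of_int a * of_int b" by (simp add: square_3[OF q3])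
  finally show ?thesis by (simp add: residue_def pq)
qed

lemma Z3E:
  assumes "x \<in> Z3"
  obtains a b where "x = of_int a / of_int b" "\<not> 3 dvd b"
  using assms by (auto simp: localized_ints_def)

lemma Z3I: "\<not> 3 dvd b \<Longrightarrow> of_int a / of_int b \<in> Z3"
  by (auto simp: localized_ints_def)

lemma Z3_of_int [simp]: "of_int n \<in> Z3"
  using Z3I[of 1 n] by simp

lemma not_3_dvd_mult: "\<lbrakk>\<not> 3 dvd b; \<not> 3 dvd d\<rbrakk> \<Longrightarrow> \<not> 3 dvd b * (d :: int)"
  by (simp add: prime_dvd_mult_iff)

lemma residue_add_mult:
  assumes "x \<in> Z3" "y \<in> Z3"
  shows "x + y \<in> Z3" "x * y \<in> Z3"
    and "residue (x + y) = residue x + residue y" "residue (x * y) = residue x * residue y"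
proof -
  from assms(1) obtain a b where x: "x = of_int a / of_int b" and b: "\<not> 3 dvd b" by (rule Z3E)
  from assms(2) obtain c d where y: "y = of_int c / of_int d" and d: "\<not> 3 dvd d" by (rule Z3E)
  have bd: "\<not> 3 dvd b * d" using b d by (rule not_3_dvd_mult)
  have "b \<noteq> 0" "d \<noteq> 0" using b d by auto
  then have sum: "x + y = of_int (a * d + c * b) / of_int (b * d)"
    and prod: "x * y = of_int (a * c) / of_int (b * d)"
    by (simp_all add: x y field_simps)
  show "x + y \<in> Z3" "x * y \<in> Z3" unfolding sum prod by (rule Z3I[OF bd])+
  have "residue (x + y) = of_int a * of_int b * (of_int d * of_int d) + of_int c * of_int d * (of_int b * of_int b)"
    unfolding sum residue_frac[OF bd] by (simp add: algebra_simps)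
  then show "residue (x + y) = residue x + residue y"
    by (simp only: square_3[OF b] square_3[OF d]) (simp add: x y residue_frac b d)
  show "residue (x * y) = residue x * residue y"
    unfolding prod residue_frac[OF bd] by (simp add: x y residue_frac b d algebra_simps)
qed

lemma residue_of_int [simp]: "residue (of_int n) = of_int n"
  using residue_frac[of 1 n] by simp

lemma residue_numeral [simp]: "residue 0 = 0" "residue 1 = 1" "residue (numeral w) = numeral w"
  using residue_of_int[of 0] residue_of_int[of 1] residue_of_int[of "numeral w"] by simp_all

lemma Z3_numeral [simp]: "0 \<in> Z3" "1 \<in> Z3" "numeral w \<in> Z3"
  using Z3_of_int[of 0] Z3_of_int[of 1] Z3_of_int[of "numeral w"] by simp_all

lemma Z3_minus [simp]: "x \<in> Z3 \<Longrightarrow> - x \<in> Z3"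
  using residue_add_mult(2)[OF Z3_of_int[of "-1"], of x] by simp

lemma Z3_diff [simp]: "\<lbrakk>x \<in> Z3; y \<in> Z3\<rbrakk> \<Longrightarrow> x - y \<in> Z3"
  using residue_add_mult(1)[OF _ Z3_minus] by fastforce

lemma residue_diff: "\<lbrakk>x \<in> Z3; y \<in> Z3\<rbrakk> \<Longrightarrow> residue (x - y) = residue x - residue y"
  using residue_add_mult(3)[of "x - y" y] by simp

lemma residue_eq_0_iff:
  assumes "x \<in> Z3"
  shows "residue x = 0 \<longleftrightarrow> x / 3 \<in> Z3"
proof
  assume "x / 3 \<in> Z3"
  then have "residue (3 * (x / 3)) = residue 3 * residue (x / 3)"
    by (intro residue_add_mult) simp_all
  moreover have "(3 :: 3) = 0" by simp
  ultimately show "residue x = 0" by simp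
next
  assume 0: "residue x = 0"
  from assms obtain a b where x: "x = of_int a / of_int b" and b: "\<not> 3 dvd b" by (rule Z3E)
  have "(of_int (a * b) :: 3) = of_int 0" using 0 by (simp add: x residue_frac b)
  then have "3 dvd a * b" unfolding of_int_3_eq_iff by (simp add: dvd_eq_mod_eq_0)
  then have "3 dvd a" using b not_3_dvd_mult by blast
  then obtain c where "a = 3 * c" by (rule dvdE)
  then show "x / 3 \<in> Z3" using Z3I[OF b, of c] by (simp add: x)
qed

lemma Z3_triple: "x \<in> (*) 3 ` Z3 \<longleftrightarrow> x / 3 \<in> Z3"
  by (auto intro!: image_eqI[of x _ "x / 3"])

section \<open>The corner of the order in terms of ten rational parameters\<close>

definition mk_arr :: "rat \<Rightarrow> rat \<Rightarrow> rat \<Rightarrow> rat \<Rightarrow> rat \<Rightarrow> rat \<Rightarrow> rat \<Rightarrow> rat \<Rightarrow> rat \<Rightarrow> rat \<Rightarrow> arr" where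
  "mk_arr s t u v w x y z1 z2 z3 =
     \<lparr> a11 = (\<chi> i j. if i = 3 \<and> j = 3 then s else 0), a14 = (\<chi> i. if i = 3 then t else 0),
       a22 = u, a24 = v, a33 = w, a41 = (\<chi> i. if i = 3 then x else 0), a42 = y,
       a44 = Qex z1 z2 z3 \<rparr>"

lemma mk_arr_inject:
  "mk_arr s t u v w x y z1 z2 z3 = mk_arr s' t' u' v' w' x' y' z1' z2' z3' \<longleftrightarrow>
     s = s' \<and> t = t' \<and> u = u' \<and> v = v' \<and> w = w' \<and> x = x' \<and> y = y' \<and> z1 = z1' \<and> z2 = z2' \<and> z3 = z3'"
  by (auto simp: mk_arr_def vec_eq_iff split: if_splits)

lemma if_conj_zero: "(if P \<and> Q then x else 0) = (if P then if Q then x else 0 else 0)"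
  by simp

lemma arr_add_mk: "arr_add (mk_arr s t u v w x y z1 z2 z3) (mk_arr s' t' u' v' w' x' y' z1' z2' z3') =
    mk_arr (s + s') (t + t') (u + u') (v + v') (w + w') (x + x') (y + y') (z1 + z1') (z2 + z2') (z3 + z3')"
  by (simp add: mk_arr_def arr_add_def vec_eq_iff)

lemma arr_smult_mk: "arr_smult r (mk_arr s t u v w x y z1 z2 z3) =
    mk_arr (r * s) (r * t) (r * u) (r * v) (r * w) (r * x) (r * y) (r * z1) (r * z2) (r * z3)"
  by (simp add: mk_arr_def arr_smult_def vec_eq_iff qconst_def)

lemma qex_arith [simp]:
  "12 * Qex a b c = Qex (12 * a) (12 * b) (12 * c)"
proof -
  have eq: "(12 :: qex) = Qex 12 0 0"
  proof -
    have "of_nat n = Qex (of_nat n) 0 0" for n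
      by (induction n) (simp_all add: zero_qex_def one_qex_def)
    from this[of 12] show ?thesis by simp
  qed
  show ?thesis unfolding eq by simp
qed

lemma arr_mult_mk:
  "arr_mult (mk_arr s t u v w x y z1 z2 z3) (mk_arr s' t' u' v' w' x' y' z1' z2' z3') =
    mk_arr (s * s') (s * t' + z1' * t) (u * u') (u * v' + v * z1') (w * w') (x * s' + z1 * x')
      (y * u' + z1 * y') (z1 * z1') (x * t' - 12 * (y * v') + z1 * z2' + z2 * z1')
      (y * v' + z1 * z3' + z3 * z1')"
proof -
  have "(\<Sum>i\<in>UNIV. (if i = (3 :: 3) then x else 0) * (if i = 3 then t' else 0)) = x * t'"
    by (simp add: if_distrib[of "\<lambda>a. a * _"] cong: if_cong)
  then show ?thesis
    by (simp add: mk_arr_def arr_mult_def vec_eq_iff matrix_matrix_mult_def matrix_vector_mult_def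
        vector_matrix_mult_def if_conj_zero if_distrib[of "\<lambda>a. a * _"] if_distrib[of "\<lambda>a. _ * a"]
        qconst_def eta_def xi_def minus_qex_def cong: if_cong)
qed

lemma arr_mult_corner:
  "arr_mult (arr_mult (mk_arr 1 0 1 0 1 0 0 1 0 0) a) (mk_arr 1 0 1 0 1 0 0 1 0 0) =
    mk_arr (a11 a $ 3 $ 3) (a14 a $ 3) (a22 a) (a24 a) (a33 a) (a41 a $ 3) (a42 a)
      (const_part (a44 a)) (eta_part (a44 a)) (xi_part (a44 a))"
  by (cases "a44 a")
    (simp add: mk_arr_def arr_mult_def vec_eq_iff matrix_matrix_mult_def matrix_vector_mult_def
        vector_matrix_mult_def if_conj_zero if_distrib[of "\<lambda>a. a * _"] if_distrib[of "\<lambda>a. _ * a"]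
        qconst_def eta_def xi_def minus_qex_def cong: if_cong)

lemma corner_idempotent:
  "e3 \<oplus>\<^bsub>Lambda3\<^esub> e4 \<oplus>\<^bsub>Lambda3\<^esub> e5 \<oplus>\<^bsub>Lambda3\<^esub> e6 = mk_arr 1 0 1 0 1 0 0 1 0 0"
  by (simp add: Lambda3_def arr_algebra_def e3_def e4_def e5_def e6_def arr_zero_def arr_add_def
      mk_arr_def vec_eq_iff zero_qex_def one_qex_def)

definition Lambda_set :: "arr set" where
  "Lambda_set = {mk_arr s t u v w x y z1 z2 z3 | s t u v w x y z1 z2 z3.
     {s, t, u, v, w, x / 3, y, z1, z2 / 3, z3} \<subseteq> Z3}"

lemma mk_arr_Lambda_iff:
  "mk_arr s t u v w x y z1 z2 z3 \<in> Lambda_set \<longleftrightarrow> {s, t, u, v, w, x / 3, y, z1, z2 / 3, z3} \<subseteq> Z3"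
  unfolding Lambda_set_def by (auto simp: mk_arr_inject)

lemma Lambda3'_simps:
  "carrier Lambda3' = Lambda_set"
  "\<one>\<^bsub>Lambda3'\<^esub> = mk_arr 1 0 1 0 1 0 0 1 0 0"
  "\<zero>\<^bsub>Lambda3'\<^esub> = mk_arr 0 0 0 0 0 0 0 0 0 0"
  "a \<oplus>\<^bsub>Lambda3'\<^esub> b = arr_add a b"
  "a \<otimes>\<^bsub>Lambda3'\<^esub> b = arr_mult a b"
  "r \<odot>\<^bsub>Lambda3'\<^esub> a = arr_smult r a"
proof -
  let ?e = "mk_arr 1 0 1 0 1 0 0 1 0 0"
  have carrier: "carrier Lambda3' = (\<lambda>a. arr_mult (arr_mult ?e a) ?e) ` carrier Lambda3"
    unfolding Lambda3'_def corner_idempotent by (simp add: corner_def) (simp add: Lambda3_def arr_algebra_def)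
  have "arr_mult (arr_mult ?e a) ?e \<in> Lambda_set" if "a \<in> carrier Lambda3" for a
    using that unfolding arr_mult_corner mk_arr_Lambda_iff by (simp add: Lambda3_def Z3_triple)
  moreover have "a \<in> (\<lambda>a. arr_mult (arr_mult ?e a) ?e) ` carrier Lambda3" if a: "a \<in> Lambda_set" for a
  proof (rule image_eqI)
    show "a = arr_mult (arr_mult ?e a) ?e"
      using a unfolding arr_mult_corner by (auto simp: Lambda_set_def) (simp add: mk_arr_def)
    show "a \<in> carrier Lambda3"
      using a by (auto simp: Lambda_set_def Lambda3_def Z3_triple) (simp_all add: mk_arr_def)
  qed
  ultimately show "carrier Lambda3' = Lambda_set" unfolding carrier by blast
  show "\<one>\<^bsub>Lambda3'\<^esub> = ?e" unfolding Lambda3'_def corner_idempotent by (simp add: corner_def)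
  show "\<zero>\<^bsub>Lambda3'\<^esub> = mk_arr 0 0 0 0 0 0 0 0 0 0"
    by (simp add: Lambda3'_def corner_def Lambda3_def arr_algebra_def arr_zero_def mk_arr_def
        vec_eq_iff zero_qex_def)
qed (simp_all add: Lambda3'_def corner_def Lambda3_def arr_algebra_def)

text \<open>
  The coordinates \<open>x\<close> and \<open>z\<^sub>2\<close> are divided by 3. As \<open>12 / 3\<close> is 1 modulo 3, the term \<open>\<xi> - 12 \<eta>\<close> in the
  product of the blocks \<open>(4,2)\<close> and \<open>(2,4)\<close> is absorbed by adding \<open>z\<^sub>3\<close> to \<open>z\<^sub>2 / 3\<close>.
\<close>

definition Lambda_hom :: "arr \<Rightarrow> coord \<Rightarrow> 3" where
  "Lambda_hom a k =
    (if k = cS I2 I2 then residue (a11 a $ 3 $ 3) else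
     if k = cT I2 then residue (a14 a $ 3) else
     if k = cX I2 then residue (a41 a $ 3 / 3) else
     if k = cU then residue (a22 a) else
     if k = cV then residue (a24 a) else
     if k = cW then residue (a33 a) else
     if k = cY then residue (a42 a) else
     if k = cZ1 then residue (const_part (a44 a)) else
     if k = cZ2 then residue (eta_part (a44 a) / 3) + residue (xi_part (a44 a)) else
     if k = cZ3 then residue (xi_part (a44 a)) else 0)"

lemma Lambda_hom_mk:
  "Lambda_hom (mk_arr s t u v w x y z1 z2 z3) k =
    (if k = cS I2 I2 then residue s else if k = cT I2 then residue t else
     if k = cX I2 then residue (x / 3) else if k = cU then residue u else
     if k = cV then residue v else if k = cW then residue w else if k = cY then residue y else
     if k = cZ1 then residue z1 else if k = cZ2 then residue (z2 / 3) + residue z3 else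
     if k = cZ3 then residue z3 else 0)"
  by (simp add: Lambda_hom_def mk_arr_def)

text \<open>One function instead of ten variables makes a single hypothesis of the integrality
  conditions. The entries divisible by 3 appear as explicit multiples to match
  \<open>Lambda_mult\<close>.\<close>

lemma Lambda_setE:
  assumes "a \<in> Lambda_set"
  obtains c :: "nat \<Rightarrow> rat" where
    "a = mk_arr (c 0) (c 1) (c 2) (c 3) (c 4) (3 * c 5) (c 6) (c 7) (3 * c 8) (c 9)" "\<forall>i. c i \<in> Z3"
proof -
  from assms obtain s t u v w x y z1 z2 z3 where a: "a = mk_arr s t u v w x y z1 z2 z3"
    and Z: "{s, t, u, v, w, x / 3, y, z1, z2 / 3, z3} \<subseteq> Z3" by (auto simp: Lambda_set_def)
  define xs where "xs = [s, t, u, v, w, x / 3, y, z1, z2 / 3, z3]"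
  define c where "c i = (if i < 10 then xs ! i else 0)" for i
  have "set xs \<subseteq> Z3" "length xs = 10" using Z by (simp_all add: xs_def)
  then have "\<forall>i. c i \<in> Z3" unfolding c_def by (auto dest!: nth_mem)
  moreover have "a = mk_arr (c 0) (c 1) (c 2) (c 3) (c 4) (3 * c 5) (c 6) (c 7) (3 * c 8) (c 9)"
    by (simp add: a c_def xs_def)
  ultimately show ?thesis by (rule that[rotated])
qed

lemma Lambda_setI:
  "\<lbrakk>s \<in> Z3; t \<in> Z3; u \<in> Z3; v \<in> Z3; w \<in> Z3; x \<in> Z3; y \<in> Z3; z1 \<in> Z3; z2 \<in> Z3; z3 \<in> Z3\<rbrakk> \<Longrightarrow>
    mk_arr s t u v w (3 * x) y z1 (3 * z2) z3 \<in> Lambda_set"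
  by (simp add: mk_arr_Lambda_iff)

text \<open>The factor 4 is 12 / 3, where 12 is the structure constant in \<xi> - 12 \<eta>.\<close>

lemma Lambda_mult:
  "arr_mult (mk_arr s t u v w (3 * x) y z1 (3 * z2) z3) (mk_arr s' t' u' v' w' (3 * x') y' z1' (3 * z2') z3') =
    mk_arr (s * s') (s * t' + z1' * t) (u * u') (u * v' + v * z1') (w * w') (3 * (x * s' + z1 * x'))
      (y * u' + z1 * y') (z1 * z1') (3 * (x * t' - 4 * (y * v') + z1 * z2' + z2 * z1'))
      (y * v' + z1 * z3' + z3 * z1')"
  by (simp add: arr_mult_mk mk_arr_inject algebra_simps)

lemma Lambda_add:
  "arr_add (mk_arr s t u v w (3 * x) y z1 (3 * z2) z3) (mk_arr s' t' u' v' w' (3 * x') y' z1' (3 * z2') z3') =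
    mk_arr (s + s') (t + t') (u + u') (v + v') (w + w') (3 * (x + x')) (y + y') (z1 + z1') (3 * (z2 + z2')) (z3 + z3')"
  by (simp add: arr_add_mk mk_arr_inject)

lemma Lambda_smult:
  "arr_smult r (mk_arr s t u v w (3 * x) y z1 (3 * z2) z3) =
    mk_arr (r * s) (r * t) (r * u) (r * v) (r * w) (3 * (r * x)) (r * y) (r * z1) (3 * (r * z2)) (r * z3)"
  by (simp add: arr_smult_mk mk_arr_inject)

lemma abelian_group_Lambda: "abelian_group Lambda3'"
proof (rule abelian_groupI)
  fix a assume "a \<in> carrier Lambda3'"
  then have "a \<in> Lambda_set" by (simp only: Lambda3'_simps)
  then obtain c :: "nat \<Rightarrow> rat" where a: "a = mk_arr (c 0) (c 1) (c 2) (c 3) (c 4) (3 * c 5) (c 6) (c 7) (3 * c 8) (c 9)"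
        "\<forall>i. c i \<in> Z3"
    by (rule Lambda_setE)
  let ?b = "mk_arr (- c 0) (- c 1) (- c 2) (- c 3) (- c 4) (3 * (- c 5)) (- c 6) (- c 7) (3 * (- c 8)) (- c 9)"
  have "?b \<oplus>\<^bsub>Lambda3'\<^esub> a = \<zero>\<^bsub>Lambda3'\<^esub>" by (simp add: a(1) Lambda3'_simps arr_add_mk)
  moreover have "?b \<in> carrier Lambda3'"
    unfolding Lambda3'_simps by (rule Lambda_setI) (simp_all add: a)
  ultimately show "\<exists>b\<in>carrier Lambda3'. b \<oplus>\<^bsub>Lambda3'\<^esub> a = \<zero>\<^bsub>Lambda3'\<^esub>" by blast
next
  show "\<zero>\<^bsub>Lambda3'\<^esub> \<in> carrier Lambda3'"
    using Lambda_setI[of 0 0 0 0 0 0 0 0 0 0] by (simp add: Lambda3'_simps)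
next
  fix a b assume "a \<in> carrier Lambda3'" "b \<in> carrier Lambda3'"
  then have "a \<in> Lambda_set" "b \<in> Lambda_set" by (simp_all only: Lambda3'_simps)
  then show "a \<oplus>\<^bsub>Lambda3'\<^esub> b \<in> carrier Lambda3'"
    unfolding Lambda3'_simps
    by (elim Lambda_setE) (simp only: Lambda_add, intro Lambda_setI residue_add_mult(1), simp_all)
next
  fix a assume "a \<in> carrier Lambda3'"
  then show "\<zero>\<^bsub>Lambda3'\<^esub> \<oplus>\<^bsub>Lambda3'\<^esub> a = a"
    by (auto simp: Lambda3'_simps Lambda_set_def arr_add_mk)
qed (simp_all add: Lambda3'_simps arr_add_def add_ac)

lemma Lambda_quotient:
  "algebra_quotient Lambda3' (coord_algebra corner_coords) F3 (\<lambda>k x. of_int k \<odot>\<^bsub>Lambda3'\<^esub> x) Lambda_hom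
     ((\<lambda>x. of_int 3 \<odot>\<^bsub>Lambda3'\<^esub> x) ` carrier Lambda3')"
proof -
  let ?C = "coord_algebra corner_coords"
  note closed = residue_add_mult(1,2)
  note hom = residue_add_mult(3,4) residue_diff
  interpret abelian_group Lambda3' by (rule abelian_group_Lambda)
  show ?thesis
  proof
    fix a b assume carr: "a \<in> carrier Lambda3'" "b \<in> carrier Lambda3'"
    from carr(1)[unfolded Lambda3'_simps(1)] obtain c :: "nat \<Rightarrow> rat" where a: "a = mk_arr (c 0) (c 1) (c 2) (c 3) (c 4) (3 * c 5) (c 6) (c 7) (3 * c 8) (c 9)"
        "\<forall>i. c i \<in> Z3"
      by (rule Lambda_setE)
    from carr(2)[unfolded Lambda3'_simps(1)] obtain d :: "nat \<Rightarrow> rat" where b: "b = mk_arr (d 0) (d 1) (d 2) (d 3) (d 4) (3 * d 5) (d 6) (d 7) (3 * d 8) (d 9)"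
        "\<forall>i. d i \<in> Z3"
      by (rule Lambda_setE)
    show "a \<otimes>\<^bsub>Lambda3'\<^esub> b \<in> carrier Lambda3'"
      unfolding a(1) b(1) Lambda3'_simps Lambda_mult using a b by (intro Lambda_setI) (simp_all add: closed)
    show "Lambda_hom (a \<oplus>\<^bsub>Lambda3'\<^esub> b) = Lambda_hom a \<oplus>\<^bsub>?C\<^esub> Lambda_hom b"
      using a b by (simp add: Lambda3'_simps Lambda_add coord_algebra_def Lambda_hom_mk add_divide_distrib diff_divide_distrib hom coord_eq_iff)
    show "Lambda_hom (a \<otimes>\<^bsub>Lambda3'\<^esub> b) = Lambda_hom a \<otimes>\<^bsub>?C\<^esub> Lambda_hom b"
      using a b by (simp add: Lambda3'_simps Lambda_mult coord_algebra_def Lambda_hom_mk add_divide_distrib diff_divide_distrib hom closed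
          coord_eq_iff tsum_def algebra_simps)
  next
    show "Lambda_hom ` carrier Lambda3' = carrier ?C"
    proof (intro equalityI subsetI)
      fix c assume c: "c \<in> carrier ?C"
      obtain r :: "3 \<Rightarrow> int" where r: "\<And>c. of_int (r c) = c"
        using of_int_3_surj by metis
      let ?r = "\<lambda>k. of_int (r (c k)) :: rat"
      \<comment> \<open>The coordinate \<open>cZ2\<close> stands for z2 / 3 + z3; therefore
        \<open>cZ3\<close> is subtracted before the multiplication by 3.\<close>
      let ?a = "mk_arr (?r (cS I2 I2)) (?r (cT I2)) (?r cU) (?r cV) (?r cW) (3 * ?r (cX I2)) (?r cY) (?r cZ1)
        (3 * (?r cZ2 - ?r cZ3)) (?r cZ3)"
      have "Lambda_hom ?a = c"
        using c by (simp add: coord_eq_iff Lambda_hom_mk diff_divide_distrib residue_diff r coord_algebra_def corner_coords_iff)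
      then have "c = Lambda_hom ?a" ..
      moreover have "?a \<in> carrier Lambda3'"
        unfolding Lambda3'_simps by (rule Lambda_setI) simp_all
      ultimately show "c \<in> Lambda_hom ` carrier Lambda3'" by (rule image_eqI)
    qed (auto simp: coord_algebra_def Lambda_hom_def corner_coords_def)
    show "\<one>\<^bsub>Lambda3'\<^esub> \<in> carrier Lambda3'"
      using Lambda_setI[of 1 0 1 0 1 0 0 1 0 0] by (simp add: Lambda3'_simps)
    show "Lambda_hom \<one>\<^bsub>Lambda3'\<^esub> = \<one>\<^bsub>?C\<^esub>"
      by (simp add: Lambda3'_simps coord_eq_iff Lambda_hom_mk coord_algebra_def corner_coords_def)
    fix r :: int and a assume "a \<in> carrier Lambda3'"
    then have "a \<in> Lambda_set" by (simp only: Lambda3'_simps)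
    then obtain c :: "nat \<Rightarrow> rat" where a: "a = mk_arr (c 0) (c 1) (c 2) (c 3) (c 4) (3 * c 5) (c 6) (c 7) (3 * c 8) (c 9)"
        "\<forall>i. c i \<in> Z3"
      by (rule Lambda_setE)
    show "of_int r \<odot>\<^bsub>Lambda3'\<^esub> a \<in> carrier Lambda3'"
      unfolding a(1) Lambda3'_simps Lambda_smult using a by (intro Lambda_setI closed) simp_all
    show "Lambda_hom (of_int r \<odot>\<^bsub>Lambda3'\<^esub> a) = r \<odot>\<^bsub>?C\<^esub> Lambda_hom a"
      using a by (simp add: Lambda3'_simps Lambda_smult coord_algebra_def Lambda_hom_mk add_divide_distrib diff_divide_distrib hom coord_eq_iff
          algebra_simps)
  next
    have "a \<in> (\<lambda>x. of_int 3 \<odot>\<^bsub>Lambda3'\<^esub> x) ` carrier Lambda3'"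
      if "a \<in> carrier Lambda3'" "Lambda_hom a = \<zero>\<^bsub>?C\<^esub>" for a
    proof -
      from that(1)[unfolded Lambda3'_simps(1)] obtain c :: "nat \<Rightarrow> rat" where a: "a = mk_arr (c 0) (c 1) (c 2) (c 3) (c 4) (3 * c 5) (c 6) (c 7) (3 * c 8) (c 9)"
        "\<forall>i. c i \<in> Z3"
        by (rule Lambda_setE)
      let ?b = "mk_arr (c 0 / 3) (c 1 / 3) (c 2 / 3) (c 3 / 3) (c 4 / 3) (3 * (c 5 / 3)) (c 6 / 3) (c 7 / 3) (3 * (c 8 / 3)) (c 9 / 3)"
      have "a = of_int 3 \<odot>\<^bsub>Lambda3'\<^esub> ?b"
        by (simp add: a Lambda3'_simps arr_smult_mk)
      \<comment> \<open>As \<open>cZ2\<close> is the residue of z2 / 3 + z3 and \<open>cZ3\<close>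
        that of z3, the vanishing of both makes z2 / 3 divisible by 3.\<close>
      have "Lambda_hom a cZ2 = 0" "Lambda_hom a cZ3 = 0" using that(2) by (simp_all add: coord_algebra_def)
      then have "residue (c 8) = 0" by (simp add: a(1) Lambda_hom_mk)
      then have "c 8 / 3 \<in> Z3" using a(2) residue_eq_0_iff by blast
      with \<open>a = of_int 3 \<odot>\<^bsub>Lambda3'\<^esub> ?b\<close> show ?thesis
      proof (intro image_eqI)
        show "?b \<in> carrier Lambda3'"
        using that(2) a \<open>c 8 / 3 \<in> Z3\<close> unfolding Lambda3'_simps
        by (intro Lambda_setI) (simp_all add: coord_algebra_def coord_eq_iff Lambda_hom_mk residue_eq_0_iff)
      qed
    qed
    moreover have "of_int 3 \<odot>\<^bsub>Lambda3'\<^esub> a \<in> carrier Lambda3' \<and> Lambda_hom (of_int 3 \<odot>\<^bsub>Lambda3'\<^esub> a) = \<zero>\<^bsub>?C\<^esub>"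
      if "a \<in> carrier Lambda3'" for a
    proof -
      from that[unfolded Lambda3'_simps(1)] obtain c :: "nat \<Rightarrow> rat" where a: "a = mk_arr (c 0) (c 1) (c 2) (c 3) (c 4) (3 * c 5) (c 6) (c 7) (3 * c 8) (c 9)"
        "\<forall>i. c i \<in> Z3"
        by (rule Lambda_setE)
      then have "of_int 3 \<odot>\<^bsub>Lambda3'\<^esub> a = mk_arr (3 * c 0) (3 * c 1) (3 * c 2) (3 * c 3) (3 * c 4) (3 * (3 * c 5)) (3 * c 6)
          (3 * c 7) (3 * (3 * c 8)) (3 * c 9)"
        by (simp add: Lambda3'_simps Lambda_smult)
      moreover have "mk_arr (3 * c 0) (3 * c 1) (3 * c 2) (3 * c 3) (3 * c 4) (3 * (3 * c 5)) (3 * c 6)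
          (3 * c 7) (3 * (3 * c 8)) (3 * c 9) \<in> Lambda_set"
        using a by (intro Lambda_setI closed) simp_all
      ultimately show ?thesis
        using a by (simp add: Lambda3'_simps(1) coord_algebra_def Lambda_hom_mk add_divide_distrib diff_divide_distrib hom coord_eq_iff)
    qed
    ultimately show "(\<lambda>x. of_int 3 \<odot>\<^bsub>Lambda3'\<^esub> x) ` carrier Lambda3' =
        {x \<in> carrier Lambda3'. Lambda_hom x = \<zero>\<^bsub>?C\<^esub>}" by blast
  qed (rule unital_algebra_corner_coord)
qed


section \<open>The coefficient matrix modulo 3\<close>

instance label :: finite
proof
  show "finite (UNIV :: label set)" unfolding set_labels[symmetric] by simp
qed

instance coord :: finite
proof
  show "finite (UNIV :: coord set)" unfolding set_coords[symmetric] by simp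
qed

text \<open>
  \<open>dual k\<close> is the linear combination of transitive bisets whose coordinates modulo 3 are the \<open>k\<close>-th unit
  vector. It is composed of similar combinations for the columns and the rows of the products.
\<close>

fun dual_a :: "tri \<Rightarrow> (int \<times> sub) list" where
  "dual_a I0 = [(1, C2)]"
| "dual_a I1 = [(1, C3)]"
| "dual_a I2 = [(1, C6)]"

text \<open>Over the integers the columns add up to (-3, 0, 3) with last entry -2, which is the last
  unit vector modulo 3.\<close>

definition dual_a_last :: "(int \<times> sub) list" where
  "dual_a_last = [(-1, C1), (-1, C2), (1, C3), (1, C6)]"

text \<open>The first two differences are unit vectors over the integers. The third combination is
  (-3, -3, -2), a unit vector modulo 3.\<close>

fun dual_b :: "tri \<Rightarrow> (int \<times> sub) list" where
  "dual_b I0 = [(1, C2), (-1, C6)]"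
| "dual_b I1 = [(1, C3), (-1, C6)]"
| "dual_b I2 = [(-1, C2), (-1, C3)]"

definition dual_b_last :: "(int \<times> sub) list" where
  "dual_b_last = [(1, C1), (1, C2), (-1, C3), (-1, C6)]"

fun scale_comb :: "int \<Rightarrow> sub \<Rightarrow> (int \<times> sub) list \<Rightarrow> (int \<times> label) list" where
  "scale_comb a K [] = []"
| "scale_comb a K ((b, P) # bs) = (a * b, Prod K P) # scale_comb a K bs"

fun tensor :: "(int \<times> sub) list \<Rightarrow> (int \<times> sub) list \<Rightarrow> (int \<times> label) list" where
  "tensor [] bs = []"
| "tensor ((a, K) # as) bs = scale_comb a K bs @ tensor as bs"

text \<open>With the part through the trivial group removed, the coordinates are \<open>r\<close>
  times \<open>sgn_part x y\<close>.\<close>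

definition sgn_pure :: "int \<Rightarrow> bool \<Rightarrow> bool \<Rightarrow> (int \<times> label) list" where
  "sgn_pure r x y = [(r, Sgn x y), (- r, Prod (sgn_ker x) (sgn_ker y)), (r, Prod (sgn_ker x) (sgn_sub y)),
     (r, Prod (sgn_sub x) (sgn_ker y)), (- 2 * r, Prod (sgn_sub x) (sgn_sub y))]"

text \<open>For \<open>cV\<close>, \<open>cY\<close> and \<open>cZ3\<close>, differences in x and y
  isolate an entry of \<open>sgn_part\<close>. For \<open>cW\<close>, the part through the trivial
  group is removed from \<open>Cyc\<close> and the rest is halved, 1/2 being -1 modulo 3. For
  \<open>cZ1\<close>, the combinations of the other diagonal coordinates \<open>cS i i\<close>,
  \<open>cU\<close> and \<open>cW\<close> are subtracted from \<open>Diag\<close>.\<close>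

fun dual :: "coord \<Rightarrow> (int \<times> label) list" where
  "dual (cS i j) = tensor (dual_a i) (dual_b j)"
| "dual (cT i) = tensor (dual_a i) dual_b_last"
| "dual (cX j) = tensor dual_a_last (dual_b j)"
| "dual cZ2 = tensor dual_a_last dual_b_last"
| "dual cU = sgn_pure 1 True True"
| "dual cV = sgn_pure 1 True False @ sgn_pure (-1) True True"
| "dual cY = sgn_pure 1 False True @ sgn_pure (-1) True True"
| "dual cZ3 = sgn_pure 1 False False @ sgn_pure (-1) False True @ sgn_pure (-1) True False @ sgn_pure 1 True True"
| "dual cW = [(-1, Prod C1 C1), (1, Prod C1 C3), (1, Prod C3 C1), (-1, Cyc)]"
| "dual cZ1 = [(1, Prod C1 C1), (-1, Prod C1 C3), (-1, Prod C2 C2), (1, Prod C2 C6), (-1, Prod C3 C1),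
     (1, Prod C6 C2), (-1, Prod C6 C6), (-1, Sgn True True), (1, Cyc), (1, Diag)]"

definition dual_coord :: "(int \<times> label) list \<Rightarrow> coord \<Rightarrow> coord \<Rightarrow> bool" where
  "dual_coord ts k l \<longleftrightarrow> comb ts l mod 3 = (if k = l then 1 else 0)"
definition dual_ok :: "coord \<Rightarrow> bool" where
  "dual_ok k \<longleftrightarrow> list_all (dual_coord (dual k) k) coords"

lemma dual_table: "list_all dual_ok coords"
  by code_simp

lemma comb_dual: "(of_int (comb (dual k) l) :: 3) = of_bool (k = l)"
proof -
  have "comb (dual k) l mod 3 = (if k = l then 1 else 0)"
    using dual_table set_coords by (simp add: list_all_iff dual_ok_def dual_coord_def)
  then have "(of_int (comb (dual k) l mod 3) :: 3) = of_bool (k = l)" by simp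
  then show ?thesis by (simp only: of_int_mod_3)
qed

fun comb_coeff :: "(int \<times> label) list \<Rightarrow> label \<Rightarrow> int" where
  "comb_coeff [] i = 0"
| "comb_coeff ((t, j) # ts) i = (if j = i then t else 0) + comb_coeff ts i"

lemma comb_eq_sum: "comb ts k = (\<Sum>i\<in>UNIV. comb_coeff ts i * coeff i k)"
proof (induction ts)
  case (Cons a ts)
  obtain t j where a: "a = (t, j)" by (cases a)
  have "(\<Sum>i\<in>UNIV. (if j = i then t else 0) * coeff i k) = t * coeff j k"
    by (simp add: if_distrib[of "\<lambda>x. x * _"] cong: if_cong)
  then show ?case using Cons by (simp add: a algebra_simps sum.distrib)
qed simp

definition coeff_map :: "(label \<Rightarrow> 3) \<Rightarrow> coord \<Rightarrow> 3" where
  "coeff_map m k = (\<Sum>i\<in>UNIV. m i * of_int (coeff i k))"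

lemma coeff_map_surj: "surj coeff_map"
proof (rule surjI)
  fix x :: "coord \<Rightarrow> 3"
  show "coeff_map (\<lambda>i. \<Sum>k\<in>UNIV. x k * of_int (comb_coeff (dual k) i)) = x"
  proof
    fix l
    have "coeff_map (\<lambda>i. \<Sum>k\<in>UNIV. x k * of_int (comb_coeff (dual k) i)) l =
        (\<Sum>i\<in>UNIV. \<Sum>k\<in>UNIV. x k * (of_int (comb_coeff (dual k) i * coeff i l)))"
      by (simp add: coeff_map_def sum_distrib_right mult.assoc)
    also have "\<dots> = (\<Sum>k\<in>UNIV. x k * of_int (comb (dual k) l))"
      by (subst sum.swap) (simp add: comb_eq_sum sum_distrib_left)
    also have "\<dots> = x l" by (simp add: comb_dual of_bool_def if_distrib[of "\<lambda>a. _ * a"] cong: if_cong)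
    finally show "coeff_map (\<lambda>i. \<Sum>k\<in>UNIV. x k * of_int (comb_coeff (dual k) i)) l = x l" .
  qed
qed

lemma CARD_label_coord: "CARD(label) = CARD(coord)"
proof -
  have "distinct labels" "length labels = 22" "distinct coords" "length coords = 22"
    by (simp_all add: labels_def all_subs_def coords_def all3_def)
  then show ?thesis by (metis distinct_card set_labels set_coords)
qed

text \<open>A count: the map is onto by \<open>dual\<close>, and there are as many labels as
  coordinates.\<close>

lemma coeff_map_inj: "inj coeff_map"
proof (rule eq_card_imp_inj_on)
  have "CARD(label \<Rightarrow> 3) = CARD(coord \<Rightarrow> 3)"
    by (simp only: card_fun CARD_label_coord finite_UNIV if_True)
  then show "card (range coeff_map) = CARD(label \<Rightarrow> 3)" by (simp add: coeff_map_surj)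
qed simp

definition rep_ok :: "label \<Rightarrow> bool" where
  "rep_ok i \<longleftrightarrow> mat_label (mat_rep i) = i \<and> mat_closed (mat_rep i)"

lemma reps_table: "list_all rep_ok labels"
  by code_simp

lemma rel_label_rep: "rel_label (rel_rep i) = i"
  using reps_table set_labels by (simp add: list_all_iff rep_ok_def mat_rep_mat mat_label_mat)

lemma rel_subgroup_rep: "rel_subgroup (rel_rep i)"
proof -
  have "mat_closed (mat (rel_rep i))"
    using reps_table set_labels by (simp add: list_all_iff rep_ok_def mat_rep_mat)
  moreover have "mat_mem (mat L) a b \<longleftrightarrow> (a, b) \<in> L" for L a b
    by (simp add: mat_mem_def mat_def)
  moreover have "in_sub K s1" for K by (cases K) simp_all
  then have "(s1, s1) \<in> rel_rep i" by (cases i) (simp_all add: rel_rep_def)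
  ultimately show ?thesis
    using set_all6
    by (simp add: rel_subgroup_def mat_closed_def list_all_iff closed1_def closed2_def closed3_def closed4_def)
qed


section \<open>Bisets for the symmetric group of degree three\<close>

fun tri_nat :: "tri \<Rightarrow> nat" where
  "tri_nat I0 = 1" | "tri_nat I1 = 2" | "tri_nat I2 = 3"

fun tri_act :: "s3 \<Rightarrow> tri \<Rightarrow> tri" where
  "tri_act (Rot i) j = tplus i j"
| "tri_act (Ref i) j = tplus i (tneg j)"

text \<open>The residues 0, 1, 2 become the letters 1, 2, 3 that \<open>sym_group 3\<close>
  permutes; all other numbers have to be fixed.\<close>

definition el :: "s3 \<Rightarrow> nat \<Rightarrow> nat" where
  "el g n = (if n = 1 then tri_nat (tri_act g I0) else if n = 2 then tri_nat (tri_act g I1)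
     else if n = 3 then tri_nat (tri_act g I2) else n)"

lemma el_tri_nat: "el g (tri_nat j) = tri_nat (tri_act g j)"
  by (cases j) (simp_all add: el_def)

lemma tri_act_smul: "tri_act (smul a b) j = tri_act a (tri_act b j)"
  by (cases a; cases b) (simp_all add: tplus_laws)

lemma el_smul: "el (smul a b) = el a \<circ> el b"
proof
  fix n
  consider j where "n = tri_nat j" | "n \<noteq> 1" "n \<noteq> 2" "n \<noteq> 3"
    by (metis tri_nat.simps)
  then show "el (smul a b) n = (el a \<circ> el b) n"
    by cases (simp_all add: el_tri_nat tri_act_smul, simp add: el_def)
qed

lemma el_one: "el s1 = id"
  by (auto simp: el_def fun_eq_iff)

lemma inj_el: "inj el"
proof (rule injI)
  fix a b assume "el a = el b"
  then have *: "tri_nat (tri_act a j) = tri_nat (tri_act b j)" for j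
    using el_tri_nat by metis
  have "inj tri_nat"
  proof (rule injI)
    fix i j assume "tri_nat i = tri_nat j"
    then show "i = j" by (cases i; cases j) simp_all
  qed
  then have "tri_act a I0 = tri_act b I0" "tri_act a I1 = tri_act b I1" using * by (auto dest: injD)
  moreover have "\<forall>a b. tri_act a I0 = tri_act b I0 \<longrightarrow> tri_act a I1 = tri_act b I1 \<longrightarrow> a = b"
    unfolding all_s3 by simp
  ultimately show "a = b" by blast
qed

lemma el_inverse: "el (sinv a) (el a n) = n" "el a (el (sinv a) n) = n"
  using fun_cong[OF el_smul[of "sinv a" a], of n] fun_cong[OF el_smul[of a "sinv a"], of n]
  by (simp_all add: el_one)

lemma el_permutes: "el a permutes {1..3}"
  unfolding permutes_def
proof (intro conjI allI impI)
  fix n :: nat assume "n \<notin> {1..3}"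
  then show "el a n = n" by (auto simp: el_def)
next
  fix n show "\<exists>!m. el a m = n" by (metis el_inverse)
qed

lemma card_range_el: "card (range el) = 6"
proof -
  have "card (range el) = card (UNIV :: s3 set)" by (rule card_image[OF inj_el])
  also have "\<dots> = 6" by (simp add: UNIV_s3)
  finally show ?thesis .
qed

text \<open>The six permutations \<open>el a\<close> are distinct, and there are only six
  permutations of three letters.\<close>

lemma carrier_sym_group_3: "carrier (sym_group 3) = range el"
proof -
  have "card (range el) = card {p. p permutes {1..3::nat}}"
    using card_permutations[of "{1..3::nat}" 3] unfolding card_range_el by (simp add: fact_numeral)
  moreover have "range el \<subseteq> {p. p permutes {1..3}}" using el_permutes by auto
  ultimately show ?thesis
    using card_subset_eq[of "{p. p permutes {1..3::nat}}" "range el"]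
    by (simp add: sym_group_def finite_permutations)
qed

interpretation S: biset_group "sym_group 3"
proof -
  have "finite (carrier (sym_group 3))" by (simp add: carrier_sym_group_3)
  then show "biset_group (sym_group 3)"
    using sym_group_is_group by (simp add: biset_group_def biset_group_axioms_def)
qed

lemma el_carrier [simp]: "el a \<in> carrier (sym_group 3)"
  by (simp add: carrier_sym_group_3)

lemma el_mult: "el a \<otimes>\<^bsub>sym_group 3\<^esub> el b = el (smul a b)"
  by (simp add: sym_group_mult el_smul)

lemma el_inv: "inv\<^bsub>sym_group 3\<^esub> (el a) = el (sinv a)"
  by (rule S.G.inv_equality) (simp_all add: el_mult el_one sym_group_one)

lemma card_sym_group_3: "card (carrier (sym_group 3)) = 6"
  unfolding carrier_sym_group_3 by (rule card_range_el)

definition to_rel :: "((nat \<Rightarrow> nat) \<times> (nat \<Rightarrow> nat)) set \<Rightarrow> (s3 \<times> s3) set" where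
  "to_rel L = {(a, b). (el a, el b) \<in> L}"

abbreviation "rstab M x \<equiv> to_rel (stab (sym_group 3) M x)"

abbreviation "rels \<equiv> Pow (carrier (sym_group 3) \<times> carrier (sym_group 3))"

lemma stab_rels: "stab (sym_group 3) M x \<in> rels"
  by (auto simp: stab_def)

lemma to_rel_image: "L \<in> rels \<Longrightarrow> L = map_prod el el ` to_rel L"
  by (force simp: to_rel_def carrier_sym_group_3)

lemma image_to_rel: "to_rel (map_prod el el ` L) = L"
  using inj_el by (auto simp: to_rel_def dest: injD)

lemma card_to_rel: "L \<in> rels \<Longrightarrow> card (to_rel L) = card L"
proof -
  assume "L \<in> rels"
  then have "card L = card (map_prod el el ` to_rel L)" using to_rel_image by metis
  also have "\<dots> = card (to_rel L)"
    using prod.inj_map[OF inj_el inj_el] by (intro card_image) (auto intro: inj_on_subset)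
  finally show ?thesis by simp
qed

lemma to_rel_relcomp: "L \<in> rels \<Longrightarrow> to_rel (L O P) = to_rel L O to_rel P"
  by (auto simp: to_rel_def carrier_sym_group_3)

lemma triples_to_rel:
  assumes "L \<in> rels" "P \<in> rels"
  shows "card {(a, b, c). (a, b) \<in> L \<and> (b, c) \<in> P} = triples (to_rel L) (to_rel P)"
proof -
  let ?f = "map_prod el (map_prod el el)"
  have "{(a, b, c). (a, b) \<in> L \<and> (b, c) \<in> P} = ?f ` {(a, b, c). (a, b) \<in> to_rel L \<and> (b, c) \<in> to_rel P}"
  proof (intro equalityI subsetI)
    fix t assume "t \<in> {(a, b, c). (a, b) \<in> L \<and> (b, c) \<in> P}"
    then obtain a b c where t: "t = (a, b, c)" "(a, b) \<in> L" "(b, c) \<in> P" by auto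
    moreover from this obtain a' b' c' where "a = el a'" "b = el b'" "c = el c'"
      using assms unfolding carrier_sym_group_3 by blast
    ultimately show "t \<in> ?f ` {(a, b, c). (a, b) \<in> to_rel L \<and> (b, c) \<in> to_rel P}"
      by (intro image_eqI[of _ _ "(a', b', c')"]) (simp_all add: to_rel_def)
  qed (auto simp: to_rel_def)
  moreover have "inj ?f" by (intro prod.inj_map inj_el)
  ultimately show ?thesis by (simp add: triples_def card_image inj_on_subset[OF \<open>inj ?f\<close>])
qed

lemma to_rel_conj: "to_rel (conj_rel (sym_group 3) (el g) (el h) L) = conj2 g h (to_rel L)"
  by (auto simp: to_rel_def conj_rel_def conj2_def el_inv el_mult)

lemma conj2_one: "conj2 g s1 P = conj1 g P"
  by (simp add: conj1_def conj2_def)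

lemma conj2_conj2: "conj2 (sinv x) (sinv y) (conj2 x y L) = L"
  by (auto simp: conj2_def smul_assoc)

context
  fixes M :: "(nat \<Rightarrow> nat, 'x) biset" and x :: 'x
  assumes M: "finite_biset (sym_group 3) M" and x: "x \<in> points M"
begin

lemma act_el:
  assumes "y \<in> points M"
  shows "lact M (el g) y \<in> points M" "ract M y (el g) \<in> points M"
    "lact M (el s1) y = y" "ract M y (el s1) = y"
    "lact M (el (smul g h)) y = lact M (el g) (lact M (el h) y)"
    "ract M y (el (smul g h)) = ract M (ract M y (el g)) (el h)"
    "ract M (lact M (el g) y) (el h) = lact M (el g) (ract M y (el h))"
    "lact M (el (sinv g)) (lact M (el g) y) = y" "lact M (el g) (lact M (el (sinv g)) y) = y"
  using assms S.finite_bisetD(2,3)[OF M, of "el g" y] S.finite_bisetD(4,5)[OF M, of y]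
    S.finite_bisetD(6-8)[OF M, of "el g" "el h" y] S.lact_inv[OF M, of "el g" y]
  by (simp_all add: el_mult el_inv el_one sym_group_one)

lemma rel_subgroup_stab: "rel_subgroup (rstab M x)"
  using x unfolding rel_subgroup_def to_rel_def stab_def
  by (auto simp: act_el(1-6) act_el(7)[symmetric])

lemma rstab_move: "rstab M (lact M (el g) (ract M x (el h))) = conj2 g (sinv h) (rstab M x)"
  by (simp add: S.stab_conj[OF M x] el_inv to_rel_conj)

lemma rstab_lact: "rstab M (lact M (el g) x) = conj1 g (rstab M x)"
  using rstab_move[of g s1] x by (simp add: act_el conj2_one)

lemma rstab_orbit:
  assumes "y \<in> orbit (sym_group 3) M x"
  shows "rel_label (rstab M y) = rel_label (rstab M x)" "card (rstab M y) = card (rstab M x)"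
  using assms by (auto simp: orbit_def carrier_sym_group_3 rstab_move rel_label_conj2 card_conj2)

end

text \<open>
  A transitive biset has 36 divided by the order of a stabiliser many points, so that it contributes
  \<open>coeff i\<close>, where \<open>i\<close> is the label of its stabilisers.
\<close>

definition biset_coord :: "(nat \<Rightarrow> nat, 'x) biset \<Rightarrow> coord \<Rightarrow> rat" where
  "biset_coord M k =
     (\<Sum>x\<in>points M. of_nat (card (rstab M x)) * of_int (coeff (rel_label (rstab M x)) k)) / 36"

text \<open>By \<open>weighted_sum_prod\<close> the sum over the points of the product becomes a sum
  over pairs (m, n), up to the factor 6, the order of the group. Replacing n by g n permutes the
  points of N; the sum over the six choices of g turns the term of each pair into the left side of
  \<open>mackey\<close>.\<close>

lemma biset_coord_prod:
  assumes M: "finite_biset (sym_group 3) M" and N: "finite_biset (sym_group 3) N"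
  shows "biset_coord (biset_prod (sym_group 3) M N) k = cmul (biset_coord M) (biset_coord N) k"
proof -
  define F where "F m P = (of_nat (triples (rstab M m) P) * of_int (coeff (rel_label (rstab M m O P)) k) :: rat)" for m P
  let ?w = "\<lambda>m n. (of_nat (card (rstab M m)) * of_nat (card (rstab N n)) :: rat) *
    of_int (cmul (coeff (rel_label (rstab M m))) (coeff (rel_label (rstab N n))) k)"
  have mackey': "(\<Sum>g\<in>UNIV. F m (conj1 g (rstab N n))) = ?w m n" if "m \<in> points M" "n \<in> points N" for m n
  proof -
    have "(\<Sum>g\<in>UNIV. F m (conj1 g (rstab N n))) =
        of_int (\<Sum>g\<in>UNIV. int (triples (rstab M m) (conj1 g (rstab N n))) *
          coeff (rel_label (rstab M m O conj1 g (rstab N n))) k)"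
      by (simp add: F_def)
    also have "\<dots> = ?w m n"
      unfolding mackey[OF rel_subgroup_stab[OF M that(1)] rel_subgroup_stab[OF N that(2)]] by simp
    finally show ?thesis .
  qed
  have shift: "(\<Sum>n\<in>points N. F m (rstab N n)) = (\<Sum>n\<in>points N. F m (conj1 g (rstab N n)))" for m g
  proof -
    have "bij_betw (lact N (el g)) (points N) (points N)"
      by (rule bij_betw_byWitness[where f' = "lact N (el (sinv g))"])
         (auto simp: act_el[OF N])
    then have "(\<Sum>n\<in>points N. F m (rstab N n)) = (\<Sum>n\<in>points N. F m (rstab N (lact N (el g) n)))"
      by (rule sum.reindex_bij_betw[symmetric])
    also have "\<dots> = (\<Sum>n\<in>points N. F m (conj1 g (rstab N n)))"
      by (intro sum.cong) (simp_all add: rstab_lact[OF N])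
    finally show ?thesis .
  qed
  have "6 * (36 * biset_coord (biset_prod (sym_group 3) M N) k) =
      (\<Sum>(m, n)\<in>points M \<times> points N. F m (rstab N n))"
  proof -
    have "36 * biset_coord (biset_prod (sym_group 3) M N) k =
      (\<Sum>C\<in>points (biset_prod (sym_group 3) M N). of_nat (card (stab (sym_group 3) (biset_prod (sym_group 3) M N) C)) *
        of_int (coeff (rel_label (rstab (biset_prod (sym_group 3) M N) C)) k))"
      by (simp add: biset_coord_def card_to_rel[OF stab_rels])
    then show ?thesis
      using S.weighted_sum_prod[OF M N, of "\<lambda>L. of_int (coeff (rel_label (to_rel L)) k)"]
      by (simp add: card_sym_group_3 F_def triples_to_rel[OF stab_rels stab_rels] to_rel_relcomp[OF stab_rels])
  qed
  also have "\<dots> = (\<Sum>m\<in>points M. \<Sum>n\<in>points N. F m (rstab N n))"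
    by (simp add: sum.cartesian_product)
  finally have 1: "6 * (36 * biset_coord (biset_prod (sym_group 3) M N) k) =
    (\<Sum>m\<in>points M. \<Sum>n\<in>points N. F m (rstab N n))" .
  have "6 * (\<Sum>m\<in>points M. \<Sum>n\<in>points N. F m (rstab N n)) =
      (\<Sum>g\<in>(UNIV :: s3 set). \<Sum>m\<in>points M. \<Sum>n\<in>points N. F m (rstab N n))"
    by (simp add: UNIV_s3)
  also have "\<dots> = (\<Sum>g\<in>UNIV. \<Sum>m\<in>points M. \<Sum>n\<in>points N. F m (conj1 g (rstab N n)))"
    by (rule sum.cong[OF refl], rule sum.cong[OF refl], rule shift)
  also have "\<dots> = (\<Sum>m\<in>points M. \<Sum>n\<in>points N. \<Sum>g\<in>UNIV. F m (conj1 g (rstab N n)))"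
    by (subst sum.swap, intro sum.cong refl, subst sum.swap, rule refl)
  also have "\<dots> = (\<Sum>m\<in>points M. \<Sum>n\<in>points N. ?w m n)"
    by (intro sum.cong refl) (rule mackey')
  also have "\<dots> = 36 * 36 * cmul (biset_coord M) (biset_coord N) k"
  proof -
    have eq: "biset_coord L = (\<lambda>k. 1 / 36 * (\<Sum>x\<in>points L. of_nat (card (rstab L x)) *
        of_int (coeff (rel_label (rstab L x)) k)))" for L :: "(nat \<Rightarrow> nat, 'z) biset"
      by (simp add: biset_coord_def fun_eq_iff)
    show ?thesis
      unfolding eq[of M] eq[of N] cmul_scale cmul_sum of_int_cmul
      by (simp add: sum_distrib_left mult.assoc)
  qed
  finally show ?thesis using 1 by simp
qed

lemma biset_coord_iso:
  assumes M: "finite_biset (sym_group 3) M" and "isomorphic_bisets (sym_group 3) M N"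
  shows "biset_coord M = biset_coord N"
proof -
  from assms(2) obtain f where bij: "bij_betw f (points M) (points N)"
    and f: "\<And>g x. \<lbrakk>g \<in> carrier (sym_group 3); x \<in> points M\<rbrakk> \<Longrightarrow> f (lact M g x) = lact N g (f x)"
      "\<And>g x. \<lbrakk>g \<in> carrier (sym_group 3); x \<in> points M\<rbrakk> \<Longrightarrow> f (ract M x g) = ract N (f x) g"
    unfolding isomorphic_bisets_def by blast
  have "stab (sym_group 3) N (f x) = stab (sym_group 3) M x" if x: "x \<in> points M" for x
  proof -
    have "lact N g (f x) = ract N (f x) h \<longleftrightarrow> lact M g x = ract M x h"
      if "g \<in> carrier (sym_group 3)" "h \<in> carrier (sym_group 3)" for g h
      using inj_onD[OF bij_betw_imp_inj_on[OF bij]] that x f S.finite_bisetD(2,3)[OF M] by metis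
    then show ?thesis by (auto simp: stab_def)
  qed
  then show ?thesis
    by (simp add: biset_coord_def fun_eq_iff flip: sum.reindex_bij_betw[OF bij])
qed

lemma biset_coord_sum:
  assumes "finite_biset (sym_group 3) M" "finite_biset (sym_group 3) N"
  shows "biset_coord (biset_sum M N) k = biset_coord M k + biset_coord N k"
proof -
  have "stab (sym_group 3) (biset_sum M N) (Inl x) = stab (sym_group 3) M x"
    "stab (sym_group 3) (biset_sum M N) (Inr y) = stab (sym_group 3) N y" for x y
    by (simp_all add: stab_def biset_sum_def)
  moreover have "points (biset_sum M N) = points M <+> points N" by (simp add: biset_sum_def)
  ultimately show ?thesis
    using S.finite_bisetD(1)[OF assms(1)] S.finite_bisetD(1)[OF assms(2)]
    by (simp add: biset_coord_def sum.Plus add_divide_distrib)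
qed

lemma biset_coord_transitive:
  assumes M: "finite_biset (sym_group 3) M" and x: "x \<in> points M" and "points M = orbit (sym_group 3) M x"
  shows "biset_coord M k = of_int (coeff (rel_label (rstab M x)) k)"
proof -
  have "card (rstab M x) * card (points M) = 36"
    using S.orbit_card[OF M x] assms(3) by (simp add: card_to_rel[OF stab_rels] card_sym_group_3)
  then have "(of_nat (card (rstab M x)) * of_nat (card (points M)) :: rat) = 36"
    by (metis of_nat_mult of_nat_numeral)
  moreover have "biset_coord M k = (\<Sum>y\<in>points M. of_nat (card (rstab M x)) * of_int (coeff (rel_label (rstab M x)) k)) / 36"
    unfolding biset_coord_def using rstab_orbit[OF M x] assms(3) by (intro arg_cong2[where f = "(/)"] sum.cong) auto
  ultimately show ?thesis by (simp add: mult.assoc[symmetric] mult.commute[of "of_nat (card (points M))"])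
qed

definition rep_biset :: "label \<Rightarrow> (nat \<Rightarrow> nat, ((nat \<Rightarrow> nat) \<times> (nat \<Rightarrow> nat)) set) biset" where
  "rep_biset i = S.coset_biset (map_prod el el ` rel_rep i)"

lemma rep_biset_props:
  shows "finite_biset (sym_group 3) (rep_biset i)"
    and "map_prod el el ` rel_rep i \<in> points (rep_biset i)"
    and "points (rep_biset i) = orbit (sym_group 3) (rep_biset i) (map_prod el el ` rel_rep i)"
    and "stab (sym_group 3) (rep_biset i) (map_prod el el ` rel_rep i) = map_prod el el ` rel_rep i"
proof -
  let ?L = "map_prod el el ` rel_rep i"
  note D = rel_subgroupD[OF rel_subgroup_rep[of i]]
  have L1: "?L \<subseteq> carrier (sym_group 3) \<times> carrier (sym_group 3)" by auto
  have L2: "(\<one>\<^bsub>sym_group 3\<^esub>, \<one>\<^bsub>sym_group 3\<^esub>) \<in> ?L"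
    using D(1) by (force simp: sym_group_one simp flip: el_one)
  have L3: "(a \<otimes>\<^bsub>sym_group 3\<^esub> c, b \<otimes>\<^bsub>sym_group 3\<^esub> d) \<in> ?L" if "(a, b) \<in> ?L" "(c, d) \<in> ?L" for a b c d
    using that D(2) by (fastforce simp: el_mult)
  have L4: "(inv\<^bsub>sym_group 3\<^esub> a, inv\<^bsub>sym_group 3\<^esub> b) \<in> ?L" if "(a, b) \<in> ?L" for a b
    using that D(3) by (fastforce simp: el_inv)
  show "finite_biset (sym_group 3) (rep_biset i)" "?L \<in> points (rep_biset i)"
    "points (rep_biset i) = orbit (sym_group 3) (rep_biset i) ?L"
    "stab (sym_group 3) (rep_biset i) ?L = ?L"
    unfolding rep_biset_def using S.coset_biset_props[OF L1 L2 L3 L4] by blast+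
qed

lemma biset_coord_rep: "biset_coord (rep_biset i) k = of_int (coeff i k)"
  using biset_coord_transitive[OF rep_biset_props(1,2,3)]
  by (simp add: rep_biset_props(4) image_to_rel rel_label_rep)

lemma orbit_eq:
  assumes M: "finite_biset (sym_group 3) M" and x: "x \<in> points M" and y: "y \<in> orbit (sym_group 3) M x"
  shows "orbit (sym_group 3) M y = orbit (sym_group 3) M x"
proof -
  have sub: "orbit (sym_group 3) M z \<subseteq> orbit (sym_group 3) M w"
    if "w \<in> points M" "z \<in> orbit (sym_group 3) M w" for w z
    using that S.orbit_closed[OF M that(1)] S.orbit_subset[OF M that(1)] S.finite_bisetD(3)[OF M]
    by (auto simp: orbit_def[of _ _ z])
  from y obtain g h where gh: "g \<in> carrier (sym_group 3)" "h \<in> carrier (sym_group 3)"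
    "y = lact M g (ract M x h)" by (auto simp: orbit_def)
  have "lact M (inv\<^bsub>sym_group 3\<^esub> g) (ract M y (inv\<^bsub>sym_group 3\<^esub> h)) =
      lact M (inv\<^bsub>sym_group 3\<^esub> g) (lact M g (ract M (ract M x h) (inv\<^bsub>sym_group 3\<^esub> h)))"
    unfolding gh(3) using gh(1,2) x S.finite_bisetD(3,8)[OF M] S.G.inv_closed by metis
  also have "\<dots> = x" unfolding S.ract_inv(1)[OF M gh(2) x] by (rule S.lact_inv(1)[OF M gh(1) x])
  finally have "x = lact M (inv\<^bsub>sym_group 3\<^esub> g) (ract M y (inv\<^bsub>sym_group 3\<^esub> h))" by (rule sym)
  then have "x \<in> orbit (sym_group 3) M y"
    unfolding orbit_def using gh by (intro image_eqI[of _ _ "(inv\<^bsub>sym_group 3\<^esub> g, inv\<^bsub>sym_group 3\<^esub> h)"]) (simp, blast intro: S.G.inv_closed)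
  then show ?thesis using sub[OF x y] sub[of y x] S.orbit_subset[OF M x] y by blast
qed

lemma transitive_rep:
  assumes M: "finite_biset (sym_group 3) M" and x: "x \<in> points M" and trans: "points M = orbit (sym_group 3) M x"
  shows "isomorphic_bisets (sym_group 3) M (rep_biset (rel_label (rstab M x)))"
proof -
  let ?i = "rel_label (rstab M x)"
  obtain a b where ab: "rstab M x = conj2 a b (rel_rep ?i)"
    using subgroup_classification[OF rel_subgroup_stab[OF M x]] by blast
  \<comment> \<open>This point undoes the conjugation, and its stabiliser is the representative
    itself. On the right it is b, because right multiplication conjugates by the inverse.\<close>
  define y where "y = lact M (el (sinv a)) (ract M x (el b))"
  have "rstab M y = conj2 (sinv a) (sinv b) (rstab M x)"
    unfolding y_def by (rule rstab_move[OF M x])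
  also have "\<dots> = rel_rep ?i" by (subst ab) (rule conj2_conj2)
  finally have "stab (sym_group 3) M y = map_prod el el ` rel_rep ?i"
    using to_rel_image[OF stab_rels] by metis
  moreover have "y \<in> orbit (sym_group 3) M x" unfolding y_def orbit_def by force
  ultimately show ?thesis
    using trans orbit_eq[OF M x] rep_biset_props[of ?i]
    by (intro S.transitive_isomorphic[OF M rep_biset_props(1), of y]) auto
qed


section \<open>The double Burnside algebra in coordinates\<close>

abbreviation "FB \<equiv> free_biset_algebra F3 (sym_group 3)"

abbreviation "cls \<equiv> biset_class (sym_group 3)"

lemma FB_eq: "FB = basis_algebra F3 (biset_classes (sym_group 3))
    (\<lambda>c d. Some (biset_class_mult (sym_group 3) c d)) {cls (regular_biset (sym_group 3))}"
  by (simp add: free_biset_algebra_def)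

interpretation FB: Module.module F3 FB
  unfolding FB_eq by (rule module_basis)

text \<open>\<open>biset_coord\<close> is rational on account of the division by 36, but its values
  are integers by \<open>biset_coord_int\<close>; rounding merely passes to the type of
  integers.\<close>

definition class_img :: "(nat \<Rightarrow> nat, nat) biset set \<Rightarrow> coord \<Rightarrow> 3" where
  "class_img c k = of_int \<lfloor>biset_coord (SOME M. M \<in> c) k\<rfloor>"

lemma class_img:
  assumes "finite_biset (sym_group 3) M" "biset_coord M = (\<lambda>k. of_int (z k))"
  shows "class_img (cls M) = (\<lambda>k. of_int (z k))"
proof -
  have "(SOME P. P \<in> cls M) \<in> cls M"
    using S.biset_class_nonempty[OF assms(1)] by (rule someI_ex)
  then have "biset_coord (SOME P. P \<in> cls M) = biset_coord M"
    by (intro biset_coord_iso) (auto simp: biset_class_def)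
  then show ?thesis by (simp add: fun_eq_iff class_img_def assms(2))
qed

definition rep_class :: "label \<Rightarrow> (nat \<Rightarrow> nat, nat) biset set" where
  "rep_class i = cls (rep_biset i)"

text \<open>Summing over all labels whose class is c gives the right coefficient even where classes
  of different labels might coincide, so injectivity of \<open>rep_class\<close> does not
  enter.\<close>

definition rep_comb :: "(label \<Rightarrow> int) \<Rightarrow> (nat \<Rightarrow> nat, nat) biset set \<Rightarrow> int" where
  "rep_comb m c = (\<Sum>i\<in>UNIV. if c = rep_class i then m i else 0) mod 3"

lemma rep_comb_support: "{c. rep_comb m c \<noteq> 0} \<subseteq> range rep_class"
proof
  fix c assume "c \<in> {c. rep_comb m c \<noteq> 0}"
  then have nz: "rep_comb m c \<noteq> 0" by simp
  show "c \<in> range rep_class"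
  proof (rule ccontr)
    assume "c \<notin> range rep_class"
    then have "c \<noteq> rep_class i" for i by blast
    with nz show False by (simp add: rep_comb_def)
  qed
qed

lemma rep_comb_carrier: "rep_comb m \<in> carrier FB"
proof -
  have "range rep_class \<subseteq> biset_classes (sym_group 3)"
    by (auto simp: rep_class_def intro: S.biset_class_in rep_biset_props)
  with rep_comb_support[of m] have "{c. rep_comb m c \<noteq> 0} \<subseteq> biset_classes (sym_group 3)" by blast
  moreover have "finite {c. rep_comb m c \<noteq> 0}" by (rule finite_subset[OF rep_comb_support]) simp
  ultimately show ?thesis unfolding FB_eq basis_carrier_iff by (simp add: rep_comb_def)
qed

lemma rep_comb_add: "rep_comb m \<oplus>\<^bsub>FB\<^esub> rep_comb n = rep_comb (\<lambda>i. m i + n i)"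
proof
  fix c
  have "(\<Sum>i\<in>UNIV. if c = rep_class i then m i + n i else 0) =
      (\<Sum>i\<in>UNIV. if c = rep_class i then m i else 0) + (\<Sum>i\<in>UNIV. if c = rep_class i then n i else 0)"
    unfolding sum.distrib[symmetric] by (rule sum.cong) auto
  then show "(rep_comb m \<oplus>\<^bsub>FB\<^esub> rep_comb n) c = rep_comb (\<lambda>i. m i + n i) c"
    by (simp add: FB_eq basis_add rep_comb_def mod_simps)
qed

lemma rep_comb_zero: "(\<And>i. m i mod 3 = 0) \<Longrightarrow> rep_comb m = \<zero>\<^bsub>FB\<^esub>"
proof
  fix c assume "\<And>i. m i mod 3 = 0"
  then have "3 dvd (\<Sum>i\<in>UNIV. if c = rep_class i then m i else 0)"
    by (intro dvd_sum) auto
  then show "rep_comb m c = \<zero>\<^bsub>FB\<^esub> c" by (simp add: rep_comb_def FB_eq basis_zero)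
qed

lemma rep_comb_single: "rep_comb (\<lambda>j. of_bool (j = i)) = basis_elt F3 (rep_class i)"
proof
  fix c
  have "(\<Sum>j\<in>UNIV. if c = rep_class j then of_bool (j = i) else 0) =
      (\<Sum>j\<in>UNIV. if j = i then of_bool (c = rep_class i) else (0 :: int))"
    by (rule sum.cong) auto
  then show "rep_comb (\<lambda>j. of_bool (j = i)) c = basis_elt F3 (rep_class i) c"
    by (simp add: rep_comb_def basis_elt_eq)
qed

lemma val_rep_comb: "val (rep_comb m) \<phi> = (\<Sum>i\<in>UNIV. of_int (m i) * \<phi> (rep_class i))"
proof -
  have "val (rep_comb m) \<phi> =
      (\<Sum>c\<in>range rep_class. of_int (\<Sum>i\<in>UNIV. if c = rep_class i then m i else 0) * \<phi> c)"
    by (subst val_superset[OF _ rep_comb_support]) (simp_all add: rep_comb_def)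
  also have "\<dots> = (\<Sum>i\<in>UNIV. \<Sum>c\<in>range rep_class. if c = rep_class i then of_int (m i) * \<phi> c else 0)"
    unfolding of_int_sum sum_distrib_right by (subst sum.swap) (intro sum.cong refl, auto)
  also have "\<dots> = (\<Sum>i\<in>UNIV. of_int (m i) * \<phi> (rep_class i))" by simp
  finally show ?thesis .
qed

definition biset_sum_relations :: "((nat \<Rightarrow> nat, nat) biset set \<Rightarrow> int) set" where
  "biset_sum_relations =
     {basis_elt F3 (cls (biset_sum M N)) \<ominus>\<^bsub>FB\<^esub> (basis_elt F3 (cls M) \<oplus>\<^bsub>FB\<^esub> basis_elt F3 (cls N))
       | (M :: (nat \<Rightarrow> nat, nat) biset) (N :: (nat \<Rightarrow> nat, nat) biset).
         finite_biset (sym_group 3) M \<and> finite_biset (sym_group 3) N}"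

lemma biset_relations_eq:
  "biset_relations F3 (sym_group 3) = (\<lambda>H. submodule H F3 FB) hull biset_sum_relations"
  by (simp add: biset_relations_def biset_sum_relations_def)

lemma basis_elt_cls: "finite_biset (sym_group 3) M \<Longrightarrow> basis_elt F3 (cls M) \<in> carrier FB"
  unfolding FB_eq by (intro basis_elt_carrier S.biset_class_in)

lemma submodule_FB:
  assumes "submodule J F3 FB"
  shows "J \<subseteq> carrier FB" "\<zero>\<^bsub>FB\<^esub> \<in> J" "\<lbrakk>f \<in> J; g \<in> J\<rbrakk> \<Longrightarrow> f \<oplus>\<^bsub>FB\<^esub> g \<in> J" "f \<in> J \<Longrightarrow> \<ominus>\<^bsub>FB\<^esub> f \<in> J"
proof -
  interpret submodule J F3 FB by fact
  show "J \<subseteq> carrier FB" using subset by simp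
  show "\<zero>\<^bsub>FB\<^esub> \<in> J" using one_closed by simp
  show "f \<oplus>\<^bsub>FB\<^esub> g \<in> J" if "f \<in> J" "g \<in> J" using m_closed[OF that] by simp
  show "\<ominus>\<^bsub>FB\<^esub> f \<in> J" if "f \<in> J" using m_inv_closed[OF that] by (simp add: a_inv_def)
qed

text \<open>Induction on the number of points, splitting off one orbit. The same integers
  \<open>m\<close> describe the coordinates and the class modulo J, which links the numerical and
  the formal side. J is arbitrary: the whole module yields integrality, and a submodule containing
  the relations yields the kernel.\<close>

lemma biset_decomposition:
  fixes M :: "(nat \<Rightarrow> nat, nat) biset"
  assumes J: "submodule J F3 FB" "biset_sum_relations \<subseteq> J" and "finite_biset (sym_group 3) M"
  shows "\<exists>m u. (\<forall>k. biset_coord M k = of_int (\<Sum>i\<in>UNIV. m i * coeff i k)) \<and> u \<in> J \<and>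
    basis_elt F3 (cls M) = u \<oplus>\<^bsub>FB\<^esub> rep_comb m"
  using assms(3)
proof (induction "card (points M)" arbitrary: M rule: less_induct)
  case less
  note M = less.prems
  note Jc = submodule_FB[OF J(1)]
  have sum_rel: "\<exists>u\<in>J. basis_elt F3 (cls (biset_sum P Q)) =
      u \<oplus>\<^bsub>FB\<^esub> (basis_elt F3 (cls P) \<oplus>\<^bsub>FB\<^esub> basis_elt F3 (cls Q))"
    if "finite_biset (sym_group 3) P" "finite_biset (sym_group 3) Q" for P Q :: "(nat \<Rightarrow> nat, nat) biset"
  proof -
    let ?c = "basis_elt F3 (cls P) \<oplus>\<^bsub>FB\<^esub> basis_elt F3 (cls Q)"
    have c: "?c \<in> carrier FB" using that by (intro FB.a_closed basis_elt_cls)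
    define u where "u = basis_elt F3 (cls (biset_sum P Q)) \<ominus>\<^bsub>FB\<^esub> ?c"
    have "u \<in> J"
      using J(2) that unfolding biset_sum_relations_def u_def by blast
    moreover have "basis_elt F3 (cls (biset_sum P Q)) = u \<oplus>\<^bsub>FB\<^esub> ?c"
      unfolding u_def using c basis_elt_cls[OF S.finite_biset_sum[OF that]]
      by (simp add: FB.minus_eq FB.a_assoc FB.l_neg del: FB.add.m_closed)
    ultimately show ?thesis by blast
  qed
  show ?case
  proof (cases "points M = {}")
    case True
    \<comment> \<open>The empty biset is isomorphic to its sum with itself, so that its class is the
      negative of a relation and lies in J.\<close>
    have "isomorphic_bisets (sym_group 3) M (biset_sum M M)"
      unfolding isomorphic_bisets_def using True by (auto simp: biset_sum_def bij_betw_def)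
    then have "cls (biset_sum M M) = cls M"
      using S.biset_class_eq_iff[OF M S.finite_biset_sum[OF M M]] by simp
    then obtain u where u: "u \<in> J" "basis_elt F3 (cls M) = u \<oplus>\<^bsub>FB\<^esub> (basis_elt F3 (cls M) \<oplus>\<^bsub>FB\<^esub> basis_elt F3 (cls M))"
      using sum_rel[OF M M] by auto
    have uc: "u \<in> carrier FB" using u(1) Jc(1) by blast
    have b: "basis_elt F3 (cls M) \<in> carrier FB" by (rule basis_elt_cls[OF M])
    have "\<zero>\<^bsub>FB\<^esub> \<oplus>\<^bsub>FB\<^esub> basis_elt F3 (cls M) = (u \<oplus>\<^bsub>FB\<^esub> basis_elt F3 (cls M)) \<oplus>\<^bsub>FB\<^esub> basis_elt F3 (cls M)"
      using u(2) uc b by (simp add: FB.a_assoc)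
    then have "u \<oplus>\<^bsub>FB\<^esub> basis_elt F3 (cls M) = \<zero>\<^bsub>FB\<^esub>"
      using uc b by (metis FB.a_closed FB.add.right_cancel FB.zero_closed)
    then have "basis_elt F3 (cls M) = \<ominus>\<^bsub>FB\<^esub> u"
      using uc b by (metis FB.a_comm FB.minus_equality)
    then have "basis_elt F3 (cls M) \<in> J" using Jc(4)[OF u(1)] by simp
    moreover have "rep_comb (\<lambda>i. 0) = \<zero>\<^bsub>FB\<^esub>" by (rule rep_comb_zero) simp
    ultimately show ?thesis
      using True b by (intro exI[of _ "\<lambda>i. 0"] exI[of _ "basis_elt F3 (cls M)"]) (simp add: biset_coord_def)
  next
    case False
    then obtain x where x: "x \<in> points M" by blast
    define A where "A = orbit (sym_group 3) M x"
    define B where "B = points M - A"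
    have A: "A \<subseteq> points M" "x \<in> A" using S.orbit_subset[OF M x] S.orbit_self[OF M x] by (simp_all add: A_def)
    have closed: "lact M g y \<in> A \<and> ract M y g \<in> A" if "g \<in> carrier (sym_group 3)" "y \<in> A" for g y
      using that A(1) S.orbit_closed[OF M x] by (auto simp: A_def)
    have closedB: "lact M g y \<in> B \<and> ract M y g \<in> B" if "g \<in> carrier (sym_group 3)" "y \<in> B" for g y
      using that S.orbit_closed[OF M x] S.finite_bisetD(2,3)[OF M] by (auto simp: A_def B_def)
    have fin: "finite_biset (sym_group 3) (sub_biset M A)" "finite_biset (sym_group 3) (sub_biset M B)"
      using closed closedB A(1) by (auto intro!: S.finite_sub_biset[OF M] simp: B_def)
    let ?i = "rel_label (rstab (sub_biset M A) x)"
    have x': "x \<in> points (sub_biset M A)" using A(2) by (simp add: sub_biset_def)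
    have "points (sub_biset M A) = orbit (sym_group 3) (sub_biset M A) x"
      by (simp add: sub_biset_def A_def orbit_def)
    note iso = transitive_rep[OF fin(1) x' this]
    then have clsA: "cls (sub_biset M A) = rep_class ?i"
      by (simp add: rep_class_def S.biset_class_eq_iff fin rep_biset_props)
    have coordA: "biset_coord (sub_biset M A) k = of_int (coeff ?i k)" for k
      by (simp add: biset_coord_iso[OF fin(1) iso] biset_coord_rep)
    have iso_sum: "isomorphic_bisets (sym_group 3) M (biset_sum (sub_biset M A) (sub_biset M B))"
      by (rule S.sub_biset_sum) (use A closed closedB in \<open>auto simp: B_def\<close>)
    then have clsM: "cls M = cls (biset_sum (sub_biset M A) (sub_biset M B))"
      by (simp add: S.biset_class_eq_iff M fin S.finite_biset_sum)
    have "card (points (sub_biset M B)) < card (points M)"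
      using x A S.finite_bisetD(1)[OF M] by (auto simp: sub_biset_def B_def intro!: psubset_card_mono)
    then obtain m u where IH: "\<And>k. biset_coord (sub_biset M B) k = of_int (\<Sum>i\<in>UNIV. m i * coeff i k)"
      "u \<in> J" "basis_elt F3 (cls (sub_biset M B)) = u \<oplus>\<^bsub>FB\<^esub> rep_comb m"
      using less.hyps[OF _ fin(2)] by blast
    obtain v where v: "v \<in> J" "basis_elt F3 (cls M) =
        v \<oplus>\<^bsub>FB\<^esub> (basis_elt F3 (rep_class ?i) \<oplus>\<^bsub>FB\<^esub> basis_elt F3 (cls (sub_biset M B)))"
      using sum_rel[OF fin] unfolding clsM[symmetric] clsA by blast
    let ?m = "\<lambda>j. of_bool (j = ?i) + m j"
    have "biset_coord M k = of_int (\<Sum>i\<in>UNIV. ?m i * coeff i k)" for k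
    proof -
      have "biset_coord M k = of_int (coeff ?i k + (\<Sum>i\<in>UNIV. m i * coeff i k))"
        by (simp add: biset_coord_iso[OF M iso_sum] biset_coord_sum[OF fin] coordA IH(1))
      then show ?thesis by (simp add: algebra_simps sum.distrib of_bool_def if_distrib[of "\<lambda>a. _ * a"] cong: if_cong)
    qed
    moreover have "basis_elt F3 (cls M) = (v \<oplus>\<^bsub>FB\<^esub> u) \<oplus>\<^bsub>FB\<^esub> rep_comb ?m"
    proof -
      have uv: "u \<in> carrier FB" "v \<in> carrier FB" using IH(2) v(1) Jc(1) by blast+
      show ?thesis
        unfolding v(2) IH(3) rep_comb_single[symmetric] rep_comb_add[symmetric]
        using uv rep_comb_carrier by (simp add: FB.a_ac)
    qed
    ultimately show ?thesis using Jc(3)[OF v(1) IH(2)] by (intro exI[of _ ?m] exI[of _ "v \<oplus>\<^bsub>FB\<^esub> u"]) simp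
  qed
qed

lemma biset_coord_int:
  fixes M :: "(nat \<Rightarrow> nat, nat) biset"
  assumes "finite_biset (sym_group 3) M"
  shows "\<exists>z. biset_coord M = (\<lambda>k. of_int (z k))"
proof -
  \<comment> \<open>With the whole module as J, only the assertion about coordinates is left of the
    decomposition.\<close>
  have "biset_sum_relations \<subseteq> carrier FB"
    by (auto simp: biset_sum_relations_def intro!: FB.minus_closed FB.a_closed basis_elt_cls S.finite_biset_sum)
  from biset_decomposition[OF FB.carrier_is_submodule this assms]
  obtain m where "\<forall>k. biset_coord M k = of_int (\<Sum>i\<in>UNIV. m i * coeff i k)" by blast
  then show ?thesis by (intro exI[of _ "\<lambda>k. \<Sum>i\<in>UNIV. m i * coeff i k"] ext) simp
qed

lemma class_img_rep: "class_img (rep_class i) = (\<lambda>k. of_int (coeff i k))"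
  unfolding rep_class_def by (intro class_img rep_biset_props ext biset_coord_rep)

lemma class_img_mult:
  assumes "c \<in> biset_classes (sym_group 3)" "d \<in> biset_classes (sym_group 3)"
  shows "class_img (biset_class_mult (sym_group 3) c d) k = cmul (class_img c) (class_img d) k"
proof -
  obtain M :: "(nat \<Rightarrow> nat, nat) biset" where M: "finite_biset (sym_group 3) M" "c = cls M"
    using assms(1) by (rule S.biset_classE)
  obtain N :: "(nat \<Rightarrow> nat, nat) biset" where N: "finite_biset (sym_group 3) N" "d = cls N"
    using assms(2) by (rule S.biset_classE)
  obtain z where z: "biset_coord M = (\<lambda>k. of_int (z k))" using biset_coord_int[OF M(1)] by blast
  obtain w where w: "biset_coord N = (\<lambda>k. of_int (w k))" using biset_coord_int[OF N(1)] by blast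
  have "biset_coord (biset_prod (sym_group 3) M N) = (\<lambda>k. of_int (cmul z w k))"
    by (simp add: fun_eq_iff biset_coord_prod[OF M(1) N(1)] z w of_int_cmul)
  note img = class_img[OF S.finite_biset_prod[OF M(1) N(1)] this] class_img[OF M(1) z] class_img[OF N(1) w]
  show ?thesis
    by (simp add: M(2) N(2) S.biset_class_mult_eq[OF M(1) N(1)] img of_int_cmul)
qed

lemma class_mult_closed:
  assumes "c \<in> biset_classes (sym_group 3)" "d \<in> biset_classes (sym_group 3)"
  shows "biset_class_mult (sym_group 3) c d \<in> biset_classes (sym_group 3)"
proof -
  obtain M :: "(nat \<Rightarrow> nat, nat) biset" where M: "finite_biset (sym_group 3) M" "c = cls M"
    using assms(1) by (rule S.biset_classE)
  obtain N :: "(nat \<Rightarrow> nat, nat) biset" where N: "finite_biset (sym_group 3) N" "d = cls N"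
    using assms(2) by (rule S.biset_classE)
  show ?thesis
    using M N by (simp add: S.biset_class_mult_eq S.biset_class_in S.finite_biset_prod)
qed

lemma finite_regular_biset: "finite_biset (sym_group 3) (regular_biset (sym_group 3))"
  unfolding finite_biset_def regular_biset_def
  by (simp add: S.finite_G S.G.m_assoc S.G.m_closed)

lemma class_img_regular: "class_img (cls (regular_biset (sym_group 3))) k = cone k"
proof -
  let ?M = "regular_biset (sym_group 3)"
  have x: "el s1 \<in> points ?M" by (simp add: regular_biset_def)
  have "points ?M = orbit (sym_group 3) ?M (el s1)"
  proof (intro equalityI subsetI)
    fix y assume "y \<in> points ?M"
    then obtain a where "y = el a" by (auto simp: regular_biset_def carrier_sym_group_3)
    then show "y \<in> orbit (sym_group 3) ?M (el s1)"
      unfolding orbit_def by (intro image_eqI[of _ _ "(el a, el s1)"]) (auto simp: regular_biset_def sym_group_mult el_one el_carrier[of s1, unfolded el_one])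
  qed (use S.orbit_subset[OF finite_regular_biset x] in blast)
  note coord = biset_coord_transitive[OF finite_regular_biset x this]
  have "rstab ?M (el s1) = rel_rep Diag"
    using inj_el by (auto simp: to_rel_def stab_def regular_biset_def rel_rep_def el_mult inj_eq)
  then have "biset_coord ?M = (\<lambda>k. of_int (coeff Diag k))"
    by (simp add: fun_eq_iff coord rel_label_rep)
  from class_img[OF finite_regular_biset this] have "class_img (cls ?M) k = of_int (cone k)" by simp
  then show ?thesis by (cases k rule: cone.cases) auto
qed

section \<open>The homomorphism to the coordinate algebra and its kernel\<close>

definition burnside_hom :: "((nat \<Rightarrow> nat, nat) biset set \<Rightarrow> int) \<Rightarrow> coord \<Rightarrow> 3" where
  "burnside_hom f k = val f (\<lambda>c. class_img c k)"

lemma burnside_hom_add: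
  "\<lbrakk>f \<in> carrier FB; g \<in> carrier FB\<rbrakk> \<Longrightarrow> burnside_hom (f \<oplus>\<^bsub>FB\<^esub> g) = (\<lambda>k. burnside_hom f k + burnside_hom g k)"
  unfolding FB_eq by (simp add: fun_eq_iff burnside_hom_def val_add[OF basis_finite basis_finite])

lemma burnside_hom_basis: "burnside_hom (basis_elt F3 c) = class_img c"
  by (simp add: fun_eq_iff burnside_hom_def val_basis_elt)

lemma burnside_hom_rep_comb: "burnside_hom (rep_comb m) = coeff_map (\<lambda>i. of_int (m i))"
  by (simp add: fun_eq_iff burnside_hom_def val_rep_comb class_img_rep coeff_map_def)

lemma burnside_hom_zero: "burnside_hom \<zero>\<^bsub>FB\<^esub> = (\<lambda>k. 0)"
  by (simp add: fun_eq_iff burnside_hom_def FB_eq basis_zero val_def)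

lemma burnside_hom_smult:
  "f \<in> carrier FB \<Longrightarrow> burnside_hom (r \<odot>\<^bsub>FB\<^esub> f) = (\<lambda>k. of_int r * burnside_hom f k)"
  unfolding FB_eq by (simp add: fun_eq_iff burnside_hom_def val_smult[OF basis_finite])

lemma burnside_hom_mult:
  assumes "f \<in> carrier FB" "g \<in> carrier FB"
  shows "burnside_hom (f \<otimes>\<^bsub>FB\<^esub> g) = cmul (burnside_hom f) (burnside_hom g)"
proof
  fix k
  note fin = assms[unfolded FB_eq, THEN basis_finite]
  have "burnside_hom (f \<otimes>\<^bsub>FB\<^esub> g) k =
      val f (\<lambda>a. val g (\<lambda>b. class_img (biset_class_mult (sym_group 3) a b) k))"
    unfolding FB_eq burnside_hom_def val_mult(1)[OF fin] by simp
  also have "\<dots> = val f (\<lambda>a. val g (\<lambda>b. cmul (class_img a) (class_img b) k))"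
    using assms by (intro val_cong) (auto simp: class_img_mult FB_eq basis_carrier_iff subset_iff)
  also have "\<dots> = cmul (burnside_hom f) (burnside_hom g) k"
    unfolding burnside_hom_def[abs_def] cmul_val by simp
  finally show "burnside_hom (f \<otimes>\<^bsub>FB\<^esub> g) k = cmul (burnside_hom f) (burnside_hom g) k" .
qed

lemma burnside_hom_sum_relations:
  assumes "f \<in> biset_sum_relations"
  shows "f \<in> carrier FB" "burnside_hom f = (\<lambda>k. 0)"
proof -
  from assms obtain M N :: "(nat \<Rightarrow> nat, nat) biset"
    where M: "finite_biset (sym_group 3) M" and N: "finite_biset (sym_group 3) N"
      and f: "f = basis_elt F3 (cls (biset_sum M N)) \<ominus>\<^bsub>FB\<^esub> (basis_elt F3 (cls M) \<oplus>\<^bsub>FB\<^esub> basis_elt F3 (cls N))"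
    unfolding biset_sum_relations_def by blast
  let ?b = "basis_elt F3 (cls (biset_sum M N))"
  note b = basis_elt_cls[OF M] basis_elt_cls[OF N] basis_elt_cls[OF S.finite_biset_sum[OF M N]]
  show fc: "f \<in> carrier FB" unfolding f using b by (intro FB.minus_closed FB.a_closed)
  obtain z where z: "biset_coord M = (\<lambda>k. of_int (z k))" using biset_coord_int[OF M] by blast
  obtain w where w: "biset_coord N = (\<lambda>k. of_int (w k))" using biset_coord_int[OF N] by blast
  have "biset_coord (biset_sum M N) = (\<lambda>k. of_int (z k + w k))"
    by (simp add: fun_eq_iff biset_coord_sum[OF M N] z w)
  note img = class_img[OF S.finite_biset_sum[OF M N] this] class_img[OF M z] class_img[OF N w]
  have "f \<oplus>\<^bsub>FB\<^esub> (basis_elt F3 (cls M) \<oplus>\<^bsub>FB\<^esub> basis_elt F3 (cls N)) = ?b"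
    unfolding f using b by (simp add: FB.minus_eq FB.a_assoc FB.l_neg)
  then have "burnside_hom (f \<oplus>\<^bsub>FB\<^esub> (basis_elt F3 (cls M) \<oplus>\<^bsub>FB\<^esub> basis_elt F3 (cls N))) k = burnside_hom ?b k" for k
    by simp
  then show "burnside_hom f = (\<lambda>k. 0)"
    using fc b by (simp add: fun_eq_iff burnside_hom_add burnside_hom_basis img)
qed

lemma burnside_kernel:
  "biset_relations F3 (sym_group 3) = {f \<in> carrier FB. burnside_hom f = (\<lambda>k. 0)}" (is "_ = ?ker")
proof
  have "submodule ?ker F3 FB"
  proof (rule FB.submoduleI)
    fix f assume f: "f \<in> ?ker"
    then have "burnside_hom (f \<oplus>\<^bsub>FB\<^esub> \<ominus>\<^bsub>FB\<^esub> f) = burnside_hom (\<ominus>\<^bsub>FB\<^esub> f)"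
      by (subst burnside_hom_add) auto
    with f show "\<ominus>\<^bsub>FB\<^esub> f \<in> ?ker" by (auto simp: FB.r_neg burnside_hom_zero)
  next
    fix r f assume "f \<in> ?ker"
    then show "r \<odot>\<^bsub>FB\<^esub> f \<in> ?ker"
      by (simp add: burnside_hom_smult) (simp add: FB_eq basis_smult_closed)
  qed (auto simp: burnside_hom_add burnside_hom_zero)
  then show "biset_relations F3 (sym_group 3) \<subseteq> ?ker"
    unfolding biset_relations_eq using burnside_hom_sum_relations by (intro hull_minimal) auto
next
  show "?ker \<subseteq> biset_relations F3 (sym_group 3)"
  proof
    fix f assume f: "f \<in> ?ker"
    have "f \<in> J" if J: "submodule J F3 FB" "biset_sum_relations \<subseteq> J" for J
    proof -
      note Jc = submodule_FB[OF J(1)]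
      \<comment> \<open>Modulo J each element is a combination of transitive classes with the same
        image. If that image is zero, \<open>coeff_map_inj\<close> forces the combination to vanish
        modulo 3, and only the part in J remains.\<close>
      define H where "H = {g. \<exists>m u. u \<in> J \<and> g = u \<oplus>\<^bsub>FB\<^esub> rep_comb m \<and> burnside_hom g = coeff_map (\<lambda>i. of_int (m i))}"
      have zero: "rep_comb (\<lambda>i. 0) = \<zero>\<^bsub>FB\<^esub>" by (rule rep_comb_zero) simp
      have "f \<in> H"
      proof (rule basis_span)
        have "\<zero>\<^bsub>FB\<^esub> \<in> H"
          unfolding H_def mem_Collect_eq
          by (intro exI[of _ "\<lambda>i. 0"] exI[of _ "\<zero>\<^bsub>FB\<^esub>"])
            (simp add: Jc(2) zero, simp add: burnside_hom_rep_comb flip: zero)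
        then show "(\<lambda>s. 0) \<in> H" by (simp add: FB_eq basis_zero)
        show "f \<in> carrier (basis_algebra F3 (biset_classes (sym_group 3))
            (\<lambda>c d. Some (biset_class_mult (sym_group 3) c d)) {cls (regular_biset (sym_group 3))})"
          using f by (simp flip: FB_eq)
        fix g h assume "g \<in> H" "h \<in> H"
        then obtain m u n v where
          g: "u \<in> J" "g = u \<oplus>\<^bsub>FB\<^esub> rep_comb m" "burnside_hom g = coeff_map (\<lambda>i. of_int (m i))" and
          h: "v \<in> J" "h = v \<oplus>\<^bsub>FB\<^esub> rep_comb n" "burnside_hom h = coeff_map (\<lambda>i. of_int (n i))"
          unfolding H_def by blast
        have uv: "u \<in> carrier FB" "v \<in> carrier FB" using g(1) h(1) Jc(1) by blast+
        then have "g \<oplus>\<^bsub>FB\<^esub> h = (u \<oplus>\<^bsub>FB\<^esub> v) \<oplus>\<^bsub>FB\<^esub> rep_comb (\<lambda>i. m i + n i)"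
          unfolding g(2) h(2) rep_comb_add[symmetric] using rep_comb_carrier by (simp add: FB.a_ac)
        moreover have "g \<in> carrier FB" "h \<in> carrier FB"
          unfolding g(2) h(2) using uv rep_comb_carrier by simp_all
        then have "burnside_hom (g \<oplus>\<^bsub>FB\<^esub> h) = coeff_map (\<lambda>i. of_int (m i + n i))"
          by (simp add: burnside_hom_add g(3) h(3) fun_eq_iff coeff_map_def algebra_simps sum.distrib)
        ultimately have "g \<oplus>\<^bsub>FB\<^esub> h \<in> H"
          unfolding H_def using Jc(3)[OF g(1) h(1)] by blast
        then show "g \<oplus>\<^bsub>basis_algebra F3 (biset_classes (sym_group 3))
            (\<lambda>c d. Some (biset_class_mult (sym_group 3) c d)) {cls (regular_biset (sym_group 3))}\<^esub> h \<in> H"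
          by (simp flip: FB_eq)
      next
        fix c assume "f c \<noteq> 0"
        then have "c \<in> biset_classes (sym_group 3)"
          using f by (auto simp: FB_eq basis_carrier_iff)
        then obtain M :: "(nat \<Rightarrow> nat, nat) biset" where M: "finite_biset (sym_group 3) M" "c = cls M"
          by (rule S.biset_classE)
        obtain m u where m: "biset_coord M = (\<lambda>k. of_int (\<Sum>i\<in>UNIV. m i * coeff i k))"
          and u: "u \<in> J" "basis_elt F3 c = u \<oplus>\<^bsub>FB\<^esub> rep_comb m"
          using biset_decomposition[OF J M(1)] unfolding M(2) fun_eq_iff[of "biset_coord M"] by blast
        have "burnside_hom (basis_elt F3 c) = coeff_map (\<lambda>i. of_int (m i))"
          unfolding burnside_hom_basis M(2)
          by (simp add: fun_eq_iff class_img[OF M(1) m] coeff_map_def)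
        with u show "basis_elt F3 c \<in> H" unfolding H_def by blast
      qed
      then obtain m u where u: "u \<in> J" "f = u \<oplus>\<^bsub>FB\<^esub> rep_comb m"
        and m: "burnside_hom f = coeff_map (\<lambda>i. of_int (m i))" unfolding H_def by blast
      have "coeff_map (\<lambda>i. of_int (m i)) = coeff_map (\<lambda>i. 0)"
        using f unfolding m[symmetric] by (simp add: fun_eq_iff coeff_map_def)
      from injD[OF coeff_map_inj, OF this] have "(of_int (m i) :: 3) = of_int 0" for i
        by (simp add: fun_eq_iff)
      then have "rep_comb m = \<zero>\<^bsub>FB\<^esub>" unfolding of_int_3_eq_iff by (intro rep_comb_zero) simp
      then show "f \<in> J" using u Jc(1) by auto
    qed
    then show "f \<in> biset_relations F3 (sym_group 3)"
      unfolding biset_relations_eq hull_def by simp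
  qed
qed

lemma Burnside_quotient:
  "algebra_quotient FB (coord_algebra UNIV) F3 (smult FB) burnside_hom (biset_relations F3 (sym_group 3))"
proof
  have one: "\<one>\<^bsub>FB\<^esub> = basis_elt F3 (cls (regular_biset (sym_group 3)))"
    by (simp add: FB_eq basis_one basis_elt_eq)
  show "\<one>\<^bsub>FB\<^esub> \<in> carrier FB" unfolding one by (rule basis_elt_cls[OF finite_regular_biset])
  show "burnside_hom \<one>\<^bsub>FB\<^esub> = \<one>\<^bsub>coord_algebra UNIV\<^esub>"
    unfolding one burnside_hom_basis by (simp add: fun_eq_iff class_img_regular coord_algebra_def)
  show "f \<otimes>\<^bsub>FB\<^esub> g \<in> carrier FB" if "f \<in> carrier FB" "g \<in> carrier FB" for f g
    using that unfolding FB_eq by (intro basis_mult_closed) (auto simp: class_mult_closed)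
  show "r \<odot>\<^bsub>FB\<^esub> f \<in> carrier FB" if "f \<in> carrier FB" for r f
    using that unfolding FB_eq by (rule basis_smult_closed)
  show "burnside_hom ` carrier FB = carrier (coord_algebra UNIV)"
  proof (intro equalityI subsetI)
    fix x :: "coord \<Rightarrow> 3"
    obtain n where n: "coeff_map n = x" using coeff_map_surj by (metis surjD)
    obtain r :: "3 \<Rightarrow> int" where r: "\<And>c. of_int (r c) = c" using of_int_3_surj by metis
    have "burnside_hom (rep_comb (\<lambda>i. r (n i))) = x" by (simp add: burnside_hom_rep_comb r n)
    then show "x \<in> burnside_hom ` carrier FB" using rep_comb_carrier by blast
  qed (simp add: coord_algebra_def)
qed (simp_all add: burnside_kernel burnside_hom_add burnside_hom_mult burnside_hom_smult
    unital_algebra_coord, simp_all add: coord_algebra_def)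


section \<open>Fullness of the corner\<close>

text \<open>The matrix units that make the first two idempotents of the \<open>3 \<times> 3\<close> block equivalent to the third.\<close>

definition corner_left :: "nat \<Rightarrow> coord \<Rightarrow> 3" where
  "corner_left i = (if i = 0 then (\<lambda>k. if k \<in> corner_coords then cone k else 0)
     else if i = 1 then unit_coord (cS I2 I0) else unit_coord (cS I2 I1))"

definition corner_right :: "nat \<Rightarrow> coord \<Rightarrow> 3" where
  "corner_right i = (if i = 0 then (\<lambda>k. if k \<in> corner_coords then cone k else 0)
     else if i = 1 then unit_coord (cS I0 I2) else unit_coord (cS I1 I2))"

lemma corner_full:
  "(\<lambda>k. cmul (corner_right 0) (corner_left 0) k + (cmul (corner_right 1) (corner_left 1) k +
     cmul (corner_right 2) (corner_left 2) k)) = cone"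
  "cmul (corner_left 0) (corner_left i) = corner_left i"
  by (simp_all add: coord_eq_iff corner_left_def corner_right_def unit_coord_def tsum_def corner_coords_def)

theorem corollary16:
  shows "isomorphic_algebras F3 (reduction 3 Lambda3')
           (quotient_algebra (smult F3Psi) F3Psi Psi_ideal)
         \<and> morita_equivalent TYPE('u :: infinite)
             (double_burnside_algebra F3 (sym_group 3)) (reduction 3 Lambda3')"
proof
  show "isomorphic_algebras F3 (reduction 3 Lambda3') (quotient_algebra (smult F3Psi) F3Psi Psi_ideal)"
    using isomorphic_algebras_quotients[OF Lambda_quotient path_quotient] by (simp add: reduction_def)
  let ?C = "coord_algebra UNIV" and ?K = "coord_algebra corner_coords"
  interpret A: algebra_quotient FB ?C F3 "smult FB" burnside_hom "biset_relations F3 (sym_group 3)"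
    by (rule Burnside_quotient)
  interpret B: algebra_quotient Lambda3' ?K F3 "\<lambda>k x. of_int k \<odot>\<^bsub>Lambda3'\<^esub> x" Lambda_hom
    "(\<lambda>x. of_int 3 \<odot>\<^bsub>Lambda3'\<^esub> x) ` carrier Lambda3'"
    by (rule Lambda_quotient)
  interpret AQ: Ring.ring A.Q using A.unital_algebra_quotient by (simp add: unital_algebra_def)
  interpret BQ: Ring.ring B.Q using B.unital_algebra_quotient by (simp add: unital_algebra_def)
  \<comment> \<open>The corner is embedded by rereading coordinates: a class of arrays and a class
    of combinations of bisets correspond if they have the same coordinate function, which is zero
    outside of \<open>corner_coords\<close>.\<close>
  let ?h = "A.fib \<circ> inv_into (carrier ?K) B.fib"
  have h: "?h (B.fib x) = A.fib x" if "x \<in> carrier ?K" for x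
    using B.fib_bij that by (simp add: bij_betw_def)
  have C: "x \<in> carrier ?C" for x by (simp add: coord_algebra_def)
  have K1: "\<one>\<^bsub>?K\<^esub> \<in> carrier ?K" "\<one>\<^bsub>?K\<^esub> = corner_left 0"
    by (simp_all add: coord_algebra_def corner_left_def)
  have ops: "x \<oplus>\<^bsub>?C\<^esub> y = x \<oplus>\<^bsub>?K\<^esub> y" "x \<otimes>\<^bsub>?C\<^esub> y = cmul x y" "x \<otimes>\<^bsub>?K\<^esub> y = cmul x y"
    "\<one>\<^bsub>?C\<^esub> = cone" for x y
    by (simp_all add: coord_algebra_def)
  have K: "x \<oplus>\<^bsub>?K\<^esub> y \<in> carrier ?K" "cmul x y \<in> carrier ?K" if "x \<in> carrier ?K" "y \<in> carrier ?K" for x y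
  proof -
    interpret K: Ring.ring ?K using unital_algebra_corner_coord by (simp add: unital_algebra_def)
    show "x \<oplus>\<^bsub>?K\<^esub> y \<in> carrier ?K" "cmul x y \<in> carrier ?K"
      using K.a_closed[OF that] K.m_closed[OF that] by (simp_all add: ops)
  qed
  have h1: "?h \<one>\<^bsub>B.Q\<^esub> = A.fib (corner_left 0)"
    unfolding B.quotient_simps(2) K1(2) by (rule h[OF K1(1)[unfolded K1(2)]])
  have "full_corner A.Q B.Q ?h 3 (\<lambda>i. A.fib (corner_left i)) (\<lambda>i. A.fib (corner_right i))"
  proof (intro full_corner.intro full_corner_axioms.intro AQ.ring_axioms BQ.ring_axioms)
    fix b assume "b \<in> carrier B.Q"
    then obtain x where x: "x \<in> carrier ?K" "b = B.fib x" unfolding B.quotient_simps(1) by blast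
    show "?h b \<in> carrier A.Q" unfolding x(2) h[OF x(1)] A.quotient_simps(1) using C by blast
  next
    fix b c assume "b \<in> carrier B.Q" "c \<in> carrier B.Q"
    then obtain x y where xy: "x \<in> carrier ?K" "b = B.fib x" "y \<in> carrier ?K" "c = B.fib y"
      unfolding B.quotient_simps(1) by blast
    show "?h (b \<oplus>\<^bsub>B.Q\<^esub> c) = ?h b \<oplus>\<^bsub>A.Q\<^esub> ?h c"
      unfolding xy(2,4) B.quotient_simps(4)[OF xy(1,3)] h[OF xy(1)] h[OF xy(3)] h[OF K(1)[OF xy(1,3)]]
        A.quotient_simps(4)[OF C C] ops(1) by (rule refl)
    show "?h (b \<otimes>\<^bsub>B.Q\<^esub> c) = ?h b \<otimes>\<^bsub>A.Q\<^esub> ?h c"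
      unfolding xy(2,4) B.quotient_simps(5)[OF xy(1,3)] ops h[OF xy(1)] h[OF xy(3)] h[OF K(2)[OF xy(1,3)]]
        A.quotient_simps(5)[OF C C] by (rule refl)
  next
    have "inj_on A.fib (carrier ?K)"
      using A.fib_bij C by (auto simp: bij_betw_def intro: inj_on_subset)
    then show "inj_on ?h (carrier B.Q)"
      using bij_betw_inv_into[OF B.fib_bij] by (auto simp: bij_betw_def intro: comp_inj_on)
  next
    fix a assume "a \<in> carrier A.Q"
    then obtain x where a: "a = A.fib x" unfolding A.quotient_simps(1) by blast
    \<comment> \<open>Multiplication by the corner idempotent from both sides clears the coordinates
      outside of \<open>corner_coords\<close>, so \<open>?y\<close> is the coordinate function of a
      class of arrays.\<close>
    let ?y = "cmul (cmul (corner_left 0) x) (corner_left 0)"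
    have "\<forall>k. k \<notin> corner_coords \<longrightarrow> ?y k = 0"
      unfolding corner_coords_iff by (simp add: tsum_def corner_left_def corner_coords_def)
    then have y: "?y \<in> carrier ?K" by (simp add: coord_algebra_def)
    have "?h \<one>\<^bsub>B.Q\<^esub> \<otimes>\<^bsub>A.Q\<^esub> a \<otimes>\<^bsub>A.Q\<^esub> ?h \<one>\<^bsub>B.Q\<^esub> = A.fib ?y"
      unfolding h1 a by (simp add: A.quotient_simps C ops)
    also have "\<dots> = ?h (B.fib ?y)" by (rule h[OF y, symmetric])
    finally show "?h \<one>\<^bsub>B.Q\<^esub> \<otimes>\<^bsub>A.Q\<^esub> a \<otimes>\<^bsub>A.Q\<^esub> ?h \<one>\<^bsub>B.Q\<^esub> \<in> ?h ` carrier B.Q"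
      using y unfolding B.quotient_simps(1) by blast
  next
    have "{..<3} = {0, 1, 2 :: nat}" by auto
    moreover have "A.fib x \<in> carrier A.Q" for x by (simp add: A.quotient_simps(1) C)
    ultimately have "(\<Oplus>\<^bsub>A.Q\<^esub>i\<in>{..<3}. A.fib (corner_right i) \<otimes>\<^bsub>A.Q\<^esub> A.fib (corner_left i)) =
        A.fib (cmul (corner_right 0) (corner_left 0)) \<oplus>\<^bsub>A.Q\<^esub>
        (A.fib (cmul (corner_right 1) (corner_left 1)) \<oplus>\<^bsub>A.Q\<^esub> A.fib (cmul (corner_right 2) (corner_left 2)))"
      by (simp add: AQ.finsum_insert A.quotient_simps(5) C ops)
    also have "\<dots> = A.fib cone"
      by (simp add: A.quotient_simps(4) C) (simp add: coord_algebra_def corner_full(1)[simplified])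
    also have "\<dots> = \<one>\<^bsub>A.Q\<^esub>" by (simp add: A.quotient_simps(2) ops)
    finally show "(\<Oplus>\<^bsub>A.Q\<^esub>i\<in>{..<3}. A.fib (corner_right i) \<otimes>\<^bsub>A.Q\<^esub> A.fib (corner_left i)) = \<one>\<^bsub>A.Q\<^esub>" .
  next
    fix i :: nat
    show "?h \<one>\<^bsub>B.Q\<^esub> \<otimes>\<^bsub>A.Q\<^esub> A.fib (corner_left i) = A.fib (corner_left i)"
      unfolding h1 by (simp add: A.quotient_simps C ops corner_full(2))
  qed (simp_all add: A.quotient_simps(1) C)
  from full_corner.morita_equivalent[OF this]
  show "morita_equivalent TYPE('u :: infinite) (double_burnside_algebra F3 (sym_group 3)) (reduction 3 Lambda3')"
    by (simp add: double_burnside_algebra_def reduction_def)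
qed

end
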